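(* Let $\Lambda\subset\mathbb{R}^3$ be a bounded, connected, open set, independent of $N$. Let $U_\Lambda\ge0$ be a pair potential such that: (i) $U_\Lambda(\check q,\hat q)=U_\Lambda(\hat q,\check q)$; (ii) $U_\Lambda$ is lower semi-continuous on $\overline\Lambda\times\overline\Lambda$; (iii) $\iint\chi_{\{U_\Lambda(\check q,\hat q)-\min U_\Lambda<\eta\}}\,d^3\check q\,d^3\hat q>0$ for every $\eta>0$; (iv) $U_\Lambda(q,\cdot)\in L^2(B_r(q)\cap\Lambda)$ for all $q\in\Lambda$ and $r>0$, where $B_r(q)$ is the ball of radius $r$ centered at $q$; (v) $U_\Lambda(\check q,\hat q)=+\infty$ whenever $\check q\notin\overline\Lambda$ or $\hat q\notin\overline\Lambda$. Let $H^{(N)}_\Lambda(p_1,\dots,q_N)=N\sum_{1\le i\le N}\tfrac12|p_i|^2+\sum_{1\le i<j\le N}U_\Lambda(q_i,q_j)$, let $S_{H^{(N)}_\Lambda}(\mathcal E)=\ln\Omega'_{H^{(N)}_\Lambda}(\mathcal E)$ be the ergodic ensemble entropy, and let $\varepsilon>\varepsilon_g$. Then, as $N\to\infty$, $$S_{H^{(N)}_\Lambda}(N^2\varepsilon)=-N\ln N+N\,s_\Lambda(\varepsilon)+o(N),\qquad s_\Lambda(\varepsilon)=-\mathcal H_{\mathrm B}(f_\varepsilon),$$ where $$\mathcal H_{\mathrm B}(f)=\iint f(p,q)\ln\big(f(p,q)/e\big)\,d^3p\,d^3q$$ and $f_\varepsilon$ is any minimizer of $\mathcal H_{\mathrm B}$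 over the set $\mathfrak A_\varepsilon$ of trial densities of energy $\varepsilon$. Moreover, any minimizer $f_\varepsilon$ of $\mathcal H_{\mathrm B}$ over $\mathfrak A_\varepsilon$ is of the form $f_\varepsilon(p,q)=\sigma_\varepsilon(p)\rho_\varepsilon(q)$, where $\rho_\varepsilon$ solves the fixed point equation $$\rho_\varepsilon(q)=\frac{\exp\left(-\vartheta_\varepsilon(\rho_\varepsilon)^{-1}\int_\Lambda U_\Lambda(q,\tilde q)\rho_\varepsilon(\tilde q)\,d^3\tilde q\right)}{\int_\Lambda\exp\left(-\vartheta_\varepsilon(\rho_\varepsilon)^{-1}\int_\Lambda U_\Lambda(\hat q,\tilde q)\rho_\varepsilon(\tilde q)\,d^3\tilde q\right)d^3\hat q}$$ with $\vartheta_\varepsilon(\rho)$ given by $$\tfrac32\vartheta_\varepsilon(\rho)=\varepsilon-\iint\tfrac12U_\Lambda(q,\tilde q)\rho(q)\rho(\tilde q)\,d^3q\,d^3\tilde q,$$ and where $\sigma_\varepsilon(p)=\sigma(\rho_\varepsilon)(p)$, with, whenever $\vartheta_\varepsilon(\rho)>0$, $$\sigma(\rho)(p)=\big(2\pi\vartheta_\varepsilon(\rho)\big)^{-3/2}\exp\big(-\tfrac12|p|^2/\vartheta_\varepsilon(\rho)\big).$$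
   Context: For $\mathcal E\in\mathbb{R}$, $\Omega_{H^{(N)}_\Lambda}(\mathcal E)=\frac1{N!}\int\chi_{\{H^{(N)}_\Lambda<\mathcal E\}}\,d^{6N}X$, where $X=(p_1,q_1;\dots;p_N,q_N)\in(\mathbb{R}^3\times\Lambda)^N$ and $d^{6N}X$ is Lebesgue measure; $\Omega'_{H^{(N)}_\Lambda}$ is its derivative with respect to $\mathcal E$ (formally $\frac1{N!}\int\delta(\mathcal E-H^{(N)}_\Lambda)\,d^{6N}X$). $\varepsilon_g=\inf_{\rho\in\mathfrak P(\Lambda)}\iint\frac12U_\Lambda(q,\tilde q)\rho(q)\rho(\tilde q)\,d^3q\,d^3\tilde q$, where $\mathfrak P(\Lambda)$ is the set of probability measures on $\Lambda$, written in density notation. The energy of $f$ is $$\mathcal E(f)=\iint\tfrac12|p|^2f(p,q)\,d^3p\,d^3q+\iiiint\tfrac12U_\Lambda(q,\tilde q)f(p,q)f(\tilde p,\tilde q)\,d^3p\,d^3q\,d^3\tilde p\,d^3\tilde q .$$ $\mathfrak A_\varepsilon=\{f\in(\mathfrak P\cap L^1\cap L^1\ln L^1)(\mathbb{R}^3\times\Lambda):\mathcal E(f)=\varepsilon\}$, i.e. the probability densities $f$ on $\mathbb{R}^3\times\Lambda$ with $f\ln f$ integrable and energy $\varepsilon$.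
   Formalization: Existence of a minimizer is asserted only when ε exceeds the infimum of the interaction energy over probability densities; this can be larger than ε_g over all probability measures, and at or below it the set of trial densities is empty. The other claims are stated for every minimizer. *)

theory Defs
  imports "HOL-Probability.Probability" "HOL-Library.Landau_Symbols"
begin

type_synonym phase_point = "(real^3) \<times> (real^3)"

definition lower_semicontinuous_on ::
    "'a::topological_space set \<Rightarrow> ('a \<Rightarrow> 'b::linorder) \<Rightarrow> bool" where
  "lower_semicontinuous_on S f \<longleftrightarrow>
     (\<forall>x\<in>S. \<forall>a<f x. eventually (\<lambda>y. a < f y) (at x within S))"

text \<open>
  Points of the \<open>N\<close>-particle phase space are maps \<open>X\<close> with \<open>X i = (p, q)\<close> for the particle
  \<open>i < N\<close> (numbered from \<open>0\<close>). Pair potentials take values in \<open>[0, \<infinity>]\<close>.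
\<close>

definition hamiltonian ::
    "(real^3 \<Rightarrow> real^3 \<Rightarrow> ennreal) \<Rightarrow> nat \<Rightarrow> (nat \<Rightarrow> phase_point) \<Rightarrow> ennreal" where
  "hamiltonian U N X =
     ennreal (real N * (\<Sum>i<N. 1/2 * (norm (fst (X i)))\<^sup>2)) +
     (\<Sum>j<N. \<Sum>i<j. U (snd (X i)) (snd (X j)))"

text \<open>
  Since \<open>H\<close> is nonnegative, \<open>H X < ennreal E\<close> says \<open>H X < E\<close> for every real \<open>E\<close>, also for
  \<open>E \<le> 0\<close>, where both are false. For bounded \<open>\<Lambda>\<close> the sublevel set has finite volume.
\<close>

definition phase_volume ::
    "(real^3) set \<Rightarrow> (real^3 \<Rightarrow> real^3 \<Rightarrow> ennreal) \<Rightarrow> nat \<Rightarrow> real \<Rightarrow> real" where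
  "phase_volume \<Lambda> U N E =
     1 / fact N *
     measure (Pi\<^sub>M {..<N} (\<lambda>_. lborel))
       {X \<in> space (Pi\<^sub>M {..<N} (\<lambda>_. lborel)).
          (\<forall>i<N. X i \<in> UNIV \<times> \<Lambda>) \<and> hamiltonian U N X < ennreal E}"

text \<open>
  Integrating out the momenta shows that \<open>phase_volume \<Lambda> U N\<close> is, for \<open>N \<ge> 1\<close>, a constant times
  the integral over \<open>\<Lambda>\<^sup>N\<close> of the power \<open>3 N / 2 > 1\<close> of the positive part of \<open>E\<close> minus the
  interaction energy. It is therefore differentiable everywhere and nondecreasing, so that
  \<open>deriv\<close> is its true, nonnegative derivative.
\<close>

definition ergodic_entropy ::
    "(real^3) set \<Rightarrow> (real^3 \<Rightarrow> real^3 \<Rightarrow> ennreal) \<Rightarrow> nat \<Rightarrow> real \<Rightarrow> real" where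
  "ergodic_entropy \<Lambda> U N E = ln (deriv (phase_volume \<Lambda> U N) E)"

definition prob_densities :: "'a::euclidean_space set \<Rightarrow> ('a \<Rightarrow> real) set" where
  "prob_densities A =
     {f. set_integrable lborel A f \<and> (\<forall>x\<in>A. 0 \<le> f x) \<and> (LINT x:A|lborel. f x) = 1}"

definition prob_measures_on :: "'a::topological_space set \<Rightarrow> 'a measure set" where
  "prob_measures_on A = {M. prob_space M \<and> sets M = sets (restrict_space borel A)}"

definition ground_energy ::
    "(real^3) set \<Rightarrow> (real^3 \<Rightarrow> real^3 \<Rightarrow> ennreal) \<Rightarrow> ennreal" where
  "ground_energy \<Lambda> U =
     (INF M\<in>prob_measures_on \<Lambda>. \<integral>\<^sup>+q. (\<integral>\<^sup>+q'. ennreal (1/2) * U q q' \<partial>M) \<partial>M)"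

definition interaction_energy ::
    "(real^3) set \<Rightarrow> (real^3 \<Rightarrow> real^3 \<Rightarrow> ennreal) \<Rightarrow> (real^3 \<Rightarrow> real) \<Rightarrow> ennreal" where
  "interaction_energy \<Lambda> U \<rho> =
     (\<integral>\<^sup>+q\<in>\<Lambda>. (\<integral>\<^sup>+q'\<in>\<Lambda>. (ennreal (1/2) * U q q' * ennreal (\<rho> q) * ennreal (\<rho> q'))
        \<partial>lborel) \<partial>lborel)"

text \<open>
  The same infimum over absolutely continuous measures only. It can exceed \<open>ground_energy\<close> for a
  potential that is merely lower semicontinuous: take \<open>U = 1\<close> on \<open>closure \<Lambda> \<times> closure \<Lambda>\<close>, except that
  \<open>U = 0\<close> at one diagonal point \<open>(a, a)\<close> and on \<open>A \<times> B \<union> B \<times> A\<close>, with \<open>A\<close> and \<open>B\<close> disjoint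
  closed balls in \<open>\<Lambda>\<close> not containing \<open>a \<in> \<Lambda>\<close>. Then the first infimum is \<open>0\<close> and the second is \<open>1/4\<close>, and
  there is no trial density whose energy lies between the two.
\<close>

definition density_ground_energy ::
    "(real^3) set \<Rightarrow> (real^3 \<Rightarrow> real^3 \<Rightarrow> ennreal) \<Rightarrow> ennreal" where
  "density_ground_energy \<Lambda> U = (INF \<rho>\<in>prob_densities \<Lambda>. interaction_energy \<Lambda> U \<rho>)"

definition vlasov_energy ::
    "(real^3) set \<Rightarrow> (real^3 \<Rightarrow> real^3 \<Rightarrow> ennreal) \<Rightarrow> (phase_point \<Rightarrow> real) \<Rightarrow> ennreal" where
  "vlasov_energy \<Lambda> U f =
     (\<integral>\<^sup>+x\<in>UNIV \<times> \<Lambda>. (ennreal (1/2 * (norm (fst x))\<^sup>2) * ennreal (f x)) \<partial>lborel) +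
     (\<integral>\<^sup>+x\<in>UNIV \<times> \<Lambda>. (\<integral>\<^sup>+y\<in>UNIV \<times> \<Lambda>.
        (ennreal (1/2) * U (snd x) (snd y) * ennreal (f x) * ennreal (f y))
        \<partial>lborel) \<partial>lborel)"

definition trial_densities ::
    "(real^3) set \<Rightarrow> (real^3 \<Rightarrow> real^3 \<Rightarrow> ennreal) \<Rightarrow> real \<Rightarrow> (phase_point \<Rightarrow> real) set" where
  "trial_densities \<Lambda> U \<epsilon> =
     {f \<in> prob_densities (UNIV \<times> \<Lambda>).
        set_integrable lborel (UNIV \<times> \<Lambda>) (\<lambda>x. f x * ln (f x)) \<and>
        vlasov_energy \<Lambda> U f = ennreal \<epsilon>}"

definition boltzmann_H :: "(real^3) set \<Rightarrow> (phase_point \<Rightarrow> real) \<Rightarrow> real" where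
  "boltzmann_H \<Lambda> f = (LINT x:UNIV \<times> \<Lambda>|lborel. f x * ln (f x / exp 1))"

abbreviation H_minimizer ::
    "(real^3) set \<Rightarrow> (real^3 \<Rightarrow> real^3 \<Rightarrow> ennreal) \<Rightarrow> real \<Rightarrow> (phase_point \<Rightarrow> real) \<Rightarrow> bool" where
  "H_minimizer \<Lambda> U \<epsilon> \<equiv> is_arg_min (boltzmann_H \<Lambda>) (\<lambda>f. f \<in> trial_densities \<Lambda> U \<epsilon>)"

text \<open>To be used only when \<open>interaction_energy \<Lambda> U \<rho>\<close> is finite.\<close>

definition vartheta ::
    "(real^3) set \<Rightarrow> (real^3 \<Rightarrow> real^3 \<Rightarrow> ennreal) \<Rightarrow> real \<Rightarrow> (real^3 \<Rightarrow> real) \<Rightarrow> real" where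
  "vartheta \<Lambda> U \<epsilon> \<rho> = 2/3 * (\<epsilon> - enn2real (interaction_energy \<Lambda> U \<rho>))"

text \<open>Meaningful for \<open>\<theta> > 0\<close>, the temperature.\<close>

definition maxwellian :: "real \<Rightarrow> real^3 \<Rightarrow> real" where
  "maxwellian \<theta> p = (2 * pi * \<theta>) powr (- 3/2) * exp (- (1/2 * (norm p)\<^sup>2) / \<theta>)"

definition mean_potential ::
    "(real^3) set \<Rightarrow> (real^3 \<Rightarrow> real^3 \<Rightarrow> ennreal) \<Rightarrow> (real^3 \<Rightarrow> real) \<Rightarrow> real^3 \<Rightarrow> ennreal" where
  "mean_potential \<Lambda> U \<rho> q = (\<integral>\<^sup>+q'\<in>\<Lambda>. (U q q' * ennreal (\<rho> q')) \<partial>lborel)"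

text \<open>\<open>exp (- u / \<theta>)\<close> for \<open>\<theta> > 0\<close> and \<open>u \<in> [0, \<infinity>]\<close>, with \<open>exp (- \<infinity>) = 0\<close>.\<close>

definition boltzmann_factor :: "real \<Rightarrow> ennreal \<Rightarrow> real" where
  "boltzmann_factor \<theta> u = (if u = \<infinity> then 0 else exp (- (enn2real u / \<theta>)))"

end

theory Submission
  imports Defs "HOL-Real_Asymp.Real_Asymp"
begin

text \<open>
  Integrating out the momenta (Gaussian integrals fix the constant) turns \<open>\<Omega>'\<close> into an explicit
  factor, evaluated by Stirling's formula, times a Laplace integral of \<open>(\<epsilon> - W/N\<^sup>2)\<close> to the power
  \<open>3N/2 - 1\<close> over \<open>\<Lambda>\<^sup>N\<close>, whose exponential rate must be shown to be the maximum of
  \<open>S(\<rho>) + 3/2 ln (\<epsilon> - I(\<rho>))\<close>, with \<open>S\<close> the entropy and \<open>I\<close> the interaction energy of a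
  configurational density. By Gibbs' inequality, minimizing \<open>H\<close> over the trial densities is the same
  problem, with the Maxwellian as momentum factor.

  Everything rests on one compactness fact: densities of bounded entropy have a subsequence whose
  masses on all dyadic cells converge to those of a density, and neither entropy nor energy is lost in
  the limit. The limit density is built from the step densities of the limiting cell masses, which form
  an \<open>L\<^sup>1\<close>-Cauchy sequence because their relative entropies bound Hellinger distances; the energy is
  lower semicontinuous because \<open>U\<close> is the increasing limit of its cellwise infima.

  Lower bound on the rate: under the product measure of the minimizer, Markov's inequality keeps the
  event \<open>W/N\<^sup>2 < I + \<delta>\<close> at probability bounded away from \<open>0\<close>, and a Chernoff bound controls the
  density. Upper bound: replace \<open>U\<close> by its cellwise infimum, count particles per cell (the types of
  information theory), and pass to the limit by compactness. The fixed point equation is the Euler-Lagrange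
  equation, tested against uniform densities of sets on which all potentials are bounded.
\<close>

section \<open>Real inequalities for the entropy\<close>

text \<open>The energy is only lower semicontinuous, so a limit of trial densities may have less
  interaction energy than its predecessors, and the constraint of fixed total energy is not closed.
  What the interaction loses goes into the motion: once the momenta are eliminated, the constraint
  is the open condition that the interaction energy stays below \<epsilon>, and the remaining room
  enters through an increasing logarithm, so that a loss can only help. This device serves the
  existence of minimizers and the upper bound alike, through \<open>maximizing_limit\<close>. The
  cellwise infimum of \<open>U\<close> at level \<open>k\<close> is capped at \<open>k\<close>. This
  keeps it finite where \<open>U\<close> is infinite and bounds the self-interaction terms that
  appear when a sum over pairs is completed to a square: they cost at most \<open>k * N / 2\<close>,
  against energies of order N^2. Both sides produce the constant
  \<open>3/2 * ln (4/3 * pi) + 5/2\<close>. In \<open>boltzmann_H\<close> the 5/2 is the mean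
  kinetic energy 3/2 in units of the temperature plus 1 from the factor \<open>e\<close>; in the
  phase volume it is 1 from the factorial plus 3/2 from the Gamma function.\<close>

lemma gibbs_ineq:
  fixes x y :: real
  assumes "0 \<le> x" "0 \<le> y" "y = 0 \<Longrightarrow> x = 0"
  shows "x * ln y + x - y \<le> x * ln x"
proof (cases "x = 0")
  case True
  then show ?thesis using assms by simp
next
  case False
  then have "x > 0" "y > 0" using assms by (auto simp: order_less_le)
  have "ln (y / x) \<le> y / x - 1"
    using \<open>x > 0\<close> \<open>y > 0\<close> by (intro ln_le_minus_one) simp
  then have "x * (ln y - ln x) \<le> x * (y / x - 1)"
    using \<open>x > 0\<close> \<open>y > 0\<close> by (intro mult_left_mono) (auto simp: ln_div)
  then show ?thesis
    using \<open>x > 0\<close> by (simp add: algebra_simps)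
qed

lemma gibbs_eq:
  fixes x y :: real
  assumes "0 \<le> x" "0 \<le> y" "y = 0 \<Longrightarrow> x = 0" "x * ln y + x - y = x * ln x"
  shows "x = y"
proof (cases "x = 0")
  case True
  then show ?thesis using assms by simp
next
  case False
  then have "x > 0" "y > 0" using assms by (auto simp: order_less_le)
  have "ln (y / x) = y / x - 1"
    using \<open>x > 0\<close> \<open>y > 0\<close> assms(4) by (simp add: ln_div field_simps)
  then have "y / x = 1"
    using \<open>x > 0\<close> \<open>y > 0\<close> by (intro ln_eq_minus_one) auto
  then show ?thesis using \<open>x > 0\<close> by simp
qed

text \<open>The tangent bound for \<open>ln\<close> is applied to the ratio of the square roots:
  since \<open>ln x = 2 * ln s\<close>, it carries a factor 2 and produces the cross term of the
  squared difference. This is what makes relative entropy control a distance.\<close>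

lemma hellinger_le_entropy:
  fixes x y :: real
  assumes "0 \<le> x" "0 \<le> y" "y = 0 \<Longrightarrow> x = 0"
  shows "(sqrt x - sqrt y)\<^sup>2 \<le> x * ln x - x * ln y - x + y"
proof (cases "x = 0")
  case True
  then show ?thesis using assms by simp
next
  case False
  then have "x > 0" "y > 0" using assms by (auto simp: order_less_le)
  define s where "s = sqrt x"
  define t where "t = sqrt y"
  have st: "s > 0" "t > 0" "x = s\<^sup>2" "y = t\<^sup>2"
    using \<open>x > 0\<close> \<open>y > 0\<close> by (auto simp: s_def t_def)
  have "ln (t / s) \<le> t / s - 1"
    using st by (intro ln_le_minus_one) simp
  then have "(2 * s\<^sup>2) * (ln t - ln s) \<le> (2 * s\<^sup>2) * (t / s - 1)"
    using st by (intro mult_left_mono) (auto simp: ln_div)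
  also have "\<dots> = 2 * s * t - 2 * s\<^sup>2"
    using st by (simp add: field_simps power2_eq_square)
  finally have *: "(2 * s\<^sup>2) * (ln t - ln s) \<le> 2 * s * t - 2 * s\<^sup>2" .
  have "ln x = 2 * ln s" "ln y = 2 * ln t"
    using st by (auto simp: ln_realpow)
  then show ?thesis
    using * st by (simp add: power2_diff algebra_simps)
qed

text \<open>Pinsker's inequality in a form that can be integrated termwise: Young's inequality with
  the free weight \<open>a\<close> splits the product of the difference and the sum of the square
  roots, and the squared difference is a Hellinger term. Taking \<open>a\<close> near the square
  root of an entropy gap makes the integral of the right side small.\<close>

lemma abs_diff_le_entropy:
  fixes x y a :: real
  assumes "0 \<le> x" "0 \<le> y" "y = 0 \<Longrightarrow> x = 0" "a > 0"
  shows "\<bar>x - y\<bar> \<le> (x * ln x - x * ln y - x + y) / (2 * a) + a * (x + y)"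
proof -
  define s where "s = sqrt x"
  define t where "t = sqrt y"
  have st: "s \<ge> 0" "t \<ge> 0" "x = s\<^sup>2" "y = t\<^sup>2"
    using assms by (auto simp: s_def t_def)
  have "\<bar>x - y\<bar> = \<bar>s - t\<bar> * (s + t)"
  proof -
    have "x - y = (s - t) * (s + t)"
      unfolding st by (simp add: power2_eq_square algebra_simps)
    then show ?thesis using st by (simp add: abs_mult)
  qed
  also have "\<dots> \<le> (s - t)\<^sup>2 / (2 * a) + a / 2 * (s + t)\<^sup>2"
  proof -
    have "0 \<le> (\<bar>s - t\<bar> - a * (s + t))\<^sup>2 / (2 * a)"
      using assms by simp
    also have "\<dots> = (s - t)\<^sup>2 / (2 * a) + a / 2 * (s + t)\<^sup>2 - \<bar>s - t\<bar> * (s + t)"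
      using assms by (simp add: power2_eq_square field_simps)
    finally show ?thesis by simp
  qed
  also have "\<dots> \<le> (x * ln x - x * ln y - x + y) / (2 * a) + a * (x + y)"
  proof (intro add_mono)
    show "(s - t)\<^sup>2 / (2 * a) \<le> (x * ln x - x * ln y - x + y) / (2 * a)"
      using hellinger_le_entropy[OF assms(1-3)] assms(4)
      by (intro divide_right_mono) (auto simp: s_def t_def)
    have "(s + t)\<^sup>2 \<le> 2 * (x + y)"
      using zero_le_power2[of "s - t"] by (simp add: st power2_sum power2_diff)
    then show "a / 2 * (s + t)\<^sup>2 \<le> a * (x + y)"
      using mult_left_mono[of "(s + t)\<^sup>2" "2 * (x + y)" "a / 2"] assms(4) by simp
  qed
  finally show ?thesis .
qed

lemma xlnx_ge: "x - 1 \<le> x * ln x" if "0 \<le> x" for x :: real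
  using gibbs_ineq[of x 1] that by simp

lemma continuous_on_xlnx: "continuous_on {0..} (\<lambda>x::real. x * ln x)"
  unfolding continuous_on_def
proof
  fix x :: real assume "x \<in> {0..}"
  show "((\<lambda>x. x * ln x) \<longlongrightarrow> x * ln x) (at x within {0..})"
  proof (cases "x = 0")
    case True
    have "((\<lambda>x::real. x * ln x) \<longlongrightarrow> 0) (at_right 0)"
      by real_asymp
    then show ?thesis using True by (simp add: at_within_Ici_at_right)
  next
    case False
    then show ?thesis using \<open>x \<in> {0..}\<close> by (auto intro!: tendsto_intros)
  qed
qed

lemma tendsto_xlnx:
  fixes f :: "'a \<Rightarrow> real"
  assumes "(f \<longlongrightarrow> l) F" "eventually (\<lambda>x. 0 \<le> f x) F" "0 \<le> l"
  shows "((\<lambda>x. f x * ln (f x)) \<longlongrightarrow> l * ln l) F"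
  using continuous_on_tendsto_compose[OF continuous_on_xlnx assms(1)] assms by auto

section \<open>Densities with bounded entropy\<close>

text \<open>A partition is encoded by the function that sends a point to the label of its cell, so
  step functions are compositions with \<open>c j\<close> and sums over labels are finite. Nesting
  is required for consecutive levels only; \<open>refine\<close> extends it.\<close>

locale refining_partitions = finite_measure M for M :: "'a measure" +
  fixes c :: "nat \<Rightarrow> 'a \<Rightarrow> 'b::countable"
  assumes measurable_c [measurable]: "\<And>j. c j \<in> M \<rightarrow>\<^sub>M count_space UNIV"
    and finite_c: "\<And>j. finite (c j ` space M)"
    and refine_Suc: "\<And>j x y. x \<in> space M \<Longrightarrow> y \<in> space M \<Longrightarrow> c (Suc j) x = c (Suc j) y \<Longrightarrow> c j x = c j y"
begin

definition mass :: "('a \<Rightarrow> real) \<Rightarrow> nat \<Rightarrow> 'b \<Rightarrow> real" where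
  "mass \<rho> j a = (\<integral>x. indicator {y. c j y = a} x * \<rho> x \<partial>M)"

definition vol :: "nat \<Rightarrow> 'b \<Rightarrow> real" where
  "vol j a = measure M {x \<in> space M. c j x = a}"

lemma refine:
  assumes "j \<le> i" "x \<in> space M" "y \<in> space M" "c i x = c i y"
  shows "c j x = c j y"
  using assms(1,4) by (induction rule: inc_induct) (use assms(2,3) refine_Suc in blast)+

lemma measurable_cell [measurable]: "{x \<in> space M. c j x = a} \<in> sets M"
  by measurable

lemma measurable_step [measurable]: "(\<lambda>x. h (c j x)) \<in> borel_measurable M" for h :: "'b \<Rightarrow> real"
  by (rule measurable_compose[OF measurable_c]) simp

lemma integrable_indicator_cell:
  fixes \<rho> :: "'a \<Rightarrow> real"
  assumes "integrable M \<rho>"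
  shows "integrable M (\<lambda>x. indicator {y. c j y = a} x * \<rho> x)"
  by (rule Bochner_Integration.integrable_bound[OF assms])
     (use assms in \<open>auto simp: indicator_def\<close>)

lemma step_eq_sum:
  assumes "x \<in> space M"
  shows "h (c j x) * \<rho> x = (\<Sum>a\<in>c j ` space M. h a * (indicator {y. c j y = a} x * \<rho> x :: real))"
proof -
  have "(\<Sum>a\<in>c j ` space M. h a * (indicator {y. c j y = a} x * \<rho> x))
      = (\<Sum>a\<in>c j ` space M. if c j x = a then h a * \<rho> x else 0)"
    by (intro sum.cong) (auto simp: indicator_def)
  then show ?thesis using assms finite_c by simp
qed

lemma
  assumes "integrable M \<rho>"
  shows integrable_step: "integrable M (\<lambda>x. h (c j x) * \<rho> x)"
    and integral_step: "(\<integral>x. h (c j x) * \<rho> x \<partial>M) = (\<Sum>a\<in>c j ` space M. h a * mass \<rho> j a)"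
proof -
  have "integrable M (\<lambda>x. \<Sum>a\<in>c j ` space M. h a * (indicator {y. c j y = a} x * \<rho> x))"
    using integrable_indicator_cell[OF assms] by (intro Bochner_Integration.integrable_sum integrable_mult_right) auto
  then show "integrable M (\<lambda>x. h (c j x) * \<rho> x)"
    by (subst Bochner_Integration.integrable_cong[OF refl step_eq_sum]) auto
  show "(\<integral>x. h (c j x) * \<rho> x \<partial>M) = (\<Sum>a\<in>c j ` space M. h a * mass \<rho> j a)"
    unfolding mass_def
    by (subst Bochner_Integration.integral_cong[OF refl step_eq_sum])
       (use integrable_indicator_cell[OF assms] in \<open>auto simp: Bochner_Integration.integral_sum\<close>)
qed

lemma mass_const: "mass (\<lambda>_. 1) j a = vol j a"
proof -
  have "mass (\<lambda>_. 1) j a = (\<integral>x. indicator {x \<in> space M. c j x = a} x \<partial>M)"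
    unfolding mass_def by (intro Bochner_Integration.integral_cong) (auto simp: indicator_def)
  then show ?thesis by (simp add: vol_def)
qed

lemma mass_nonneg:
  assumes "\<And>x. x \<in> space M \<Longrightarrow> 0 \<le> \<rho> x"
  shows "0 \<le> mass \<rho> j a"
  unfolding mass_def using assms by (intro integral_nonneg_AE) auto

lemma mass_mono:
  assumes "integrable M \<rho>" "\<And>x. x \<in> space M \<Longrightarrow> 0 \<le> \<rho> x" "j \<le> i" "x \<in> space M"
  shows "mass \<rho> i (c i x) \<le> mass \<rho> j (c j x)"
  unfolding mass_def
proof (intro integral_mono integrable_indicator_cell assms(1))
  fix y assume "y \<in> space M"
  then show "indicator {y. c i y = c i x} y * \<rho> y \<le> indicator {y. c j y = c j x} y * \<rho> y"
    using assms(2)[of y] refine[OF assms(3) \<open>y \<in> space M\<close> assms(4)] by (auto simp: indicator_def)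
qed

lemma mass_le:
  assumes "integrable M \<rho>" "\<And>x. x \<in> space M \<Longrightarrow> 0 \<le> \<rho> x"
  shows "mass \<rho> j a \<le> (\<integral>x. \<rho> x \<partial>M)"
  unfolding mass_def using assms
  by (intro integral_mono integrable_indicator_cell) (auto simp: indicator_def)

lemma mass_eq_0:
  assumes "vol j a = 0"
  shows "mass \<rho> j a = 0"
proof -
  have "emeasure M {x \<in> space M. c j x = a} = 0"
    using assms by (simp add: vol_def emeasure_eq_measure)
  then have "AE x in M. c j x \<noteq> a"
    by (subst AE_iff_measurable[OF measurable_cell[of j a]]) auto
  then show ?thesis
    unfolding mass_def by (intro integral_eq_zero_AE) (auto simp: indicator_def)
qed


lemma
  fixes h :: "'b \<Rightarrow> real"
  shows integral_step_vol: "(\<integral>x. h (c j x) \<partial>M) = (\<Sum>a\<in>c j ` space M. h a * vol j a)"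
    and integrable_step_vol: "integrable M (\<lambda>x. h (c j x))"
proof -
  have one: "integrable M (\<lambda>_. 1 :: real)" by simp
  show "(\<integral>x. h (c j x) \<partial>M) = (\<Sum>a\<in>c j ` space M. h a * vol j a)"
    using integral_step[OF one, of h j] unfolding mass_const mult_1_right .
  show "integrable M (\<lambda>x. h (c j x))"
    using integrable_step[OF one, of h j] unfolding mult_1_right .
qed

lemma vol_nonneg: "0 \<le> vol j a"
  unfolding vol_def by (rule measure_nonneg)

text \<open>The step densities \<open>g\<close> form a martingale along the partitions, and the
  entropy bound takes the place of uniform integrability: \<open>D j\<close> increases to a limit,
  and the increments \<open>D i - D j\<close> are relative entropies. Consistency is expressed by
  test functions, a coarse \<open>h\<close> and a fine \<open>h'\<close> that agree at every point,
  because in this form it is inherited from integrals.\<close>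

lemma consistent_masses_density:
  fixes m :: "nat \<Rightarrow> 'b \<Rightarrow> real" and C :: real
  defines "g \<equiv> \<lambda>j x. m j (c j x) / vol j (c j x)"
  assumes nonneg: "\<And>j a. 0 \<le> m j a"
    and zero: "\<And>j a. vol j a = 0 \<Longrightarrow> m j a = 0"
    and mono: "\<And>i j x. x \<in> space M \<Longrightarrow> j \<le> i \<Longrightarrow> m i (c i x) \<le> m j (c j x)"
    and consistent: "\<And>i j h h'. j \<le> i \<Longrightarrow> (\<And>x. x \<in> space M \<Longrightarrow> h (c j x) = h' (c i x)) \<Longrightarrow>
           (\<Sum>a\<in>c j ` space M. h a * m j a) = (\<Sum>b\<in>c i ` space M. h' b * m i b)"
    and total: "\<And>j. (\<Sum>a\<in>c j ` space M. m j a) = 1"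
    and bound: "\<And>j. (\<integral>x. g j x * ln (g j x) \<partial>M) \<le> C"
  obtains \<sigma> where "integrable M \<sigma>" "\<And>x. 0 \<le> \<sigma> x" "(\<integral>x. \<sigma> x \<partial>M) = 1"
    "integrable M (\<lambda>x. \<sigma> x * ln (\<sigma> x))" "(\<integral>x. \<sigma> x * ln (\<sigma> x) \<partial>M) \<le> C"
    "\<And>j a. mass \<sigma> j a = m j a"
proof -
  define D where "D j = (\<integral>x. g j x * ln (g j x) \<partial>M)" for j
  have g_nonneg: "0 \<le> g j x" for j x
    unfolding g_def using nonneg vol_nonneg by simp
  have g_meas [measurable]: "g j \<in> borel_measurable M" for j
    unfolding g_def by (rule measurable_step)
  have g_int: "integrable M (g j)" for j
    unfolding g_def by (rule integrable_step_vol)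
  have step_g_int: "integrable M (\<lambda>x. h (c j x) * g i x)" for h i j
    by (rule integrable_step[OF g_int])
  have step_g: "(\<integral>x. h (c j x) * g i x \<partial>M) = (\<Sum>a\<in>c j ` space M. h a * m j a)" if "j \<le> i" for h i j
  proof -
    \<comment> \<open>The value of \<open>h\<close> on a fine cell is read off at a chosen point; by
      refinement the choice does not matter.\<close>
    define h' where "h' b = h (c j (SOME x. x \<in> space M \<and> c i x = b))" for b
    have hh': "h (c j x) = h' (c i x)" if "x \<in> space M" for x
    proof -
      have "\<exists>y. y \<in> space M \<and> c i y = c i x" using that by auto
      from someI_ex[OF this] show ?thesis
        unfolding h'_def using refine[OF \<open>j \<le> i\<close> that] by (metis (no_types, lifting))
    qed
    have "(\<integral>x. h (c j x) * g i x \<partial>M) = (\<integral>x. (\<lambda>b. h' b * (m i b / vol i b)) (c i x) \<partial>M)"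
      by (intro Bochner_Integration.integral_cong) (auto simp: hh' g_def)
    also have "\<dots> = (\<Sum>b\<in>c i ` space M. h' b * (m i b / vol i b) * vol i b)"
      by (rule integral_step_vol)
    also have "\<dots> = (\<Sum>b\<in>c i ` space M. h' b * m i b)"
      by (intro sum.cong refl) (use zero in auto)
    also have "\<dots> = (\<Sum>a\<in>c j ` space M. h a * m j a)"
      using consistent[of j i h h'] that hh' by simp
    finally show ?thesis .
  qed
  have g_int1: "(\<integral>x. g j x \<partial>M) = 1" for j
    using step_g[of j j "\<lambda>_. 1"] total[of j] by simp
  have ln_int: "integrable M (\<lambda>x. g i x * ln (g j x))" for i j
    using step_g_int[of "\<lambda>a. ln (m j a / vol j a)" j i] by (simp add: g_def mult.commute)
  \<comment> \<open>Testing \<open>g i\<close> against the coarser function \<open>ln (g j)\<close>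
    gives the same as testing \<open>g j\<close>, so the relative entropy of \<open>g i\<close> with
    respect to \<open>g j\<close> is \<open>D i - D j\<close>.\<close>
  have ln_eq: "(\<integral>x. g i x * ln (g j x) \<partial>M) = D j" if "j \<le> i" for i j
    using step_g[OF that, of "\<lambda>a. ln (m j a / vol j a)"] step_g[OF order_refl, of "\<lambda>a. ln (m j a / vol j a)" j]
    by (simp add: g_def mult.commute D_def)
  \<comment> \<open>Absolute continuity: as \<open>ln 0 = 0\<close>, Gibbs' inequality needs the
    finer density to vanish wherever the coarser one does.\<close>
  have g_zero: "g i x = 0" if "g j x = 0" "j \<le> i" "x \<in> space M" for i j x
  proof (cases "m j (c j x) = 0")
    case True
    then show ?thesis
      using mono[OF that(3,2)] nonneg[of i "c i x"] by (simp add: g_def)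
  next
    case False
    then have "vol j (c j x) = 0" using that(1) by (simp add: g_def)
    then show ?thesis using False zero by blast
  qed
  have D_mono: "D j \<le> D i" if "j \<le> i" for i j
  proof -
    have "D j + 1 - 1 = (\<integral>x. g i x * ln (g j x) + g i x - g j x \<partial>M)"
      using ln_eq[OF that] g_int1 by (simp add: ln_int g_int)
    also have "\<dots> \<le> (\<integral>x. g i x * ln (g i x) \<partial>M)"
      by (intro integral_mono gibbs_ineq g_nonneg Bochner_Integration.integrable_add
            Bochner_Integration.integrable_diff ln_int g_int) (use g_zero that in auto)
    finally show ?thesis by (simp add: D_def)
  qed
  have L1: "(\<integral>x. \<bar>g i x - g j x\<bar> \<partial>M) \<le> (D i - D j) / (2 * a) + 2 * a" if "j \<le> i" "a > 0" for i j a
  proof -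
    have "(\<integral>x. \<bar>g i x - g j x\<bar> \<partial>M) \<le>
       (\<integral>x. (g i x * ln (g i x) - g i x * ln (g j x) - g i x + g j x) / (2 * a) + a * (g i x + g j x) \<partial>M)"
      by (intro integral_mono abs_diff_le_entropy g_nonneg that Bochner_Integration.integrable_add
            Bochner_Integration.integrable_diff ln_int g_int integrable_abs integrable_divide integrable_mult_right)
         (use g_zero that in auto)
    also have "\<dots> = (D i - D j) / (2 * a) + 2 * a"
      using ln_eq[OF that(1)] ln_eq[OF order_refl, of i] g_int1 by (simp add: ln_int g_int)
    finally show ?thesis .
  qed
  have "D \<longlonglongrightarrow> (SUP j. D j)"
    by (intro LIMSEQ_incseq_SUP bdd_aboveI2[where M = C])
       (use bound D_mono in \<open>auto simp: D_def[symmetric] incseq_def\<close>)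
  then obtain E where E: "D \<longlonglongrightarrow> E" by blast
  have D_le_E: "D j \<le> E" for j
    using D_mono by (intro incseq_le[OF _ E]) (auto simp: incseq_def)
  \<comment> \<open>An entropy gap of \<open>(1/4) ^ l\<close> with the weight
    \<open>a = (1/2) ^ l\<close> gives L1 distances of order \<open>(1/2) ^ l\<close>, which are
    summable.\<close>
  have "\<exists>N. \<forall>j\<ge>N. E - (1/4) ^ l \<le> D j" for l
  proof -
    have "eventually (\<lambda>j. E - (1/4) ^ l < D j) sequentially"
      by (rule order_tendstoD(1)[OF E]) simp
    then show ?thesis by (auto simp: eventually_sequentially intro: less_imp_le)
  qed
  then obtain N where N: "\<And>l j. j \<ge> N l \<Longrightarrow> E - (1/4) ^ l \<le> D j" by metis
  \<comment> \<open>Summing the thresholds makes \<open>n\<close> increasing and, through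
    \<open>Suc\<close>, at least \<open>l\<close> as well as at least \<open>N l\<close>.\<close>
  define n where "n l = (\<Sum>k\<le>l. Suc (N k))" for l
  have n_ge: "N l \<le> n l" for l
    unfolding n_def using member_le_sum[of l "{..l}" "\<lambda>k. Suc (N k)"] by auto
  have n_ge': "l \<le> n l" for l
    by (induction l) (auto simp: n_def)
  have n_Suc: "n l \<le> n (Suc l)" for l
    by (simp add: n_def)
  define d where "d l x = g (n (Suc l)) x - g (n l) x" for l x
  have d_int: "integrable M (d l)" for l
    unfolding d_def by (intro Bochner_Integration.integrable_diff g_int)
  have d_meas [measurable]: "d l \<in> borel_measurable M" for l
    using d_int by auto
  have d_le: "(\<integral>x. \<bar>d l x\<bar> \<partial>M) \<le> 5/2 * (1/2) ^ l" for l
  proof -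
    have "(\<integral>x. \<bar>d l x\<bar> \<partial>M) \<le> (D (n (Suc l)) - D (n l)) / (2 * (1/2) ^ l) + 2 * (1/2) ^ l"
      unfolding d_def by (intro L1 n_Suc) simp
    also have "D (n (Suc l)) - D (n l) \<le> (1/4) ^ l"
      using D_le_E[of "n (Suc l)"] N[OF n_ge, of l] by simp
    then have "(D (n (Suc l)) - D (n l)) / (2 * (1/2) ^ l) \<le> (1/4) ^ l / (2 * (1/2) ^ l)"
      by (intro divide_right_mono) auto
    also have "(1/4 :: real) ^ l = (1/2) ^ l * (1/2) ^ l"
      by (simp flip: power_mult_distrib)
    finally show ?thesis by simp
  qed
  have d_summable: "summable (\<lambda>l. \<integral>x. \<bar>d l x\<bar> \<partial>M)"
    by (rule summable_comparison_test'[where g = "\<lambda>l. 5/2 * (1/2) ^ l" and N = 0])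
       (use d_le in \<open>auto intro!: summable_mult summable_geometric\<close>)
  have AE_summable: "AE x in M. summable (\<lambda>l. \<bar>d l x\<bar>)"
  proof -
    have "(\<integral>\<^sup>+x. (\<Sum>l. ennreal \<bar>d l x\<bar>) \<partial>M) = (\<Sum>l. \<integral>\<^sup>+x. ennreal \<bar>d l x\<bar> \<partial>M)"
      by (intro nn_integral_suminf) auto
    also have "\<dots> = (\<Sum>l. ennreal (\<integral>x. \<bar>d l x\<bar> \<partial>M))"
      using d_int by (subst nn_integral_eq_integral) auto
    also have "\<dots> = ennreal (\<Sum>l. \<integral>x. \<bar>d l x\<bar> \<partial>M)"
      by (intro suminf_ennreal2 d_summable) auto
    finally have "(\<integral>\<^sup>+x. (\<Sum>l. ennreal \<bar>d l x\<bar>) \<partial>M) \<noteq> \<infinity>" by simp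
    then have "AE x in M. (\<Sum>l. ennreal \<bar>d l x\<bar>) \<noteq> \<infinity>"
      by (intro nn_integral_PInf_AE) auto
    then show ?thesis
      by eventually_elim (auto intro: summable_suminf_not_top)
  qed
  \<comment> \<open>One integrable function that dominates every \<open>g (n l)\<close>; the same
    domination serves the limit of the total mass and of all cell masses.\<close>
  define w where "w x = g (n 0) x + (\<Sum>l. \<bar>d l x\<bar>)" for x
  have w_int: "integrable M w"
    unfolding w_def using d_int d_summable AE_summable
    by (intro Bochner_Integration.integrable_add g_int integrable_suminf integrable_abs) auto
  \<comment> \<open>\<open>lim\<close> is arbitrary where the sequence diverges; the maximum keeps
    \<open>\<sigma>\<close> nonnegative on that null set as well.\<close>
  define \<sigma> where "\<sigma> x = max 0 (lim (\<lambda>l. g (n l) x))" for x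
  have \<sigma>_nonneg: "0 \<le> \<sigma> x" for x
    by (simp add: \<sigma>_def)
  have \<sigma>_meas [measurable]: "\<sigma> \<in> borel_measurable M"
    unfolding \<sigma>_def by measurable
  have telescope: "g (n l) x = g (n 0) x + (\<Sum>k<l. d k x)" for l x
    using sum_lessThan_telescope[of "\<lambda>l. g (n l) x" l] by (simp add: d_def)
  have conv: "AE x in M. (\<lambda>l. g (n l) x) \<longlonglongrightarrow> \<sigma> x"
    using AE_summable
  proof eventually_elim
    case (elim x)
    then have "summable (\<lambda>l. d l x)" by (rule summable_rabs_cancel)
    then have "(\<lambda>l. \<Sum>k<l. d k x) \<longlonglongrightarrow> (\<Sum>k. d k x)" by (rule summable_LIMSEQ)
    then have "(\<lambda>l. g (n 0) x + (\<Sum>k<l. d k x)) \<longlonglongrightarrow> g (n 0) x + (\<Sum>k. d k x)"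
      by (intro tendsto_add tendsto_const)
    then have "(\<lambda>l. g (n l) x) \<longlonglongrightarrow> g (n 0) x + (\<Sum>k. d k x)"
      by (simp only: telescope[symmetric])
    moreover from this have "0 \<le> g (n 0) x + (\<Sum>k. d k x)"
      using g_nonneg by (intro LIMSEQ_le_const) auto
    ultimately show ?case
      by (simp add: \<sigma>_def limI)
  qed
  have dom: "AE x in M. norm (g (n l) x) \<le> w x" for l
    using AE_summable
  proof eventually_elim
    case (elim x)
    have "g (n l) x \<le> g (n 0) x + (\<Sum>k<l. \<bar>d k x\<bar>)"
      by (subst telescope) (intro add_left_mono sum_mono, simp)
    also have "(\<Sum>k<l. \<bar>d k x\<bar>) \<le> (\<Sum>k. \<bar>d k x\<bar>)"
      by (intro sum_le_suminf elim) auto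
    finally show ?case using g_nonneg by (simp add: w_def)
  qed
  have \<sigma>_int: "integrable M \<sigma>"
    by (rule integrable_dominated_convergence[OF _ _ w_int conv dom]) auto
  have \<sigma>_one: "(\<integral>x. \<sigma> x \<partial>M) = 1"
    using integral_dominated_convergence[OF _ _ w_int conv dom] g_int1
    by (simp add: LIMSEQ_const_iff)
  have \<sigma>_mass: "mass \<sigma> j a = m j a" for j a
  proof -
    have "(\<lambda>l. mass (g (n l)) j a) \<longlonglongrightarrow> mass \<sigma> j a"
      unfolding mass_def
    proof (rule integral_dominated_convergence[OF _ _ w_int])
      show "AE x in M. (\<lambda>l. indicator {y. c j y = a} x * g (n l) x) \<longlonglongrightarrow> indicator {y. c j y = a} x * \<sigma> x"
        using conv by eventually_elim (intro tendsto_intros)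
      show "AE x in M. norm (indicator {y. c j y = a} x * g (n l) x) \<le> w x" for l
        using dom[of l] by eventually_elim (auto simp: indicator_def intro: order_trans[OF abs_ge_zero])
    qed auto
    \<comment> \<open>From level \<open>j\<close> on the mass of a cell of level \<open>j\<close> no
      longer changes, by consistency.\<close>
    moreover have "eventually (\<lambda>l. mass (g (n l)) j a = m j a) sequentially"
      using eventually_ge_at_top[of j]
    proof eventually_elim
      case (elim l)
      then have "j \<le> n l" using n_ge'[of l] by (rule order_trans)
      have "mass (g (n l)) j a = (\<integral>x. (\<lambda>b. of_bool (b = a)) (c j x) * g (n l) x \<partial>M)"
        unfolding mass_def by (intro Bochner_Integration.integral_cong) (auto simp: indicator_def)
      also have "\<dots> = (\<Sum>b\<in>c j ` space M. of_bool (b = a) * m j b)"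
        by (rule step_g) fact
      also have "\<dots> = (\<Sum>b\<in>c j ` space M. if b = a then m j b else 0)"
        by (intro sum.cong) auto
      also have "\<dots> = (if a \<in> c j ` space M then m j a else 0)"
        using finite_c by simp
      also have "\<dots> = m j a"
      proof (cases "a \<in> c j ` space M")
        case False
        then have "{x \<in> space M. c j x = a} = {}" by auto
        then have "vol j a = 0" by (simp only: vol_def measure_empty)
        then show ?thesis using zero False by simp
      qed simp
      finally show ?case .
    qed
    then have "(\<lambda>l. mass (g (n l)) j a) \<longlonglongrightarrow> m j a"
      by (rule tendsto_eventually)
    ultimately show ?thesis by (rule LIMSEQ_unique)
  qed
  \<comment> \<open>Fatou's lemma needs a nonnegative integrand, so \<open>t * ln t\<close> is
    replaced by a convex function with minimum 0 at 1; the added terms have a known integral because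
    all total masses are 1.\<close>
  define \<phi> where "\<phi> t = t * ln t - t + 1" for t :: real
  have \<phi>_nonneg: "0 \<le> \<phi> t" if "0 \<le> t" for t
    using xlnx_ge[OF that] by (simp add: \<phi>_def)
  have [measurable]: "\<phi> \<in> borel_measurable borel"
    unfolding \<phi>_def by measurable
  have \<phi>_le: "(\<integral>\<^sup>+x. ennreal (\<phi> (g j x)) \<partial>M) \<le> ennreal (C - 1 + measure M (space M))" for j
  proof -
    have "integrable M (\<lambda>x. \<phi> (g j x))"
      unfolding \<phi>_def using ln_int g_int by auto
    then have "(\<integral>\<^sup>+x. ennreal (\<phi> (g j x)) \<partial>M) = ennreal (\<integral>x. \<phi> (g j x) \<partial>M)"
      using \<phi>_nonneg g_nonneg by (intro nn_integral_eq_integral) auto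
    also have "(\<integral>x. \<phi> (g j x) \<partial>M) = D j - 1 + measure M (space M)"
      unfolding \<phi>_def D_def using ln_int g_int g_int1 by simp
    finally show ?thesis using bound[of j] by (simp add: D_def ennreal_leI)
  qed
  have "(\<integral>\<^sup>+x. ennreal (\<phi> (\<sigma> x)) \<partial>M) = (\<integral>\<^sup>+x. liminf (\<lambda>l. ennreal (\<phi> (g (n l) x))) \<partial>M)"
  proof (intro nn_integral_cong_AE, use conv in eventually_elim)
    case (elim x)
    have "(\<lambda>l. \<phi> (g (n l) x)) \<longlonglongrightarrow> \<phi> (\<sigma> x)"
      unfolding \<phi>_def using g_nonneg
      by (intro tendsto_add tendsto_diff tendsto_xlnx elim tendsto_const) (auto simp: \<sigma>_def)
    then have "(\<lambda>l. ennreal (\<phi> (g (n l) x))) \<longlonglongrightarrow> ennreal (\<phi> (\<sigma> x))"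
      by (rule tendsto_ennrealI)
    then show ?case by (metis lim_imp_Liminf sequentially_bot)
  qed
  also have "\<dots> \<le> liminf (\<lambda>l. \<integral>\<^sup>+x. ennreal (\<phi> (g (n l) x)) \<partial>M)"
    by (intro nn_integral_liminf) auto
  also have "\<dots> \<le> limsup (\<lambda>l. \<integral>\<^sup>+x. ennreal (\<phi> (g (n l) x)) \<partial>M)"
    by (intro Liminf_le_Limsup) auto
  also have "\<dots> \<le> ennreal (C - 1 + measure M (space M))"
    using \<phi>_le by (intro Limsup_bounded) auto
  finally have \<phi>\<sigma>: "(\<integral>\<^sup>+x. ennreal (\<phi> (\<sigma> x)) \<partial>M) \<le> ennreal (C - 1 + measure M (space M))" .
  have \<phi>\<sigma>_int: "integrable M (\<lambda>x. \<phi> (\<sigma> x))"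
  proof (rule integrableI_nonneg)
    show "(\<integral>\<^sup>+x. ennreal (\<phi> (\<sigma> x)) \<partial>M) < \<infinity>"
      using \<phi>\<sigma> ennreal_less_top le_less_trans unfolding infinity_ennreal_def by blast
  qed (use \<phi>_nonneg \<sigma>_nonneg in auto)
  have C_ge: "0 \<le> C - 1 + measure M (space M)"
  proof -
    have "0 \<le> (\<integral>x. \<phi> (g 0 x) \<partial>M)" using \<phi>_nonneg g_nonneg by (intro integral_nonneg_AE) auto
    also have "\<dots> = D 0 - 1 + measure M (space M)"
      unfolding \<phi>_def D_def using ln_int g_int g_int1 by simp
    finally show ?thesis using bound[of 0] by (simp add: D_def)
  qed
  have "ennreal (\<integral>x. \<phi> (\<sigma> x) \<partial>M) \<le> ennreal (C - 1 + measure M (space M))"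
    using \<phi>\<sigma> nn_integral_eq_integral[OF \<phi>\<sigma>_int] \<phi>_nonneg \<sigma>_nonneg by simp
  then have \<phi>\<sigma>_le: "(\<integral>x. \<phi> (\<sigma> x) \<partial>M) \<le> C - 1 + measure M (space M)"
    using C_ge by (simp add: ennreal_le_iff)
  have eq: "\<sigma> x * ln (\<sigma> x) = \<phi> (\<sigma> x) + \<sigma> x - 1" for x
    by (simp add: \<phi>_def)
  have ent_int: "integrable M (\<lambda>x. \<sigma> x * ln (\<sigma> x))"
    unfolding eq using \<phi>\<sigma>_int \<sigma>_int by auto
  have "(\<integral>x. \<sigma> x * ln (\<sigma> x) \<partial>M) = (\<integral>x. \<phi> (\<sigma> x) \<partial>M) + 1 - measure M (space M)"
    unfolding eq using \<phi>\<sigma>_int \<sigma>_int \<sigma>_one by simp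
  then have "(\<integral>x. \<sigma> x * ln (\<sigma> x) \<partial>M) \<le> C"
    using \<phi>\<sigma>_le by simp
  then show ?thesis
    using that[OF \<sigma>_int \<sigma>_nonneg \<sigma>_one ent_int _ \<sigma>_mass] by blast
qed


end

text \<open>The diagonal argument as Tychonoff's theorem: a product of unit intervals is compact,
  and over a countable index type the function space is first countable, so compactness yields a
  subsequence.\<close>

lemma pointwise_convergent_subsequence:
  fixes F :: "nat \<Rightarrow> 'c::countable \<Rightarrow> real"
  assumes "\<And>k p. F k p \<in> {0..1}"
  obtains r m where "strict_mono r" "\<And>p. (\<lambda>k. F (r k) p) \<longlonglongrightarrow> m p"
proof -
  have "compact (Pi\<^sub>E UNIV (\<lambda>_::'c. {0..1::real}))"
    by (simp add: compactin_PiE flip: compactin_euclidean_iff euclidean_product_topology)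
      (simp add: compactin_euclidean_iff)
  then have "seq_compact (Pi\<^sub>E UNIV (\<lambda>_::'c. {0..1::real}))"
    by (rule compact_imp_seq_compact)
  moreover have "\<forall>k. F k \<in> Pi\<^sub>E UNIV (\<lambda>_::'c. {0..1::real})"
    using assms by auto
  ultimately obtain m r where "strict_mono r" and lim: "(F \<circ> r) \<longlonglongrightarrow> m"
    unfolding seq_compact_def by metis
  have "(\<lambda>k. F (r k) p) \<longlonglongrightarrow> m p" for p
  proof -
    have "continuous_on UNIV (\<lambda>f::'c \<Rightarrow> real. f p)"
      by (rule continuous_on_product_coordinates)
    from continuous_on_tendsto_compose[OF this lim] show ?thesis by simp
  qed
  then show ?thesis using that \<open>strict_mono r\<close> by blast
qed

context refining_partitions
begin

text \<open>The masses of all cells converge along one subsequence, since levels and labels together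
  form a countable type. The limits inherit every linear relation between masses, and their step
  densities have entropy at most \<open>C\<close> by Gibbs' inequality on the level of cells. The
  bounds \<open>e k\<close> converge instead of being constant, so that for a convergent sequence of
  entropies the limit is compared with their limit.\<close>

theorem entropy_compactness:
  fixes \<rho> :: "nat \<Rightarrow> 'a \<Rightarrow> real"
  assumes int: "\<And>k. integrable M (\<rho> k)"
    and nonneg: "\<And>k x. x \<in> space M \<Longrightarrow> 0 \<le> \<rho> k x"
    and one: "\<And>k. (\<integral>x. \<rho> k x \<partial>M) = 1"
    and ent_int: "\<And>k. integrable M (\<lambda>x. \<rho> k x * ln (\<rho> k x))"
    and ent_le: "\<And>k. (\<integral>x. \<rho> k x * ln (\<rho> k x) \<partial>M) \<le> e k"
    and lim_e: "e \<longlonglongrightarrow> C"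
  obtains r \<sigma> where "strict_mono r" "integrable M \<sigma>" "\<And>x. 0 \<le> \<sigma> x" "(\<integral>x. \<sigma> x \<partial>M) = 1"
    "integrable M (\<lambda>x. \<sigma> x * ln (\<sigma> x))" "(\<integral>x. \<sigma> x * ln (\<sigma> x) \<partial>M) \<le> C"
    "\<And>j a. (\<lambda>k. mass (\<rho> (r k)) j a) \<longlonglongrightarrow> mass \<sigma> j a"
proof -
  have "mass (\<rho> k) j a \<in> {0..1}" for k j a
    using mass_nonneg[OF nonneg] mass_le[OF int nonneg] one by auto
  then obtain r m0 where r: "strict_mono r"
    and m0: "\<And>p. (\<lambda>k. mass (\<rho> (r k)) (fst p) (snd p)) \<longlonglongrightarrow> m0 p"
    using pointwise_convergent_subsequence[of "\<lambda>k p. mass (\<rho> k) (fst p) (snd p)"] by blast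
  define m where "m j a = m0 (j, a)" for j a
  have m: "(\<lambda>k. mass (\<rho> (r k)) j a) \<longlonglongrightarrow> m j a" for j a
    using m0[of "(j, a)"] by (simp add: m_def)
  have m_nonneg: "0 \<le> m j a" for j a
    using mass_nonneg[OF nonneg] by (intro LIMSEQ_le_const[OF m]) auto
  have m_zero: "m j a = 0" if "vol j a = 0" for j a
    using m[of j a] mass_eq_0[OF that] by (simp add: LIMSEQ_const_iff)
  have m_mono: "m i (c i x) \<le> m j (c j x)" if "x \<in> space M" "j \<le> i" for i j x
    by (rule LIMSEQ_le[OF m m]) (use mass_mono[OF int nonneg that(2,1)] in auto)
  have lim_sum: "(\<lambda>k. \<Sum>a\<in>A. h a * mass (\<rho> (r k)) j a) \<longlonglongrightarrow> (\<Sum>a\<in>A. h a * m j a)" for h j A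
    by (intro tendsto_intros m)
  have m_cons: "(\<Sum>a\<in>c j ` space M. h a * m j a) = (\<Sum>b\<in>c i ` space M. h' b * m i b)"
    if "\<And>x. x \<in> space M \<Longrightarrow> h (c j x) = h' (c i x)" for h h' i j
  proof (rule LIMSEQ_unique[OF lim_sum])
    \<comment> \<open>For each \<open>k\<close> both sums are the integral of
      \<open>\<rho> (r k)\<close> against one and the same function.\<close>
    have "(\<Sum>a\<in>c j ` space M. h a * mass (\<rho> (r k)) j a) = (\<Sum>b\<in>c i ` space M. h' b * mass (\<rho> (r k)) i b)" for k
      unfolding integral_step[OF int, symmetric] using that
      by (intro Bochner_Integration.integral_cong) auto
    then show "(\<lambda>k. \<Sum>a\<in>c j ` space M. h a * mass (\<rho> (r k)) j a) \<longlonglongrightarrow> (\<Sum>b\<in>c i ` space M. h' b * m i b)"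
      using lim_sum by simp
  qed
  have m_total: "(\<Sum>a\<in>c j ` space M. m j a) = 1" for j
  proof (rule LIMSEQ_unique)
    show "(\<lambda>k. \<Sum>a\<in>c j ` space M. mass (\<rho> (r k)) j a) \<longlonglongrightarrow> (\<Sum>a\<in>c j ` space M. m j a)"
      by (intro tendsto_intros m)
    show "(\<lambda>k. \<Sum>a\<in>c j ` space M. mass (\<rho> (r k)) j a) \<longlonglongrightarrow> 1"
      using integral_step[OF int, of "\<lambda>_. 1"] one by simp
  qed
  define G where "G j a = m j a / vol j a" for j a
  have G_nonneg: "0 \<le> G j a" for j a
    unfolding G_def using m_nonneg vol_nonneg by simp
  have bound: "(\<integral>x. G j (c j x) * ln (G j (c j x)) \<partial>M) \<le> C" for j
  proof -
    have G_vol: "h * G j a * vol j a = h * m j a" for h a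
      using m_zero[of j a] by (simp add: G_def)
    have D: "(\<integral>x. G j (c j x) * ln (G j (c j x)) \<partial>M) = (\<Sum>a\<in>c j ` space M. ln (G j a) * m j a)"
      unfolding integral_step_vol[of "\<lambda>a. G j a * ln (G j a)" j]
      by (intro sum.cong refl) (use G_vol[of 1] in \<open>auto simp: mult.commute mult.left_commute mult.assoc\<close>)
    have G_one: "(\<integral>x. G j (c j x) \<partial>M) = 1"
      unfolding integral_step_vol[of "G j" j] using m_total[of j] G_vol[of 1] by simp
    \<comment> \<open>The step density may vanish where \<open>\<rho> (r k)\<close> does not, and
      then Gibbs' inequality does not apply. Adding \<open>t\<close> removes the zeros at the price
      of the additional mass \<open>t * measure M (space M)\<close>.\<close>
    have *: "(\<Sum>a\<in>c j ` space M. ln (G j a) * m j a) \<le> C + t * measure M (space M)" if "t > 0" for t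
    proof -
      have pos: "0 < G j a + t" for a
        using G_nonneg[of j a] that by simp
      have "(\<Sum>a\<in>c j ` space M. ln (G j a + t) * mass (\<rho> (r k)) j a) - t * measure M (space M) \<le> e (r k)" for k
      proof -
        have i1: "integrable M (\<lambda>x. \<rho> (r k) x * ln (G j (c j x) + t))"
          using integrable_step[OF int, of "\<lambda>a. ln (G j a + t)" j "r k"] by (simp add: mult.commute)
        have i2: "integrable M (\<lambda>x. G j (c j x))"
          by (rule integrable_step_vol)
        have "(\<Sum>a\<in>c j ` space M. ln (G j a + t) * mass (\<rho> (r k)) j a) =
              (\<integral>x. \<rho> (r k) x * ln (G j (c j x) + t) \<partial>M)"
          by (subst integral_step[OF int, symmetric]) (simp add: mult.commute)
        then have "(\<Sum>a\<in>c j ` space M. ln (G j a + t) * mass (\<rho> (r k)) j a) - t * measure M (space M) =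
              (\<integral>x. \<rho> (r k) x * ln (G j (c j x) + t) + \<rho> (r k) x - (G j (c j x) + t) \<partial>M)"
          using i1 i2 int one G_one by simp
        also have "\<dots> \<le> (\<integral>x. \<rho> (r k) x * ln (\<rho> (r k) x) \<partial>M)"
          using i1 i2 int ent_int nonneg pos
          by (intro integral_mono gibbs_ineq Bochner_Integration.integrable_add Bochner_Integration.integrable_diff)
             (auto simp: less_imp_le less_imp_neq[symmetric])
        finally show ?thesis using ent_le[of "r k"] by linarith
      qed
      moreover have "(\<lambda>k. (\<Sum>a\<in>c j ` space M. ln (G j a + t) * mass (\<rho> (r k)) j a) - t * measure M (space M))
          \<longlonglongrightarrow> (\<Sum>a\<in>c j ` space M. ln (G j a + t) * m j a) - t * measure M (space M)"
        by (intro tendsto_intros m)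
      moreover have "(\<lambda>k. e (r k)) \<longlonglongrightarrow> C"
        using LIMSEQ_subseq_LIMSEQ[OF lim_e r] by (simp add: o_def)
      ultimately have "(\<Sum>a\<in>c j ` space M. ln (G j a + t) * m j a) - t * measure M (space M) \<le> C"
        by (intro LIMSEQ_le) auto
      moreover have "(\<Sum>a\<in>c j ` space M. ln (G j a) * m j a) \<le> (\<Sum>a\<in>c j ` space M. ln (G j a + t) * m j a)"
      proof (intro sum_mono)
        fix a
        show "ln (G j a) * m j a \<le> ln (G j a + t) * m j a"
        proof (cases "m j a = 0")
          case False
          then have "0 < m j a" "0 < vol j a"
            using m_nonneg[of j a] m_zero[of j a] vol_nonneg[of j a] by (auto simp: order_less_le)
          then have "0 < G j a" by (simp add: G_def)
          then show ?thesis using \<open>0 < m j a\<close> that by (intro mult_right_mono) auto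
        qed simp
      qed
      ultimately show ?thesis by simp
    qed
    show ?thesis unfolding D
    proof (rule field_le_epsilon)
      fix u :: real assume "u > 0"
      define t where "t = u / (measure M (space M) + 1)"
      have pos: "measure M (space M) + 1 > 0"
        using measure_nonneg[of M "space M"] by linarith
      have "t > 0" using \<open>u > 0\<close> pos by (simp add: t_def)
      have "t * measure M (space M) \<le> u"
        using \<open>u > 0\<close> pos by (simp add: t_def field_simps)
      then show "(\<Sum>a\<in>c j ` space M. ln (G j a) * m j a) \<le> C + u"
        using *[OF \<open>t > 0\<close>] by linarith
    qed
  qed
  obtain \<sigma> where "integrable M \<sigma>" "\<And>x. 0 \<le> \<sigma> x" "(\<integral>x. \<sigma> x \<partial>M) = 1"
      "integrable M (\<lambda>x. \<sigma> x * ln (\<sigma> x))" "(\<integral>x. \<sigma> x * ln (\<sigma> x) \<partial>M) \<le> C"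
      "\<And>j a. mass \<sigma> j a = m j a"
  proof (rule consistent_masses_density[of m C])
    show "0 \<le> m j a" for j a
      by (rule m_nonneg)
    show "m j a = 0" if "vol j a = 0" for j a
      by (rule m_zero[OF that])
    show "m i (c i x) \<le> m j (c j x)" if "x \<in> space M" "j \<le> i" for i j x
      by (rule m_mono[OF that])
    show "(\<Sum>a\<in>c j ` space M. h a * m j a) = (\<Sum>b\<in>c i ` space M. h' b * m i b)"
      if "j \<le> i" "\<And>x. x \<in> space M \<Longrightarrow> h (c j x) = h' (c i x)" for i j h h'
      by (rule m_cons[of h j h' i, OF that(2)])
    show "(\<Sum>a\<in>c j ` space M. m j a) = 1" for j
      by (rule m_total)
    show "(\<integral>x. m j (c j x) / vol j (c j x) * ln (m j (c j x) / vol j (c j x)) \<partial>M) \<le> C" for j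
      using bound[of j] by (simp only: G_def)
  qed blast
  show ?thesis
    by (rule that[OF r]) (fact | use m in \<open>simp only: \<open>\<And>j a. mass \<sigma> j a = m j a\<close>\<close>)+
qed

end

section \<open>Dyadic cells and the interaction energy\<close>

text \<open>The label of the half-open dyadic cube of side \<open>1 / 2 ^ j\<close> that contains
  \<open>q\<close>; half-open cubes partition the space exactly and are nested.\<close>

definition cell :: "nat \<Rightarrow> real^3 \<Rightarrow> int \<times> int \<times> int" where
  "cell j q = (\<lfloor>2 ^ j * q $ 1\<rfloor>, \<lfloor>2 ^ j * q $ 2\<rfloor>, \<lfloor>2 ^ j * q $ 3\<rfloor>)"

lemma measurable_cell_borel: "cell j \<in> borel \<rightarrow>\<^sub>M count_space UNIV"
proof (subst measurable_count_space_eq_countable; safe?)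
  fix a b c :: int
  have "cell j -` {(a, b, c)} \<inter> space borel =
    {q \<in> space borel. \<lfloor>2 ^ j * q $ 1\<rfloor> = a \<and> \<lfloor>2 ^ j * q $ 2\<rfloor> = b \<and> \<lfloor>2 ^ j * q $ 3\<rfloor> = c}"
    by (auto simp: cell_def)
  also have "\<dots> \<in> sets borel" by measurable
  finally show "cell j -` {(a, b, c)} \<inter> space borel \<in> sets borel" .
qed auto

lemma floor_eq_half:
  fixes x y :: real
  assumes "\<lfloor>2 * x\<rfloor> = \<lfloor>2 * y\<rfloor>"
  shows "\<lfloor>x\<rfloor> = \<lfloor>y\<rfloor>"
  using floor_divide_real_eq_div[of 2 "2 * x"] floor_divide_real_eq_div[of 2 "2 * y"] assms by simp

lemma cell_refine: "cell (Suc j) q = cell (Suc j) q' \<Longrightarrow> cell j q = cell j q'"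
  by (auto simp: cell_def mult.assoc intro: floor_eq_half)

lemma finite_cells:
  assumes "bounded S"
  shows "finite (cell j ` S)"
proof -
  obtain B where B: "\<And>q. q \<in> S \<Longrightarrow> norm q \<le> B"
    using assms by (auto simp: bounded_iff)
  let ?I = "{\<lfloor>- (2 ^ j * B)\<rfloor>..\<lfloor>2 ^ j * B\<rfloor>}"
  have "\<lfloor>2 ^ j * q $ i\<rfloor> \<in> ?I" if "q \<in> S" for q i
  proof -
    have "\<bar>q $ i\<bar> \<le> B"
      using component_le_norm_cart[of q i] B[OF that] by linarith
    then have "\<bar>2 ^ j * q $ i\<bar> \<le> 2 ^ j * B"
      by (simp add: abs_mult)
    then have "- (2 ^ j * B) \<le> 2 ^ j * q $ i" "2 ^ j * q $ i \<le> 2 ^ j * B" by linarith+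
    then show ?thesis by (simp only: atLeastAtMost_iff floor_mono simp_thms)
  qed
  then have "cell j ` S \<subseteq> ?I \<times> ?I \<times> ?I"
    by (auto simp: cell_def)
  then show ?thesis by (rule finite_subset) auto
qed

lemma cell_diameter:
  assumes "cell j q = cell j q'"
  shows "dist q q' \<le> 3 / 2 ^ j"
proof -
  have *: "\<bar>(q - q') $ i\<bar> \<le> 1 / 2 ^ j" if "\<lfloor>2 ^ j * q $ i\<rfloor> = \<lfloor>2 ^ j * q' $ i\<rfloor>" for i
  proof -
    have "\<bar>2 ^ j * q $ i - 2 ^ j * q' $ i\<bar> \<le> 1"
      using that by linarith
    then have "2 ^ j * \<bar>(q - q') $ i\<bar> \<le> 1"
      by (simp add: abs_mult flip: right_diff_distrib)
    then show ?thesis by (simp add: field_simps)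
  qed
  have "dist q q' \<le> (\<Sum>i\<in>UNIV. \<bar>(q - q') $ i\<bar>)"
    unfolding dist_norm by (rule norm_le_l1_cart)
  also have "\<dots> = \<bar>(q - q') $ 1\<bar> + \<bar>(q - q') $ 2\<bar> + \<bar>(q - q') $ 3\<bar>"
    by (rule sum_3)
  also have "\<dots> \<le> 1 / 2 ^ j + 1 / 2 ^ j + 1 / 2 ^ j"
    using assms by (intro add_mono *) (auto simp: cell_def)
  finally show ?thesis by simp
qed

lemma ennreal_mult4:
  "0 \<le> a \<Longrightarrow> 0 \<le> b \<Longrightarrow> 0 \<le> c \<Longrightarrow> 0 \<le> d \<Longrightarrow>
    ennreal (a * b * c * d) = ennreal a * ennreal b * ennreal c * ennreal d"
  by (simp add: ennreal_mult)

text \<open>The hypotheses in the form in which the proof meets them: lower semicontinuity on the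
  open set itself, and square integrability over all of \<open>\<Lambda>\<close>, which for a
  bounded set is the local condition with a large ball.\<close>

locale pair_potential =
  fixes \<Lambda> :: "(real^3) set" and U :: "real^3 \<Rightarrow> real^3 \<Rightarrow> ennreal"
  assumes bounded_dom: "bounded \<Lambda>" and open_dom: "open \<Lambda>"
    and U_sym: "\<And>q q'. U q q' = U q' q"
    and U_lsc: "lower_semicontinuous_on (\<Lambda> \<times> \<Lambda>) (\<lambda>(q, q'). U q q')"
    and U_square_integrable: "\<And>q. q \<in> \<Lambda> \<Longrightarrow> (\<integral>\<^sup>+q'\<in>\<Lambda>. (U q q')\<^sup>2 \<partial>lborel) < \<infinity>"
begin

definition L :: "(real^3) measure" where
  "L = restrict_space lborel \<Lambda>"

lemma dom_sets [measurable, simp]: "\<Lambda> \<in> sets borel"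
  using open_dom by simp

lemma space_L [simp]: "space L = \<Lambda>"
  by (simp add: L_def space_restrict_space)

lemma nn_integral_L: "(\<integral>\<^sup>+q. f q \<partial>L) = (\<integral>\<^sup>+q\<in>\<Lambda>. f q \<partial>lborel)"
  unfolding L_def by (rule nn_integral_restrict_space) simp

lemma finite_measure_L: "finite_measure L"
proof
  have "emeasure L \<Lambda> = emeasure lborel \<Lambda>"
    unfolding L_def by (rule emeasure_restrict_space) auto
  then show "emeasure L (space L) \<noteq> \<infinity>"
    using emeasure_bounded_finite[OF bounded_dom] by auto
qed

lemma measurable_cell_L: "cell j \<in> L \<rightarrow>\<^sub>M count_space UNIV"
  unfolding L_def by (rule measurable_restrict_space1) (simp add: measurable_cell_borel)

sublocale refining_partitions L cell
proof -
  interpret finite_measure L by (rule finite_measure_L)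
  show "refining_partitions L cell"
    by unfold_locales (auto intro: measurable_cell_L finite_cells bounded_dom cell_refine)
qed

sublocale LL: pair_sigma_finite L L ..

text \<open>The cap at \<open>j\<close> keeps the values finite, so that energies become finite sums
  of reals, and it also covers labels of cells that miss \<open>\<Lambda>\<close>, where the infimum
  is over the empty set. It grows with the level, so the supremum over all levels is still
  \<open>U\<close>.\<close>

definition cellU :: "nat \<Rightarrow> int \<times> int \<times> int \<Rightarrow> int \<times> int \<times> int \<Rightarrow> ennreal" where
  "cellU j a b = min (of_nat j) (INF r\<in>{r \<in> \<Lambda>. cell j r = a}. INF r'\<in>{r' \<in> \<Lambda>. cell j r' = b}. U r r')"

lemma cellU_le:
  assumes "q \<in> \<Lambda>" "q' \<in> \<Lambda>"
  shows "cellU j (cell j q) (cell j q') \<le> U q q'"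
  unfolding cellU_def using assms
  by (intro min.coboundedI2 INF_lower2[of q] INF_lower2[of q']) auto

lemma cellU_le_level: "cellU j a b \<le> of_nat j"
  by (simp add: cellU_def)

lemma cellU_mono:
  assumes "j \<le> i" "q \<in> \<Lambda>" "q' \<in> \<Lambda>"
  shows "cellU j (cell j q) (cell j q') \<le> cellU i (cell i q) (cell i q')"
  unfolding cellU_def
proof (intro min.mono INF_superset_mono)
  have sub: "{r \<in> \<Lambda>. cell i r = cell i s} \<subseteq> {r \<in> \<Lambda>. cell j r = cell j s}" if "s \<in> \<Lambda>" for s
  proof safe
    fix r assume "r \<in> \<Lambda>" "cell i r = cell i s"
    then show "cell j r = cell j s" using that by (intro refine[OF assms(1)]) simp_all
  qed
  show "{r \<in> \<Lambda>. cell i r = cell i q} \<subseteq> {r \<in> \<Lambda>. cell j r = cell j q}"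
    and "{r \<in> \<Lambda>. cell i r = cell i q'} \<subseteq> {r \<in> \<Lambda>. cell j r = cell j q'}"
    by (rule sub, fact)+
qed (use assms in auto)

text \<open>Any \<open>a\<close> below \<open>U q q'\<close> is, by lower semicontinuity, also below
  \<open>U\<close> near the pair, and pairs taken from the same two cells of level \<open>j\<close>
  stay within distance \<open>6 / 2 ^ j\<close>. Testing with all such \<open>a\<close> also covers
  an infinite value.\<close>

lemma cellU_SUP:
  assumes "q \<in> \<Lambda>" "q' \<in> \<Lambda>"
  shows "(SUP j. cellU j (cell j q) (cell j q')) = U q q'"
proof (rule antisym)
  show "(SUP j. cellU j (cell j q) (cell j q')) \<le> U q q'"
    by (intro SUP_least cellU_le assms)
  show "U q q' \<le> (SUP j. cellU j (cell j q) (cell j q'))"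
  proof (rule dense_le)
    fix a assume a: "a < U q q'"
    then have "a \<noteq> \<infinity>" by auto
    then obtain n where n: "a \<le> of_nat n"
      using ennreal_Ex_less_of_nat[of a] by (auto simp: less_top intro: less_imp_le)
    have "eventually (\<lambda>y. a < (case y of (q, q') \<Rightarrow> U q q')) (at (q, q') within \<Lambda> \<times> \<Lambda>)"
      using U_lsc a assms unfolding lower_semicontinuous_on_def by auto
    then obtain d where "d > 0" and
      d: "\<And>r r'. r \<in> \<Lambda> \<Longrightarrow> r' \<in> \<Lambda> \<Longrightarrow> (r, r') \<noteq> (q, q') \<Longrightarrow> dist (r, r') (q, q') < d \<Longrightarrow> a < U r r'"
      unfolding eventually_at by auto
    \<comment> \<open>The filter \<open>at _ within _\<close> leaves out the point itself, which is
      added back here.\<close>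
    have d': "a \<le> U r r'" if "r \<in> \<Lambda>" "r' \<in> \<Lambda>" "dist (r, r') (q, q') < d" for r r'
      using d[OF that(1,2) _ that(3)] a by (cases "(r, r') = (q, q')") (auto intro: less_imp_le)
    have "((\<lambda>j. 6 / 2 ^ j) \<longlongrightarrow> (0::real)) sequentially"
      by real_asymp
    then have "eventually (\<lambda>j. 6 / 2 ^ j < d) sequentially"
      using \<open>d > 0\<close> by (rule order_tendstoD)
    then have "eventually (\<lambda>j. 6 / 2 ^ j < d \<and> n \<le> j) sequentially"
      using eventually_ge_at_top[of n] by eventually_elim auto
    then obtain j where j: "6 / 2 ^ j < d" "n \<le> j"
      by (auto simp: eventually_sequentially)
    have "a \<le> cellU j (cell j q) (cell j q')"
      unfolding cellU_def
    proof (intro min.boundedI INF_greatest)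
      show "a \<le> of_nat j"
        using n j(2) by (metis order_trans of_nat_mono)
      fix r r' assume r: "r \<in> {r \<in> \<Lambda>. cell j r = cell j q}" "r' \<in> {r' \<in> \<Lambda>. cell j r' = cell j q'}"
      have "dist (r, r') (q, q') \<le> dist r q + dist r' q'"
        unfolding dist_Pair_Pair by (rule sqrt_sum_squares_le_sum) auto
      also have "\<dots> \<le> 3 / 2 ^ j + 3 / 2 ^ j"
        using r by (intro add_mono cell_diameter) auto
      also have "\<dots> < d" using j(1) by simp
      finally show "a \<le> U r r'" using r by (intro d') auto
    qed
    also have "\<dots> \<le> (SUP j. cellU j (cell j q) (cell j q'))"
      by (rule SUP_upper) simp
    finally show "a \<le> (SUP j. cellU j (cell j q) (cell j q'))" .
  qed
qed

lemma measurable_cellU [measurable]: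
  "(\<lambda>x. cellU j (cell j (fst x)) (cell j (snd x))) \<in> borel_measurable (L \<Otimes>\<^sub>M L)"
proof -
  have 1: "(\<lambda>x. cell j (fst x)) \<in> L \<Otimes>\<^sub>M L \<rightarrow>\<^sub>M count_space UNIV"
    and 2: "(\<lambda>x. cell j (snd x)) \<in> L \<Otimes>\<^sub>M L \<rightarrow>\<^sub>M count_space UNIV"
    by measurable
  show ?thesis
    by (rule measurable_compose_countable[OF measurable_compose_countable[OF _ 2] 1]) simp
qed

text \<open>Measurability comes from the representation of \<open>U\<close> as a supremum, over
  countably many levels, of functions that are constant on pairs of cells.\<close>

lemma measurable_U_pair: "(\<lambda>x. U (fst x) (snd x)) \<in> borel_measurable (L \<Otimes>\<^sub>M L)"
proof -
  have "(\<lambda>x. SUP j. cellU j (cell j (fst x)) (cell j (snd x))) \<in> borel_measurable (L \<Otimes>\<^sub>M L)"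
    by measurable
  then show ?thesis
    by (rule measurable_cong[THEN iffD1, rotated]) (auto simp: space_pair_measure cellU_SUP)
qed

lemma measurable_U [measurable (raw)]:
  assumes [measurable]: "f \<in> M \<rightarrow>\<^sub>M L" "g \<in> M \<rightarrow>\<^sub>M L"
  shows "(\<lambda>x. U (f x) (g x)) \<in> borel_measurable M"
  using measurable_compose[OF measurable_Pair[OF assms] measurable_U_pair] by simp

lemma measurable_cellU' [measurable (raw)]:
  assumes [measurable]: "f \<in> M \<rightarrow>\<^sub>M L" "g \<in> M \<rightarrow>\<^sub>M L"
  shows "(\<lambda>x. cellU j (cell j (f x)) (cell j (g x))) \<in> borel_measurable M"
  using measurable_compose[OF measurable_Pair[OF assms] measurable_cellU] by simp

text \<open>It depends on \<open>\<rho>\<close> only through finitely many cell masses, and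
  continuously; convergence of the masses therefore suffices to pass to the limit at each
  level.\<close>

definition cell_energy :: "nat \<Rightarrow> (real^3 \<Rightarrow> real) \<Rightarrow> real" where
  "cell_energy j \<rho> = (\<Sum>a\<in>cell j ` \<Lambda>. (\<Sum>b\<in>cell j ` \<Lambda>. 1/2 * enn2real (cellU j a b) * mass \<rho> j b) * mass \<rho> j a)"

lemma cellU_finite: "ennreal (enn2real (cellU j a b)) = cellU j a b"
  using le_less_trans[OF cellU_le_level of_nat_less_top] by (intro ennreal_enn2real)

lemma interaction_energy_L:
  "interaction_energy \<Lambda> U \<rho> = (\<integral>\<^sup>+q. (\<integral>\<^sup>+q'. ennreal (1/2) * U q q' * ennreal (\<rho> q) * ennreal (\<rho> q') \<partial>L) \<partial>L)"
  unfolding interaction_energy_def by (simp only: nn_integral_L)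

lemma cell_energy_nn_integral:
  assumes int: "integrable L \<rho>" and nonneg: "\<And>q. q \<in> \<Lambda> \<Longrightarrow> 0 \<le> \<rho> q"
  shows "(\<integral>\<^sup>+q. (\<integral>\<^sup>+q'. ennreal (1/2) * cellU j (cell j q) (cell j q') * ennreal (\<rho> q) * ennreal (\<rho> q') \<partial>L) \<partial>L)
         = ennreal (cell_energy j \<rho>)"
proof -
  let ?h = "\<lambda>a. \<Sum>b\<in>cell j ` \<Lambda>. 1/2 * enn2real (cellU j a b) * mass \<rho> j b"
  have "(\<integral>\<^sup>+q'. ennreal (1/2) * cellU j (cell j q) (cell j q') * ennreal (\<rho> q) * ennreal (\<rho> q') \<partial>L)
      = ennreal (?h (cell j q) * \<rho> q)" if q: "q \<in> \<Lambda>" for q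
  proof -
    let ?k = "\<lambda>b. 1/2 * enn2real (cellU j (cell j q) b)"
    have "(\<integral>\<^sup>+q'. ennreal (1/2) * cellU j (cell j q) (cell j q') * ennreal (\<rho> q) * ennreal (\<rho> q') \<partial>L)
      = (\<integral>\<^sup>+q'. ennreal (?k (cell j q') * \<rho> q' * \<rho> q) \<partial>L)"
    proof (intro nn_integral_cong)
      fix q' assume "q' \<in> space L"
      then have "0 \<le> \<rho> q" "0 \<le> \<rho> q'" using nonneg q by auto
      then show "ennreal (1/2) * cellU j (cell j q) (cell j q') * ennreal (\<rho> q) * ennreal (\<rho> q')
          = ennreal (?k (cell j q') * \<rho> q' * \<rho> q)"
        using ennreal_mult4[of "1/2" "enn2real (cellU j (cell j q) (cell j q'))" "\<rho> q'" "\<rho> q"]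
        by (simp only: cellU_finite enn2real_nonneg mult_ac)

    qed
    also have "\<dots> = ennreal (\<integral>q'. ?k (cell j q') * \<rho> q' * \<rho> q \<partial>L)"
      using nonneg q by (intro nn_integral_eq_integral integrable_mult_left integrable_step[OF int]) auto
    also have "(\<integral>q'. ?k (cell j q') * \<rho> q' * \<rho> q \<partial>L) = ?h (cell j q) * \<rho> q"
      using integral_step[OF int, of ?k j] by simp
    finally show ?thesis .
  qed
  then have "(\<integral>\<^sup>+q. (\<integral>\<^sup>+q'. ennreal (1/2) * cellU j (cell j q) (cell j q') * ennreal (\<rho> q) * ennreal (\<rho> q') \<partial>L) \<partial>L)
     = (\<integral>\<^sup>+q. ennreal (?h (cell j q) * \<rho> q) \<partial>L)"
    by (intro nn_integral_cong) simp
  also have "\<dots> = ennreal (\<integral>q. ?h (cell j q) * \<rho> q \<partial>L)"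
    using nonneg mass_nonneg[of \<rho>]
    by (intro nn_integral_eq_integral integrable_step[OF int] AE_I2 mult_nonneg_nonneg sum_nonneg) auto
  also have "(\<integral>q. ?h (cell j q) * \<rho> q \<partial>L) = cell_energy j \<rho>"
    unfolding cell_energy_def using integral_step[OF int, of ?h j] by simp
  finally show ?thesis .
qed

lemma interaction_energy_SUP:
  assumes int: "integrable L \<rho>" and nonneg: "\<And>q. q \<in> \<Lambda> \<Longrightarrow> 0 \<le> \<rho> q"
  shows "interaction_energy \<Lambda> U \<rho> = (SUP j. ennreal (cell_energy j \<rho>))"
proof -
  have [measurable]: "\<rho> \<in> borel_measurable L" using int by auto
  let ?f = "\<lambda>j q q'. ennreal (1/2) * cellU j (cell j q) (cell j q') * ennreal (\<rho> q) * ennreal (\<rho> q')"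
  have mono: "?f j q q' \<le> ?f i q q'" if "j \<le> i" "q \<in> \<Lambda>" "q' \<in> \<Lambda>" for i j q q'
    by (intro mult_mono cellU_mono that) auto
  have "interaction_energy \<Lambda> U \<rho> = (\<integral>\<^sup>+q. (\<integral>\<^sup>+q'. (SUP j. ?f j q q') \<partial>L) \<partial>L)"
    unfolding interaction_energy_L
    by (intro nn_integral_cong)
       (simp add: cellU_SUP SUP_mult_left_ennreal[symmetric] SUP_mult_right_ennreal[symmetric])
  also have "\<dots> = (\<integral>\<^sup>+q. (SUP j. (\<integral>\<^sup>+q'. ?f j q q' \<partial>L)) \<partial>L)"
    by (intro nn_integral_cong nn_integral_monotone_convergence_SUP_AE AE_I2)
       (use mono in \<open>auto\<close>)
  also have "\<dots> = (SUP j. (\<integral>\<^sup>+q. (\<integral>\<^sup>+q'. ?f j q q' \<partial>L) \<partial>L))"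
    by (intro nn_integral_monotone_convergence_SUP_AE AE_I2 nn_integral_mono)
       (use mono in \<open>auto\<close>)
  finally show ?thesis by (simp only: cell_energy_nn_integral[OF int nonneg])
qed

definition entropic :: "(real^3 \<Rightarrow> real) \<Rightarrow> bool" where
  "entropic \<rho> \<longleftrightarrow> integrable L \<rho> \<and> (\<forall>q\<in>\<Lambda>. 0 \<le> \<rho> q) \<and> (\<integral>q. \<rho> q \<partial>L) = 1 \<and> integrable L (\<lambda>q. \<rho> q * ln (\<rho> q))"

definition ent :: "(real^3 \<Rightarrow> real) \<Rightarrow> real" where
  "ent \<rho> = (\<integral>q. \<rho> q * ln (\<rho> q) \<partial>L)"

text \<open>The level \<open>i\<close> is fixed while \<open>k\<close> grows, and the bound is
  required only eventually. Thus the energy of the \<open>k\<close>-th density may be known merely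
  at a level that grows with \<open>k\<close>, as happens in the upper bound for the Laplace
  integral.\<close>

theorem energy_compactness:
  assumes \<rho>: "\<And>k. entropic (\<rho> k)"
    and ent_le: "\<And>k. ent (\<rho> k) \<le> e k" "e \<longlonglongrightarrow> C"
    and en: "\<And>i. eventually (\<lambda>k. cell_energy i (\<rho> k) \<le> x k) sequentially" "x \<longlonglongrightarrow> X"
  obtains \<sigma> where "entropic \<sigma>" "ent \<sigma> \<le> C" "interaction_energy \<Lambda> U \<sigma> \<le> ennreal X"
proof -
  obtain r \<sigma> where r: "strict_mono r" and \<sigma>: "integrable L \<sigma>" "\<And>q. 0 \<le> \<sigma> q" "(\<integral>q. \<sigma> q \<partial>L) = 1"
      "integrable L (\<lambda>q. \<sigma> q * ln (\<sigma> q))" "ent \<sigma> \<le> C"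
    and lim: "\<And>j a. (\<lambda>k. mass (\<rho> (r k)) j a) \<longlonglongrightarrow> mass \<sigma> j a"
  proof (rule entropy_compactness[of \<rho> e C])
    show "integrable L (\<rho> k)" "(\<integral>q. \<rho> k q \<partial>L) = 1" "integrable L (\<lambda>q. \<rho> k q * ln (\<rho> k q))"
      "(\<integral>q. \<rho> k q * ln (\<rho> k q) \<partial>L) \<le> e k" for k
      using \<rho>[of k] ent_le(1)[of k] by (auto simp: entropic_def ent_def)
    show "0 \<le> \<rho> k q" if "q \<in> space L" for k q
      using \<rho>[of k] that by (auto simp: entropic_def)
    show "e \<longlonglongrightarrow> C" by (rule ent_le(2))
  qed (auto simp: ent_def)
  have "ennreal (cell_energy i \<sigma>) \<le> ennreal X" for i
  proof (rule ennreal_leI, rule tendsto_le[OF sequentially_bot])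
    show "(\<lambda>k. x (r k)) \<longlonglongrightarrow> X"
      using LIMSEQ_subseq_LIMSEQ[OF en(2) r] by (simp add: o_def)
    show "(\<lambda>k. cell_energy i (\<rho> (r k))) \<longlonglongrightarrow> cell_energy i \<sigma>"
      unfolding cell_energy_def by (intro tendsto_intros lim)
    show "eventually (\<lambda>k. cell_energy i (\<rho> (r k)) \<le> x (r k)) sequentially"
      using eventually_subseq[OF r en(1)] .
  qed
  then have "interaction_energy \<Lambda> U \<sigma> \<le> ennreal X"
    using \<sigma> by (subst interaction_energy_SUP) (auto intro: SUP_least)
  then show ?thesis
    using \<sigma> by (intro that[of \<sigma>]) (auto simp: entropic_def)
qed

end

section \<open>Gaussian integrals and momentum volumes\<close>

lemma nn_integral_lborel_scaleR:
  fixes f :: "'a::euclidean_space \<Rightarrow> ennreal"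
  assumes [measurable]: "f \<in> borel_measurable borel" and "c \<noteq> 0"
  shows "(\<integral>\<^sup>+x. f x \<partial>lborel) = ennreal (\<bar>c\<bar> ^ DIM('a)) * (\<integral>\<^sup>+x. f (c *\<^sub>R x) \<partial>lborel)"
proof -
  have "(\<integral>\<^sup>+x. f x \<partial>lborel) = (\<integral>\<^sup>+x. f x \<partial>density (distr lborel borel (\<lambda>x. 0 + c *\<^sub>R x)) (\<lambda>_. ennreal (\<bar>c\<bar> ^ DIM('a))))"
    using lborel_affine[OF assms(2), where 'a='a and t=0] by simp
  also have "\<dots> = ennreal (\<bar>c\<bar> ^ DIM('a)) * (\<integral>\<^sup>+x. f (c *\<^sub>R x) \<partial>lborel)"
    by (simp add: nn_integral_density nn_integral_distr nn_integral_cmult)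
  finally show ?thesis .
qed

lemma emeasure_eq_nn_integral_of_bool:
  assumes "{x \<in> space M. P x} \<in> sets M"
  shows "emeasure M {x \<in> space M. P x} = (\<integral>\<^sup>+x. of_bool (P x) \<partial>M)"
proof -
  have "emeasure M {x \<in> space M. P x} = (\<integral>\<^sup>+x. indicator {x \<in> space M. P x} x \<partial>M)"
    by (rule nn_integral_indicator[symmetric]) fact
  also have "\<dots> = (\<integral>\<^sup>+x. of_bool (P x) \<partial>M)"
    by (intro nn_integral_cong) (simp add: indicator_def)
  finally show ?thesis .
qed

text \<open>Tonelli on the set of pairs with \<open>s x < R\<close>. It reduces integrals of
  functions of \<open>s\<close> to the volumes of its sublevel sets, a substitute for polar
  coordinates that works in any dimension.\<close>

lemma layer_cake:
  fixes s :: "'a \<Rightarrow> real" and h :: "real \<Rightarrow> ennreal"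
  assumes "sigma_finite_measure M" and [measurable]: "s \<in> borel_measurable M" "h \<in> borel_measurable borel"
  shows "(\<integral>\<^sup>+x. (\<integral>\<^sup>+R. h R * indicator {s x<..} R \<partial>lborel) \<partial>M) =
         (\<integral>\<^sup>+R. h R * emeasure M {x \<in> space M. s x < R} \<partial>lborel)"
proof -
  interpret sigma_finite_measure M by fact
  interpret pair_sigma_finite M lborel ..
  have "(\<integral>\<^sup>+x. (\<integral>\<^sup>+R. h R * indicator {s x<..} R \<partial>lborel) \<partial>M) =
        (\<integral>\<^sup>+x. (\<integral>\<^sup>+R. (if s x < R then h R else 0) \<partial>lborel) \<partial>M)"
    by (intro nn_integral_cong) (auto simp: indicator_def)
  also have "\<dots> = (\<integral>\<^sup>+R. (\<integral>\<^sup>+x. (if s x < R then h R else 0) \<partial>M) \<partial>lborel)"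
    by (rule Fubini'[symmetric]) measurable
  also have "\<dots> = (\<integral>\<^sup>+R. (\<integral>\<^sup>+x. h R * indicator {x \<in> space M. s x < R} x \<partial>M) \<partial>lborel)"
    by (intro nn_integral_cong) (auto simp: indicator_def)
  also have "\<dots> = (\<integral>\<^sup>+R. h R * emeasure M {x \<in> space M. s x < R} \<partial>lborel)"
    by (intro nn_integral_cong nn_integral_cmult_indicator) measurable
  finally show ?thesis .
qed

lemma nn_integral_greaterThan_eq_atLeast:
  "(\<integral>\<^sup>+R. f R * indicator {r<..} R \<partial>lborel) = (\<integral>\<^sup>+R. f R * indicator {r..} R \<partial>lborel)" for r :: real
  using AE_lborel_singleton[of r] by (intro nn_integral_cong_AE) (auto simp: indicator_def)

lemma nn_integral_exp_tail:
  "(\<integral>\<^sup>+R. ennreal (exp (- R)) * indicator {r<..} R \<partial>lborel) = ennreal (exp (- r))"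
proof -
  have "((\<lambda>R::real. - exp (- R)) \<longlongrightarrow> 0) at_top" by real_asymp
  then show ?thesis
    unfolding nn_integral_greaterThan_eq_atLeast
    by (subst nn_integral_FTC_atLeast[where F = "\<lambda>R. - exp (- R)" and T = 0])
       (auto intro!: derivative_eq_intros)
qed

text \<open>The antiderivative \<open>- ((R + 1) * exp (- R))\<close> is the reason why the moment
  formulas below carry the factor \<open>s x + 1\<close>; the plain moment is recovered from it by
  subtracting the mass.\<close>

lemma nn_integral_mult_exp_tail:
  assumes "0 \<le> r"
  shows "(\<integral>\<^sup>+R. ennreal (R * exp (- R)) * indicator {r<..} R \<partial>lborel) = ennreal ((r + 1) * exp (- r))"
proof -
  have "((\<lambda>R::real. - ((R + 1) * exp (- R))) \<longlongrightarrow> 0) at_top" by real_asymp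
  then show ?thesis
    unfolding nn_integral_greaterThan_eq_atLeast using assms
    by (subst nn_integral_FTC_atLeast[where F = "\<lambda>R. - ((R + 1) * exp (- R))" and T = 0])
       (auto intro!: derivative_eq_intros simp: algebra_simps)
qed

lemma nn_integral_Gamma:
  fixes a :: real
  assumes "a > 0"
  shows "(\<integral>\<^sup>+R. ennreal (R powr (a - 1) * exp (- R)) * indicator {0<..} R \<partial>lborel) = ennreal (Gamma a)"
proof -
  have "(\<integral>\<^sup>+R. ennreal (indicator {0..} R * (R powr (a - 1) / exp R)) \<partial>lborel) = ennreal (Gamma a)"
    using Gamma_integral_real[OF assms] by (intro nn_integral_has_integral_lebesgue) auto
  then show ?thesis
    unfolding nn_integral_greaterThan_eq_atLeast
    by (simp add: indicator_mult_ennreal mult.commute exp_minus field_simps)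
qed

text \<open>Layer cake turns both integrals into Gamma integrals of the sublevel volume. The first
  is used in two directions: with a known \<open>c\<close> to compute a Gaussian integral, and with
  a known Gaussian integral to find \<open>c\<close>.\<close>

lemma
  fixes s :: "'a \<Rightarrow> real"
  assumes M: "sigma_finite_measure M" and s: "s \<in> borel_measurable M" "\<And>x. 0 \<le> s x"
    and vol: "\<And>R. R > 0 \<Longrightarrow> emeasure M {x \<in> space M. s x < R} = ennreal (c * R powr a)"
    and "0 \<le> a" "0 \<le> c"
  shows nn_integral_exp_radial: "(\<integral>\<^sup>+x. ennreal (exp (- s x)) \<partial>M) = ennreal (c * Gamma (a + 1))"
    and nn_integral_mult_exp_radial:
      "(\<integral>\<^sup>+x. ennreal ((s x + 1) * exp (- s x)) \<partial>M) = ennreal (c * Gamma (a + 2))"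
proof -
  define v where "v R = emeasure M {x \<in> space M. s x < R}" for R
  have vol: "v R = ennreal (c * R powr a)" if "R > 0" for R
    using vol[OF that] by (simp only: v_def)
  have vol0: "v R = 0" if "R \<le> 0" for R
  proof -
    have "{x \<in> space M. s x < R} = {}" using s(2) that by (auto simp: not_less intro: order_trans)
    then show ?thesis by (simp only: v_def emeasure_empty)
  qed
  have "(\<integral>\<^sup>+x. ennreal (exp (- s x)) \<partial>M) = (\<integral>\<^sup>+R. ennreal (exp (- R)) * v R \<partial>lborel)"
    unfolding v_def by (subst layer_cake[OF M s(1), symmetric]) (auto simp: nn_integral_exp_tail)
  also have "\<dots> = (\<integral>\<^sup>+R. ennreal c * (ennreal (R powr (a + 1 - 1) * exp (- R)) * indicator {0<..} R) \<partial>lborel)"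
    using assms(5,6)
    by (intro nn_integral_cong) (auto simp: vol vol0 indicator_def ennreal_mult[symmetric] ac_simps not_less)
  also have "\<dots> = ennreal (c * Gamma (a + 1))"
    using assms(5,6) nn_integral_Gamma[of "a + 1"]
    by (subst nn_integral_cmult) (auto simp: ennreal_mult)
  finally show "(\<integral>\<^sup>+x. ennreal (exp (- s x)) \<partial>M) = ennreal (c * Gamma (a + 1))" .
  have "(\<integral>\<^sup>+x. ennreal ((s x + 1) * exp (- s x)) \<partial>M)
      = (\<integral>\<^sup>+R. ennreal (R * exp (- R)) * v R \<partial>lborel)"
    unfolding v_def by (subst layer_cake[OF M s(1), symmetric]) (auto simp: nn_integral_mult_exp_tail s(2))
  also have "\<dots> = (\<integral>\<^sup>+R. ennreal c * (ennreal (R powr (a + 2 - 1) * exp (- R)) * indicator {0<..} R) \<partial>lborel)"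
    using assms(5,6)
    by (intro nn_integral_cong)
       (auto simp: vol vol0 indicator_def ennreal_mult[symmetric] not_less powr_add algebra_simps)
  also have "\<dots> = ennreal (c * Gamma (a + 2))"
    using assms(5,6) nn_integral_Gamma[of "a + 2"]
    by (subst nn_integral_cmult) (auto simp: ennreal_mult)
  finally show "(\<integral>\<^sup>+x. ennreal ((s x + 1) * exp (- s x)) \<partial>M) = ennreal (c * Gamma (a + 2))" .
qed

lemma emeasure_norm_square_less:
  assumes "R > 0"
  shows "emeasure lborel {p :: real^3. (norm p)\<^sup>2 < R} = ennreal (unit_ball_vol 3 * R powr (3/2))"
proof -
  have "{p :: real^3. (norm p)\<^sup>2 < R} = ball 0 (sqrt R)"
    using real_less_rsqrt real_sqrt_less_iff by (auto simp: real_less_lsqrt)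
      (metis assms less_le norm_ge_zero real_sqrt_pow2 power_strict_mono zero_less_numeral)
  moreover have "sqrt R ^ 3 = R powr (3/2)"
    using assms by (simp add: powr_half_sqrt[symmetric] powr_powr flip: powr_realpow)
  ultimately show ?thesis
    using assms by (simp add: emeasure_ball)
qed

lemma Gamma_seven_halves: "Gamma (7/2 :: real) = 5/2 * Gamma (5/2)"
  using Gamma_plus1[of "5/2 :: real"] by (simp add: nonpos_Ints_def)

lemma unit_ball_vol_3_Gamma: "unit_ball_vol 3 * Gamma (5/2) = pi powr (3/2)"
proof -
  have "Gamma (5/2 :: real) \<noteq> 0"
    using Gamma_real_pos[of "5/2"] by linarith
  then show ?thesis by (simp add: unit_ball_vol_def)
qed

lemma
  shows nn_integral_gaussian: "(\<integral>\<^sup>+p. ennreal (exp (- (norm p)\<^sup>2)) \<partial>(lborel :: (real^3) measure)) = ennreal (pi powr (3/2))"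
    and nn_integral_gaussian_moment:
      "(\<integral>\<^sup>+p. ennreal (((norm p)\<^sup>2 + 1) * exp (- (norm p)\<^sup>2)) \<partial>(lborel :: (real^3) measure)) = ennreal (5/2 * pi powr (3/2))"
proof -
  have "sigma_finite_measure (lborel :: (real^3) measure)" ..
  note * = nn_integral_exp_radial[OF this, where s = "\<lambda>p. (norm p)\<^sup>2" and c = "unit_ball_vol 3" and a = "3/2"]
    and ** = nn_integral_mult_exp_radial[OF this, where s = "\<lambda>p. (norm p)\<^sup>2" and c = "unit_ball_vol 3" and a = "3/2"]
  show "(\<integral>\<^sup>+p. ennreal (exp (- (norm p)\<^sup>2)) \<partial>(lborel :: (real^3) measure)) = ennreal (pi powr (3/2))"
    by (subst *) (auto simp: emeasure_norm_square_less unit_ball_vol_3_Gamma)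
  show "(\<integral>\<^sup>+p. ennreal (((norm p)\<^sup>2 + 1) * exp (- (norm p)\<^sup>2)) \<partial>(lborel :: (real^3) measure)) = ennreal (5/2 * pi powr (3/2))"
    by (subst **) (auto simp: emeasure_norm_square_less Gamma_seven_halves unit_ball_vol_3_Gamma[symmetric])
qed

section \<open>Mass and mean energy of the Maxwellian\<close>

lemma maxwellian_pos: "\<theta> > 0 \<Longrightarrow> 0 < maxwellian \<theta> p"
  by (simp add: maxwellian_def)

lemma measurable_maxwellian [measurable]: "maxwellian \<theta> \<in> borel_measurable borel"
  unfolding maxwellian_def by measurable

lemma ln_maxwellian:
  assumes "\<theta> > 0"
  shows "ln (maxwellian \<theta> p) = - 3/2 * ln (2 * pi * \<theta>) - (1/2 * (norm p)\<^sup>2) / \<theta>"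
  using assms by (simp add: maxwellian_def ln_mult ln_powr)

text \<open>Scaling the momentum by \<open>sqrt (2 * \<theta>)\<close> reduces every temperature to
  the Gaussian \<open>exp (- (norm p)\<^sup>2)\<close>. The weight \<open>g\<close> is kept general
  because it is needed once as 1 and once as \<open>x + 1\<close>.\<close>

lemma nn_integral_maxwellian_scale:
  assumes "\<theta> > 0" and [measurable]: "g \<in> borel_measurable borel" and "\<And>x. x \<ge> 0 \<Longrightarrow> 0 \<le> g x"
  shows "(\<integral>\<^sup>+p. ennreal (g ((1/2 * (norm p)\<^sup>2) / \<theta>) * maxwellian \<theta> p) \<partial>lborel)
    = ennreal (pi powr (-3/2)) * (\<integral>\<^sup>+p. ennreal (g ((norm p)\<^sup>2) * exp (- (norm p)\<^sup>2)) \<partial>(lborel :: (real^3) measure))"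
proof -
  let ?c = "sqrt (2 * \<theta>)"
  have c: "?c \<noteq> 0" "\<bar>?c\<bar> ^ 3 = (2 * \<theta>) powr (3/2)"
    using assms(1) by (simp_all add: powr_half_sqrt[symmetric] powr_powr flip: powr_realpow)
  have "(\<integral>\<^sup>+p. ennreal (g ((1/2 * (norm p)\<^sup>2) / \<theta>) * maxwellian \<theta> p) \<partial>lborel)
     = ennreal ((2 * \<theta>) powr (3/2)) *
       (\<integral>\<^sup>+p. ennreal (g ((1/2 * (norm (?c *\<^sub>R p))\<^sup>2) / \<theta>) * maxwellian \<theta> (?c *\<^sub>R p)) \<partial>(lborel :: (real^3) measure))"
    by (subst nn_integral_lborel_scaleR[OF _ c(1)]) (use c in auto)
  also have "(\<lambda>p::real^3. ennreal (g ((1/2 * (norm (?c *\<^sub>R p))\<^sup>2) / \<theta>) * maxwellian \<theta> (?c *\<^sub>R p)))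
     = (\<lambda>p. ennreal ((2 * pi * \<theta>) powr (-3/2)) * ennreal (g ((norm p)\<^sup>2) * exp (- (norm p)\<^sup>2)))"
  proof
    fix p :: "real^3"
    have *: "(1/2 * (norm (?c *\<^sub>R p))\<^sup>2) / \<theta> = (norm p)\<^sup>2"
      using assms(1) by (simp add: power_mult_distrib)
    have **: "- (1/2 * (norm (?c *\<^sub>R p))\<^sup>2) / \<theta> = - (norm p)\<^sup>2"
      unfolding minus_divide_left[symmetric] * ..
    show "ennreal (g ((1/2 * (norm (?c *\<^sub>R p))\<^sup>2) / \<theta>) * maxwellian \<theta> (?c *\<^sub>R p))
      = ennreal ((2 * pi * \<theta>) powr (-3/2)) * ennreal (g ((norm p)\<^sup>2) * exp (- (norm p)\<^sup>2))"
      unfolding maxwellian_def * ** using assms(3)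
      by (subst ennreal_mult[symmetric]) (auto simp: ac_simps)
  qed
  also have "ennreal ((2 * \<theta>) powr (3/2)) * (\<integral>\<^sup>+p. ennreal ((2 * pi * \<theta>) powr (-3/2)) * ennreal (g ((norm p)\<^sup>2) * exp (- (norm p)\<^sup>2)) \<partial>(lborel :: (real^3) measure))
    = ennreal ((2 * \<theta>) powr (3/2)) * ennreal ((2 * pi * \<theta>) powr (-3/2)) * (\<integral>\<^sup>+p. ennreal (g ((norm p)\<^sup>2) * exp (- (norm p)\<^sup>2)) \<partial>(lborel :: (real^3) measure))"
    by (subst nn_integral_cmult) (auto simp: mult.assoc)
  also have "ennreal ((2 * \<theta>) powr (3/2)) * ennreal ((2 * pi * \<theta>) powr (-3/2)) = ennreal (pi powr (-3/2))"
  proof -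
    have "(2 * pi * \<theta>) powr (-3/2) = (2 * \<theta>) powr (-3/2) * pi powr (-3/2)"
      using assms(1) by (subst powr_mult[symmetric]) (auto simp: mult_ac)
    then have "(2 * \<theta>) powr (3/2) * (2 * pi * \<theta>) powr (-3/2) = ((2 * \<theta>) powr (3/2) * (2 * \<theta>) powr (-3/2)) * pi powr (-3/2)"
      by simp
    also have "(2 * \<theta>) powr (3/2) * (2 * \<theta>) powr (-3/2) = 1"
      using assms(1) by (simp flip: powr_add)
    finally show ?thesis by (simp flip: ennreal_mult)
  qed
  finally show ?thesis .
qed

lemma pi_powr_cancel: "pi powr (-3/2) * pi powr (3/2) = 1" "pi powr - (3/2) * pi powr (3/2) = 1"
  by (simp_all flip: powr_add)

lemma nn_integral_maxwellian:
  assumes "\<theta> > 0"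
  shows "(\<integral>\<^sup>+p. ennreal (maxwellian \<theta> p) \<partial>lborel) = 1"
  using nn_integral_maxwellian_scale[OF assms, of "\<lambda>_. 1"]
  by (simp add: nn_integral_gaussian pi_powr_cancel del: powr_minus_divide flip: ennreal_mult)

lemma
  assumes "\<theta> > 0"
  shows integrable_maxwellian: "integrable lborel (maxwellian \<theta>)"
    and integral_maxwellian: "(\<integral>p. maxwellian \<theta> p \<partial>lborel) = 1"
  using nn_integral_maxwellian[OF assms] maxwellian_pos[OF assms]
  by (auto intro!: integrableI_nonneg integral_eq_nn_integral[THEN trans] simp: less_imp_le)

lemma
  assumes "\<theta> > 0"
  shows integrable_maxwellian_energy: "integrable lborel (\<lambda>p. 1/2 * (norm p)\<^sup>2 * maxwellian \<theta> p)"
    and integral_maxwellian_energy: "(\<integral>p. 1/2 * (norm p)\<^sup>2 * maxwellian \<theta> p \<partial>lborel) = 3/2 * \<theta>"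
proof -
  \<comment> \<open>With the summand 1 the known moment applies; removing the mass leaves
    \<open>\<theta> * (5/2 - 1)\<close>.\<close>
  let ?F = "\<lambda>p::real^3. ((1/2 * (norm p)\<^sup>2) / \<theta> + 1) * maxwellian \<theta> p"
  have F: "(\<integral>\<^sup>+p. ennreal (?F p) \<partial>lborel) = ennreal (5/2)"
  proof -
    have "(\<integral>\<^sup>+p. ennreal (?F p) \<partial>lborel) = ennreal (pi powr (-3/2)) * ennreal (5/2 * pi powr (3/2))"
      using nn_integral_maxwellian_scale[OF assms, of "\<lambda>x. x + 1"] by (simp only: nn_integral_gaussian_moment) auto
    also have "\<dots> = ennreal (5/2 * (pi powr (-3/2) * pi powr (3/2)))"
      by (simp add: ac_simps flip: ennreal_mult del: powr_minus_divide)
    finally show ?thesis by (simp only: pi_powr_cancel mult_1_right)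
  qed
  have F_nonneg: "0 \<le> ?F p" for p
    using maxwellian_pos[OF assms, of p] assms by (intro mult_nonneg_nonneg) auto
  have F_int: "integrable lborel ?F"
    using F F_nonneg by (intro integrableI_nonneg) auto
  have F_eq: "(\<integral>p. ?F p \<partial>lborel) = 5/2"
    using F F_nonneg by (subst integral_eq_nn_integral) auto
  have eq: "1/2 * (norm p)\<^sup>2 * maxwellian \<theta> p = \<theta> * (?F p - maxwellian \<theta> p)" for p :: "real^3"
    using assms by (simp add: field_simps)
  show "integrable lborel (\<lambda>p. 1/2 * (norm p)\<^sup>2 * maxwellian \<theta> p)"
    unfolding eq by (intro integrable_mult_right Bochner_Integration.integrable_diff F_int integrable_maxwellian assms)
  have "(\<integral>p. \<theta> * (?F p - maxwellian \<theta> p) \<partial>lborel) = \<theta> * (5/2 - 1)"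
    by (subst integral_mult_right_zero, subst Bochner_Integration.integral_diff[OF F_int integrable_maxwellian[OF assms]])
       (simp only: F_eq integral_maxwellian[OF assms])
  then show "(\<integral>p. 1/2 * (norm p)\<^sup>2 * maxwellian \<theta> p \<partial>lborel) = 3/2 * \<theta>"
    unfolding eq by simp
qed

text \<open>Only the homogeneity in \<open>R\<close> is proved by induction: the last momentum is
  integrated out, and scaling it by \<open>sqrt R\<close> pulls the power of \<open>R\<close> out of
  the integral. The constant is left open, since its recursion would be a Beta integral; a Gaussian
  integral gives it at once afterwards.\<close>

lemma momentum_volume_scaling:
  "\<exists>c\<ge>0. \<forall>R. emeasure (Pi\<^sub>M {..<N} (\<lambda>_. lborel :: (real^3) measure))
      {p \<in> space (Pi\<^sub>M {..<N} (\<lambda>_. lborel)). (\<Sum>i<N. (norm (p i))\<^sup>2) < R}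
    = ennreal (if 0 < R then c * R powr (3/2 * real N) else 0)"
proof (induction N)
  case 0
  \<comment> \<open>The empty sum is below \<open>R\<close> exactly for positive \<open>R\<close>,
    on a space with a single point of mass 1.\<close>
  show ?case
    by (intro exI[of _ 1]) (auto simp: PiM_empty space_PiM_empty)
next
  case (Suc N)
  interpret product_sigma_finite "\<lambda>_::nat. lborel :: (real^3) measure" ..
  let ?P = "\<lambda>N. Pi\<^sub>M {..<N} (\<lambda>_. lborel :: (real^3) measure)"
  define a where "a = 3/2 * real N"
  obtain c where "c \<ge> 0" and c: "\<And>R. emeasure (?P N) {p \<in> space (?P N). (\<Sum>i<N. (norm (p i))\<^sup>2) < R}
    = ennreal (if 0 < R then c * R powr a else 0)"
    using Suc.IH unfolding a_def by blast
  \<comment> \<open>The volume of the section of the region for \<open>R = 1\<close> at last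
    momentum \<open>z\<close>; its integral is the next constant.\<close>
  define K where "K z = (if (norm z)\<^sup>2 < 1 then c * (1 - (norm z)\<^sup>2) powr a else 0)" for z :: "real^3"
  have [measurable]: "K \<in> borel_measurable borel" unfolding K_def by measurable
  have K_nonneg: "0 \<le> K z" for z using \<open>c \<ge> 0\<close> by (simp add: K_def)
  have "(\<integral>\<^sup>+z. ennreal (K z) \<partial>lborel) \<le> (\<integral>\<^sup>+z. ennreal c * indicator (ball (0::real^3) 1) z \<partial>lborel)"
  proof (intro nn_integral_mono)
    fix z :: "real^3"
    have "(1 - (norm z)\<^sup>2) powr a \<le> 1" if "(norm z)\<^sup>2 < 1"
      using that by (intro powr_le1) (auto simp: a_def)
    then have "K z \<le> c * indicator (ball 0 1) z"
      using \<open>c \<ge> 0\<close> mult_left_mono[of "(1 - (norm z)\<^sup>2) powr a" 1 c]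
      by (auto simp: K_def indicator_def abs_square_less_1)
    then have "ennreal (K z) \<le> ennreal (c * indicator (ball 0 1) z)" by (rule ennreal_leI)
    also have "\<dots> = ennreal c * indicator (ball 0 1) z"
      by (simp add: indicator_def)
    finally show "ennreal (K z) \<le> ennreal c * indicator (ball 0 1) z" .
  qed
  also have "\<dots> = ennreal c * emeasure lborel (ball (0::real^3) 1)"
    by (intro nn_integral_cmult_indicator) auto
  also have "\<dots> < \<infinity>" by (simp add: emeasure_ball ennreal_mult_less_top)
  finally have K_fin: "(\<integral>\<^sup>+z. ennreal (K z) \<partial>lborel) = ennreal (enn2real (\<integral>\<^sup>+z. ennreal (K z) \<partial>lborel))"
    by simp
  have "emeasure (?P (Suc N)) {p \<in> space (?P (Suc N)). (\<Sum>i<Suc N. (norm (p i))\<^sup>2) < R}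
      = ennreal (if 0 < R then enn2real (\<integral>\<^sup>+z. ennreal (K z) \<partial>lborel) * R powr (3/2 * real (Suc N)) else 0)" for R
  proof -
    have [measurable]: "(\<lambda>p. \<Sum>i<n. (norm (p i))\<^sup>2) \<in> borel_measurable (?P n)" for n
      by measurable
    have "emeasure (?P (Suc N)) {p \<in> space (?P (Suc N)). (\<Sum>i<Suc N. (norm (p i))\<^sup>2) < R}
      = (\<integral>\<^sup>+p. of_bool ((\<Sum>i<Suc N. (norm (p i))\<^sup>2) < R) \<partial>?P (Suc N))"
      by (intro emeasure_eq_nn_integral_of_bool) measurable
    also have "\<dots> = (\<integral>\<^sup>+y. \<integral>\<^sup>+x. of_bool ((\<Sum>i<Suc N. (norm ((x(N := y)) i))\<^sup>2) < R) \<partial>?P N \<partial>lborel)"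
      unfolding lessThan_Suc by (rule product_nn_integral_insert_rev) (auto simp flip: lessThan_Suc)
    also have "\<dots> = (\<integral>\<^sup>+y. ennreal (if 0 < R - (norm y)\<^sup>2 then c * (R - (norm y)\<^sup>2) powr a else 0) \<partial>(lborel :: (real^3) measure))"
    proof (intro nn_integral_cong)
      fix y :: "real^3"
      have "(\<integral>\<^sup>+x. of_bool ((\<Sum>i<Suc N. (norm ((x(N := y)) i))\<^sup>2) < R) \<partial>?P N)
        = (\<integral>\<^sup>+x. indicator {p \<in> space (?P N). (\<Sum>i<N. (norm (p i))\<^sup>2) < R - (norm y)\<^sup>2} x \<partial>?P N)"
        by (intro nn_integral_cong) (auto simp: indicator_def less_diff_eq)
      also have "\<dots> = emeasure (?P N) {p \<in> space (?P N). (\<Sum>i<N. (norm (p i))\<^sup>2) < R - (norm y)\<^sup>2}"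
        by (intro nn_integral_indicator) measurable
      finally show "(\<integral>\<^sup>+x. of_bool ((\<Sum>i<Suc N. (norm ((x(N := y)) i))\<^sup>2) < R) \<partial>?P N)
        = ennreal (if 0 < R - (norm y)\<^sup>2 then c * (R - (norm y)\<^sup>2) powr a else 0)"
        by (simp only: c)
    qed
    also have "\<dots> = ennreal (if 0 < R then enn2real (\<integral>\<^sup>+z. ennreal (K z) \<partial>lborel) * R powr (3/2 * real (Suc N)) else 0)"
    proof (cases "R > 0")
      case False
      then have "\<not> 0 < R - (norm y)\<^sup>2" for y :: "real^3"
        using zero_le_power2[of "norm y"] by linarith
      then show ?thesis using False by simp
    next
      case True
      let ?c = "sqrt R"
      have cc: "?c \<noteq> 0" "\<bar>?c\<bar> ^ 3 = R powr (3/2)"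
        using True by (simp_all add: powr_half_sqrt[symmetric] powr_powr flip: powr_realpow)
      have "(\<integral>\<^sup>+y. ennreal (if 0 < R - (norm y)\<^sup>2 then c * (R - (norm y)\<^sup>2) powr a else 0) \<partial>(lborel :: (real^3) measure))
        = ennreal (R powr (3/2)) * (\<integral>\<^sup>+z. ennreal (if 0 < R - (norm (?c *\<^sub>R z))\<^sup>2 then c * (R - (norm (?c *\<^sub>R z))\<^sup>2) powr a else 0) \<partial>(lborel :: (real^3) measure))"
        by (subst nn_integral_lborel_scaleR[OF _ cc(1)]) (use cc in auto)
      also have "(\<lambda>z::real^3. ennreal (if 0 < R - (norm (?c *\<^sub>R z))\<^sup>2 then c * (R - (norm (?c *\<^sub>R z))\<^sup>2) powr a else 0))
        = (\<lambda>z. ennreal (R powr a) * ennreal (K z))"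
      proof
        fix z :: "real^3"
        have e: "R - (norm (?c *\<^sub>R z))\<^sup>2 = R * (1 - (norm z)\<^sup>2)"
          using True by (simp add: power_mult_distrib algebra_simps)
        have "(if 0 < R - (norm (?c *\<^sub>R z))\<^sup>2 then c * (R - (norm (?c *\<^sub>R z))\<^sup>2) powr a else 0) = R powr a * K z"
          unfolding e K_def using True by (auto simp: powr_mult zero_less_mult_iff)
        then show "ennreal (if 0 < R - (norm (?c *\<^sub>R z))\<^sup>2 then c * (R - (norm (?c *\<^sub>R z))\<^sup>2) powr a else 0)
          = ennreal (R powr a) * ennreal (K z)"
          using K_nonneg by (simp add: ennreal_mult)
      qed
      also have "(\<integral>\<^sup>+z. ennreal (R powr a) * ennreal (K z) \<partial>lborel) = ennreal (R powr a) * ennreal (enn2real (\<integral>\<^sup>+z. ennreal (K z) \<partial>lborel))"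
        by (subst nn_integral_cmult) (auto simp: K_fin[symmetric])
      also have "ennreal (R powr (3/2)) * (ennreal (R powr a) * ennreal (enn2real (\<integral>\<^sup>+z. ennreal (K z) \<partial>lborel)))
        = ennreal (enn2real (\<integral>\<^sup>+z. ennreal (K z) \<partial>lborel) * (R powr (3/2) * R powr a))"
        by (simp add: ac_simps flip: ennreal_mult)
      also have "R powr (3/2) * R powr a = R powr (3/2 * real (Suc N))"
        unfolding powr_add[symmetric] a_def by (simp add: field_simps)
      finally show ?thesis using True by simp
    qed
    finally show ?thesis .
  qed
  then show ?case
    by (intro exI[of _ "enn2real (\<integral>\<^sup>+z. ennreal (K z) \<partial>lborel)"]) auto
qed

text \<open>The Gaussian integral over all momenta is computed twice, as a product over the
  particles and radially from the sublevel volumes; comparing the results determines the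
  constant.\<close>

theorem momentum_volume:
  "emeasure (Pi\<^sub>M {..<N} (\<lambda>_. lborel :: (real^3) measure))
      {p \<in> space (Pi\<^sub>M {..<N} (\<lambda>_. lborel)). (\<Sum>i<N. (norm (p i))\<^sup>2) < R}
    = ennreal (if 0 < R then pi powr (3/2 * real N) / Gamma (3/2 * real N + 1) * R powr (3/2 * real N) else 0)"
proof -
  interpret product_sigma_finite "\<lambda>_::nat. lborel :: (real^3) measure" ..
  interpret P: finite_product_sigma_finite "\<lambda>_::nat. lborel :: (real^3) measure" "{..<N}" by standard simp
  let ?P = "Pi\<^sub>M {..<N} (\<lambda>_. lborel :: (real^3) measure)"
  obtain c where "c \<ge> 0" and c: "\<And>R. emeasure ?P {p \<in> space ?P. (\<Sum>i<N. (norm (p i))\<^sup>2) < R}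
    = ennreal (if 0 < R then c * R powr (3/2 * real N) else 0)"
    using momentum_volume_scaling[of N] by blast
  have "ennreal (c * Gamma (3/2 * real N + 1)) = (\<integral>\<^sup>+p. ennreal (exp (- (\<Sum>i<N. (norm (p i))\<^sup>2))) \<partial>?P)"
    using \<open>c \<ge> 0\<close>
    by (intro nn_integral_exp_radial[symmetric]) (auto simp: c intro: P.sigma_finite_measure_axioms sum_nonneg)
  also have "\<dots> = (\<integral>\<^sup>+p. (\<Prod>i<N. ennreal (exp (- (norm (p i))\<^sup>2))) \<partial>?P)"
    by (intro nn_integral_cong) (simp add: exp_sum prod_ennreal flip: sum_negf)
  also have "\<dots> = (\<Prod>i<N. \<integral>\<^sup>+p. ennreal (exp (- (norm p)\<^sup>2)) \<partial>(lborel :: (real^3) measure))"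
    by (intro product_nn_integral_prod) auto
  also have "\<dots> = ennreal (pi powr (3/2 * real N))"
    by (simp add: nn_integral_gaussian ennreal_power powr_powr flip: powr_realpow)
  finally have "c * Gamma (3/2 * real N + 1) = pi powr (3/2 * real N)"
    using \<open>c \<ge> 0\<close> by (simp add: Gamma_real_pos less_imp_le)
  then have "c = pi powr (3/2 * real N) / Gamma (3/2 * real N + 1)"
    using Gamma_real_pos[of "3/2 * real N + 1"]
    by (metis add_nonneg_pos less_numeral_extra(1) less_numeral_extra(3) mult_nonneg_nonneg nonzero_mult_div_cancel_right
        of_nat_0_le_iff zero_le_divide_iff zero_le_numeral)
  then show ?thesis using c by simp
qed

section \<open>Reduction of the variational problem to configuration space\<close>

context pair_potential
begin

section \<open>Phase space as a product of momentum space and \<open>\<Lambda>\<close>\<close>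

abbreviation P :: "phase_point measure" where
  "P \<equiv> lborel \<Otimes>\<^sub>M L"

sublocale PL: pair_sigma_finite "lborel :: (real^3) measure" L ..

lemma measurable_L_borel: "(\<lambda>q. q) \<in> L \<rightarrow>\<^sub>M lborel"
  unfolding L_def by (intro measurable_restrict_space1 measurable_ident_sets refl)

lemma sets_P: "sets P = sets (restrict_space lborel (UNIV \<times> \<Lambda>) :: phase_point measure)"
proof -
  let ?R = "restrict_space lborel (UNIV \<times> \<Lambda>) :: phase_point measure"
  have space_R: "space ?R = UNIV \<times> \<Lambda>" and space_P: "space P = UNIV \<times> \<Lambda>"
    by (simp_all add: space_restrict_space space_pair_measure)
  have "(\<lambda>x. (fst x, snd x)) \<in> P \<rightarrow>\<^sub>M lborel \<Otimes>\<^sub>M lborel"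
    by (intro measurable_Pair measurable_fst measurable_compose[OF measurable_snd measurable_L_borel])
  then have id1: "(\<lambda>x. x) \<in> P \<rightarrow>\<^sub>M ?R"
    by (intro measurable_restrict_space2) (auto simp: space_P lborel_prod)
  have "(\<lambda>x. (fst x, snd x)) \<in> ?R \<rightarrow>\<^sub>M P"
  proof (intro measurable_Pair)
    have "fst \<in> (lborel :: phase_point measure) \<rightarrow>\<^sub>M (lborel :: (real^3) measure)"
      and "snd \<in> (lborel :: phase_point measure) \<rightarrow>\<^sub>M (lborel :: (real^3) measure)"
      by (simp_all flip: lborel_prod)
    note fst_snd = this[THEN measurable_restrict_space1]
    show "fst \<in> ?R \<rightarrow>\<^sub>M lborel" by (rule fst_snd)
    show "snd \<in> ?R \<rightarrow>\<^sub>M L"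
      unfolding L_def by (rule measurable_restrict_space2[OF _ fst_snd(2)]) (auto simp: space_R)
  qed
  then have id2: "(\<lambda>x. x) \<in> ?R \<rightarrow>\<^sub>M P" by simp
  have sub: "A \<in> sets N'" if "(\<lambda>x. x) \<in> N' \<rightarrow>\<^sub>M N" "space N' = space N" "A \<in> sets N"
    for A and N N' :: "phase_point measure"
    using measurable_sets[OF that(1,3)] sets.sets_into_space[OF that(3)] that(2) by (simp add: vimage_def Int_absorb2)
  show ?thesis
    using sub[OF id1] sub[OF id2] space_R space_P by blast
qed

lemma dom_phase_sets: "UNIV \<times> \<Lambda> \<in> sets (borel :: phase_point measure)"
  by (subst borel_prod[symmetric], rule pair_measureI) auto

text \<open>It makes Fubini available for the set integrals over
  \<open>UNIV \<times> \<Lambda>\<close> in the definitions. The two measures are compared on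
  rectangles.\<close>

lemma restrict_lborel_P: "restrict_space lborel (UNIV \<times> \<Lambda>) = P"
proof (rule pair_measure_eqI[symmetric])
  fix A B assume A: "A \<in> sets (lborel :: (real^3) measure)" and B: "B \<in> sets L"
  have B': "B \<in> sets borel" "B \<subseteq> \<Lambda>"
    using B by (auto simp: L_def sets_restrict_space)
  have "emeasure (restrict_space lborel (UNIV \<times> \<Lambda>)) (A \<times> B) = emeasure lborel (A \<times> B)"
    using B' dom_phase_sets by (intro emeasure_restrict_space) auto
  also have "\<dots> = emeasure lborel A * emeasure lborel B"
    unfolding lborel_prod[symmetric] using A B' by (intro lborel.emeasure_pair_measure_Times) auto
  also have "emeasure lborel B = emeasure L B"
    unfolding L_def using B' by (intro emeasure_restrict_space[symmetric]) auto
  finally show "emeasure lborel A * emeasure L B = emeasure (restrict_space lborel (UNIV \<times> \<Lambda>)) (A \<times> B)" by simp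
qed (rule sets_P lborel.sigma_finite_measure_axioms sigma_finite_measure_axioms)+

lemma
  fixes f :: "phase_point \<Rightarrow> real"
  shows set_integrable_P: "set_integrable lborel (UNIV \<times> \<Lambda>) f \<longleftrightarrow> integrable P f"
    and set_integral_P: "(LINT x:UNIV \<times> \<Lambda>|lborel. f x) = (\<integral>x. f x \<partial>P)"
  unfolding set_integrable_def set_lebesgue_integral_def restrict_lborel_P[symmetric] using dom_phase_sets
  by (simp_all add: integrable_restrict_space integral_restrict_space)

lemma
  fixes f :: "real^3 \<Rightarrow> real"
  shows set_integrable_L: "set_integrable lborel \<Lambda> f \<longleftrightarrow> integrable L f"
    and set_integral_L: "(LINT q:\<Lambda>|lborel. f q) = (\<integral>q. f q \<partial>L)"
  unfolding set_integrable_def set_lebesgue_integral_def L_def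
  by (simp_all add: integrable_restrict_space integral_restrict_space)

lemma nn_integral_P: "(\<integral>\<^sup>+x\<in>UNIV \<times> \<Lambda>. f x \<partial>lborel) = (\<integral>\<^sup>+x. f x \<partial>P)"
  unfolding restrict_lborel_P[symmetric] using dom_phase_sets by (subst nn_integral_restrict_space) auto

lemma AE_P: "(AE x in lborel. x \<in> UNIV \<times> \<Lambda> \<longrightarrow> Q x) \<longleftrightarrow> (AE x in P. Q x)"
  unfolding restrict_lborel_P[symmetric] using dom_phase_sets by (subst AE_restrict_space_iff) auto

lemma space_P: "space P = UNIV \<times> \<Lambda>"
  by (simp add: space_pair_measure)

lemma measurable_U_right: "q \<in> \<Lambda> \<Longrightarrow> (\<lambda>q'. U q q') \<in> borel_measurable L"
  by (rule measurable_U[OF measurable_const measurable_ident_sets]) auto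

section \<open>Energy and entropy in terms of the spatial marginal\<close>

definition kinetic_energy :: "(phase_point \<Rightarrow> real) \<Rightarrow> ennreal" where
  "kinetic_energy f = (\<integral>\<^sup>+x. ennreal (1/2 * (norm (fst x))\<^sup>2) * ennreal (f x) \<partial>P)"

text \<open>Tonelli with the momentum integrated first. The marginal is compared with
  \<open>\<rho>\<close> almost everywhere only, because the Bochner integral that will define
  \<open>\<rho>\<close> has the value 0 on the null set where a section is not integrable.\<close>

lemma nn_integral_snd_marginal:
  assumes [measurable]: "f \<in> borel_measurable P" "h \<in> borel_measurable L"
    and marg: "AE q in L. (\<integral>\<^sup>+p. ennreal (f (p, q)) \<partial>lborel) = ennreal (\<rho> q)"
  shows "(\<integral>\<^sup>+x. h (snd x) * ennreal (f x) \<partial>P) = (\<integral>\<^sup>+q. h q * ennreal (\<rho> q) \<partial>L)"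
proof -
  have "(\<integral>\<^sup>+x. h (snd x) * ennreal (f x) \<partial>P) = (\<integral>\<^sup>+q. \<integral>\<^sup>+p. h q * ennreal (f (p, q)) \<partial>lborel \<partial>L)"
    by (subst PL.nn_integral_snd[symmetric]) auto
  also have "\<dots> = (\<integral>\<^sup>+q. h q * (\<integral>\<^sup>+p. ennreal (f (p, q)) \<partial>lborel) \<partial>L)"
    by (intro nn_integral_cong nn_integral_cmult) auto
  also have "\<dots> = (\<integral>\<^sup>+q. h q * ennreal (\<rho> q) \<partial>L)"
    by (intro nn_integral_cong_AE, use marg in eventually_elim) simp
  finally show ?thesis .
qed

lemma vlasov_energy_marginal:
  assumes [measurable]: "f \<in> borel_measurable P" "\<rho> \<in> borel_measurable L"
    and marg: "AE q in L. (\<integral>\<^sup>+p. ennreal (f (p, q)) \<partial>lborel) = ennreal (\<rho> q)"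
  shows "vlasov_energy \<Lambda> U f = kinetic_energy f + interaction_energy \<Lambda> U \<rho>"
proof -
  let ?V = "\<lambda>q. \<integral>\<^sup>+q'. ennreal (1/2) * U q q' * ennreal (\<rho> q') \<partial>L"
  have "(\<integral>\<^sup>+y. ennreal (1/2) * U (snd x) (snd y) * ennreal (f x) * ennreal (f y) \<partial>P)
      = ?V (snd x) * ennreal (f x)" if "x \<in> space P" for x
  proof -
    have [simp]: "snd x \<in> \<Lambda>" using that by (auto simp: space_P)
    have m: "(\<lambda>q'. ennreal (1/2) * U (snd x) q') \<in> borel_measurable L"
      by (intro borel_measurable_times_ennreal measurable_const measurable_U_right) simp_all
    have m2 [measurable]: "(\<lambda>y. ennreal (1/2) * U (snd x) (snd y)) \<in> borel_measurable P"
      by (rule measurable_compose[OF measurable_snd m])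
    have "(\<integral>\<^sup>+y. ennreal (1/2) * U (snd x) (snd y) * ennreal (f x) * ennreal (f y) \<partial>P)
      = (\<integral>\<^sup>+y. (ennreal (1/2) * U (snd x) (snd y) * ennreal (f y)) * ennreal (f x) \<partial>P)"
      by (simp add: mult_ac)
    also have "\<dots> = (\<integral>\<^sup>+y. ennreal (1/2) * U (snd x) (snd y) * ennreal (f y) \<partial>P) * ennreal (f x)"
      by (intro nn_integral_multc borel_measurable_times_ennreal m2) measurable
    also have "(\<integral>\<^sup>+y. ennreal (1/2) * U (snd x) (snd y) * ennreal (f y) \<partial>P) = ?V (snd x)"
      by (rule nn_integral_snd_marginal[where h = "\<lambda>q'. ennreal (1/2) * U (snd x) q'", OF assms(1) m marg])
    finally show ?thesis .
  qed
  then have "(\<integral>\<^sup>+x. (\<integral>\<^sup>+y. ennreal (1/2) * U (snd x) (snd y) * ennreal (f x) * ennreal (f y) \<partial>P) \<partial>P)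
     = (\<integral>\<^sup>+x. ?V (snd x) * ennreal (f x) \<partial>P)"
    by (intro nn_integral_cong) simp
  also have "\<dots> = (\<integral>\<^sup>+q. ?V q * ennreal (\<rho> q) \<partial>L)"
    by (intro nn_integral_snd_marginal[where h = ?V] marg) measurable
  also have "\<dots> = interaction_energy \<Lambda> U \<rho>"
    unfolding interaction_energy_L
  proof (intro nn_integral_cong)
    fix q assume "q \<in> space L"
    then have m: "(\<lambda>q'. ennreal (1/2) * U q q') \<in> borel_measurable L"
      by (intro borel_measurable_times_ennreal measurable_const measurable_U_right) simp_all
    have m3: "(\<lambda>q'. ennreal (1/2) * U q q' * ennreal (\<rho> q')) \<in> borel_measurable L"
      by (rule borel_measurable_times_ennreal[OF m]) measurable
    have "?V q * ennreal (\<rho> q) = (\<integral>\<^sup>+q'. ennreal (1/2) * U q q' * ennreal (\<rho> q') * ennreal (\<rho> q) \<partial>L)"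
      by (rule nn_integral_multc[OF m3, symmetric])
    also have "\<dots> = (\<integral>\<^sup>+q'. ennreal (1/2) * U q q' * ennreal (\<rho> q) * ennreal (\<rho> q') \<partial>L)"
      by (intro nn_integral_cong) (simp only: mult_ac)
    finally show "?V q * ennreal (\<rho> q) = (\<integral>\<^sup>+q'. ennreal (1/2) * U q q' * ennreal (\<rho> q) * ennreal (\<rho> q') \<partial>L)" .
  qed
  finally show ?thesis
    unfolding vlasov_energy_def kinetic_energy_def by (simp only: nn_integral_P)
qed

text \<open>The value of \<open>boltzmann_H\<close> at the Maxwellian of temperature
  \<open>vartheta\<close> times \<open>\<rho>\<close>. The 5/2 is 3/2 from the Gaussian exponent
  plus 1 from the factor \<open>e\<close>.\<close>

definition reduced_H :: "real \<Rightarrow> (real^3 \<Rightarrow> real) \<Rightarrow> real" where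
  "reduced_H \<epsilon> \<rho> = ent \<rho> - 3/2 * ln (2 * pi * vartheta \<Lambda> U \<epsilon> \<rho>) - 5/2"

lemma vartheta_pos_iff:
  assumes "interaction_energy \<Lambda> U \<rho> < \<infinity>"
  shows "0 < vartheta \<Lambda> U \<epsilon> \<rho> \<longleftrightarrow> interaction_energy \<Lambda> U \<rho> < ennreal \<epsilon>"
  using assms unfolding vartheta_def
  by (cases "interaction_energy \<Lambda> U \<rho>") (auto simp: ennreal_less_iff)

lemma vartheta_pos:
  assumes "interaction_energy \<Lambda> U \<rho> < ennreal \<epsilon>"
  shows "0 < vartheta \<Lambda> U \<epsilon> \<rho>"
  using assms by (subst vartheta_pos_iff) (auto intro: less_trans)

lemma boltzmann_H_eq:
  assumes "integrable P f" "integrable P (\<lambda>x. f x * ln (f x))" "(\<integral>x. f x \<partial>P) = 1" "\<And>x. x \<in> space P \<Longrightarrow> 0 \<le> f x"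
  shows "boltzmann_H \<Lambda> f = (\<integral>x. f x * ln (f x) \<partial>P) - 1"
proof -
  have "boltzmann_H \<Lambda> f = (\<integral>x. f x * ln (f x / exp 1) \<partial>P)"
    unfolding boltzmann_H_def by (rule set_integral_P)
  also have "\<dots> = (\<integral>x. f x * ln (f x) - f x \<partial>P)"
  proof (intro Bochner_Integration.integral_cong refl)
    fix x assume "x \<in> space P"
    with assms(4) have "0 \<le> f x" by blast
    then show "f x * ln (f x / exp 1) = f x * ln (f x) - f x"
      by (cases "f x = 0") (auto simp: ln_div algebra_simps)
  qed
  finally show ?thesis using assms by simp
qed

lemma
  fixes a b :: "real^3 \<Rightarrow> real"
  assumes a: "integrable lborel a" and b: "integrable L b"
  shows integrable_P_product: "integrable P (\<lambda>x. a (fst x) * b (snd x))"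
    and integral_P_product: "(\<integral>x. a (fst x) * b (snd x) \<partial>P) = (\<integral>p. a p \<partial>lborel) * (\<integral>q. b q \<partial>L)"
proof -
  have [measurable]: "a \<in> borel_measurable borel" "b \<in> borel_measurable L" using a b by auto
  show int: "integrable P (\<lambda>x. a (fst x) * b (snd x))"
    by (rule PL.Fubini_integrable) (use a b in \<open>auto simp: abs_mult\<close>)
  show "(\<integral>x. a (fst x) * b (snd x) \<partial>P) = (\<integral>p. a p \<partial>lborel) * (\<integral>q. b q \<partial>L)"
    using PL.integral_fst'[OF int] by simp
qed

text \<open>The temperature is chosen such that the mean kinetic energy
  \<open>3/2 * \<theta>\<close> fills the gap between the interaction energy and \<epsilon>, so the
  product meets the energy constraint exactly.\<close>

lemma maxwellian_product_trial:
  assumes \<rho>: "entropic \<rho>" and energy: "interaction_energy \<Lambda> U \<rho> < ennreal \<epsilon>"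
  defines "f \<equiv> \<lambda>x. maxwellian (vartheta \<Lambda> U \<epsilon> \<rho>) (fst x) * \<rho> (snd x)"
  shows "f \<in> trial_densities \<Lambda> U \<epsilon>" and "boltzmann_H \<Lambda> f = reduced_H \<epsilon> \<rho>"
proof -
  define \<theta> where "\<theta> = vartheta \<Lambda> U \<epsilon> \<rho>"
  have \<theta>: "\<theta> > 0" unfolding \<theta>_def by (rule vartheta_pos[OF energy])
  have f: "f x = maxwellian \<theta> (fst x) * \<rho> (snd x)" for x
    by (simp add: f_def \<theta>_def)
  have \<rho>': "integrable L \<rho>" "\<And>q. q \<in> \<Lambda> \<Longrightarrow> 0 \<le> \<rho> q" "(\<integral>q. \<rho> q \<partial>L) = 1" "integrable L (\<lambda>q. \<rho> q * ln (\<rho> q))"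
    using \<rho> by (auto simp: entropic_def)
  then have [measurable]: "\<rho> \<in> borel_measurable L" by auto
  have f_nonneg: "0 \<le> f x" if "x \<in> space P" for x
    using that \<rho>'(2)[of "snd x"] maxwellian_pos[OF \<theta>, of "fst x"] by (auto simp: f space_P)
  have f_int: "integrable P f" and f_one: "(\<integral>x. f x \<partial>P) = 1"
    unfolding f using integrable_P_product[OF integrable_maxwellian[OF \<theta>] \<rho>'(1)]
      integral_P_product[OF integrable_maxwellian[OF \<theta>] \<rho>'(1)] integral_maxwellian[OF \<theta>] \<rho>'(3)
    by auto
  \<comment> \<open>\<open>k\<close> is the Maxwellian times its own logarithm; its integral
    consists of the normalisation term and \<open>- 3/2\<close> from the mean energy.\<close>
  define k where "k p = maxwellian \<theta> p * (- 3/2 * ln (2 * pi * \<theta>) - (1/2 * (norm p)\<^sup>2) / \<theta>)" for p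
  have m_eq: "k p = (- 3/2 * ln (2 * pi * \<theta>)) * maxwellian \<theta> p - 1 / \<theta> * (1/2 * (norm p)\<^sup>2 * maxwellian \<theta> p)" for p
    by (simp add: k_def algebra_simps)
  have m_int: "integrable lborel k"
    unfolding m_eq[abs_def] using integrable_maxwellian[OF \<theta>] integrable_maxwellian_energy[OF \<theta>]
    by (intro Bochner_Integration.integrable_diff integrable_mult_right)
  have m_integral: "(\<integral>p. k p \<partial>lborel) = - 3/2 * ln (2 * pi * \<theta>) - 3/2"
    unfolding m_eq
    by (subst Bochner_Integration.integral_diff[OF integrable_mult_right integrable_mult_right,
          OF integrable_maxwellian[OF \<theta>] integrable_maxwellian_energy[OF \<theta>]])
       (simp only: integral_mult_right_zero integral_maxwellian[OF \<theta>] integral_maxwellian_energy[OF \<theta>], use \<theta> in simp)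
  \<comment> \<open>The logarithm of the product splits only where \<open>\<rho>\<close> is
    positive; elsewhere both sides vanish.\<close>
  have ln_f: "f x * ln (f x) = k (fst x) * \<rho> (snd x) + maxwellian \<theta> (fst x) * (\<rho> (snd x) * ln (\<rho> (snd x)))"
    if "x \<in> space P" for x
  proof (cases "\<rho> (snd x) = 0")
    case False
    then have "\<rho> (snd x) > 0" using that \<rho>'(2)[of "snd x"] by (auto simp: space_P)
    then have eq: "ln (f x) = (- 3/2 * ln (2 * pi * \<theta>) - (1/2 * (norm (fst x))\<^sup>2) / \<theta>) + ln (\<rho> (snd x))"
      using maxwellian_pos[OF \<theta>, of "fst x"] by (simp add: f ln_mult ln_maxwellian[OF \<theta>])
    have "m * r * (A + l) = m * A * r + m * (r * l)" for m r A l :: real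
      by (simp add: algebra_simps)
    then show ?thesis unfolding eq k_def unfolding f .
  qed (simp add: f)
  have ln_f_int: "integrable P (\<lambda>x. f x * ln (f x))"
    by (subst Bochner_Integration.integrable_cong[OF refl ln_f])
       (auto intro!: Bochner_Integration.integrable_add integrable_P_product m_int integrable_maxwellian \<theta> \<rho>')
  have "(\<integral>x. f x * ln (f x) \<partial>P) = - 3/2 * ln (2 * pi * \<theta>) - 3/2 + ent \<rho>"
    by (subst Bochner_Integration.integral_cong[OF refl ln_f], assumption,
        subst Bochner_Integration.integral_add)
       (auto intro!: integrable_P_product m_int integrable_maxwellian \<theta> \<rho>'
        simp: integral_P_product[OF m_int \<rho>'(1)] integral_P_product[OF integrable_maxwellian[OF \<theta>] \<rho>'(4)]
          m_integral integral_maxwellian[OF \<theta>] \<rho>'(3) ent_def)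
  then show "boltzmann_H \<Lambda> f = reduced_H \<epsilon> \<rho>"
    using boltzmann_H_eq[OF f_int ln_f_int f_one f_nonneg] by (simp add: reduced_H_def \<theta>_def)
  have "(\<integral>\<^sup>+p. ennreal (f (p, q)) \<partial>lborel) = ennreal (\<rho> q)" if "q \<in> \<Lambda>" for q
  proof -
    have "(\<integral>\<^sup>+p. ennreal (f (p, q)) \<partial>lborel) = (\<integral>\<^sup>+p. ennreal (maxwellian \<theta> p) * ennreal (\<rho> q) \<partial>lborel)"
      using \<rho>'(2)[OF that] maxwellian_pos[OF \<theta>] by (intro nn_integral_cong) (simp add: f ennreal_mult less_imp_le)
    then show ?thesis by (simp add: nn_integral_multc nn_integral_maxwellian[OF \<theta>])
  qed
  then have marg: "AE q in L. (\<integral>\<^sup>+p. ennreal (f (p, q)) \<partial>lborel) = ennreal (\<rho> q)"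
    by auto
  have "kinetic_energy f = (\<integral>\<^sup>+x. ennreal ((1/2 * (norm (fst x))\<^sup>2 * maxwellian \<theta> (fst x)) * \<rho> (snd x)) \<partial>P)"
    unfolding kinetic_energy_def using f_nonneg
    by (intro nn_integral_cong) (simp add: f mult.assoc flip: ennreal_mult)
  also have "\<dots> = ennreal (\<integral>x. (1/2 * (norm (fst x))\<^sup>2 * maxwellian \<theta> (fst x)) * \<rho> (snd x) \<partial>P)"
    using f_nonneg
    by (intro nn_integral_eq_integral integrable_P_product integrable_maxwellian_energy \<theta> \<rho>' AE_I2)
       (auto simp: f space_P mult.assoc)
  also have "\<dots> = ennreal (3/2 * \<theta>)"
    by (subst integral_P_product[OF integrable_maxwellian_energy[OF \<theta>] \<rho>'(1)])
       (simp only: integral_maxwellian_energy[OF \<theta>] \<rho>'(3) mult_1_right)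
  finally have kin: "kinetic_energy f = ennreal (3/2 * \<theta>)" .
  have "vlasov_energy \<Lambda> U f = ennreal (3/2 * \<theta>) + interaction_energy \<Lambda> U \<rho>"
    using vlasov_energy_marginal[OF _ _ marg] f_int kin by auto
  also have "interaction_energy \<Lambda> U \<rho> = ennreal (enn2real (interaction_energy \<Lambda> U \<rho>))"
    using energy by (intro ennreal_enn2real[symmetric]) (auto intro: less_trans)
  also have "ennreal (3/2 * \<theta>) + \<dots> = ennreal \<epsilon>"
  proof -
    have "3/2 * \<theta> + enn2real (interaction_energy \<Lambda> U \<rho>) = \<epsilon>"
      by (simp add: \<theta>_def vartheta_def field_simps)
    moreover have "0 \<le> 3/2 * \<theta>" using \<theta> by simp
    ultimately show ?thesis by (metis ennreal_plus enn2real_nonneg)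
  qed
  finally show "f \<in> trial_densities \<Lambda> U \<epsilon>"
    unfolding trial_densities_def prob_densities_def
    using f_int f_nonneg f_one ln_f_int by (simp add: set_integrable_P set_integral_P space_P)
qed


text \<open>The comparison density is the product of the marginal of \<open>f\<close> with the
  Maxwellian that has the kinetic energy of \<open>f\<close>. As both have the same kinetic energy
  and the same marginal, the difference of the \<open>H\<close>-values is their relative entropy, so
  it is nonnegative and vanishes only if they agree almost everywhere. Splitting the relative
  entropy into integrable pieces requires the integrability of \<open>\<rho> * ln \<rho>\<close>,
  which has to be shown first.\<close>

theorem trial_density_reduction:
  assumes f: "f \<in> trial_densities \<Lambda> U \<epsilon>" and "\<epsilon> > 0"
  obtains \<rho> where "entropic \<rho>" "interaction_energy \<Lambda> U \<rho> < ennreal \<epsilon>"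
    "reduced_H \<epsilon> \<rho> \<le> boltzmann_H \<Lambda> f"
    "boltzmann_H \<Lambda> f = reduced_H \<epsilon> \<rho> \<Longrightarrow>
      AE x in P. f x = maxwellian (vartheta \<Lambda> U \<epsilon> \<rho>) (fst x) * \<rho> (snd x)"
proof -
  have f_int: "integrable P f" and f_one: "(\<integral>x. f x \<partial>P) = 1"
    and f_nonneg: "\<And>x. x \<in> space P \<Longrightarrow> 0 \<le> f x"
    and f_ln: "integrable P (\<lambda>x. f x * ln (f x))"
    and f_energy: "vlasov_energy \<Lambda> U f = ennreal \<epsilon>"
    using f unfolding trial_densities_def prob_densities_def
    by (auto simp: set_integrable_P set_integral_P space_P)
  have f_meas [measurable]: "f \<in> borel_measurable P" using f_int by auto
  define \<rho> where "\<rho> q = (\<integral>p. f (p, q) \<partial>lborel)" for q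
  have f_case: "integrable P (case_prod (\<lambda>p q. f (p, q)))" using f_int by simp
  have \<rho>_int: "integrable L \<rho>"
    unfolding \<rho>_def using PL.integrable_snd[OF f_case] .
  have \<rho>_one: "(\<integral>q. \<rho> q \<partial>L) = 1"
    unfolding \<rho>_def using PL.integral_snd[OF f_case] f_one by simp
  have f_nonneg': "0 \<le> f (p, q)" if "q \<in> \<Lambda>" for p q
    using f_nonneg[of "(p, q)"] that by (simp add: space_P)
  have \<rho>_nonneg: "0 \<le> \<rho> q" if "q \<in> \<Lambda>" for q
    unfolding \<rho>_def using f_nonneg'[OF that] by (intro integral_nonneg_AE) auto
  have [measurable]: "\<rho> \<in> borel_measurable L" using \<rho>_int by auto
  have AE_int: "AE q in L. integrable lborel (\<lambda>p. f (p, q))"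
    by (rule PL.AE_integrable_snd[OF f_case])
  have marg: "AE q in L. (\<integral>\<^sup>+p. ennreal (f (p, q)) \<partial>lborel) = ennreal (\<rho> q)"
    using AE_int AE_space
  proof eventually_elim
    case (elim q)
    then show ?case
      unfolding \<rho>_def using f_nonneg' by (intro nn_integral_eq_integral) auto
  qed
  have sum: "kinetic_energy f + interaction_energy \<Lambda> U \<rho> = ennreal \<epsilon>"
    using vlasov_energy_marginal[OF f_meas _ marg] f_energy by simp
  define g where "g x = 1/2 * (norm (fst x))\<^sup>2 * f x" for x
  have g_meas [measurable]: "g \<in> borel_measurable P" unfolding g_def by measurable
  have g_nonneg: "0 \<le> g x" if "x \<in> space P" for x
    using f_nonneg[OF that] by (simp add: g_def)
  have kin: "kinetic_energy f = (\<integral>\<^sup>+x. ennreal (g x) \<partial>P)"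
    unfolding kinetic_energy_def g_def using f_nonneg
    by (intro nn_integral_cong) (simp add: mult.assoc flip: ennreal_mult)
  have "kinetic_energy f \<le> ennreal \<epsilon>" using sum by (metis add_increasing2 order_refl zero_le)
  then have g_fin: "(\<integral>\<^sup>+x. ennreal (g x) \<partial>P) < \<infinity>" using kin by (auto intro: le_less_trans)
  have g_int: "integrable P g"
    using g_nonneg g_fin by (intro integrableI_nonneg AE_I2) auto
  define K where "K = (\<integral>x. g x \<partial>P)"
  have kinK: "kinetic_energy f = ennreal K"
    unfolding kin K_def using g_nonneg by (intro nn_integral_eq_integral g_int AE_I2) auto
  have K_nonneg: "0 \<le> K" unfolding K_def using g_nonneg by (intro integral_nonneg_AE AE_I2) auto
  \<comment> \<open>Without kinetic energy \<open>f\<close> would be concentrated on momentum zero,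
    a null set. This makes the temperature strictly positive.\<close>
  have "K \<noteq> 0"
  proof
    assume "K = 0"
    then have "AE x in P. g x = 0"
      using g_int g_nonneg unfolding K_def by (subst (asm) integral_nonneg_eq_0_iff_AE) auto
    moreover have "AE x in P. fst x \<noteq> 0"
    proof (rule PL.AE_pair_measure)
      show "AE x in lborel. AE y in L. fst (x :: real^3, y) \<noteq> 0"
        using AE_lborel_singleton[of "0 :: real^3"] by eventually_elim auto
    qed measurable
    ultimately have "AE x in P. f x = 0"
      by eventually_elim (auto simp: g_def)
    then have "(\<integral>x. f x \<partial>P) = 0" by (rule integral_eq_zero_AE)
    then show False using f_one by simp
  qed
  then have K_pos: "K > 0" using K_nonneg by simp
  define \<theta> where "\<theta> = vartheta \<Lambda> U \<epsilon> \<rho>"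
  have I_fin: "interaction_energy \<Lambda> U \<rho> \<noteq> \<infinity>"
    using sum by (metis ennreal_add_eq_top ennreal_neq_top infinity_ennreal_def)
  then obtain I where I: "interaction_energy \<Lambda> U \<rho> = ennreal I" "0 \<le> I"
    by (cases "interaction_energy \<Lambda> U \<rho>") auto
  have KI: "K + I = \<epsilon>"
    using sum K_nonneg I \<open>\<epsilon> > 0\<close> unfolding kinK I(1)
    by (simp flip: ennreal_plus)
  have energy: "interaction_energy \<Lambda> U \<rho> < ennreal \<epsilon>"
    unfolding I(1) using KI K_pos I(2) by (simp add: ennreal_less_iff)
  have K\<theta>: "K = 3/2 * \<theta>"
    using KI I by (simp add: \<theta>_def vartheta_def)
  have \<theta>: "\<theta> > 0" using K\<theta> K_pos by simp
  \<comment> \<open>Gibbs' inequality on the fibre over \<open>q\<close>, against the Maxwellian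
    with mass \<open>\<rho> q\<close>, bounds \<open>\<rho> q * ln (\<rho> q)\<close> by this
    integrable function; the bound from below is elementary.\<close>
  define F where "F q = (\<integral>p. f (p, q) * ln (f (p, q)) \<partial>lborel) + 3/2 * ln (2 * pi * \<theta>) * \<rho> q
      + 1 / \<theta> * (\<integral>p. g (p, q) \<partial>lborel)" for q
  have f_ln_case: "integrable P (case_prod (\<lambda>p q. f (p, q) * ln (f (p, q))))"
    using f_ln by (simp add: split_beta')
  have g_case: "integrable P (case_prod (\<lambda>p q. g (p, q)))" using g_int by simp
  have F_int: "integrable L F"
    unfolding F_def using PL.integrable_snd[OF f_ln_case] PL.integrable_snd[OF g_case] \<rho>_int
    by (intro Bochner_Integration.integrable_add integrable_mult_right)
  have F_integral: "(\<integral>q. F q \<partial>L) = (\<integral>x. f x * ln (f x) \<partial>P) + 3/2 * ln (2 * pi * \<theta>) + 3/2"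
  proof -
    have "(\<integral>q. F q \<partial>L) = (\<integral>x. f x * ln (f x) \<partial>P) + 3/2 * ln (2 * pi * \<theta>) * 1 + 1 / \<theta> * K"
      unfolding F_def K_def
      using PL.integrable_snd[OF f_ln_case] PL.integrable_snd[OF g_case] \<rho>_int
        PL.integral_snd[OF f_ln_case] PL.integral_snd[OF g_case] \<rho>_one
      by (simp add: split_beta')
    then show ?thesis using K\<theta> \<theta> by simp
  qed
  have le_F: "AE q in L. \<rho> q \<noteq> 0 \<longrightarrow> \<rho> q * ln (\<rho> q) \<le> F q"
    using AE_int AE_space PL.AE_integrable_snd[OF f_ln_case] PL.AE_integrable_snd[OF g_case]
  proof eventually_elim
    case (elim q)
    show ?case
    proof (rule impI)
      assume "\<rho> q \<noteq> 0"
      then have r: "\<rho> q > 0" using \<rho>_nonneg elim(2) by (simp add: less_le)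
      have eq: "f (p, q) * ln (maxwellian \<theta> p * \<rho> q) + f (p, q) - maxwellian \<theta> p * \<rho> q
        = (ln (\<rho> q) - 3/2 * ln (2 * pi * \<theta>) + 1) * f (p, q) - 1 / \<theta> * g (p, q) - maxwellian \<theta> p * \<rho> q" for p
        using r maxwellian_pos[OF \<theta>, of p]
        by (simp add: ln_mult ln_maxwellian[OF \<theta>] g_def algebra_simps)
      have "(ln (\<rho> q) - 3/2 * ln (2 * pi * \<theta>) + 1) * \<rho> q - 1 / \<theta> * (\<integral>p. g (p, q) \<partial>lborel) - \<rho> q
        = (\<integral>p. f (p, q) * ln (maxwellian \<theta> p * \<rho> q) + f (p, q) - maxwellian \<theta> p * \<rho> q \<partial>lborel)"
        unfolding eq using elim integrable_maxwellian[OF \<theta>] integral_maxwellian[OF \<theta>]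
        by (simp add: \<rho>_def[of q, symmetric])
      also have "\<dots> \<le> (\<integral>p. f (p, q) * ln (f (p, q)) \<partial>lborel)"
      proof (rule integral_mono)
        show "integrable lborel (\<lambda>p. f (p, q) * ln (maxwellian \<theta> p * \<rho> q) + f (p, q) - maxwellian \<theta> p * \<rho> q)"
          unfolding eq using elim integrable_maxwellian[OF \<theta>]
          by (intro Bochner_Integration.integrable_diff integrable_mult_right integrable_mult_left)
        show "integrable lborel (\<lambda>p. f (p, q) * ln (f (p, q)))" using elim by simp
        fix p
        show "f (p, q) * ln (maxwellian \<theta> p * \<rho> q) + f (p, q) - maxwellian \<theta> p * \<rho> q \<le> f (p, q) * ln (f (p, q))"
          using f_nonneg' elim(2) r maxwellian_pos[OF \<theta>, of p] by (intro gibbs_ineq) auto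
      qed
      finally show "\<rho> q * ln (\<rho> q) \<le> F q"
        by (simp add: F_def algebra_simps)
    qed
  qed
  have \<rho>_ln: "integrable L (\<lambda>q. \<rho> q * ln (\<rho> q))"
  proof (rule Bochner_Integration.integrable_bound)
    show "integrable L (\<lambda>q. \<bar>F q\<bar> + 1 + \<rho> q)"
      using F_int \<rho>_int by simp
    show "AE q in L. norm (\<rho> q * ln (\<rho> q)) \<le> norm (\<bar>F q\<bar> + 1 + \<rho> q)"
      using le_F AE_space
    proof eventually_elim
      case (elim q)
      then show ?case using xlnx_ge[OF \<rho>_nonneg, of q] \<rho>_nonneg[of q] by auto
    qed
  qed measurable
  have ent: "entropic \<rho>"
    using \<rho>_int \<rho>_nonneg \<rho>_one \<rho>_ln by (simp add: entropic_def)
  \<comment> \<open>A positive \<open>f\<close> over a zero of \<open>\<rho>\<close> would break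
    Gibbs' inequality, so such points must form a null set.\<close>
  have f0: "AE x in P. \<rho> (snd x) = 0 \<longrightarrow> f x = 0"
  proof -
    have "(\<integral>\<^sup>+x. (indicator {q. \<rho> q = 0} (snd x)) * ennreal (f x) \<partial>P) = (\<integral>\<^sup>+q. indicator {q. \<rho> q = 0} q * ennreal (\<rho> q) \<partial>L)"
    proof (rule nn_integral_snd_marginal[OF f_meas _ marg])
      have "(\<lambda>q. if \<rho> q = 0 then 1 else 0 :: ennreal) \<in> borel_measurable L" by measurable
      moreover have "(\<lambda>q. if \<rho> q = 0 then 1 else 0 :: ennreal) = indicator {q. \<rho> q = 0}"
        by (auto simp: indicator_def fun_eq_iff)
      ultimately show "indicator {q. \<rho> q = 0} \<in> borel_measurable L" by simp
    qed
    also have "\<dots> = 0" by (subst nn_integral_0_iff_AE) (auto simp: indicator_def)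
    finally have "AE x in P. indicator {q. \<rho> q = 0} (snd x) * ennreal (f x) = 0"
      by (subst (asm) nn_integral_0_iff_AE)
         (auto simp: indicator_def if_distrib[of "\<lambda>x. x * _"] cong: if_cong)
    then show ?thesis using AE_space
    proof eventually_elim
      case (elim x)
      then show ?case using f_nonneg[of x] by (auto simp: indicator_def)
    qed
  qed
  have f_ln\<rho>: "integrable P (\<lambda>x. f x * ln (\<rho> (snd x)))"
    and f_ln\<rho>_integral: "(\<integral>x. f x * ln (\<rho> (snd x)) \<partial>P) = (\<integral>q. \<rho> q * ln (\<rho> q) \<partial>L)"
  proof -
    have "(\<integral>\<^sup>+x. ennreal (norm (f x * ln (\<rho> (snd x)))) \<partial>P) = (\<integral>\<^sup>+x. ennreal \<bar>ln (\<rho> (snd x))\<bar> * ennreal (f x) \<partial>P)"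
      using f_nonneg by (intro nn_integral_cong) (simp add: abs_mult mult.commute flip: ennreal_mult)
    also have "\<dots> = (\<integral>\<^sup>+q. ennreal \<bar>ln (\<rho> q)\<bar> * ennreal (\<rho> q) \<partial>L)"
      by (rule nn_integral_snd_marginal[OF f_meas _ marg, where h = "\<lambda>q. ennreal \<bar>ln (\<rho> q)\<bar>"]) measurable
    also have "\<dots> = (\<integral>\<^sup>+q. ennreal (norm (\<rho> q * ln (\<rho> q))) \<partial>L)"
      using \<rho>_nonneg by (intro nn_integral_cong) (simp add: abs_mult mult.commute flip: ennreal_mult)
    also have "\<dots> < \<infinity>" using \<rho>_ln by (simp add: integrable_iff_bounded)
    finally show i: "integrable P (\<lambda>x. f x * ln (\<rho> (snd x)))"
      by (intro integrableI_bounded) measurable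
    then have ic: "integrable P (case_prod (\<lambda>p q. f (p, q) * ln (\<rho> q)))"
      by (simp add: split_beta')
    show "(\<integral>x. f x * ln (\<rho> (snd x)) \<partial>P) = (\<integral>q. \<rho> q * ln (\<rho> q) \<partial>L)"
      using PL.integral_snd[OF ic] by (simp add: \<rho>_def split_beta')
  qed
  have m\<rho>_int: "integrable P (\<lambda>x. maxwellian \<theta> (fst x) * \<rho> (snd x))"
    and m\<rho>_integral: "(\<integral>x. maxwellian \<theta> (fst x) * \<rho> (snd x) \<partial>P) = 1"
    using integrable_P_product[OF integrable_maxwellian[OF \<theta>] \<rho>_int]
      integral_P_product[OF integrable_maxwellian[OF \<theta>] \<rho>_int] integral_maxwellian[OF \<theta>] \<rho>_one by auto
  \<comment> \<open>The integrand of the relative entropy, expanded into terms that are integrable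
    one by one; \<open>D_eq\<close> recovers the closed form.\<close>
  define D where "D x = f x * ln (f x) + 3/2 * ln (2 * pi * \<theta>) * f x + 1 / \<theta> * g x - f x * ln (\<rho> (snd x))
      - f x + maxwellian \<theta> (fst x) * \<rho> (snd x)" for x
  have D_int: "integrable P D"
    unfolding D_def using f_ln f_int g_int f_ln\<rho> m\<rho>_int
    by (intro Bochner_Integration.integrable_add Bochner_Integration.integrable_diff integrable_mult_right)
  have H: "boltzmann_H \<Lambda> f = (\<integral>x. f x * ln (f x) \<partial>P) - 1"
    by (rule boltzmann_H_eq[OF f_int f_ln f_one f_nonneg])
  have "(\<integral>x. D x \<partial>P) = (\<integral>x. f x * ln (f x) \<partial>P) + 3/2 * ln (2 * pi * \<theta>) * 1 + 1 / \<theta> * K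
      - (\<integral>q. \<rho> q * ln (\<rho> q) \<partial>L) - 1 + 1"
    unfolding D_def using f_ln f_int g_int f_ln\<rho> m\<rho>_int by (simp add: f_one K_def f_ln\<rho>_integral m\<rho>_integral)
  then have D_integral: "(\<integral>x. D x \<partial>P) = boltzmann_H \<Lambda> f - reduced_H \<epsilon> \<rho>"
    using K\<theta> \<theta> by (simp add: H reduced_H_def ent_def \<theta>_def)
  have D_eq: "D x = f x * ln (f x) - (f x * ln (maxwellian \<theta> (fst x) * \<rho> (snd x)) + f x - maxwellian \<theta> (fst x) * \<rho> (snd x))"
    if "\<rho> (snd x) = 0 \<longrightarrow> f x = 0" "x \<in> space P" for x
  proof (cases "\<rho> (snd x) = 0")
    case True
    then show ?thesis using that by (simp add: D_def g_def)
  next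
    case False
    then have "\<rho> (snd x) > 0" using \<rho>_nonneg[of "snd x"] that(2) by (auto simp: space_P less_le)
    then show ?thesis
      using maxwellian_pos[OF \<theta>, of "fst x"]
      by (simp add: D_def ln_mult ln_maxwellian[OF \<theta>] g_def algebra_simps)
  qed
  have m\<rho>_nonneg: "0 \<le> maxwellian \<theta> (fst x) * \<rho> (snd x)" "maxwellian \<theta> (fst x) * \<rho> (snd x) = 0 \<longleftrightarrow> \<rho> (snd x) = 0"
    if "x \<in> space P" for x
    using maxwellian_pos[OF \<theta>, of "fst x"] \<rho>_nonneg[of "snd x"] that by (auto simp: space_P)
  have D_nonneg: "AE x in P. 0 \<le> D x"
    using f0 AE_space
  proof eventually_elim
    case (elim x)
    then show ?case
      using gibbs_ineq[OF f_nonneg m\<rho>_nonneg(1), of x x] m\<rho>_nonneg(2)[of x] D_eq[of x] by simp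
  qed
  have "0 \<le> (\<integral>x. D x \<partial>P)" by (rule integral_nonneg_AE[OF D_nonneg])
  then have le: "reduced_H \<epsilon> \<rho> \<le> boltzmann_H \<Lambda> f" using D_integral by simp
  have "AE x in P. f x = maxwellian (vartheta \<Lambda> U \<epsilon> \<rho>) (fst x) * \<rho> (snd x)" if "boltzmann_H \<Lambda> f = reduced_H \<epsilon> \<rho>"
  proof -
    have "AE x in P. D x = 0"
      using integral_nonneg_eq_0_iff_AE[OF D_int D_nonneg] D_integral that by simp
    then show ?thesis using f0 AE_space
    proof eventually_elim
      case (elim x)
      then show ?case
        unfolding \<theta>_def[symmetric]
        using gibbs_eq[OF f_nonneg m\<rho>_nonneg(1), of x x] m\<rho>_nonneg(2)[of x] D_eq[of x] by simp
    qed
  qed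
  with ent energy le show ?thesis by (rule that)
qed

end

section \<open>Existence of minimizers\<close>

context pair_potential
begin

lemma entropic_bounded:
  assumes [measurable]: "\<rho> \<in> borel_measurable L" and nonneg: "\<And>q. q \<in> \<Lambda> \<Longrightarrow> 0 \<le> \<rho> q"
    and bound: "\<And>q. q \<in> \<Lambda> \<Longrightarrow> \<rho> q \<le> B" and one: "(\<integral>q. \<rho> q \<partial>L) = 1"
  shows "entropic \<rho>"
proof -
  have 1: "integrable L \<rho>"
    using nonneg bound by (intro integrable_const_bound[where B = B] AE_I2) auto
  have "\<bar>\<rho> q * ln (\<rho> q)\<bar> \<le> 1 + B\<^sup>2" if "q \<in> \<Lambda>" for q
  proof -
    have r: "0 \<le> \<rho> q" "\<rho> q \<le> B" using nonneg bound that by auto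
    then have "\<rho> q * ln (\<rho> q) \<le> \<rho> q * \<rho> q"
      by (cases "\<rho> q = 0") (auto intro!: mult_left_mono order_trans[OF ln_le_minus_one])
    also have "\<dots> \<le> B\<^sup>2"
      unfolding power2_eq_square using r by (intro mult_mono) auto
    finally show ?thesis using xlnx_ge[OF r(1)] r(1) zero_le_power2[of B] unfolding abs_le_iff by linarith
  qed
  then have "integrable L (\<lambda>q. \<rho> q * ln (\<rho> q))"
    by (intro integrable_const_bound[where B = "1 + B\<^sup>2"] AE_I2) auto
  with 1 show ?thesis using nonneg one by (simp add: entropic_def)
qed

lemma interaction_energy_scale_mono:
  assumes "\<And>q. q \<in> \<Lambda> \<Longrightarrow> ennreal (\<sigma> q) \<le> ennreal c * ennreal (\<rho> q)"
    and [measurable]: "\<rho> \<in> borel_measurable L"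
  shows "interaction_energy \<Lambda> U \<sigma> \<le> ennreal c * ennreal c * interaction_energy \<Lambda> U \<rho>"
proof -
  have "interaction_energy \<Lambda> U \<sigma> \<le> (\<integral>\<^sup>+q. (\<integral>\<^sup>+q'. ennreal c * ennreal c * (ennreal (1/2) * U q q' * ennreal (\<rho> q) * ennreal (\<rho> q')) \<partial>L) \<partial>L)"
    unfolding interaction_energy_L
  proof (intro nn_integral_mono)
    fix q q' assume "q \<in> space L" "q' \<in> space L"
    then have "ennreal (1/2) * U q q' * ennreal (\<sigma> q) * ennreal (\<sigma> q') \<le>
        ennreal (1/2) * U q q' * (ennreal c * ennreal (\<rho> q)) * (ennreal c * ennreal (\<rho> q'))"
      using assms(1) by (intro mult_mono order_refl) auto
    then show "ennreal (1/2) * U q q' * ennreal (\<sigma> q) * ennreal (\<sigma> q') \<le>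
        ennreal c * ennreal c * (ennreal (1/2) * U q q' * ennreal (\<rho> q) * ennreal (\<rho> q'))"
      by (simp only: mult_ac)
  qed
  also have "\<dots> = (\<integral>\<^sup>+q. ennreal c * ennreal c * (\<integral>\<^sup>+q'. (ennreal (1/2) * U q q' * ennreal (\<rho> q) * ennreal (\<rho> q')) \<partial>L) \<partial>L)"
    by (intro nn_integral_cong nn_integral_cmult borel_measurable_times_ennreal measurable_const measurable_U_right) auto
  also have "\<dots> = ennreal c * ennreal c * interaction_energy \<Lambda> U \<rho>"
    unfolding interaction_energy_L by (intro nn_integral_cmult) measurable
  finally show ?thesis .
qed

text \<open>An admissible density need not have finite entropy, so it is truncated at height
  \<open>n\<close> and normalised. The energy grows at most by the square of the normalising factor,
  which tends to 1.\<close>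

lemma entropic_below:
  assumes "density_ground_energy \<Lambda> U < ennreal \<epsilon>"
  obtains \<rho> where "entropic \<rho>" "interaction_energy \<Lambda> U \<rho> < ennreal \<epsilon>"
proof -
  obtain \<rho> where \<rho>: "\<rho> \<in> prob_densities \<Lambda>" "interaction_energy \<Lambda> U \<rho> < ennreal \<epsilon>"
    using assms unfolding density_ground_energy_def by (auto simp: INF_less_iff)
  then have int: "integrable L \<rho>" and one: "(\<integral>q. \<rho> q \<partial>L) = 1" and nonneg: "\<And>q. q \<in> \<Lambda> \<Longrightarrow> 0 \<le> \<rho> q"
    by (auto simp: prob_densities_def set_integrable_L set_integral_L)
  have [measurable]: "\<rho> \<in> borel_measurable L" using int by auto
  obtain i where i: "interaction_energy \<Lambda> U \<rho> = ennreal i" "0 \<le> i"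
    using \<rho>(2) by (cases "interaction_energy \<Lambda> U \<rho>") auto
  have "i < \<epsilon>" using \<rho>(2) i by (simp add: ennreal_less_iff)
  define c where "c n = (\<integral>q. min (\<rho> q) (real n) \<partial>L)" for n :: nat
  have "(\<lambda>n. \<integral>q. min (\<rho> q) (real n) \<partial>L) \<longlonglongrightarrow> (\<integral>q. \<rho> q \<partial>L)"
  proof (rule integral_dominated_convergence[OF _ _ int])
    show "AE q in L. (\<lambda>n. min (\<rho> q) (real n)) \<longlonglongrightarrow> \<rho> q"
    proof (intro AE_I2 tendsto_eventually)
      fix q
      have "eventually (\<lambda>n. nat \<lceil>\<rho> q\<rceil> \<le> n) sequentially" by (rule eventually_ge_at_top)
      then show "eventually (\<lambda>n. min (\<rho> q) (real n) = \<rho> q) sequentially"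
        by eventually_elim linarith
    qed
    show "AE q in L. norm (min (\<rho> q) (real n)) \<le> \<rho> q" for n
      using nonneg by (intro AE_I2) auto
  qed auto
  then have c: "c \<longlonglongrightarrow> 1" by (simp add: c_def[abs_def] one)
  have "(\<lambda>n. inverse (c n) * inverse (c n) * i) \<longlonglongrightarrow> inverse 1 * inverse 1 * i"
    by (intro tendsto_intros c) auto
  then have "eventually (\<lambda>n. inverse (c n) * inverse (c n) * i < \<epsilon>) sequentially"
    using \<open>i < \<epsilon>\<close> by (intro order_tendstoD(2)) auto
  moreover have "eventually (\<lambda>n. 0 < c n) sequentially"
    by (rule order_tendstoD(1)[OF c]) simp
  ultimately have "eventually (\<lambda>n. inverse (c n) * inverse (c n) * i < \<epsilon> \<and> 0 < c n) sequentially"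
    by eventually_elim auto
  then obtain n where n: "inverse (c n) * inverse (c n) * i < \<epsilon>" "0 < c n"
    by (auto simp: eventually_sequentially)
  define \<sigma> where "\<sigma> q = inverse (c n) * min (\<rho> q) (real n)" for q
  have [measurable]: "\<sigma> \<in> borel_measurable L" unfolding \<sigma>_def by measurable
  have "entropic \<sigma>"
  proof (rule entropic_bounded)
    show "0 \<le> \<sigma> q" if "q \<in> \<Lambda>" for q using nonneg[OF that] n by (simp add: \<sigma>_def)
    show "\<sigma> q \<le> inverse (c n) * real n" for q
      using n unfolding \<sigma>_def by (intro mult_left_mono) auto
    show "(\<integral>q. \<sigma> q \<partial>L) = 1" using n by (simp add: \<sigma>_def c_def[symmetric])
  qed measurable
  moreover have "interaction_energy \<Lambda> U \<sigma> < ennreal \<epsilon>"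
  proof -
    have "interaction_energy \<Lambda> U \<sigma> \<le> ennreal (inverse (c n)) * ennreal (inverse (c n)) * interaction_energy \<Lambda> U \<rho>"
    proof (rule interaction_energy_scale_mono)
      fix q assume "q \<in> \<Lambda>"
      then show "ennreal (\<sigma> q) \<le> ennreal (inverse (c n)) * ennreal (\<rho> q)"
        using nonneg[of q] n by (subst ennreal_mult[symmetric]) (auto simp: \<sigma>_def intro!: ennreal_leI mult_left_mono)
    qed measurable
    also have "\<dots> = ennreal (inverse (c n) * inverse (c n) * i)"
      using n i by (simp add: ennreal_mult)
    also have "\<dots> < ennreal \<epsilon>"
      using n i \<open>i < \<epsilon>\<close> by (intro ennreal_lessI) linarith+
    finally show ?thesis .
  qed
  ultimately show ?thesis by (rule that)
qed

lemma ent_ge: "entropic \<rho> \<Longrightarrow> 1 - measure L \<Lambda> \<le> ent \<rho>"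
proof -
  assume \<rho>: "entropic \<rho>"
  have "1 - measure L \<Lambda> = (\<integral>q. \<rho> q - 1 \<partial>L)"
    using \<rho> by (simp add: entropic_def)
  also have "\<dots> \<le> ent \<rho>"
    unfolding ent_def using \<rho> by (intro integral_mono xlnx_ge) (auto simp: entropic_def)
  finally show ?thesis .
qed

lemma cell_energy_nonneg: "entropic \<rho> \<Longrightarrow> 0 \<le> cell_energy j \<rho>"
  unfolding cell_energy_def using mass_nonneg[of \<rho>]
  by (intro sum_nonneg mult_nonneg_nonneg) (auto simp: entropic_def)

text \<open>Here \<open>t k\<close> is the room left for kinetic energy, \<open>u\<close> an error
  that vanishes, and \<open>\<kappa>\<close> a coefficient that tends to 3/2; the existence of
  minimizers uses the constants 0 and 3/2, the upper bound uses \<open>k / (2 * N)\<close> and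
  \<open>3/2 - 1 / N\<close>. The objective \<open>- ent + \<kappa> * ln t\<close> is bounded below
  along the sequence, which keeps \<open>t\<close> away from 0 and the entropy integral bounded
  above, so compactness applies.\<close>

lemma maximizing_limit:
  fixes A \<kappa> t u :: "nat \<Rightarrow> real"
  assumes \<rho>: "\<And>k. entropic (\<rho> k)"
    and t: "\<And>k. 0 < t k" "\<And>k. t k \<le> T"
    and energy: "\<And>i. eventually (\<lambda>k. cell_energy i (\<rho> k) \<le> \<epsilon> - t k + u k) sequentially"
    and u: "u \<longlonglongrightarrow> 0"
    and \<kappa>: "\<And>k. 1 \<le> \<kappa> k" "\<And>k. \<kappa> k \<le> 2" "\<kappa> \<longlonglongrightarrow> 3/2"
    and le: "\<And>k. A k \<le> - ent (\<rho> k) + \<kappa> k * ln (t k)" and A: "A \<longlonglongrightarrow> A'"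
    and "\<epsilon> > 0"
  obtains \<sigma> where "entropic \<sigma>" "interaction_energy \<Lambda> U \<sigma> < ennreal \<epsilon>"
    "A' \<le> - ent \<sigma> + 3/2 * ln (\<epsilon> - enn2real (interaction_energy \<Lambda> U \<sigma>))"
proof -
  obtain a where a: "\<And>k. \<bar>A k\<bar> \<le> a"
    using convergent_imp_Bseq[OF convergentI[OF A]] by (auto simp: Bseq_def)
  define c1 where "c1 = a + \<bar>1 - measure L \<Lambda>\<bar>"
  have c1: "0 \<le> c1" using a[of 0] by (simp add: c1_def)
  \<comment> \<open>If \<open>ln (t k)\<close> were below \<open>- c1\<close>, then
    \<open>\<kappa> k \<ge> 1\<close> would push the objective below its lower bound, since
    \<open>- ent\<close> is at most \<open>measure L \<Lambda> - 1\<close>.\<close>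
  have ln_ge: "- c1 \<le> ln (t k)" for k
  proof (rule ccontr)
    assume "\<not> - c1 \<le> ln (t k)"
    then have neg: "ln (t k) < - c1" by simp
    then have "\<kappa> k * ln (t k) \<le> 1 * ln (t k)"
      using c1 \<kappa>(1)[of k] by (intro mult_right_mono_neg) auto
    moreover have "- c1 \<le> \<kappa> k * ln (t k)"
      using le[of k] a[of k] ent_ge[OF \<rho>, of k] unfolding c1_def by linarith
    ultimately show False using neg by simp
  qed
  have t_ge: "exp (- c1) \<le> t k" for k
    using ln_ge[of k] t(1)[of k] by (metis exp_le_cancel_iff exp_ln)
  have "\<kappa> k * ln (t k) \<le> 2 * \<bar>ln T\<bar>" for k
  proof -
    have "ln (t k) \<le> ln T" using t[of k] by (intro ln_mono) (auto intro: less_le_trans)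
    then have "\<kappa> k * ln (t k) \<le> \<kappa> k * \<bar>ln T\<bar>" using \<kappa>(1)[of k] by (intro mult_left_mono) auto
    also have "\<dots> \<le> 2 * \<bar>ln T\<bar>" using \<kappa>(2)[of k] by (intro mult_right_mono) auto
    finally show ?thesis .
  qed
  then have ent_le: "ent (\<rho> k) \<le> 2 * \<bar>ln T\<bar> + a" for k
    using le[of k] a[of k] by (smt (verit))
  let ?S = "{1 - measure L \<Lambda>..2 * \<bar>ln T\<bar> + a} \<times> {exp (- c1)..T}"
  have "compact ?S" by (intro compact_Times compact_Icc)
  then have sc: "seq_compact ?S" by (rule compact_imp_seq_compact)
  have inS: "\<forall>k. (ent (\<rho> k), t k) \<in> ?S"
    using ent_ge[OF \<rho>] ent_le t_ge t(2) by auto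
  obtain l r where l: "l \<in> ?S" and r: "strict_mono r" and lim: "((\<lambda>k. (ent (\<rho> k), t k)) \<circ> r) \<longlonglongrightarrow> l"
    by (rule seq_compactE[OF sc inS])
  obtain s t' where [simp]: "l = (s, t')" by (cases l)
  have s: "(\<lambda>k. ent (\<rho> (r k))) \<longlonglongrightarrow> s" and t': "(\<lambda>k. t (r k)) \<longlonglongrightarrow> t'"
    using tendsto_fst[OF lim] tendsto_snd[OF lim] by (simp_all add: o_def)
  have t'_pos: "0 < t'" using l by (auto intro: less_le_trans[of 0 "exp (- c1)"])
  have u': "(\<lambda>k. u (r k)) \<longlonglongrightarrow> 0" and \<kappa>': "(\<lambda>k. \<kappa> (r k)) \<longlonglongrightarrow> 3/2" and A'': "(\<lambda>k. A (r k)) \<longlonglongrightarrow> A'"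
    using LIMSEQ_subseq_LIMSEQ[OF u r] LIMSEQ_subseq_LIMSEQ[OF \<kappa>(3) r] LIMSEQ_subseq_LIMSEQ[OF A r]
    by (simp_all add: o_def)
  have x: "(\<lambda>k. \<epsilon> - t (r k) + u (r k)) \<longlonglongrightarrow> \<epsilon> - t'"
    using tendsto_add[OF tendsto_diff[OF tendsto_const[of \<epsilon>] t'] u'] by simp
  have ev: "eventually (\<lambda>k. cell_energy i (\<rho> (r k)) \<le> \<epsilon> - t (r k) + u (r k)) sequentially" for i
    by (rule eventually_subseq[OF r energy])
  have X: "0 \<le> \<epsilon> - t'"
  proof (rule tendsto_lowerbound[OF x])
    show "eventually (\<lambda>k. 0 \<le> \<epsilon> - t (r k) + u (r k)) sequentially"
      using ev[of 0] by eventually_elim (use cell_energy_nonneg[OF \<rho>] order_trans in blast)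
  qed simp
  obtain \<sigma> where \<sigma>: "entropic \<sigma>" "ent \<sigma> \<le> s" "interaction_energy \<Lambda> U \<sigma> \<le> ennreal (\<epsilon> - t')"
    by (rule energy_compactness[of "\<lambda>k. \<rho> (r k)" "\<lambda>k. ent (\<rho> (r k))" s "\<lambda>k. \<epsilon> - t (r k) + u (r k)" "\<epsilon> - t'"])
       (use \<rho> s ev x in auto)
  have "ennreal (\<epsilon> - t') < ennreal \<epsilon>" using t'_pos \<open>\<epsilon> > 0\<close> by (intro ennreal_lessI) auto
  then have "interaction_energy \<Lambda> U \<sigma> < ennreal \<epsilon>" using \<sigma>(3) by (rule le_less_trans[rotated])
  moreover have "A' \<le> - ent \<sigma> + 3/2 * ln (\<epsilon> - enn2real (interaction_energy \<Lambda> U \<sigma>))"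
  proof -
    have "A' \<le> - s + 3/2 * ln t'"
      by (rule LIMSEQ_le[OF A'' tendsto_add[OF tendsto_minus[OF s] tendsto_mult[OF \<kappa>' tendsto_ln[OF t']]]])
         (use t'_pos le in auto)
    \<comment> \<open>The limit may have more room than \<open>t'\<close>, because energy can drop;
      the logarithm is increasing, so the inequality goes in the right direction.\<close>
    also have "\<dots> \<le> - ent \<sigma> + 3/2 * ln (\<epsilon> - enn2real (interaction_energy \<Lambda> U \<sigma>))"
    proof -
      have "enn2real (interaction_energy \<Lambda> U \<sigma>) \<le> \<epsilon> - t'"
        using \<sigma>(3) X by (rule enn2real_leI[rotated])
      then have "ln t' \<le> ln (\<epsilon> - enn2real (interaction_energy \<Lambda> U \<sigma>))"
        using t'_pos by (intro ln_mono) auto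
      then show ?thesis using \<sigma>(2) by simp
    qed
    finally show ?thesis .
  qed
  ultimately show ?thesis using \<sigma>(1) by (intro that[of \<sigma>])
qed

section \<open>Attainment of the minimum\<close>

lemma reduced_H_eq:
  assumes "interaction_energy \<Lambda> U \<rho> < ennreal \<epsilon>"
  shows "reduced_H \<epsilon> \<rho> = ent \<rho> - 3/2 * ln (\<epsilon> - enn2real (interaction_energy \<Lambda> U \<rho>)) - 3/2 * ln (4/3 * pi) - 5/2"
proof -
  have pos: "\<epsilon> - enn2real (interaction_energy \<Lambda> U \<rho>) > 0"
    using vartheta_pos[OF assms] by (simp add: vartheta_def)
  have "2 * pi * vartheta \<Lambda> U \<epsilon> \<rho> = 4/3 * pi * (\<epsilon> - enn2real (interaction_energy \<Lambda> U \<rho>))"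
    by (simp add: vartheta_def)
  then have "ln (2 * pi * vartheta \<Lambda> U \<epsilon> \<rho>) = ln (4/3 * pi) + ln (\<epsilon> - enn2real (interaction_energy \<Lambda> U \<rho>))"
    using pos by (simp only:) (subst ln_mult, auto)
  then show ?thesis by (simp add: reduced_H_def algebra_simps)
qed

lemma cell_energy_le:
  assumes "entropic \<rho>" "interaction_energy \<Lambda> U \<rho> < \<infinity>"
  shows "cell_energy i \<rho> \<le> enn2real (interaction_energy \<Lambda> U \<rho>)"
proof -
  have "ennreal (cell_energy i \<rho>) \<le> interaction_energy \<Lambda> U \<rho>"
    using assms(1) by (subst interaction_energy_SUP) (auto simp: entropic_def intro: SUP_upper)
  then have "enn2real (ennreal (cell_energy i \<rho>)) \<le> enn2real (interaction_energy \<Lambda> U \<rho>)"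
    using assms(2) by (intro enn2real_mono) auto
  then show ?thesis using cell_energy_nonneg[OF assms(1)] by simp
qed

text \<open>The direct method along a minimizing sequence; the additive constants of
  \<open>reduced_H\<close> are moved into the sequence \<open>A\<close> of
  \<open>maximizing_limit\<close>.\<close>

theorem reduced_minimizer_exists:
  assumes "density_ground_energy \<Lambda> U < ennreal \<epsilon>"
  obtains \<sigma> where "entropic \<sigma>" "interaction_energy \<Lambda> U \<sigma> < ennreal \<epsilon>"
    "\<And>\<rho>. entropic \<rho> \<Longrightarrow> interaction_energy \<Lambda> U \<rho> < ennreal \<epsilon> \<Longrightarrow> reduced_H \<epsilon> \<sigma> \<le> reduced_H \<epsilon> \<rho>"
proof -
  define S where "S = {\<rho>. entropic \<rho> \<and> interaction_energy \<Lambda> U \<rho> < ennreal \<epsilon>}"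
  have \<epsilon>: "\<epsilon> > 0" using assms by (metis ennreal_neg not_less not_less_zero)
  have "S \<noteq> {}" using entropic_below[OF assms] by (auto simp: S_def)
  have fin: "interaction_energy \<Lambda> U \<rho> < \<infinity>" if "\<rho> \<in> S" for \<rho>
    using that by (auto simp: S_def intro: less_trans)
  have t_pos: "0 < \<epsilon> - enn2real (interaction_energy \<Lambda> U \<rho>)" if "\<rho> \<in> S" for \<rho>
    using vartheta_pos[of \<rho> \<epsilon>] that by (simp add: vartheta_def S_def)
  have "1 - measure L \<Lambda> - 3/2 * ln \<epsilon> - 3/2 * ln (4/3 * pi) - 5/2 \<le> reduced_H \<epsilon> \<rho>" if "\<rho> \<in> S" for \<rho>
  proof -
    have "ln (\<epsilon> - enn2real (interaction_energy \<Lambda> U \<rho>)) \<le> ln \<epsilon>"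
      using t_pos[OF that] \<epsilon> by (intro ln_mono) auto
    then show ?thesis using that ent_ge[of \<rho>] by (simp add: S_def reduced_H_eq)
  qed
  then have bdd: "bdd_below (reduced_H \<epsilon> ` S)" by (intro bdd_belowI2)
  define m where "m = (INF \<rho>\<in>S. reduced_H \<epsilon> \<rho>)"
  have m_le: "m \<le> reduced_H \<epsilon> \<rho>" if "\<rho> \<in> S" for \<rho>
    unfolding m_def by (rule cINF_lower[OF bdd that])
  have "\<exists>\<rho>\<in>S. reduced_H \<epsilon> \<rho> < m + 1 / real (Suc k)" for k
    using cINF_less_iff[OF \<open>S \<noteq> {}\<close> bdd, of "m + 1 / real (Suc k)"] by (simp add: m_def)
  then obtain \<rho> where \<rho>: "\<And>k. \<rho> k \<in> S" "\<And>k. reduced_H \<epsilon> (\<rho> k) < m + 1 / real (Suc k)"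
    by metis
  define t where "t k = \<epsilon> - enn2real (interaction_energy \<Lambda> U (\<rho> k))" for k
  obtain \<sigma> where \<sigma>: "entropic \<sigma>" "interaction_energy \<Lambda> U \<sigma> < ennreal \<epsilon>"
    "- m - 3/2 * ln (4/3 * pi) - 5/2 \<le> - ent \<sigma> + 3/2 * ln (\<epsilon> - enn2real (interaction_energy \<Lambda> U \<sigma>))"
  proof (rule maximizing_limit[where \<rho> = \<rho> and t = t and T = \<epsilon> and \<epsilon> = \<epsilon> and u = "\<lambda>_. 0" and \<kappa> = "\<lambda>_. 3/2"
        and A = "\<lambda>k. - m - 1 / real (Suc k) - 3/2 * ln (4/3 * pi) - 5/2" and A' = "- m - 3/2 * ln (4/3 * pi) - 5/2"])
    show "entropic (\<rho> k)" for k using \<rho>(1)[of k] by (simp add: S_def)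
    show "0 < t k" for k unfolding t_def by (rule t_pos[OF \<rho>(1)])
    show "t k \<le> \<epsilon>" for k by (simp add: t_def)
    show "eventually (\<lambda>k. cell_energy i (\<rho> k) \<le> \<epsilon> - t k + 0) sequentially" for i
      using cell_energy_le[OF _ fin[OF \<rho>(1)]] \<rho>(1) by (auto simp: t_def S_def)
    show "- m - 1 / real (Suc k) - 3/2 * ln (4/3 * pi) - 5/2 \<le> - ent (\<rho> k) + 3/2 * ln (t k)" for k
      using \<rho>(1)[of k] \<rho>(2)[of k] by (simp add: S_def reduced_H_eq t_def)
    show "(\<lambda>k. - m - 1 / real (Suc k) - 3/2 * ln (4/3 * pi) - 5/2) \<longlonglongrightarrow> - m - 3/2 * ln (4/3 * pi) - 5/2"
      using tendsto_diff[OF tendsto_const[of "- m - 3/2 * ln (4/3 * pi) - 5/2"] LIMSEQ_Suc[OF lim_inverse_n']]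
      by (simp add: algebra_simps)
  qed (use \<epsilon> in auto)
  have "reduced_H \<epsilon> \<sigma> \<le> m" using \<sigma>(3) by (simp add: reduced_H_eq[OF \<sigma>(2)])
  then show ?thesis
    using that[OF \<sigma>(1,2)] m_le by (force simp: S_def intro: order_trans)
qed

theorem minimizer_exists:
  assumes "density_ground_energy \<Lambda> U < ennreal \<epsilon>"
  shows "\<exists>f. H_minimizer \<Lambda> U \<epsilon> f"
proof -
  have \<epsilon>: "\<epsilon> > 0" using assms by (metis ennreal_neg not_less not_less_zero)
  obtain \<sigma> where \<sigma>: "entropic \<sigma>" "interaction_energy \<Lambda> U \<sigma> < ennreal \<epsilon>"
    "\<And>\<rho>. entropic \<rho> \<Longrightarrow> interaction_energy \<Lambda> U \<rho> < ennreal \<epsilon> \<Longrightarrow> reduced_H \<epsilon> \<sigma> \<le> reduced_H \<epsilon> \<rho>"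
    using reduced_minimizer_exists[OF assms] by blast
  define f where "f x = maxwellian (vartheta \<Lambda> U \<epsilon> \<sigma>) (fst x) * \<sigma> (snd x)" for x
  have f: "f \<in> trial_densities \<Lambda> U \<epsilon>" "boltzmann_H \<Lambda> f = reduced_H \<epsilon> \<sigma>"
    using maxwellian_product_trial[OF \<sigma>(1,2)] unfolding f_def by blast+
  have "boltzmann_H \<Lambda> f \<le> boltzmann_H \<Lambda> g" if g: "g \<in> trial_densities \<Lambda> U \<epsilon>" for g
  proof -
    obtain \<rho> where "entropic \<rho>" "interaction_energy \<Lambda> U \<rho> < ennreal \<epsilon>" "reduced_H \<epsilon> \<rho> \<le> boltzmann_H \<Lambda> g"
      by (rule trial_density_reduction[OF g \<epsilon>])
    with \<sigma>(3)[of \<rho>] show ?thesis unfolding f(2) by linarith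
  qed
  then have "H_minimizer \<Lambda> U \<epsilon> f" using f(1) by (auto simp: is_arg_min_def not_less)
  then show ?thesis by (intro exI[of _ f])
qed

text \<open>The Maxwellian product over the marginal of a minimizer is itself a competitor, so the
  reduction inequality must be an equality, and its equality case gives the product form.\<close>

theorem minimizer_reduction:
  assumes f: "H_minimizer \<Lambda> U \<epsilon> f" and \<epsilon>: "\<epsilon> > 0"
  obtains \<rho> where "entropic \<rho>" "interaction_energy \<Lambda> U \<rho> < ennreal \<epsilon>" "boltzmann_H \<Lambda> f = reduced_H \<epsilon> \<rho>"
    "AE x in P. f x = maxwellian (vartheta \<Lambda> U \<epsilon> \<rho>) (fst x) * \<rho> (snd x)"
    "\<And>\<sigma>. entropic \<sigma> \<Longrightarrow> interaction_energy \<Lambda> U \<sigma> < ennreal \<epsilon> \<Longrightarrow> reduced_H \<epsilon> \<rho> \<le> reduced_H \<epsilon> \<sigma>"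
proof -
  have f_trial: "f \<in> trial_densities \<Lambda> U \<epsilon>"
    and f_min: "\<And>g. g \<in> trial_densities \<Lambda> U \<epsilon> \<Longrightarrow> boltzmann_H \<Lambda> f \<le> boltzmann_H \<Lambda> g"
    using f by (auto simp: is_arg_min_def not_less)
  have min: "boltzmann_H \<Lambda> f \<le> reduced_H \<epsilon> \<sigma>" if "entropic \<sigma>" "interaction_energy \<Lambda> U \<sigma> < ennreal \<epsilon>" for \<sigma>
    using f_min[OF maxwellian_product_trial(1)[OF that]] maxwellian_product_trial(2)[OF that] by simp
  obtain \<rho> where \<rho>: "entropic \<rho>" "interaction_energy \<Lambda> U \<rho> < ennreal \<epsilon>" "reduced_H \<epsilon> \<rho> \<le> boltzmann_H \<Lambda> f"
    "boltzmann_H \<Lambda> f = reduced_H \<epsilon> \<rho> \<Longrightarrow>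
      AE x in P. f x = maxwellian (vartheta \<Lambda> U \<epsilon> \<rho>) (fst x) * \<rho> (snd x)"
    using trial_density_reduction[OF f_trial \<epsilon>] by blast
  have eq: "boltzmann_H \<Lambda> f = reduced_H \<epsilon> \<rho>" using min[OF \<rho>(1,2)] \<rho>(3) by simp
  show ?thesis using that[OF \<rho>(1,2) eq \<rho>(4)[OF eq]] min eq by simp
qed

end

section \<open>The fixed point equation\<close>

lemma ennreal_half_mult_eq:
  assumes "ennreal (1/2) * x = ennreal i" "0 \<le> i"
  shows "x = ennreal (2 * i)"
proof -
  have "ennreal 2 * (ennreal (1/2) * x) = ennreal 2 * ennreal i" by (simp only: assms(1))
  moreover have "ennreal 2 * (ennreal (1/2) * x) = x"
    unfolding mult.assoc[symmetric] by (subst ennreal_mult[symmetric]) auto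
  moreover have "ennreal 2 * ennreal i = ennreal (2 * i)" using assms(2) by (intro ennreal_mult[symmetric]) auto
  ultimately show ?thesis by simp
qed

context pair_potential
begin

section \<open>The interaction energy as a quadratic form\<close>

lemma mean_potential_L: "mean_potential \<Lambda> U \<rho> q = (\<integral>\<^sup>+q'. U q q' * ennreal (\<rho> q') \<partial>L)"
  unfolding mean_potential_def by (simp only: nn_integral_L)

lemma measurable_mean_potential [measurable]:
  assumes [measurable]: "\<rho> \<in> borel_measurable L"
  shows "mean_potential \<Lambda> U \<rho> \<in> borel_measurable L"
  unfolding mean_potential_L[abs_def] by measurable

lemma mean_potential_cong:
  assumes "AE q in L. \<rho> q = \<sigma> q"
  shows "mean_potential \<Lambda> U \<rho> q = mean_potential \<Lambda> U \<sigma> q"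
  unfolding mean_potential_L by (intro nn_integral_cong_AE, use assms in eventually_elim) simp

lemma interaction_energy_mean_potential:
  assumes [measurable]: "\<rho> \<in> borel_measurable L"
  shows "interaction_energy \<Lambda> U \<rho> = ennreal (1/2) * (\<integral>\<^sup>+q. mean_potential \<Lambda> U \<rho> q * ennreal (\<rho> q) \<partial>L)"
proof -
  have "interaction_energy \<Lambda> U \<rho> = (\<integral>\<^sup>+q. ennreal (1/2) * (mean_potential \<Lambda> U \<rho> q * ennreal (\<rho> q)) \<partial>L)"
    unfolding interaction_energy_L
  proof (intro nn_integral_cong)
    fix q assume q: "q \<in> space L"
    have m: "(\<lambda>q'. U q q' * ennreal (\<rho> q')) \<in> borel_measurable L"
      using q by (intro borel_measurable_times_ennreal measurable_U_right) auto
    have "(\<integral>\<^sup>+q'. ennreal (1/2) * U q q' * ennreal (\<rho> q) * ennreal (\<rho> q') \<partial>L)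
      = (\<integral>\<^sup>+q'. (ennreal (1/2) * ennreal (\<rho> q)) * (U q q' * ennreal (\<rho> q')) \<partial>L)"
      by (intro nn_integral_cong) (simp only: mult_ac)
    also have "\<dots> = (ennreal (1/2) * ennreal (\<rho> q)) * mean_potential \<Lambda> U \<rho> q"
      unfolding mean_potential_L by (rule nn_integral_cmult[OF m])
    finally show "(\<integral>\<^sup>+q'. ennreal (1/2) * U q q' * ennreal (\<rho> q) * ennreal (\<rho> q') \<partial>L)
      = ennreal (1/2) * (mean_potential \<Lambda> U \<rho> q * ennreal (\<rho> q))"
      by (simp only: mult_ac)
  qed
  also have "\<dots> = ennreal (1/2) * (\<integral>\<^sup>+q. mean_potential \<Lambda> U \<rho> q * ennreal (\<rho> q) \<partial>L)"
    by (rule nn_integral_cmult) measurable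
  finally show ?thesis .
qed

text \<open>Tonelli together with the symmetry of \<open>U\<close>: the mutual energy of two
  densities may be read from either of them.\<close>

lemma mean_potential_symmetric:
  assumes [measurable]: "\<rho> \<in> borel_measurable L" "\<eta> \<in> borel_measurable L"
  shows "(\<integral>\<^sup>+q. mean_potential \<Lambda> U \<rho> q * ennreal (\<eta> q) \<partial>L) = (\<integral>\<^sup>+q. mean_potential \<Lambda> U \<eta> q * ennreal (\<rho> q) \<partial>L)"
proof -
  have *: "(\<integral>\<^sup>+q. mean_potential \<Lambda> U \<rho> q * ennreal (\<eta> q) \<partial>L)
      = (\<integral>\<^sup>+q. (\<integral>\<^sup>+q'. U q q' * ennreal (\<rho> q') * ennreal (\<eta> q) \<partial>L) \<partial>L)"
    if [measurable]: "\<rho> \<in> borel_measurable L" "\<eta> \<in> borel_measurable L" for \<rho> \<eta>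
  proof (intro nn_integral_cong)
    fix q assume q: "q \<in> space L"
    have m: "(\<lambda>q'. U q q' * ennreal (\<rho> q')) \<in> borel_measurable L"
      using q by (intro borel_measurable_times_ennreal measurable_U_right) auto
    show "mean_potential \<Lambda> U \<rho> q * ennreal (\<eta> q) = (\<integral>\<^sup>+q'. U q q' * ennreal (\<rho> q') * ennreal (\<eta> q) \<partial>L)"
      unfolding mean_potential_L by (rule nn_integral_multc[OF m, symmetric])
  qed
  have "(\<integral>\<^sup>+q. (\<integral>\<^sup>+q'. U q q' * ennreal (\<rho> q') * ennreal (\<eta> q) \<partial>L) \<partial>L)
     = (\<integral>\<^sup>+q'. (\<integral>\<^sup>+q. U q q' * ennreal (\<rho> q') * ennreal (\<eta> q) \<partial>L) \<partial>L)"
    by (rule LL.Fubini'[symmetric]) measurable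
  also have "\<dots> = (\<integral>\<^sup>+q'. (\<integral>\<^sup>+q. U q' q * ennreal (\<eta> q) * ennreal (\<rho> q') \<partial>L) \<partial>L)"
    by (intro nn_integral_cong) (simp only: U_sym mult_ac)
  finally show ?thesis unfolding *[OF assms] *[OF assms(2,1)] .
qed

lemma mean_potential_mix:
  assumes [measurable]: "\<rho> \<in> borel_measurable L" "\<eta> \<in> borel_measurable L"
    and nonneg: "\<And>q. q \<in> \<Lambda> \<Longrightarrow> 0 \<le> \<rho> q" "\<And>q. q \<in> \<Lambda> \<Longrightarrow> 0 \<le> \<eta> q"
    and st: "0 \<le> s" "0 \<le> t" and q: "q \<in> \<Lambda>"
  shows "mean_potential \<Lambda> U (\<lambda>q. s * \<rho> q + t * \<eta> q) q
    = ennreal s * mean_potential \<Lambda> U \<rho> q + ennreal t * mean_potential \<Lambda> U \<eta> q"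
proof -
  have m: "(\<lambda>q'. U q q' * ennreal (\<sigma> q')) \<in> borel_measurable L" if [measurable]: "\<sigma> \<in> borel_measurable L" for \<sigma>
    using q by (intro borel_measurable_times_ennreal measurable_U_right) auto
  have "mean_potential \<Lambda> U (\<lambda>q. s * \<rho> q + t * \<eta> q) q
    = (\<integral>\<^sup>+q'. ennreal s * (U q q' * ennreal (\<rho> q')) + ennreal t * (U q q' * ennreal (\<eta> q')) \<partial>L)"
    unfolding mean_potential_L using nonneg st
    by (intro nn_integral_cong) (simp add: ennreal_mult distrib_left mult_ac)
  also have "\<dots> = (\<integral>\<^sup>+q'. ennreal s * (U q q' * ennreal (\<rho> q')) \<partial>L) + (\<integral>\<^sup>+q'. ennreal t * (U q q' * ennreal (\<eta> q')) \<partial>L)"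
    by (intro nn_integral_add borel_measurable_times_ennreal[OF measurable_const] m assms) simp_all
  also have "\<dots> = ennreal s * mean_potential \<Lambda> U \<rho> q + ennreal t * mean_potential \<Lambda> U \<eta> q"
    unfolding mean_potential_L by (simp add: nn_integral_cmult m)
  finally show ?thesis .
qed

text \<open>The quadratic form expanded along a segment: the two mixed terms coincide by symmetry,
  and the factor 1/2 leaves one \<open>s * t * b\<close>. The self-energy of \<open>\<eta>\<close>
  enters only through an upper bound \<open>J\<close>; it is multiplied by t^2 and so does not
  affect first-order variations.\<close>

lemma interaction_energy_mix:
  assumes [measurable]: "\<rho> \<in> borel_measurable L" "\<eta> \<in> borel_measurable L"
    and nonneg: "\<And>q. q \<in> \<Lambda> \<Longrightarrow> 0 \<le> \<rho> q" "\<And>q. q \<in> \<Lambda> \<Longrightarrow> 0 \<le> \<eta> q"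
    and st: "0 \<le> s" "0 \<le> t"
    and I: "interaction_energy \<Lambda> U \<rho> = ennreal i" "0 \<le> i"
    and b: "(\<integral>\<^sup>+q. mean_potential \<Lambda> U \<rho> q * ennreal (\<eta> q) \<partial>L) = ennreal b" "0 \<le> b"
    and J: "(\<integral>\<^sup>+q. mean_potential \<Lambda> U \<eta> q * ennreal (\<eta> q) \<partial>L) \<le> ennreal (2 * J)" "0 \<le> J"
  shows "interaction_energy \<Lambda> U (\<lambda>q. s * \<rho> q + t * \<eta> q) \<le> ennreal (s\<^sup>2 * i + s * t * b + t\<^sup>2 * J)"
proof -
  let ?V = "mean_potential \<Lambda> U \<rho>" and ?W = "mean_potential \<Lambda> U \<eta>"
  define x where "x = (\<integral>\<^sup>+q. ?V q * ennreal (\<rho> q) \<partial>L)"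
  have x: "x = ennreal (2 * i)"
    using interaction_energy_mean_potential[OF assms(1)] I by (intro ennreal_half_mult_eq) (simp_all add: x_def)
  have "interaction_energy \<Lambda> U (\<lambda>q. s * \<rho> q + t * \<eta> q)
    = ennreal (1/2) * (\<integral>\<^sup>+q. mean_potential \<Lambda> U (\<lambda>q. s * \<rho> q + t * \<eta> q) q * ennreal (s * \<rho> q + t * \<eta> q) \<partial>L)"
    by (rule interaction_energy_mean_potential) measurable
  also have "(\<integral>\<^sup>+q. mean_potential \<Lambda> U (\<lambda>q. s * \<rho> q + t * \<eta> q) q * ennreal (s * \<rho> q + t * \<eta> q) \<partial>L)
    = (\<integral>\<^sup>+q. ((ennreal (s\<^sup>2) * (?V q * ennreal (\<rho> q)) + ennreal (s * t) * (?V q * ennreal (\<eta> q)))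
        + ennreal (s * t) * (?W q * ennreal (\<rho> q))) + ennreal (t\<^sup>2) * (?W q * ennreal (\<eta> q)) \<partial>L)"
  proof (intro nn_integral_cong)
    fix q assume "q \<in> space L"
    then have q: "q \<in> \<Lambda>" by simp
    show "mean_potential \<Lambda> U (\<lambda>q. s * \<rho> q + t * \<eta> q) q * ennreal (s * \<rho> q + t * \<eta> q)
      = ((ennreal (s\<^sup>2) * (?V q * ennreal (\<rho> q)) + ennreal (s * t) * (?V q * ennreal (\<eta> q)))
        + ennreal (s * t) * (?W q * ennreal (\<rho> q))) + ennreal (t\<^sup>2) * (?W q * ennreal (\<eta> q))"
      using nonneg[OF q] st
      by (simp add: mean_potential_mix[OF assms(1,2) nonneg st q] ennreal_mult power2_eq_square)
         (simp add: algebra_simps)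
  qed
  also have "\<dots> = ((ennreal (s\<^sup>2) * x + ennreal (s * t) * ennreal b) + ennreal (s * t) * (\<integral>\<^sup>+q. ?W q * ennreal (\<rho> q) \<partial>L))
      + ennreal (t\<^sup>2) * (\<integral>\<^sup>+q. ?W q * ennreal (\<eta> q) \<partial>L)"
    unfolding x_def b(1)[symmetric]
    by (subst nn_integral_add, measurable, subst nn_integral_add, measurable, subst nn_integral_add, measurable)
       (simp add: nn_integral_cmult)
  also have "(\<integral>\<^sup>+q. ?W q * ennreal (\<rho> q) \<partial>L) = ennreal b"
    using mean_potential_symmetric[OF assms(1,2)] b(1) by simp
  also have "((ennreal (s\<^sup>2) * x + ennreal (s * t) * ennreal b) + ennreal (s * t) * ennreal b)
      + ennreal (t\<^sup>2) * (\<integral>\<^sup>+q. ?W q * ennreal (\<eta> q) \<partial>L)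
      \<le> ((ennreal (s\<^sup>2) * x + ennreal (s * t) * ennreal b) + ennreal (s * t) * ennreal b)
      + ennreal (t\<^sup>2) * ennreal (2 * J)"
    by (intro add_left_mono mult_left_mono J(1)) simp
  also have "\<dots> = ennreal (2 * (s\<^sup>2 * i + s * t * b + t\<^sup>2 * J))"
    unfolding x using I(2) b(2) J(2) st
    by (simp add: algebra_simps flip: ennreal_mult ennreal_plus)
  finally have "interaction_energy \<Lambda> U (\<lambda>q. s * \<rho> q + t * \<eta> q)
      \<le> ennreal (1/2) * ennreal (2 * (s\<^sup>2 * i + s * t * b + t\<^sup>2 * J))"
    by (simp add: mult_left_mono)
  also have "\<dots> = ennreal (s\<^sup>2 * i + s * t * b + t\<^sup>2 * J)"
    using ennreal_mult'[of "1/2" "2 * (s\<^sup>2 * i + s * t * b + t\<^sup>2 * J)"] by (simp only: mult.assoc[symmetric]) simp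
  finally show ?thesis .
qed


text \<open>By \<open>x \<le> 1 + x * x\<close>, on a set of finite volume. It makes the potential
  of the constant density finite at every point of \<open>\<Lambda>\<close>, which the variation
  below relies on.\<close>

lemma U_integrable:
  assumes "q \<in> \<Lambda>"
  shows "(\<integral>\<^sup>+q'\<in>\<Lambda>. U q q' \<partial>lborel) < \<infinity>"
proof -
  have le: "x \<le> 1 + x * x" for x :: ennreal
  proof (cases "x \<le> 1")
    case False
    then have "x * 1 \<le> x * x" by (intro mult_left_mono) auto
    then show ?thesis by (simp add: add_increasing)
  qed (simp add: add_increasing2)
  have m: "(\<lambda>q'. U q q' * U q q') \<in> borel_measurable L"
    by (intro borel_measurable_times_ennreal measurable_U_right assms)
  have "(\<integral>\<^sup>+q'. U q q' \<partial>L) \<le> (\<integral>\<^sup>+q'. 1 + U q q' * U q q' \<partial>L)"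
    by (intro nn_integral_mono le)
  also have "\<dots> = emeasure L \<Lambda> + (\<integral>\<^sup>+q'. U q q' * U q q' \<partial>L)"
    using m by (subst nn_integral_add) simp_all
  also have "\<dots> < \<infinity>"
    using U_square_integrable[OF assms(1)] finite_measure.emeasure_finite[OF finite_measure_L, of "\<Lambda>"] unfolding power2_eq_square nn_integral_L
    by (simp add: less_top[symmetric])
  finally show ?thesis by (simp only: nn_integral_L)
qed

text \<open>If the inequality failed on a set of positive measure, it would fail with a definite gap
  on a part \<open>A\<close> of it, and moving a little mass to the uniform density on
  \<open>A\<close> would lower the functional. Only this direction is obtained by variation, since
  adding mass always keeps the density nonnegative. The constant \<open>c\<close> is the mean of
  \<open>ln (\<rho> q) + v q / \<theta>\<close> under \<open>\<rho>\<close>.\<close>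

lemma euler_lagrange_lower:
  assumes \<rho>: "entropic \<rho>" and energy: "interaction_energy \<Lambda> U \<rho> < ennreal \<epsilon>"
    and min: "\<And>\<sigma>. entropic \<sigma> \<Longrightarrow> interaction_energy \<Lambda> U \<sigma> < ennreal \<epsilon> \<Longrightarrow> reduced_H \<epsilon> \<rho> \<le> reduced_H \<epsilon> \<sigma>"
  defines "\<theta> \<equiv> vartheta \<Lambda> U \<epsilon> \<rho>" and "v \<equiv> \<lambda>q. enn2real (mean_potential \<Lambda> U \<rho> q)"
  defines "c \<equiv> ent \<rho> + 2 * enn2real (interaction_energy \<Lambda> U \<rho>) / \<theta>"
  shows "AE q in L. mean_potential \<Lambda> U \<rho> q \<noteq> \<infinity> \<longrightarrow> exp (c - v q / \<theta>) \<le> \<rho> q"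
proof (rule ccontr)
  assume not_AE: "\<not> ?thesis"
  let ?V = "mean_potential \<Lambda> U \<rho>"
  define G where "G = mean_potential \<Lambda> U (\<lambda>_. 1)"
  have G: "G q = (\<integral>\<^sup>+q'. U q q' \<partial>L)" for q by (simp add: G_def mean_potential_L)
  have G_meas [measurable]: "G \<in> borel_measurable L"
    unfolding G_def by (rule measurable_mean_potential) simp
  have \<rho>_int: "integrable L \<rho>" and \<rho>_nonneg: "\<And>q. q \<in> \<Lambda> \<Longrightarrow> 0 \<le> \<rho> q" and \<rho>_one: "(\<integral>q. \<rho> q \<partial>L) = 1"
    and \<rho>_ln: "integrable L (\<lambda>q. \<rho> q * ln (\<rho> q))"
    using \<rho> by (auto simp: entropic_def)
  have \<rho>_meas [measurable]: "\<rho> \<in> borel_measurable L" using \<rho>_int by auto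
  have v_meas [measurable]: "v \<in> borel_measurable L" unfolding v_def by measurable
  have \<theta>: "\<theta> > 0" unfolding \<theta>_def by (rule vartheta_pos[OF energy])
  define i where "i = enn2real (interaction_energy \<Lambda> U \<rho>)"
  have i: "interaction_energy \<Lambda> U \<rho> = ennreal i" "0 \<le> i"
    using ennreal_enn2real[OF less_trans[OF energy ennreal_less_top]] by (simp_all add: i_def)
  have \<theta>_eq: "\<epsilon> - i = 3/2 * \<theta>" by (simp add: \<theta>_def vartheta_def i_def)
  \<comment> \<open>The bound on \<open>?V\<close> makes the mutual energy with
    \<open>\<rho>\<close> finite, the bound on \<open>G\<close> the self-energy of the uniform
    density, and \<open>1 / real (Suc n)\<close> is the definite gap.\<close>
  define B where "B n = {q \<in> space L. ?V q \<le> of_nat n \<and> G q \<le> of_nat n \<and> \<rho> q \<le> exp (c - 1 / real (Suc n) - v q / \<theta>)}" for n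
  have V_meas [measurable]: "?V \<in> borel_measurable L"
    by (rule measurable_mean_potential[OF \<rho>_meas])
  have B_sets [measurable]: "B n \<in> sets L" for n
    unfolding B_def
    by (intro sets.sets_Collect_conj borel_measurable_le[OF V_meas measurable_const]
          borel_measurable_le[OF G_meas measurable_const] borel_measurable_le[OF \<rho>_meas]) measurable
  have cover: "q \<in> (\<Union>n. B n)" if q: "q \<in> \<Lambda>" "?V q \<noteq> \<infinity>" "\<rho> q < exp (c - v q / \<theta>)" for q
  proof -
    have "G q < \<infinity>" using U_integrable[OF q(1)] by (simp add: nn_integral_L G)
    then obtain n1 where n1: "G q \<le> of_nat n1"
      using ennreal_Ex_less_of_nat[of "G q"] by (auto intro: less_imp_le)
    obtain n2 where n2: "?V q \<le> of_nat n2"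
      using ennreal_Ex_less_of_nat[of "?V q"] q(2) by (auto simp: less_top intro: less_imp_le)
    have "(\<lambda>n. exp (c - 1 / real (Suc n) - v q / \<theta>)) \<longlonglongrightarrow> exp (c - 0 - v q / \<theta>)"
      by (intro tendsto_intros LIMSEQ_Suc[OF lim_inverse_n'])
    then have "eventually (\<lambda>n. \<rho> q < exp (c - 1 / real (Suc n) - v q / \<theta>)) sequentially"
      using q(3) by (intro order_tendstoD(1)) auto
    then have "eventually (\<lambda>n. \<rho> q < exp (c - 1 / real (Suc n) - v q / \<theta>) \<and> n1 \<le> n \<and> n2 \<le> n) sequentially"
      using eventually_ge_at_top[of n1] eventually_ge_at_top[of n2] by eventually_elim auto
    then obtain n where n: "\<rho> q < exp (c - 1 / real (Suc n) - v q / \<theta>)" "n1 \<le> n" "n2 \<le> n"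
      by (auto simp: eventually_sequentially)
    have "of_nat n1 \<le> (of_nat n :: ennreal)" "of_nat n2 \<le> (of_nat n :: ennreal)"
      using n by (auto intro: of_nat_mono)
    then have "q \<in> B n" using n1 n2 n(1) q(1) by (auto simp: B_def intro: order_trans)
    then show ?thesis by blast
  qed
  have "\<exists>n. emeasure L (B n) \<noteq> 0"
  proof (rule ccontr)
    assume "\<nexists>n. emeasure L (B n) \<noteq> 0"
    then have "(\<Union>n. B n) \<in> null_sets L" by (intro null_sets_UN) (auto simp: null_sets_def)
    then have "AE q in L. q \<notin> (\<Union>n. B n)" by (rule AE_not_in)
    then have "AE q in L. ?V q \<noteq> \<infinity> \<longrightarrow> exp (c - v q / \<theta>) \<le> \<rho> q"
      using AE_space
    proof eventually_elim
      case (elim q)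
      then show ?case using cover[of q] by force
    qed
    then show False using not_AE by simp
  qed
  then obtain n where n: "emeasure L (B n) \<noteq> 0" by blast
  define A where "A = B n"
  define a where "a = measure L A"
  define \<delta> where "\<delta> = 1 / real (Suc n)"
  have [measurable]: "A \<in> sets L" unfolding A_def by measurable
  have a: "a > 0" using n by (simp add: a_def A_def emeasure_eq_measure zero_less_measure_iff)
  have \<delta>: "\<delta> > 0" by (simp add: \<delta>_def)
  have A: "?V q \<le> ennreal (real n)" "G q \<le> ennreal (real n)" "\<rho> q \<le> exp (c - \<delta> - v q / \<theta>)" "q \<in> \<Lambda>" if "q \<in> A" for q
    using that by (auto simp: A_def B_def \<delta>_def ennreal_of_nat_eq_real_of_nat)
  have v_A: "0 \<le> v q" "v q \<le> real n" "?V q = ennreal (v q)" if "q \<in> A" for q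
    using enn2real_leI[OF _ A(1)[OF that]] le_less_trans[OF A(1)[OF that] ennreal_less_top]
    by (auto simp: v_def)
  define \<eta> where "\<eta> q = indicator A q / a" for q
  have \<eta>_meas [measurable]: "\<eta> \<in> borel_measurable L" unfolding \<eta>_def by measurable
  have \<eta>_nonneg: "0 \<le> \<eta> q" for q using a by (simp add: \<eta>_def)
  have \<eta>_int: "integrable L \<eta>" and \<eta>_one: "(\<integral>q. \<eta> q \<partial>L) = 1"
  proof -
    have ind: "integrable L (indicator A :: _ \<Rightarrow> real)"
      by (rule integrable_real_indicator) (auto simp: less_top[symmetric])
    have "A \<inter> \<Lambda> = A" using A(4) by blast
    then show "integrable L \<eta>" "(\<integral>q. \<eta> q \<partial>L) = 1"
      unfolding \<eta>_def[abs_def] using ind a by (auto simp: a_def)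
  qed
  have \<eta>v_int: "integrable L (\<lambda>q. \<eta> q * v q)"
  proof (rule Bochner_Integration.integrable_bound)
    show "integrable L (\<lambda>q. \<eta> q * real n)" using \<eta>_int by simp
    show "AE q in L. norm (\<eta> q * v q) \<le> norm (\<eta> q * real n)"
      using v_A a by (intro AE_I2) (auto simp: \<eta>_def indicator_def divide_right_mono)
  qed measurable
  define b where "b = (\<integral>q. \<eta> q * v q \<partial>L)"
  have \<eta>v_nonneg: "0 \<le> \<eta> q * v q" for q using \<eta>_nonneg[of q] by (simp add: v_def)
  have b: "(\<integral>\<^sup>+q. ?V q * ennreal (\<eta> q) \<partial>L) = ennreal b" "0 \<le> b"
  proof -
    have "?V q * ennreal (\<eta> q) = ennreal (\<eta> q * v q)" if "q \<in> space L" for q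
    proof (cases "q \<in> A")
      case True
      then show ?thesis using v_A[OF True] \<eta>_nonneg by (simp add: ennreal_mult mult.commute)
    qed (simp add: \<eta>_def)
    then have "(\<integral>\<^sup>+q. ?V q * ennreal (\<eta> q) \<partial>L) = (\<integral>\<^sup>+q. ennreal (\<eta> q * v q) \<partial>L)"
      by (intro nn_integral_cong)
    then show "(\<integral>\<^sup>+q. ?V q * ennreal (\<eta> q) \<partial>L) = ennreal b"
      unfolding b_def by (simp add: nn_integral_eq_integral[OF \<eta>v_int] \<eta>v_nonneg)
    show "0 \<le> b" unfolding b_def by (intro integral_nonneg_AE AE_I2 \<eta>v_nonneg)
  qed
  \<comment> \<open>On \<open>A\<close> the potential of \<open>\<eta>\<close> is at most
    \<open>G q / a\<close>, hence at most \<open>n / a\<close>.\<close>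
  define J where "J = real n / (2 * a)"
  have J0: "0 \<le> J" using a by (simp add: J_def)
  have J: "(\<integral>\<^sup>+q. mean_potential \<Lambda> U \<eta> q * ennreal (\<eta> q) \<partial>L) \<le> ennreal (2 * J)"
  proof -
    have "mean_potential \<Lambda> U \<eta> q * ennreal (\<eta> q) \<le> ennreal (2 * J) * ennreal (\<eta> q)" if "q \<in> space L" for q
    proof (cases "q \<in> A")
      case True
      have "mean_potential \<Lambda> U \<eta> q \<le> (\<integral>\<^sup>+q'. U q q' * ennreal (1 / a) \<partial>L)"
        unfolding mean_potential_L using a
        by (intro nn_integral_mono mult_left_mono ennreal_leI) (auto simp: \<eta>_def indicator_def)
      also have "\<dots> = G q * ennreal (1 / a)"
        unfolding G using that by (intro nn_integral_multc measurable_U_right) simp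
      also have "\<dots> \<le> ennreal (real n) * ennreal (1 / a)"
        by (intro mult_right_mono A(2) True) simp
      also have "\<dots> = ennreal (2 * J)"
        using a by (subst ennreal_mult[symmetric]) (auto simp: J_def)
      finally show ?thesis by (intro mult_right_mono) auto
    qed (simp add: \<eta>_def)
    then have "(\<integral>\<^sup>+q. mean_potential \<Lambda> U \<eta> q * ennreal (\<eta> q) \<partial>L) \<le> (\<integral>\<^sup>+q. ennreal (2 * J) * ennreal (\<eta> q) \<partial>L)"
      by (intro nn_integral_mono)
    also have "\<dots> = ennreal (2 * J) * ennreal 1"
      using \<eta>_nonneg by (subst nn_integral_cmult) (auto simp: nn_integral_eq_integral[OF \<eta>_int] \<eta>_one)
    finally show ?thesis by simp
  qed
  \<comment> \<open>A lower bound on \<open>A\<close> for the comparison exponential;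
    \<open>C\<close> then bounds the slope with which \<open>ln (\<sigma> q)\<close> can rise above
    its exponent as \<open>t\<close> grows.\<close>
  define E0 where "E0 = exp (c - \<delta> - real n / \<theta>)"
  define C where "C = 1 / (a * E0)"
  define d where "d t = (1 - t)\<^sup>2 * i + (1 - t) * t * b + t\<^sup>2 * J" for t
  \<comment> \<open>An upper bound for the functional at the mixture, up to an additive constant and
    exact at \<open>t = 0\<close>. Its derivative there turns out to be
    \<open>- \<delta>\<close>.\<close>
  define h where "h t = (1 - t) * ent \<rho> + t * (c - \<delta> + t * C - b / \<theta>) - 3/2 * ln (\<epsilon> - d t)" for t
  have key: "h 0 \<le> h t" if t: "0 < t" "t < 1" "d t < \<epsilon>" for t
  proof -
    define \<sigma> where "\<sigma> q = (1 - t) * \<rho> q + t * \<eta> q" for q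
    have [measurable]: "\<sigma> \<in> borel_measurable L" unfolding \<sigma>_def by measurable
    have \<sigma>_int: "integrable L \<sigma>" unfolding \<sigma>_def using \<rho>_int \<eta>_int by auto
    have \<sigma>_one: "(\<integral>q. \<sigma> q \<partial>L) = 1" unfolding \<sigma>_def using \<rho>_int \<eta>_int \<rho>_one \<eta>_one by simp
    have \<sigma>_nonneg: "0 \<le> \<sigma> q" if "q \<in> \<Lambda>" for q
      using \<rho>_nonneg[OF that] \<eta>_nonneg[of q] t by (simp add: \<sigma>_def)
    \<comment> \<open>Gibbs' inequality bounds the share of \<open>\<rho>\<close> in
      \<open>\<sigma> * ln \<sigma>\<close>, and the pointwise estimate on \<open>A\<close> the
      share of \<open>\<eta>\<close>. This avoids differentiating \<open>x * ln x\<close>, whose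
      slope is infinite at 0.\<close>
    define R where "R q = (1 - t) * (\<rho> q * ln (\<rho> q) + \<sigma> q - \<rho> q) + t * ((c - \<delta> + t * C) * \<eta> q - 1 / \<theta> * (\<eta> q * v q))" for q
    have R_int: "integrable L R"
      unfolding R_def using \<rho>_ln \<sigma>_int \<rho>_int \<eta>_int \<eta>v_int
      by (intro Bochner_Integration.integrable_add Bochner_Integration.integrable_diff integrable_mult_right)
    have R_integral: "(\<integral>q. R q \<partial>L) = (1 - t) * ent \<rho> + t * (c - \<delta> + t * C - b / \<theta>)"
      unfolding R_def using \<rho>_ln \<sigma>_int \<rho>_int \<eta>_int \<eta>v_int
      by (simp add: \<sigma>_one \<rho>_one \<eta>_one ent_def b_def)
    have \<sigma>_le: "\<sigma> q * ln (\<sigma> q) \<le> R q" if q: "q \<in> \<Lambda>" for q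
    proof (cases "\<sigma> q = 0")
      case True
      then have "(1 - t) * \<rho> q = 0" "t * \<eta> q = 0"
        using \<rho>_nonneg[OF q] \<eta>_nonneg[of q] t by (auto simp: \<sigma>_def add_nonneg_eq_0_iff)
      then show ?thesis using True t by (simp add: R_def)
    next
      case False
      then have pos: "\<sigma> q > 0" using \<sigma>_nonneg[OF q] by simp
      have 1: "\<rho> q * ln (\<sigma> q) \<le> \<rho> q * ln (\<rho> q) + \<sigma> q - \<rho> q"
        using gibbs_ineq[of "\<rho> q" "\<sigma> q"] \<rho>_nonneg[OF q] pos by simp
      have 2: "\<eta> q * ln (\<sigma> q) \<le> \<eta> q * (c - \<delta> - v q / \<theta> + t * C)"
      proof (cases "q \<in> A")
        case qA: True
        let ?E = "exp (c - \<delta> - v q / \<theta>)"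
        have E0: "E0 \<le> ?E" "0 < E0"
          unfolding E0_def using v_A(2)[OF qA] \<theta> by (auto simp: divide_right_mono)
        have "\<sigma> q \<le> 1 * \<rho> q + t * (1 / a)"
          unfolding \<sigma>_def using t \<rho>_nonneg[OF q] a qA by (intro add_mono mult_right_mono mult_left_mono) (auto simp: \<eta>_def)
        also have "\<dots> \<le> ?E + t / a" using A(3)[OF qA] by simp
        also have "\<dots> = ?E * (1 + t / (a * ?E))" by (simp add: field_simps)
        finally have "ln (\<sigma> q) \<le> ln (?E * (1 + t / (a * ?E)))"
          using pos by (intro ln_mono) auto
        also have "\<dots> = ln ?E + ln (1 + t / (a * ?E))"
          using t a by (intro ln_mult_pos add_pos_pos) auto
        also have "\<dots> \<le> (c - \<delta> - v q / \<theta>) + t / (a * ?E)"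
          using t a by (simp add: ln_add_one_self_le_self)
        also have "t / (a * ?E) \<le> t / (a * E0)"
          using t a E0 by (intro divide_left_mono mult_left_mono) auto
        finally have "ln (\<sigma> q) \<le> c - \<delta> - v q / \<theta> + t * C" by (simp add: C_def)
        then show ?thesis using \<eta>_nonneg by (intro mult_left_mono)
      qed (simp add: \<eta>_def)
      have "\<sigma> q * ln (\<sigma> q) = (1 - t) * (\<rho> q * ln (\<sigma> q)) + t * (\<eta> q * ln (\<sigma> q))"
        by (simp add: \<sigma>_def algebra_simps)
      also have "\<dots> \<le> (1 - t) * (\<rho> q * ln (\<rho> q) + \<sigma> q - \<rho> q) + t * (\<eta> q * (c - \<delta> - v q / \<theta> + t * C))"
        using t by (intro add_mono mult_left_mono[OF 1] mult_left_mono[OF 2]) auto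
      also have "\<eta> q * (c - \<delta> - v q / \<theta> + t * C) = (c - \<delta> + t * C) * \<eta> q - 1 / \<theta> * (\<eta> q * v q)"
        by (simp add: algebra_simps)
      finally show ?thesis by (simp add: R_def)
    qed
    have \<sigma>_ln: "integrable L (\<lambda>q. \<sigma> q * ln (\<sigma> q))"
    proof (rule Bochner_Integration.integrable_bound)
      show "integrable L (\<lambda>q. \<bar>R q\<bar> + 1 + \<sigma> q)" using R_int \<sigma>_int by simp
      show "AE q in L. norm (\<sigma> q * ln (\<sigma> q)) \<le> norm (\<bar>R q\<bar> + 1 + \<sigma> q)"
      proof (rule AE_I2)
        fix q assume "q \<in> space L"
        then show "norm (\<sigma> q * ln (\<sigma> q)) \<le> norm (\<bar>R q\<bar> + 1 + \<sigma> q)"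
          using xlnx_ge[OF \<sigma>_nonneg, of q] \<sigma>_nonneg[of q] \<sigma>_le[of q] by auto
      qed
    qed measurable
    have \<sigma>: "entropic \<sigma>"
      using \<sigma>_int \<sigma>_nonneg \<sigma>_one \<sigma>_ln by (simp add: entropic_def)
    have ent_\<sigma>: "ent \<sigma> \<le> (1 - t) * ent \<rho> + t * (c - \<delta> + t * C - b / \<theta>)"
      unfolding ent_def[of \<sigma>] R_integral[symmetric] using \<sigma>_le by (intro integral_mono \<sigma>_ln R_int) auto
    have I\<sigma>: "interaction_energy \<Lambda> U \<sigma> \<le> ennreal (d t)"
      unfolding \<sigma>_def d_def using t
      by (intro interaction_energy_mix \<rho>_nonneg \<eta>_nonneg i b J J0) auto
    have d_nonneg: "0 \<le> d t"
      unfolding d_def using t i(2) b(2) J0 by (intro add_nonneg_nonneg mult_nonneg_nonneg) auto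
    have energy_\<sigma>: "interaction_energy \<Lambda> U \<sigma> < ennreal \<epsilon>"
      using I\<sigma> t(3) d_nonneg by (auto intro!: le_less_trans[OF I\<sigma>] ennreal_lessI)
    have "ln (\<epsilon> - d t) \<le> ln (\<epsilon> - enn2real (interaction_energy \<Lambda> U \<sigma>))"
      using enn2real_leI[OF d_nonneg I\<sigma>] t(3) by (intro ln_mono) auto
    then have "h 0 \<le> h t"
      using min[OF \<sigma> energy_\<sigma>] ent_\<sigma> unfolding reduced_H_eq[OF energy_\<sigma>] reduced_H_eq[OF energy]
      by (simp add: h_def d_def i_def[symmetric])
    then show ?thesis .
  qed
  have d0: "d 0 < \<epsilon>" using \<theta>_eq \<theta> by (simp add: d_def)
  have "(h has_real_derivative (- ent \<rho> + (c - \<delta> - b / \<theta>) + 3/2 * (b - 2 * i) / (\<epsilon> - i))) (at 0)"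
    unfolding h_def d_def using d0 \<theta>
    by (auto intro!: derivative_eq_intros simp: d_def field_simps)
  \<comment> \<open>By \<open>\<theta>_eq\<close> the energy term contributes
    \<open>(b - 2 * i) / \<theta>\<close>; then \<open>b\<close> cancels, and the choice of
    \<open>c\<close> removes all but \<open>- \<delta>\<close>.\<close>
  moreover have "3/2 * (b - 2 * i) / (\<epsilon> - i) = b / \<theta> - 2 * i / \<theta>"
    unfolding \<theta>_eq using \<theta> by (simp add: field_simps)
  ultimately have "(h has_real_derivative - \<delta>) (at 0)"
    by (simp add: c_def i_def[symmetric])
  then obtain e where e: "e > 0" "\<And>t. 0 < t \<Longrightarrow> t < e \<Longrightarrow> h t < h 0"
    using DERIV_neg_dec_right[of h "- \<delta>" 0] \<delta> by auto
  have "(d \<longlongrightarrow> d 0) (at_right 0)"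
    unfolding d_def by (intro tendsto_intros)
  then have "eventually (\<lambda>t. d t < \<epsilon>) (at_right 0)"
    using d0 by (rule order_tendstoD)
  moreover have "eventually (\<lambda>t::real. 0 < t \<and> t < min 1 e) (at_right 0)"
    using e(1) by (intro eventually_at_rightI[of _ "min 1 e"]) auto
  ultimately have "eventually (\<lambda>t. d t < \<epsilon> \<and> 0 < t \<and> t < min 1 e) (at_right 0)"
    by eventually_elim auto
  then obtain t where "d t < \<epsilon>" "0 < t" "t < min 1 e"
    using eventually_happens'[OF trivial_limit_at_right_real] by blast
  then show False using key[of t] e(2)[of t] by simp
qed

text \<open>The lower bound integrates to an equality: \<open>c\<close> is the mean of
  \<open>ln (\<rho> q) + v q / \<theta>\<close>, so the nonnegative \<open>D\<close> has integral 0
  and vanishes almost everywhere. The lower bound also shows that \<open>\<rho>\<close> is positive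
  wherever the potential is finite, while finite energy forces \<open>\<rho> = 0\<close> where it is
  infinite. Normalisation gives \<open>exp c = 1 / Z\<close>.\<close>

theorem fixed_point_equation:
  assumes \<rho>: "entropic \<rho>" and energy: "interaction_energy \<Lambda> U \<rho> < ennreal \<epsilon>"
    and min: "\<And>\<sigma>. entropic \<sigma> \<Longrightarrow> interaction_energy \<Lambda> U \<sigma> < ennreal \<epsilon> \<Longrightarrow> reduced_H \<epsilon> \<rho> \<le> reduced_H \<epsilon> \<sigma>"
  defines "\<theta> \<equiv> vartheta \<Lambda> U \<epsilon> \<rho>"
  defines "Z \<equiv> \<integral>r. boltzmann_factor \<theta> (mean_potential \<Lambda> U \<rho> r) \<partial>L"
  shows "0 < Z" and "AE q in L. \<rho> q = boltzmann_factor \<theta> (mean_potential \<Lambda> U \<rho> q) / Z"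
proof -
  let ?V = "mean_potential \<Lambda> U \<rho>"
  define v where "v q = enn2real (?V q)" for q
  have \<rho>_int: "integrable L \<rho>" and \<rho>_nonneg: "\<And>q. q \<in> \<Lambda> \<Longrightarrow> 0 \<le> \<rho> q" and \<rho>_one: "(\<integral>q. \<rho> q \<partial>L) = 1"
    and \<rho>_ln: "integrable L (\<lambda>q. \<rho> q * ln (\<rho> q))"
    using \<rho> by (auto simp: entropic_def)
  have \<rho>_meas [measurable]: "\<rho> \<in> borel_measurable L" using \<rho>_int by auto
  have v_meas [measurable]: "v \<in> borel_measurable L" unfolding v_def by measurable
  have \<theta>: "\<theta> > 0" unfolding \<theta>_def by (rule vartheta_pos[OF energy])
  define i where "i = enn2real (interaction_energy \<Lambda> U \<rho>)"
  have i: "interaction_energy \<Lambda> U \<rho> = ennreal i" "0 \<le> i"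
    using ennreal_enn2real[OF less_trans[OF energy ennreal_less_top]] by (simp_all add: i_def)
  define c where "c = ent \<rho> + 2 * i / \<theta>"
  have lower: "AE q in L. ?V q \<noteq> \<infinity> \<longrightarrow> exp (c - v q / \<theta>) \<le> \<rho> q"
    using euler_lagrange_lower[OF \<rho> energy min] by (simp add: \<theta>_def v_def c_def i_def)
  have Vi: "ennreal (1/2) * (\<integral>\<^sup>+q. ?V q * ennreal (\<rho> q) \<partial>L) = ennreal i"
    using interaction_energy_mean_potential[OF \<rho>_meas] i by simp
  then have "(\<integral>\<^sup>+q. ?V q * ennreal (\<rho> q) \<partial>L) \<noteq> \<infinity>"
    by (auto simp: ennreal_mult_eq_top_iff)
  then have "AE q in L. ?V q * ennreal (\<rho> q) \<noteq> \<infinity>"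
    by (intro nn_integral_PInf_AE) measurable
  then have V_fin: "AE q in L. ?V q = \<infinity> \<longrightarrow> \<rho> q = 0"
    using AE_space
  proof eventually_elim
    case (elim q)
    then show ?case using \<rho>_nonneg[of q] by (auto simp: ennreal_mult_eq_top_iff less_le)
  qed
  have \<rho>v_nonneg: "AE q in L. 0 \<le> \<rho> q * v q"
    using \<rho>_nonneg by (intro AE_I2) (simp add: v_def)
  have "(\<integral>\<^sup>+q. ?V q * ennreal (\<rho> q) \<partial>L) = (\<integral>\<^sup>+q. ennreal (\<rho> q * v q) \<partial>L)"
  proof (intro nn_integral_cong_AE, use V_fin AE_space in eventually_elim)
    case (elim q)
    show ?case
    proof (cases "?V q = \<infinity>")
      case False
      then have "?V q = ennreal (v q)" by (simp add: v_def less_top)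
      moreover have "0 \<le> v q" by (simp add: v_def)
      ultimately show ?thesis using elim \<rho>_nonneg[of q] by (simp add: ennreal_mult mult.commute)
    qed (use elim in simp)
  qed
  then have Vi': "ennreal (1/2) * (\<integral>\<^sup>+q. ennreal (\<rho> q * v q) \<partial>L) = ennreal i" using Vi by simp
  have \<rho>v_int: "integrable L (\<lambda>q. \<rho> q * v q)"
    using Vi' by (intro integrableI_nonneg \<rho>v_nonneg) (auto simp: ennreal_mult_eq_top_iff less_top[symmetric])
  have \<rho>v_integral: "(\<integral>q. \<rho> q * v q \<partial>L) = 2 * i"
  proof -
    have nn: "0 \<le> (\<integral>q. \<rho> q * v q \<partial>L)" by (rule integral_nonneg_AE[OF \<rho>v_nonneg])
    have "ennreal (1/2 * (\<integral>q. \<rho> q * v q \<partial>L)) = ennreal i"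
      using Vi' nn unfolding nn_integral_eq_integral[OF \<rho>v_int \<rho>v_nonneg] by (subst ennreal_mult) auto
    then show ?thesis using nn i(2) by (subst (asm) ennreal_inj) auto
  qed
  define D where "D q = \<rho> q * ln (\<rho> q) + 1 / \<theta> * (\<rho> q * v q) - c * \<rho> q" for q
  have D_int: "integrable L D" unfolding D_def using \<rho>_ln \<rho>v_int \<rho>_int by simp
  have D_integral: "(\<integral>q. D q \<partial>L) = 0"
    unfolding D_def using \<rho>_ln \<rho>v_int \<rho>_int by (simp add: \<rho>v_integral \<rho>_one ent_def[symmetric] c_def)
  have D_eq: "D q = \<rho> q * (ln (\<rho> q) - (c - v q / \<theta>))" for q by (simp add: D_def algebra_simps)
  have "AE q in L. 0 \<le> D q"
    using lower V_fin AE_space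
  proof eventually_elim
    case (elim q)
    show ?case
    proof (cases "\<rho> q = 0")
      case False
      then have "\<rho> q > 0" "exp (c - v q / \<theta>) \<le> \<rho> q" using elim \<rho>_nonneg[of q] by (auto simp: less_le)
      then have "c - v q / \<theta> \<le> ln (\<rho> q)" by (subst ln_ge_iff) auto
      then show ?thesis unfolding D_eq using \<open>\<rho> q > 0\<close> by simp
    qed (simp add: D_def)
  qed
  then have "AE q in L. D q = 0"
    using integral_nonneg_eq_0_iff_AE[OF D_int] D_integral by simp
  then have eq: "AE q in L. \<rho> q = exp c * boltzmann_factor \<theta> (?V q)"
    using lower V_fin AE_space
  proof eventually_elim
    case (elim q)
    show ?case
    proof (cases "?V q = \<infinity>")
      case True
      then show ?thesis using elim by (simp add: boltzmann_factor_def)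
    next
      case False
      then have "\<rho> q > 0" using elim by (auto intro: less_le_trans[OF exp_gt_zero])
      then have "ln (\<rho> q) = c - v q / \<theta>" using elim(1) by (simp add: D_eq)
      then have "\<rho> q = exp (c - v q / \<theta>)" using \<open>\<rho> q > 0\<close> by (metis exp_ln)
      then show ?thesis using False by (simp add: boltzmann_factor_def v_def exp_diff exp_minus field_simps)
    qed
  qed
  have [measurable]: "(\<lambda>q. boltzmann_factor \<theta> (?V q)) \<in> borel_measurable L"
    unfolding boltzmann_factor_def by measurable
  have "(\<integral>q. \<rho> q \<partial>L) = (\<integral>q. exp c * boltzmann_factor \<theta> (?V q) \<partial>L)"
    by (intro integral_cong_AE eq) auto
  then have Z: "exp c * Z = 1" using \<rho>_one by (simp add: Z_def)
  then show "0 < Z" by (metis exp_gt_zero zero_less_mult_pos zero_less_one)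
  have "exp c = 1 / Z" using Z \<open>0 < Z\<close> by (simp add: field_simps)
  then show "AE q in L. \<rho> q = boltzmann_factor \<theta> (?V q) / Z"
    using eq by simp
qed

end

section \<open>The derivative of the phase space volume\<close>

text \<open>The exponent exceeds 1, so the difference quotient at the kink is at most
  \<open>\<bar>h\<bar> powr (a - 1)\<close> in absolute value and tends to 0; elsewhere the function
  is locally a power or zero.\<close>

lemma has_derivative_positive_part_powr:
  fixes a s :: real
  assumes "a > 1"
  shows "((\<lambda>s. if 0 < s then s powr a else 0) has_real_derivative (if 0 < s then a * s powr (a - 1) else 0)) (at s)"
proof -
  consider "s > 0" | "s < 0" | "s = 0" by linarith
  then show ?thesis
  proof cases
    case 1
    have "((\<lambda>s. s powr a) has_real_derivative a * s powr (a - 1)) (at s)"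
      using 1 by (rule has_real_derivative_powr)
    moreover have "eventually (\<lambda>x. x powr a = (if 0 < x then x powr a else 0)) (nhds s)"
      using eventually_nhds_in_open[of "{0<..}" s] 1 by (auto elim: eventually_mono)
    ultimately show ?thesis using 1 by (simp add: DERIV_cong_ev[OF refl _ refl])
  next
    case 2
    have "((\<lambda>s. 0) has_real_derivative 0) (at s)" by simp
    moreover have "eventually (\<lambda>x. 0 = (if 0 < x then x powr a else 0)) (nhds s)"
      using eventually_nhds_in_open[of "{..<0}" s] 2 by (auto elim!: eventually_mono)
    ultimately have "((\<lambda>s. if 0 < s then s powr a else 0) has_real_derivative 0) (at s)"
      by (subst (asm) DERIV_cong_ev[OF refl _ refl]) auto
    then show ?thesis using 2 by simp
  next
    case 3
    have "((\<lambda>h. \<bar>h\<bar> powr (a - 1)) \<longlongrightarrow> 0) (at (0::real))"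
      using assms by (intro tendsto_eq_intros refl | simp)+
    then have "((\<lambda>h. (if 0 < h then h powr a else 0) / h) \<longlongrightarrow> 0) (at (0::real))"
    proof (rule Lim_null_comparison[rotated])
      show "eventually (\<lambda>h. norm ((if 0 < h then h powr a else 0) / h) \<le> \<bar>h\<bar> powr (a - 1)) (at (0::real))"
      proof (intro always_eventually allI)
        fix h :: real
        show "norm ((if 0 < h then h powr a else 0) / h) \<le> \<bar>h\<bar> powr (a - 1)"
        proof (cases "0 < h")
          case True
          then show ?thesis by (simp add: powr_diff)
        qed simp
      qed
    qed
    then show ?thesis unfolding DERIV_def 3 add_0 by simp
  qed
qed

lemma positive_part_powr_lipschitz:
  fixes a s t S :: real
  assumes "a > 1" "s \<le> S" "t \<le> S" "S > 0"
  shows "\<bar>(if 0 < s then s powr a else 0) - (if 0 < t then t powr a else 0)\<bar> \<le> a * S powr (a - 1) * \<bar>s - t\<bar>"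
proof -
  have "norm ((if 0 < s then s powr a else 0) - (if 0 < t then t powr a else 0)) \<le> a * S powr (a - 1) * norm (s - t)"
  proof (rule field_differentiable_bound[where S = "{..S}" and f' = "\<lambda>s. if 0 < s then a * s powr (a - 1) else 0"])
    show "((\<lambda>s. if 0 < s then s powr a else 0) has_real_derivative (if 0 < z then a * z powr (a - 1) else 0)) (at z within {..S})" for z
      by (rule has_field_derivative_at_within[OF has_derivative_positive_part_powr[OF assms(1)]])
    show "norm (if 0 < z then a * z powr (a - 1) else 0) \<le> a * S powr (a - 1)" if "z \<in> {..S}" for z
      using that assms by (auto intro!: powr_mono2)
  qed (use assms in auto)
  then show ?thesis by simp
qed

text \<open>Dominated convergence along sequences: the difference quotients are dominated by the
  Lipschitz constant, which is integrable because the measure is finite. The constant may depend on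
  the range \<open>B\<close> of the increments, as a convergent sequence is bounded.\<close>

lemma has_derivative_integral_lipschitz:
  fixes f :: "'a \<Rightarrow> real \<Rightarrow> real"
  assumes "finite_measure M"
    and deriv: "\<And>x. x \<in> space M \<Longrightarrow> (f x has_real_derivative f' x) (at E)"
    and int: "\<And>e. integrable M (\<lambda>x. f x e)" and [measurable]: "f' \<in> borel_measurable M"
    and lip: "\<And>B. B > 0 \<Longrightarrow> \<exists>K. \<forall>x\<in>space M. \<forall>h. \<bar>h\<bar> \<le> B \<longrightarrow> \<bar>f x (E + h) - f x E\<bar> \<le> K * \<bar>h\<bar>"
  shows "((\<lambda>e. \<integral>x. f x e \<partial>M) has_real_derivative (\<integral>x. f' x \<partial>M)) (at E)"
  unfolding DERIV_def tendsto_at_iff_sequentially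
proof (intro allI impI)
  interpret finite_measure M by fact
  fix X :: "nat \<Rightarrow> real" assume X: "\<forall>i. X i \<in> UNIV - {0}" "X \<longlonglongrightarrow> 0"
  obtain B where B: "B > 0" "\<And>i. \<bar>X i\<bar> \<le> B"
    using convergent_imp_Bseq[OF convergentI[OF X(2)]] by (auto simp: Bseq_def)
  obtain K where K: "\<And>x h. x \<in> space M \<Longrightarrow> \<bar>h\<bar> \<le> B \<Longrightarrow> \<bar>f x (E + h) - f x E\<bar> \<le> K * \<bar>h\<bar>"
    using lip[OF B(1)] by blast
  have "(\<lambda>i. \<integral>x. (f x (E + X i) - f x E) / X i \<partial>M) \<longlonglongrightarrow> (\<integral>x. f' x \<partial>M)"
  proof (rule integral_dominated_convergence[where w = "\<lambda>_. K"])
    show "(\<lambda>x. (f x (E + X i) - f x E) / X i) \<in> borel_measurable M" for i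
      using int[of E] int[of "E + X i"] by (intro borel_measurable_divide borel_measurable_diff) auto
    show "AE x in M. (\<lambda>i. (f x (E + X i) - f x E) / X i) \<longlonglongrightarrow> f' x"
    proof (rule AE_I2)
      fix x assume "x \<in> space M"
      from deriv[OF this] show "(\<lambda>i. (f x (E + X i) - f x E) / X i) \<longlonglongrightarrow> f' x"
        unfolding DERIV_def tendsto_at_iff_sequentially using X by (auto simp: o_def)
    qed
    show "AE x in M. norm ((f x (E + X i) - f x E) / X i) \<le> K" for i
    proof (rule AE_I2)
      fix x assume "x \<in> space M"
      from K[OF this B(2)] X(1) show "norm ((f x (E + X i) - f x E) / X i) \<le> K"
        by (simp add: divide_le_eq)
    qed
  qed auto
  moreover have "(\<integral>x. (f x (E + X i) - f x E) / X i \<partial>M) = ((\<integral>x. f x (E + X i) \<partial>M) - (\<integral>x. f x E \<partial>M)) / X i" for i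
    using int by simp
  ultimately show "((\<lambda>h. ((\<integral>x. f x (E + h) \<partial>M) - (\<integral>x. f x E \<partial>M)) / h) \<circ> X) \<longlonglongrightarrow> (\<integral>x. f' x \<partial>M)"
    unfolding o_def by (simp only:)
qed

text \<open>Induction on \<open>N\<close>: the last pair is split off, the induction hypothesis is
  applied with that pair fixed, and Tonelli moves the last momentum past the remaining positions.
  The restriction to \<open>{..<N}\<close> makes the component families extensional, as elements of
  a product space must be.\<close>

lemma nn_integral_PiM_pair:
  assumes sf1: "sigma_finite_measure M1" and sf2: "sigma_finite_measure M2"
    and "F \<in> borel_measurable (Pi\<^sub>M {..<N} (\<lambda>_. M1) \<Otimes>\<^sub>M Pi\<^sub>M {..<N} (\<lambda>_. M2))"
  shows "(\<integral>\<^sup>+X. F (\<lambda>i\<in>{..<N}. fst (X i), \<lambda>i\<in>{..<N}. snd (X i)) \<partial>Pi\<^sub>M {..<N::nat} (\<lambda>_. M1 \<Otimes>\<^sub>M M2))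
    = (\<integral>\<^sup>+q. \<integral>\<^sup>+p. F (p, q) \<partial>Pi\<^sub>M {..<N} (\<lambda>_. M1) \<partial>Pi\<^sub>M {..<N} (\<lambda>_. M2))"
  using assms(3)
proof (induction N arbitrary: F)
  case 0
  show ?case
    by (simp add: PiM_empty nn_integral_count_space_finite restrict_def)
next
  case (Suc N)
  interpret M1: sigma_finite_measure M1 by fact
  interpret M2: sigma_finite_measure M2 by fact
  interpret M12: pair_sigma_finite M1 M2 ..
  interpret phase: product_sigma_finite "\<lambda>_::nat. M1 \<Otimes>\<^sub>M M2" ..
  interpret mom: product_sigma_finite "\<lambda>_::nat. M1" ..
  interpret conf: product_sigma_finite "\<lambda>_::nat. M2" ..
  interpret momN: finite_product_sigma_finite "\<lambda>_::nat. M1" "{..<N}" by standard simp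
  interpret confN: finite_product_sigma_finite "\<lambda>_::nat. M2" "{..<N}" by standard simp
  note F [measurable] = Suc.prems
  let ?A = "\<lambda>n. Pi\<^sub>M {..<n} (\<lambda>_. M1)" and ?B = "\<lambda>n. Pi\<^sub>M {..<n} (\<lambda>_. M2)" and ?C = "\<lambda>n. Pi\<^sub>M {..<n} (\<lambda>_. M1 \<Otimes>\<^sub>M M2)"
  let ?r = "\<lambda>n g X. (\<lambda>i\<in>{..<n::nat}. g (X i))"
  interpret swap: pair_sigma_finite M1 "?B N"
    by (intro pair_sigma_finite.intro sf1 confN.sigma_finite_measure_axioms)
  have ins: "{..<Suc N} = {..<N} \<union> {N}" by auto
  have upd: "(\<lambda>x. F ((p x)(N := y x), (q x)(N := z x))) \<in> borel_measurable R"
    if "p \<in> R \<rightarrow>\<^sub>M ?A N" "y \<in> R \<rightarrow>\<^sub>M M1" "q \<in> R \<rightarrow>\<^sub>M ?B N" "z \<in> R \<rightarrow>\<^sub>M M2" for p y q z and R :: "'z measure"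
    by (rule measurable_compose[OF measurable_Pair[OF measurable_fun_upd[OF ins that(1,2)] measurable_fun_upd[OF ins that(3,4)]] F])
  have restr: "(\<lambda>X. ?r n fst X) \<in> ?C n \<rightarrow>\<^sub>M ?A n" "(\<lambda>X. ?r n snd X) \<in> ?C n \<rightarrow>\<^sub>M ?B n" for n
    by (rule measurable_restrict; measurable)+
  have F_restr: "(\<lambda>X. F (?r (Suc N) fst X, ?r (Suc N) snd X)) \<in> borel_measurable (?C (Suc N))"
    by (rule measurable_compose[OF measurable_Pair[OF restr] F])
  define G where "G y z = (\<integral>\<^sup>+q. \<integral>\<^sup>+p. F (p(N := y), q(N := z)) \<partial>?A N \<partial>?B N)" for y z
  \<comment> \<open>Joint measurability in all four variables, needed before any of them is
    integrated out.\<close>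
  have upd4: "(\<lambda>x. F ((snd x)(N := fst (fst (fst x))), (snd (fst x))(N := snd (fst (fst x)))))
      \<in> borel_measurable (((M1 \<Otimes>\<^sub>M M2) \<Otimes>\<^sub>M ?B N) \<Otimes>\<^sub>M ?A N)"
    by (rule upd; measurable)
  have G_meas: "(\<lambda>x. G (fst x) (snd x)) \<in> borel_measurable (M1 \<Otimes>\<^sub>M M2)"
    unfolding G_def
    using momN.borel_measurable_nn_integral_fst[OF upd4, THEN confN.borel_measurable_nn_integral_fst] by simp
  have "(\<integral>\<^sup>+X. F (?r (Suc N) fst X, ?r (Suc N) snd X) \<partial>?C (Suc N))
    = (\<integral>\<^sup>+y. \<integral>\<^sup>+X. F (?r (Suc N) fst (X(N := y)), ?r (Suc N) snd (X(N := y))) \<partial>?C N \<partial>(M1 \<Otimes>\<^sub>M M2))"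
    using phase.product_nn_integral_insert_rev[of "{..<N}" N "\<lambda>X. F (?r (Suc N) fst X, ?r (Suc N) snd X)"] F_restr
    by (simp add: lessThan_Suc)
  also have "\<dots> = (\<integral>\<^sup>+y. G (fst y) (snd y) \<partial>(M1 \<Otimes>\<^sub>M M2))"
  proof (intro nn_integral_cong)
    fix y assume y: "y \<in> space (M1 \<Otimes>\<^sub>M M2)"
    then have y12: "fst y \<in> space M1" "snd y \<in> space M2" by (auto simp: space_pair_measure)
    have "(\<integral>\<^sup>+X. F (?r (Suc N) fst (X(N := y)), ?r (Suc N) snd (X(N := y))) \<partial>?C N)
      = (\<integral>\<^sup>+X. (\<lambda>x. F ((fst x)(N := fst y), (snd x)(N := snd y))) (?r N fst X, ?r N snd X) \<partial>?C N)"
    proof (intro nn_integral_cong)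
      fix X
      have "?r (Suc N) g (X(N := y)) = (?r N g X)(N := g y)" for g :: "_ \<Rightarrow> 'z"
        by (auto simp: fun_eq_iff restrict_def)
      moreover have "?r (Suc N) g (X(N := y)) = (?r N g X)(N := g y)" for g :: "_ \<Rightarrow> 'y"
        by (auto simp: fun_eq_iff restrict_def)
      ultimately show "F (?r (Suc N) fst (X(N := y)), ?r (Suc N) snd (X(N := y)))
        = (\<lambda>x. F ((fst x)(N := fst y), (snd x)(N := snd y))) (?r N fst X, ?r N snd X)"
        by (auto simp: fun_eq_iff restrict_def intro!: arg_cong[where f = F])
    qed
    also have "\<dots> = G (fst y) (snd y)"
      unfolding G_def by (subst Suc.IH) (auto intro!: upd simp: y12)
    finally show "(\<integral>\<^sup>+X. F (?r (Suc N) fst (X(N := y)), ?r (Suc N) snd (X(N := y))) \<partial>?C N) = G (fst y) (snd y)" .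
  qed
  also have "\<dots> = (\<integral>\<^sup>+z. \<integral>\<^sup>+y. G y z \<partial>M1 \<partial>M2)"
    using M12.nn_integral_snd[OF G_meas] by simp
  also have "\<dots> = (\<integral>\<^sup>+z. \<integral>\<^sup>+q. \<integral>\<^sup>+y. \<integral>\<^sup>+p. F (p(N := y), q(N := z)) \<partial>?A N \<partial>M1 \<partial>?B N \<partial>M2)"
  proof (intro nn_integral_cong)
    fix z assume z: "z \<in> space M2"
    have "(\<lambda>x. F ((snd x)(N := fst (fst x)), (snd (fst x))(N := z))) \<in> borel_measurable ((M1 \<Otimes>\<^sub>M ?B N) \<Otimes>\<^sub>M ?A N)"
      by (rule upd; (rule measurable_const[OF z] | measurable))
    then have "case_prod (\<lambda>y q. \<integral>\<^sup>+p. F (p(N := y), q(N := z)) \<partial>?A N) \<in> borel_measurable (M1 \<Otimes>\<^sub>M ?B N)"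
      using momN.borel_measurable_nn_integral_fst by (simp add: split_beta')
    then show "(\<integral>\<^sup>+y. G y z \<partial>M1) = (\<integral>\<^sup>+q. \<integral>\<^sup>+y. \<integral>\<^sup>+p. F (p(N := y), q(N := z)) \<partial>?A N \<partial>M1 \<partial>?B N)"
      unfolding G_def by (rule swap.Fubini'[symmetric])
  qed
  also have "\<dots> = (\<integral>\<^sup>+z. \<integral>\<^sup>+q. \<integral>\<^sup>+p. F (p, q(N := z)) \<partial>?A (Suc N) \<partial>?B N \<partial>M2)"
  proof (intro nn_integral_cong)
    fix z q assume z: "z \<in> space M2" and q: "q \<in> space (?B N)"
    have c: "q(N := z) \<in> space (?B (Suc N))"
      using z q by (auto simp: space_PiM PiE_iff extensional_def)
    have "(\<lambda>p. F (p, q(N := z))) \<in> borel_measurable (?A (Suc N))"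
      by (rule measurable_compose[OF measurable_Pair[OF measurable_ident measurable_const[OF c]] F, unfolded id_def])
    then show "(\<integral>\<^sup>+y. \<integral>\<^sup>+p. F (p(N := y), q(N := z)) \<partial>?A N \<partial>M1) = (\<integral>\<^sup>+p. F (p, q(N := z)) \<partial>?A (Suc N))"
      unfolding lessThan_Suc by (intro mom.product_nn_integral_insert_rev[symmetric]) auto
  qed
  also have "\<dots> = (\<integral>\<^sup>+q. \<integral>\<^sup>+p. F (p, q) \<partial>?A (Suc N) \<partial>?B (Suc N))"
  proof -
    interpret momS: finite_product_sigma_finite "\<lambda>_::nat. M1" "{..<Suc N}" by standard simp
    have "(\<lambda>x. F (snd x, fst x)) \<in> borel_measurable (?B (Suc N) \<Otimes>\<^sub>M ?A (Suc N))"
      by (rule measurable_compose[OF measurable_Pair[OF measurable_snd measurable_fst] F])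
    then have "(\<lambda>q. \<integral>\<^sup>+p. F (p, q) \<partial>?A (Suc N)) \<in> borel_measurable (?B (Suc N))"
      using momS.borel_measurable_nn_integral_fst[of "\<lambda>x. F (snd x, fst x)" "?B (Suc N)"] by simp
    then show ?thesis
      using conf.product_nn_integral_insert_rev[of "{..<N}" N "\<lambda>q. \<integral>\<^sup>+p. F (p, q) \<partial>?A (Suc N)"]
      by (simp add: lessThan_Suc)
  qed
  finally show ?case .
qed

text \<open>The identity is measurable in both directions, so the measurable sets agree, and on
  boxes both measures give the product of the factor measures.\<close>

lemma PiM_restrict_space:
  assumes "sigma_finite_measure M" and S: "S \<in> sets M" and "finite I"
  shows "restrict_space (Pi\<^sub>M I (\<lambda>_. M)) (Pi\<^sub>E I (\<lambda>_. S)) = Pi\<^sub>M I (\<lambda>_. restrict_space M S)"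
proof -
  interpret M: sigma_finite_measure M by fact
  interpret R: sigma_finite_measure "restrict_space M S"
    using S by (intro sigma_finite_measure_restrict_space assms(1))
  interpret PM: product_sigma_finite "\<lambda>_. M" ..
  interpret PR: product_sigma_finite "\<lambda>_. restrict_space M S" ..
  have SM: "S \<subseteq> space M" using sets.sets_into_space[OF S] .
  let ?N = "restrict_space (Pi\<^sub>M I (\<lambda>_. M)) (Pi\<^sub>E I (\<lambda>_. S))"
  have PS: "Pi\<^sub>E I (\<lambda>_. S) \<in> sets (Pi\<^sub>M I (\<lambda>_. M))"
    using S assms(3) by (intro sets_PiM_I_finite) auto
  have space_N: "space ?N = Pi\<^sub>E I (\<lambda>_. S)"
    using sets.sets_into_space[OF PS] by (auto simp: space_restrict_space)
  have space_R: "space (Pi\<^sub>M I (\<lambda>_. restrict_space M S)) = Pi\<^sub>E I (\<lambda>_. S)"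
    using SM by (auto simp: space_PiM space_restrict_space Int_absorb2)
  have id1: "(\<lambda>x. x) \<in> ?N \<rightarrow>\<^sub>M Pi\<^sub>M I (\<lambda>_. restrict_space M S)"
  proof (rule measurable_PiM_single'[where f = "\<lambda>i x. x i"])
    fix i assume i: "i \<in> I"
    have "(\<lambda>x. x i) \<in> ?N \<rightarrow>\<^sub>M M"
      using i by (intro measurable_restrict_space1 measurable_component_singleton)
    then show "(\<lambda>x. x i) \<in> ?N \<rightarrow>\<^sub>M restrict_space M S"
      using i by (intro measurable_restrict_space2) (auto simp: space_N)
  qed (use SM in \<open>auto simp: space_N space_restrict_space PiE_iff\<close>)
  have id2: "(\<lambda>x. x) \<in> Pi\<^sub>M I (\<lambda>_. restrict_space M S) \<rightarrow>\<^sub>M ?N"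
  proof (rule measurable_restrict_space2)
    show "(\<lambda>x. x) \<in> Pi\<^sub>M I (\<lambda>_. restrict_space M S) \<rightarrow>\<^sub>M Pi\<^sub>M I (\<lambda>_. M)"
    proof (rule measurable_PiM_single'[where f = "\<lambda>i x. x i"])
      fix i assume i: "i \<in> I"
      have "(\<lambda>x. x) \<in> restrict_space M S \<rightarrow>\<^sub>M M"
        by (intro measurable_restrict_space1 measurable_ident_sets refl)
      then show "(\<lambda>x. x i) \<in> Pi\<^sub>M I (\<lambda>_. restrict_space M S) \<rightarrow>\<^sub>M M"
        by (rule measurable_compose[OF measurable_component_singleton[OF i]])
    qed (use SM in \<open>auto simp: space_R PiE_iff\<close>)
  qed (auto simp: space_R)
  have sub: "A \<in> sets N'" if "(\<lambda>x. x) \<in> N' \<rightarrow>\<^sub>M N''" "space N' = space N''" "A \<in> sets N''"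
    for A and N' N'' :: "('b \<Rightarrow> 'a) measure"
    using measurable_sets[OF that(1,3)] sets.sets_into_space[OF that(3)] that(2) by (simp add: vimage_def Int_absorb2)
  show ?thesis
  proof (rule PR.PiM_eqI[OF assms(3)])
    show "sets ?N = sets (Pi\<^sub>M I (\<lambda>_. restrict_space M S))"
      using sub[OF id1] sub[OF id2] space_N space_R by blast
    fix A assume "\<And>i. i \<in> I \<Longrightarrow> A i \<in> sets (restrict_space M S)"
    then have A: "A i \<in> sets M" "A i \<subseteq> S" if "i \<in> I" for i
      using S that SM by (auto simp: sets_restrict_space_iff Int_absorb2)
    have "emeasure ?N (Pi\<^sub>E I A) = emeasure (Pi\<^sub>M I (\<lambda>_. M)) (Pi\<^sub>E I A)"
    proof (rule emeasure_restrict_space)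
      show "Pi\<^sub>E I A \<subseteq> Pi\<^sub>E I (\<lambda>_. S)" using A by (intro PiE_mono)
      show "Pi\<^sub>E I (\<lambda>_. S) \<inter> space (Pi\<^sub>M I (\<lambda>_. M)) \<in> sets (Pi\<^sub>M I (\<lambda>_. M))" using PS by auto
    qed
    also have "\<dots> = (\<Prod>i\<in>I. emeasure M (A i))"
      using A assms(3) by (intro PM.emeasure_PiM) auto
    also have "\<dots> = (\<Prod>i\<in>I. emeasure (restrict_space M S) (A i))"
    proof (intro prod.cong refl)
      fix i assume "i \<in> I"
      then show "emeasure M (A i) = emeasure (restrict_space M S) (A i)"
        using A S by (intro emeasure_restrict_space[symmetric]) auto
    qed
    finally show "emeasure ?N (Pi\<^sub>E I A) = (\<Prod>i\<in>I. emeasure (restrict_space M S) (A i))" .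
  qed
qed

context pair_potential
begin

section \<open>Integrating out the momenta of N particles\<close>

abbreviation Q :: "nat \<Rightarrow> (nat \<Rightarrow> real^3) measure" where
  "Q N \<equiv> Pi\<^sub>M {..<N} (\<lambda>_. L)"

abbreviation Pmom :: "nat \<Rightarrow> (nat \<Rightarrow> real^3) measure" where
  "Pmom N \<equiv> Pi\<^sub>M {..<N} (\<lambda>_. lborel)"

definition W :: "nat \<Rightarrow> (nat \<Rightarrow> real^3) \<Rightarrow> ennreal" where
  "W N q = (\<Sum>j<N. \<Sum>i<j. U (q i) (q j))"

lemma measurable_W [measurable]: "W N \<in> borel_measurable (Q N)"
  unfolding W_def
proof (intro borel_measurable_sum)
  fix i j assume ij: "j \<in> {..<N}" "i \<in> {..<j}"
  show "(\<lambda>q. U (q i) (q j)) \<in> borel_measurable (Q N)"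
    by (rule measurable_U; rule measurable_component_singleton) (use ij in auto)
qed

lemma finite_measure_Q: "finite_measure (Q N)"
proof
  interpret product_sigma_finite "\<lambda>_::nat. L" ..
  have "emeasure (Q N) (Pi\<^sub>E {..<N} (\<lambda>_. \<Lambda>)) = (\<Prod>i<N. emeasure L \<Lambda>)"
    by (intro emeasure_PiM) (use sets.top[of L] in auto)
  also have "\<dots> < \<infinity>"
  proof -
    have "emeasure L \<Lambda> < \<infinity>" by (metis emeasure_finite infinity_ennreal_def top.not_eq_extremum)
    then show ?thesis by (simp add: power_less_top_ennreal)
  qed
  finally show "emeasure (Q N) (space (Q N)) \<noteq> \<infinity>" by (simp add: space_PiM)
qed


text \<open>What the momentum integral leaves over, up to \<open>momentum_constant\<close>. The case
  of infinite energy is separate because \<open>enn2real\<close> sends \<infinity> to 0, which would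
  count such configurations at full weight.\<close>

definition surplus_powr :: "real \<Rightarrow> nat \<Rightarrow> real \<Rightarrow> (nat \<Rightarrow> real^3) \<Rightarrow> real" where
  "surplus_powr a N E q = (if W N q = \<infinity> then 0
     else if 0 < E - enn2real (W N q) then (E - enn2real (W N q)) powr a else 0)"

lemma measurable_surplus_powr [measurable]: "surplus_powr a N E \<in> borel_measurable (Q N)"
  unfolding surplus_powr_def by measurable

lemma surplus_powr_nonneg: "0 \<le> surplus_powr a N E q"
  by (simp add: surplus_powr_def)

lemma integrable_surplus_powr:
  assumes "0 \<le> a"
  shows "integrable (Q N) (surplus_powr a N E)"
proof -
  interpret finite_measure "Q N" by (rule finite_measure_Q)
  have "norm (surplus_powr a N E q) \<le> \<bar>E\<bar> powr a" for q
  proof -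
    have "E - enn2real (W N q) \<le> \<bar>E\<bar>" using enn2real_nonneg[of "W N q"] by linarith
    then show ?thesis using assms by (auto simp: surplus_powr_def intro!: powr_mono2)
  qed
  then show ?thesis
    by (intro integrable_const_bound[where B = "\<bar>E\<bar> powr a"] AE_I2) auto
qed

text \<open>The volume of the unit ball of dimension 3N times a radius factor: the kinetic energy is
  \<open>N / 2\<close> times the squared norm of the momenta, so the squared radius is
  \<open>2 / N\<close> times the surplus energy.\<close>

definition momentum_constant :: "nat \<Rightarrow> real" where
  "momentum_constant N = pi powr (3/2 * real N) / Gamma (3/2 * real N + 1) * (2 / real N) powr (3/2 * real N)"

lemma momentum_constant_pos: "N \<ge> 1 \<Longrightarrow> momentum_constant N > 0"
  unfolding momentum_constant_def by (intro mult_pos_pos divide_pos_pos Gamma_real_pos) (auto simp: add_nonneg_pos)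

lemma momentum_integral:
  assumes N: "N \<ge> 1"
  shows "(\<integral>\<^sup>+p. of_bool (ennreal (real N * (\<Sum>i<N. 1/2 * (norm (p i))\<^sup>2)) + W N q < ennreal E) \<partial>Pmom N)
    = ennreal (momentum_constant N * surplus_powr (3/2 * real N) N E q)"
proof (cases "W N q = \<infinity>")
  case True
  then show ?thesis by (simp add: surplus_powr_def)
next
  case False
  then obtain w where w: "W N q = ennreal w" "0 \<le> w" by (cases "W N q") auto
  define R where "R = 2 * (E - w) / real N"
  have "ennreal (real N * (\<Sum>i<N. 1/2 * (norm (p i))\<^sup>2)) + W N q < ennreal E \<longleftrightarrow> (\<Sum>i<N. (norm (p i))\<^sup>2) < R"
    for p :: "nat \<Rightarrow> real^3"
  proof -
    have nn: "0 \<le> real N * (\<Sum>i<N. 1/2 * (norm (p i))\<^sup>2)" by (intro mult_nonneg_nonneg sum_nonneg) auto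
    have "ennreal (real N * (\<Sum>i<N. 1/2 * (norm (p i))\<^sup>2)) + W N q = ennreal (real N * (\<Sum>i<N. 1/2 * (norm (p i))\<^sup>2) + w)"
      unfolding w using nn w(2) by (simp add: ennreal_plus)
    then have "ennreal (real N * (\<Sum>i<N. 1/2 * (norm (p i))\<^sup>2)) + W N q < ennreal E \<longleftrightarrow>
        real N * (\<Sum>i<N. 1/2 * (norm (p i))\<^sup>2) + w < E"
      using nn w(2) by (simp add: ennreal_less_iff del: ennreal_plus)
    also have "\<dots> \<longleftrightarrow> (\<Sum>i<N. (norm (p i))\<^sup>2) < R"
      unfolding sum_distrib_left[symmetric] using N by (simp add: R_def field_simps)
    finally show ?thesis .
  qed
  then have "(\<integral>\<^sup>+p. of_bool (ennreal (real N * (\<Sum>i<N. 1/2 * (norm (p i))\<^sup>2)) + W N q < ennreal E) \<partial>Pmom N)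
    = (\<integral>\<^sup>+p. of_bool ((\<Sum>i<N. (norm (p i))\<^sup>2) < R) \<partial>Pmom N)" by (simp only:)
  also have "\<dots> = emeasure (Pmom N) {p \<in> space (Pmom N). (\<Sum>i<N. (norm (p i))\<^sup>2) < R}"
    by (rule emeasure_eq_nn_integral_of_bool[symmetric]) measurable
  also have "\<dots> = ennreal (momentum_constant N * surplus_powr (3/2 * real N) N E q)"
  proof -
    have "R powr (3/2 * real N) = (2 / real N) powr (3/2 * real N) * (E - w) powr (3/2 * real N)" if "0 < E - w"
      using that unfolding R_def by (subst powr_mult[symmetric]) auto
    moreover have "0 < R \<longleftrightarrow> 0 < E - w" using N by (simp add: R_def zero_less_divide_iff)
    ultimately show ?thesis
      using w by (simp add: momentum_volume momentum_constant_def surplus_powr_def)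
  qed
  finally show ?thesis .
qed

text \<open>Restricting to \<open>\<Lambda>\<close> commutes with the product over particles, the
  product of phase spaces splits into momenta and positions, and the momentum integral is a ball
  volume.\<close>

lemma phase_volume_eq:
  assumes N: "N \<ge> 1"
  shows "phase_volume \<Lambda> U N E = 1 / fact N * (momentum_constant N * (\<integral>q. surplus_powr (3/2 * real N) N E q \<partial>Q N))"
proof -
  let ?PiL = "Pi\<^sub>M {..<N} (\<lambda>_. lborel :: phase_point measure)"
  let ?PiP = "Pi\<^sub>M {..<N} (\<lambda>_. P)"
  let ?D = "Pi\<^sub>E {..<N} (\<lambda>_. UNIV \<times> \<Lambda>) :: (nat \<Rightarrow> phase_point) set"
  let ?S = "{X \<in> space ?PiL. (\<forall>i<N. X i \<in> UNIV \<times> \<Lambda>) \<and> hamiltonian U N X < ennreal E}"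
  define h :: "(nat \<Rightarrow> real^3) \<times> (nat \<Rightarrow> real^3) \<Rightarrow> ennreal" where "h x = ennreal (real N * (\<Sum>i<N. 1/2 * (norm (fst x i))\<^sup>2)) + W N (snd x)" for x
  let ?r = "\<lambda>X. (\<lambda>i\<in>{..<N}. fst (X i), \<lambda>i\<in>{..<N}. snd (X i))"
  have R: "restrict_space ?PiL ?D = ?PiP"
    unfolding restrict_lborel_P[symmetric]
    by (rule PiM_restrict_space) (auto intro: lborel.sigma_finite_measure_axioms simp: dom_phase_sets)
  have comp: "(\<lambda>x. fst x i) \<in> Pmom N \<Otimes>\<^sub>M Q N \<rightarrow>\<^sub>M borel" if "i \<in> {..<N}" for i
  proof -
    have "(\<lambda>x. fst x i) \<in> Pmom N \<Otimes>\<^sub>M Q N \<rightarrow>\<^sub>M lborel"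
      by (rule measurable_compose[OF measurable_fst measurable_component_singleton[OF that]])
    then show ?thesis by simp
  qed
  have h_meas [measurable]: "h \<in> borel_measurable (Pmom N \<Otimes>\<^sub>M Q N)"
    unfolding h_def
    by (intro borel_measurable_add measurable_compose[OF _ measurable_ennreal] borel_measurable_times
          borel_measurable_const borel_measurable_sum borel_measurable_power measurable_compose[OF comp borel_measurable_norm]
          measurable_compose[OF measurable_snd measurable_W])
  have r_meas: "?r \<in> ?PiP \<rightarrow>\<^sub>M Pmom N \<Otimes>\<^sub>M Q N"
  proof (rule measurable_Pair; rule measurable_restrict)
    fix i assume i: "i \<in> {..<N}"
    show "(\<lambda>X. fst (X i)) \<in> ?PiP \<rightarrow>\<^sub>M lborel"
      by (rule measurable_compose[OF measurable_component_singleton[OF i] measurable_fst])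
    show "(\<lambda>X. snd (X i)) \<in> ?PiP \<rightarrow>\<^sub>M L"
      by (rule measurable_compose[OF measurable_component_singleton[OF i] measurable_snd])
  qed
  have ham: "hamiltonian U N X = h (?r X)" for X
  proof -
    have "(\<Sum>j<N. \<Sum>i<j. U (snd (X i)) (snd (X j))) = W N (\<lambda>i\<in>{..<N}. snd (X i))"
      unfolding W_def by (intro sum.cong refl) auto
    moreover have "(\<Sum>i<N. 1/2 * (norm (fst (X i)))\<^sup>2) = (\<Sum>i<N. 1/2 * (norm ((\<lambda>i\<in>{..<N}. fst (X i)) i))\<^sup>2)"
      by (intro sum.cong refl) auto
    ultimately show ?thesis by (simp only: hamiltonian_def h_def fst_conv snd_conv)
  qed
  have space_PiP: "space ?PiP = ?D" by (simp add: space_PiM space_P)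
  have D_sets: "?D \<in> sets ?PiL"
    using dom_phase_sets by (intro sets_PiM_I_finite) auto
  have S_eq: "?S = {X \<in> space ?PiP. h (?r X) < ennreal E}"
    unfolding space_PiP by (auto simp: ham space_PiM PiE_iff)
  have "emeasure ?PiL ?S = emeasure (restrict_space ?PiL ?D) ?S"
  proof (rule emeasure_restrict_space[symmetric])
    show "?D \<inter> space ?PiL \<in> sets ?PiL" using D_sets by auto
    show "?S \<subseteq> ?D" unfolding S_eq space_PiP by auto
  qed
  also have "\<dots> = emeasure ?PiP {X \<in> space ?PiP. h (?r X) < ennreal E}"
    unfolding R S_eq ..
  also have "\<dots> = (\<integral>\<^sup>+X. of_bool (h (?r X) < ennreal E) \<partial>?PiP)"
    by (rule emeasure_eq_nn_integral_of_bool)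
       (rule borel_measurable_less[OF measurable_compose[OF r_meas h_meas] measurable_const], simp)
  also have "\<dots> = (\<integral>\<^sup>+q. \<integral>\<^sup>+p. of_bool (h (p, q) < ennreal E) \<partial>Pmom N \<partial>Q N)"
  proof (rule nn_integral_PiM_pair[where F = "\<lambda>x. of_bool (h x < ennreal E)",
        OF lborel.sigma_finite_measure_axioms sigma_finite_measure_axioms])
    have "{x \<in> space (Pmom N \<Otimes>\<^sub>M Q N). h x < ennreal E} \<in> sets (Pmom N \<Otimes>\<^sub>M Q N)"
      by (rule borel_measurable_less[OF h_meas]) simp
    then have "(\<lambda>x. if h x < ennreal E then 1 else 0 :: ennreal) \<in> borel_measurable (Pmom N \<Otimes>\<^sub>M Q N)"
      by (intro measurable_If) simp_all
    then show "(\<lambda>x. of_bool (h x < ennreal E) :: ennreal) \<in> borel_measurable (Pmom N \<Otimes>\<^sub>M Q N)"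
      unfolding of_bool_def .
  qed
  also have "\<dots> = (\<integral>\<^sup>+q. ennreal (momentum_constant N * surplus_powr (3/2 * real N) N E q) \<partial>Q N)"
    by (intro nn_integral_cong) (simp only: h_def fst_conv snd_conv momentum_integral[OF N])
  also have "\<dots> = ennreal (\<integral>q. momentum_constant N * surplus_powr (3/2 * real N) N E q \<partial>Q N)"
    using momentum_constant_pos[OF N] surplus_powr_nonneg
    by (intro nn_integral_eq_integral integrable_mult_right integrable_surplus_powr) auto
  also have "\<dots> = ennreal (momentum_constant N * (\<integral>q. surplus_powr (3/2 * real N) N E q \<partial>Q N))"
    by simp
  finally have "emeasure ?PiL ?S = ennreal (momentum_constant N * (\<integral>q. surplus_powr (3/2 * real N) N E q \<partial>Q N))" .
  moreover have "0 \<le> momentum_constant N * (\<integral>q. surplus_powr (3/2 * real N) N E q \<partial>Q N)"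
    using momentum_constant_pos[OF N] surplus_powr_nonneg
    by (intro mult_nonneg_nonneg integral_nonneg_AE AE_I2) auto
  ultimately show ?thesis
    unfolding phase_volume_def measure_def by simp
qed

text \<open>For \<open>N \<ge> 1\<close> the exponent \<open>3/2 * N\<close> exceeds 1, so the
  integrand is differentiable in the energy with a locally bounded derivative, even across the value
  where the surplus vanishes.\<close>

lemma deriv_phase_volume:
  assumes N: "N \<ge> 1"
  shows "deriv (phase_volume \<Lambda> U N) E =
    1 / fact N * (momentum_constant N * (3/2 * real N * (\<integral>q. surplus_powr (3/2 * real N - 1) N E q \<partial>Q N)))"
proof -
  let ?a = "3/2 * real N"
  have a: "?a > 1" using N by simp
  have "((\<lambda>e. \<integral>q. surplus_powr ?a N e q \<partial>Q N) has_real_derivative (\<integral>q. ?a * surplus_powr (?a - 1) N E q \<partial>Q N)) (at E)"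
  proof (rule has_derivative_integral_lipschitz[OF finite_measure_Q])
    fix q
    show "((\<lambda>e. surplus_powr ?a N e q) has_real_derivative ?a * surplus_powr (?a - 1) N E q) (at E)"
    proof (cases "W N q = \<infinity>")
      case False
      have "((\<lambda>e. (\<lambda>s. if 0 < s then s powr ?a else 0) (e - enn2real (W N q))) has_real_derivative
          (if 0 < E - enn2real (W N q) then ?a * (E - enn2real (W N q)) powr (?a - 1) else 0) * (1 - 0)) (at E)"
        by (rule DERIV_chain2[OF has_derivative_positive_part_powr[OF a]]) (intro derivative_intros)
      moreover have "(\<lambda>e. surplus_powr ?a N e q) = (\<lambda>e. (\<lambda>s. if 0 < s then s powr ?a else 0) (e - enn2real (W N q)))"
        and "?a * surplus_powr (?a - 1) N E q = (if 0 < E - enn2real (W N q) then ?a * (E - enn2real (W N q)) powr (?a - 1) else 0) * (1 - 0)"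
        using False by (auto simp: surplus_powr_def)
      ultimately show ?thesis by (simp only:)
    qed (simp add: surplus_powr_def)
  next
    show "integrable (Q N) (\<lambda>q. surplus_powr ?a N e q)" for e
      using integrable_surplus_powr[of ?a N e] a by simp
    show "(\<lambda>q. ?a * surplus_powr (?a - 1) N E q) \<in> borel_measurable (Q N)" by measurable
    fix B :: real assume "B > 0"
    let ?S = "\<bar>E\<bar> + B"
    show "\<exists>K. \<forall>q\<in>space (Q N). \<forall>h. \<bar>h\<bar> \<le> B \<longrightarrow> \<bar>surplus_powr ?a N (E + h) q - surplus_powr ?a N E q\<bar> \<le> K * \<bar>h\<bar>"
    proof (intro exI[of _ "?a * ?S powr (?a - 1)"] ballI allI impI)
      fix q h assume h: "\<bar>h\<bar> \<le> B"
      show "\<bar>surplus_powr ?a N (E + h) q - surplus_powr ?a N E q\<bar> \<le> ?a * ?S powr (?a - 1) * \<bar>h\<bar>"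
      proof (cases "W N q = \<infinity>")
        case False
        let ?w = "enn2real (W N q)"
        have eq: "surplus_powr ?a N e q = (if 0 < e - ?w then (e - ?w) powr ?a else 0)" for e
          using False by (simp add: surplus_powr_def)
        have "0 \<le> ?w" by simp
        then have "E + h - ?w \<le> ?S" "E - ?w \<le> ?S" "0 < ?S" using h \<open>B > 0\<close> by linarith+
        moreover have "E + h - ?w - (E - ?w) = h" by simp
        ultimately show ?thesis
          unfolding eq using positive_part_powr_lipschitz[OF a, of "E + h - ?w" ?S "E - ?w"] by (simp only:)
      qed (simp add: surplus_powr_def)
    qed
  qed
  then have "((\<lambda>e. 1 / fact N * (momentum_constant N * (\<integral>q. surplus_powr ?a N e q \<partial>Q N))) has_real_derivative
     1 / fact N * (momentum_constant N * (\<integral>q. ?a * surplus_powr (?a - 1) N E q \<partial>Q N))) (at E)"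
    by (intro DERIV_cmult)
  moreover have "phase_volume \<Lambda> U N = (\<lambda>e. 1 / fact N * (momentum_constant N * (\<integral>q. surplus_powr ?a N e q \<partial>Q N)))"
    using phase_volume_eq[OF N] by (intro ext)
  ultimately show ?thesis
    by (simp add: DERIV_imp_deriv)
qed

end

section \<open>Stirling bounds\<close>

text \<open>\<open>x * ln x - x\<close> is an antiderivative of \<open>ln\<close>, so its unit
  increments lie between the values of \<open>ln\<close> at the ends; both inequalities come from
  the tangent bound \<open>ln y \<le> y - 1\<close>.\<close>

lemma xlnx_minus_x_step:
  fixes x :: real
  assumes "x > 0"
  defines "s \<equiv> \<lambda>x::real. x * ln x - x"
  shows "ln x \<le> s (x + 1) - s x" and "s (x + 1) - s x \<le> ln (x + 1)"
proof -
  have "ln ((x + 1) / x) \<le> (x + 1) / x - 1"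
    using assms(1) by (intro ln_le_minus_one) simp
  then have "x * (ln (x + 1) - ln x) \<le> x * ((x + 1) / x - 1)"
    using assms(1) by (intro mult_left_mono) (auto simp: ln_div)
  also have "\<dots> = 1" using assms(1) by (simp add: field_simps)
  finally show "s (x + 1) - s x \<le> ln (x + 1)" by (simp add: s_def algebra_simps)
  have "ln (x / (x + 1)) \<le> x / (x + 1) - 1"
    using assms(1) by (intro ln_le_minus_one) simp
  then have "(x + 1) * (ln x - ln (x + 1)) \<le> (x + 1) * (x / (x + 1) - 1)"
    using assms(1) by (intro mult_left_mono) (auto simp: ln_div)
  also have "\<dots> = - 1" using assms(1) by (simp add: field_simps)
  finally show "ln x \<le> s (x + 1) - s x" by (simp add: s_def algebra_simps)
qed

text \<open>Each unit step adds \<open>ln (x + 1)\<close> to \<open>ln (Gamma (x + 1))\<close>. This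
  is at least the increment of \<open>s\<close> from \<open>x\<close> and at most the one from
  \<open>x + 1\<close>, so one difference increases with \<open>n\<close> and the other decreases.
  Together they are Stirling's formula up to a logarithm, which is negligible against
  \<open>N\<close>.\<close>

lemma ln_Gamma_bounds:
  fixes r :: real
  assumes "r > 0"
  defines "s \<equiv> \<lambda>x::real. x * ln x - x"
  shows "ln (Gamma (r + 1)) - s r \<le> ln (Gamma (r + real n + 1)) - s (r + real n) \<and>
    ln (Gamma (r + real n + 1)) - s (r + real n + 1) \<le> ln (Gamma (r + 1)) - s (r + 1)"
proof (induction n)
  case (Suc n)
  define x where "x = r + real n"
  have x: "x > 0" using assms(1) by (simp add: x_def add_pos_nonneg)
  have "Gamma (x + 1 + 1) = (x + 1) * Gamma (x + 1)"
    using x by (intro Gamma_plus1) (auto elim!: nonpos_Ints_cases)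
  then have "ln (Gamma (x + 1 + 1)) = ln (x + 1) + ln (Gamma (x + 1))"
    using x Gamma_real_pos[of "x + 1"] by (simp add: ln_mult_pos)
  moreover have "s (x + 1) - s x \<le> ln (x + 1)"
    using xlnx_minus_x_step(2)[OF x] by (simp add: s_def)
  moreover have "ln (x + 1) \<le> s (x + 1 + 1) - s (x + 1)"
    using xlnx_minus_x_step(1)[of "x + 1"] x by (simp add: s_def)
  ultimately have "ln (Gamma (x + 1)) - s x \<le> ln (Gamma (x + 1 + 1)) - s (x + 1)"
    and "ln (Gamma (x + 1 + 1)) - s (x + 1 + 1) \<le> ln (Gamma (x + 1)) - s (x + 1)"
    by linarith+
  moreover have "r + real (Suc n) = x + 1" by (simp add: x_def)
  ultimately show ?case
    using Suc.IH unfolding x_def[symmetric] by (simp only:) linarith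
qed simp

text \<open>A half-integer \<open>m / 2\<close> is reached in unit steps from 1 or from 1/2,
  according to the parity of \<open>m\<close>; two starting points mean finitely many
  constants.\<close>

lemma ln_Gamma_half_integer:
  "\<exists>C. \<forall>m\<ge>1::nat. \<bar>ln (Gamma (real m / 2 + 1)) - (real m / 2 * ln (real m / 2) - real m / 2)\<bar> \<le> C + ln (real m / 2 + 1)"
proof -
  define s where "s x = x * ln x - x" for x :: real
  define c where "c r = \<bar>ln (Gamma (r + 1)) - s r\<bar> + \<bar>ln (Gamma (r + 1)) - s (r + 1)\<bar>" for r :: real
  have c_nonneg: "0 \<le> c r" for r by (simp add: c_def)
  have *: "\<bar>ln (Gamma (r + real n + 1)) - s (r + real n)\<bar> \<le> c r + ln (r + real n + 1)" if "r > 0" for r n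
  proof -
    have x: "r + real n > 0" using that by simp
    have b: "ln (Gamma (r + 1)) - s r \<le> ln (Gamma (r + real n + 1)) - s (r + real n)"
      "ln (Gamma (r + real n + 1)) - s (r + real n + 1) \<le> ln (Gamma (r + 1)) - s (r + 1)"
      using ln_Gamma_bounds[OF that, of n] by (auto simp: s_def)
    have "s (r + real n + 1) - s (r + real n) \<le> ln (r + real n + 1)"
      using xlnx_minus_x_step(2)[OF x] by (simp add: s_def)
    moreover have "0 \<le> ln (r + real n + 1)" using x by (intro ln_ge_zero) linarith
    ultimately show ?thesis using b unfolding c_def by linarith
  qed
  have "\<bar>ln (Gamma (real m / 2 + 1)) - s (real m / 2)\<bar> \<le> (c 1 + c (1/2)) + ln (real m / 2 + 1)" if m: "m \<ge> 1" for m :: nat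
  proof (cases "even m")
    case True
    then obtain n where "m = 2 * n" by blast
    then have eq: "real m / 2 = 1 + real (n - 1)" using m by simp
    show ?thesis unfolding eq using *[of 1 "n - 1"] c_nonneg[of "1/2"] by simp
  next
    case False
    then obtain n where "m = 2 * n + 1" by (elim oddE)
    then have eq: "real m / 2 = 1/2 + real n" by simp
    show ?thesis unfolding eq using *[of "1/2" n] c_nonneg[of 1] by simp
  qed
  then show ?thesis unfolding s_def by blast
qed

text \<open>Needed for \<open>k = 2\<close>, where the Gamma value is the factorial of
  \<open>N\<close>, and for \<open>k = 3\<close>, the momentum volume.\<close>

lemma ln_Gamma_asymptotics:
  assumes "k \<ge> (1::nat)"
  shows "(\<lambda>N. (ln (Gamma (real (k * N) / 2 + 1)) - (real (k * N) / 2 * ln (real (k * N) / 2) - real (k * N) / 2)) / real N) \<longlonglongrightarrow> 0"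
proof -
  obtain C where C: "\<And>m::nat. m \<ge> 1 \<Longrightarrow> \<bar>ln (Gamma (real m / 2 + 1)) - (real m / 2 * ln (real m / 2) - real m / 2)\<bar> \<le> C + ln (real m / 2 + 1)"
    using ln_Gamma_half_integer by blast
  have "(\<lambda>N. (C + ln (real k * real N / 2 + 1)) / real N) \<longlonglongrightarrow> 0"
    using assms by real_asymp
  then show ?thesis
  proof (rule Lim_null_comparison[rotated])
    show "eventually (\<lambda>N. norm ((ln (Gamma (real (k * N) / 2 + 1)) - (real (k * N) / 2 * ln (real (k * N) / 2) - real (k * N) / 2)) / real N)
        \<le> (C + ln (real k * real N / 2 + 1)) / real N) sequentially"
      using eventually_ge_at_top[of 1]
    proof eventually_elim
      case (elim N)
      then have "k * N \<ge> 1" using assms by simp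
      from C[OF this] show ?case
        using elim by (simp add: divide_right_mono abs_divide)
    qed
  qed
qed

context pair_potential
begin

definition laplace_integral :: "real \<Rightarrow> nat \<Rightarrow> real" where
  "laplace_integral \<epsilon> N = (\<integral>q. (if W N q = \<infinity> then 0 else if 0 < \<epsilon> - enn2real (W N q) / (real N)\<^sup>2
      then (\<epsilon> - enn2real (W N q) / (real N)\<^sup>2) powr (3/2 * real N - 1) else 0) \<partial>Q N)"

lemma surplus_powr_scale:
  assumes "N \<ge> 1"
  shows "surplus_powr a N ((real N)\<^sup>2 * \<epsilon>) q = ((real N)\<^sup>2) powr a *
    (if W N q = \<infinity> then 0 else if 0 < \<epsilon> - enn2real (W N q) / (real N)\<^sup>2
      then (\<epsilon> - enn2real (W N q) / (real N)\<^sup>2) powr a else 0)"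
proof -
  have N2: "(real N)\<^sup>2 > 0" using assms by simp
  have eq: "(real N)\<^sup>2 * \<epsilon> - enn2real (W N q) = (real N)\<^sup>2 * (\<epsilon> - enn2real (W N q) / (real N)\<^sup>2)"
    using N2 by (simp add: algebra_simps)
  show ?thesis
    unfolding surplus_powr_def eq using N2 by (simp add: zero_less_mult_iff powr_mult)
qed

lemma ergodic_entropy_formula:
  assumes N: "N \<ge> 1" and pos: "laplace_integral \<epsilon> N > 0"
  shows "ergodic_entropy \<Lambda> U N ((real N)\<^sup>2 * \<epsilon>) =
    - ln (fact N) + (3/2 * real N * ln pi - ln (Gamma (3/2 * real N + 1)) + 3/2 * real N * (ln 2 - ln (real N)))
    + ln (3/2 * real N) + (3/2 * real N - 1) * (2 * ln (real N)) + ln (laplace_integral \<epsilon> N)"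
proof -
  have N0: "real N > 0" using N by simp
  have G: "Gamma (3/2 * real N + 1) > 0" by (intro Gamma_real_pos) (simp add: add_nonneg_pos)
  have "(\<integral>q. surplus_powr (3/2 * real N - 1) N ((real N)\<^sup>2 * \<epsilon>) q \<partial>Q N) = ((real N)\<^sup>2) powr (3/2 * real N - 1) * laplace_integral \<epsilon> N"
    unfolding surplus_powr_scale[OF N] laplace_integral_def by simp
  then have "deriv (phase_volume \<Lambda> U N) ((real N)\<^sup>2 * \<epsilon>) = 1 / fact N * (momentum_constant N *
      (3/2 * real N * (((real N)\<^sup>2) powr (3/2 * real N - 1) * laplace_integral \<epsilon> N)))"
    unfolding deriv_phase_volume[OF N] by simp
  then have "ergodic_entropy \<Lambda> U N ((real N)\<^sup>2 * \<epsilon>) = ln (1 / fact N) + (ln (momentum_constant N) +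
      (ln (3/2 * real N) + (ln (((real N)\<^sup>2) powr (3/2 * real N - 1)) + ln (laplace_integral \<epsilon> N))))"
  proof -
    have ln5: "ln (a * (b * (c * (d * e)))) = ln a + (ln b + (ln c + (ln d + ln e)))"
      if "0 < a" "0 < b" "0 < c" "0 < d" "0 < e" for a b c d e :: real
      using that by (simp add: ln_mult_pos)
    assume eq: "deriv (phase_volume \<Lambda> U N) ((real N)\<^sup>2 * \<epsilon>) = 1 / fact N * (momentum_constant N *
      (3/2 * real N * (((real N)\<^sup>2) powr (3/2 * real N - 1) * laplace_integral \<epsilon> N)))"
    show ?thesis
      unfolding ergodic_entropy_def eq by (rule ln5) (use momentum_constant_pos[OF N] pos N0 in auto)
  qed
  moreover have "ln (momentum_constant N) = 3/2 * real N * ln pi - ln (Gamma (3/2 * real N + 1)) + 3/2 * real N * (ln 2 - ln (real N))"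
  proof -
    have "ln (momentum_constant N) = ln (pi powr (3/2 * real N)) - ln (Gamma (3/2 * real N + 1)) + ln ((2 / real N) powr (3/2 * real N))"
    proof -
      define g where "g = Gamma (3/2 * real N + 1)"
      have "g > 0" using G by (simp only: g_def)
      then show ?thesis
        unfolding momentum_constant_def g_def[symmetric] using N0
        by (simp add: ln_mult_pos ln_div del: ln_powr)
    qed
    then show ?thesis using N0 by (simp add: ln_powr ln_div)
  qed
  moreover have "ln (1 / fact N :: real) = - ln (fact N)" by (simp add: ln_div)
  moreover have "ln (((real N)\<^sup>2) powr (3/2 * real N - 1)) = (3/2 * real N - 1) * (2 * ln (real N))"
    using N0 by (simp add: ln_powr ln_realpow)
  ultimately show ?thesis by simp
qed

text \<open>Apart from Stirling errors this is bookkeeping. The coefficient of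
  \<open>N * ln N\<close> is \<open>- 1 - 3/2 - 3/2 + 3 = - 1\<close>, from the factorial, the Gamma
  function, the factor \<open>2 / N\<close> and the scaling of the energy by N^2. The factorial and
  the Gamma function also leave 1 and 3/2 times \<open>N\<close>.\<close>

lemma ergodic_entropy_asymptotics:
  assumes pos: "eventually (\<lambda>N. laplace_integral \<epsilon> N > 0) sequentially"
    and lim: "(\<lambda>N. ln (laplace_integral \<epsilon> N) / real N) \<longlonglongrightarrow> M"
  shows "(\<lambda>N. ergodic_entropy \<Lambda> U N ((real N)\<^sup>2 * \<epsilon>) -
    (- real N * ln (real N) + real N * (M + 3/2 * ln (4/3 * pi) + 5/2))) \<in> o(\<lambda>N. real N)"
proof (rule smalloI_tendsto)
  show "eventually (\<lambda>N. real N \<noteq> 0) sequentially"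
    using eventually_gt_at_top[of 0] by eventually_elim simp
  define e where "e k N = (ln (Gamma (real (k * N) / 2 + 1)) - (real (k * N) / 2 * ln (real (k * N) / 2) - real (k * N) / 2)) / real N"
    for k N :: nat
  have e: "e k \<longlonglongrightarrow> 0" if "k \<ge> 1" for k
    unfolding e_def[abs_def] by (rule ln_Gamma_asymptotics[OF that])
  have "(\<lambda>N. (ln (3/2 * real N) - 2 * ln (real N)) / real N) \<longlonglongrightarrow> 0" by real_asymp
  then have "(\<lambda>N. - e 2 N - e 3 N + (ln (laplace_integral \<epsilon> N) / real N - M) + (ln (3/2 * real N) - 2 * ln (real N)) / real N)
      \<longlonglongrightarrow> - 0 - 0 + (M - M) + 0"
    by (intro tendsto_intros e lim) auto
  moreover have "eventually (\<lambda>N. - e 2 N - e 3 N + (ln (laplace_integral \<epsilon> N) / real N - M) + (ln (3/2 * real N) - 2 * ln (real N)) / real N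
     = (ergodic_entropy \<Lambda> U N ((real N)\<^sup>2 * \<epsilon>) - (- real N * ln (real N) + real N * (M + 3/2 * ln (4/3 * pi) + 5/2))) / real N) sequentially"
    using pos eventually_ge_at_top[of 1]
  proof eventually_elim
    case (elim N)
    then have N: "real N > 0" by simp
    have e2: "e 2 N * real N = ln (fact N) - (real N * ln (real N) - real N)"
      using N Gamma_fact[of N, where 'a = real] by (simp add: e_def add.commute)
    have e3: "e 3 N * real N = ln (Gamma (3/2 * real N + 1)) - (3/2 * real N * (ln 3 - ln 2 + ln (real N)) - 3/2 * real N)"
    proof -
      have "ln (real (3 * N) / 2) = ln 3 - ln 2 + ln (real N)"
        using N by (simp add: ln_div ln_mult_pos)
      then show ?thesis using N by (simp add: e_def)
    qed
    have l: "ln (4/3 * pi) = 2 * ln 2 - ln 3 + ln pi"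
    proof -
      have "ln (4/3 * pi) = ln (4/3) + ln pi" by (intro ln_mult_pos) auto
      moreover have "ln (4/3 :: real) = ln (2 ^ 2) - ln 3" by (simp add: ln_div)
      moreover have "ln (2 ^ 2 :: real) = 2 * ln 2" by (subst ln_realpow) auto
      ultimately show ?thesis by simp
    qed
    let ?lhs = "- e 2 N - e 3 N + (ln (laplace_integral \<epsilon> N) / real N - M) + (ln (3/2 * real N) - 2 * ln (real N)) / real N"
    have "?lhs * real N = - (e 2 N * real N) - e 3 N * real N + (ln (laplace_integral \<epsilon> N) - M * real N) + (ln (3/2 * real N) - 2 * ln (real N))"
    proof -
      have "(- a - b + (l / n - M) + c / n) * n = - (a * n) - b * n + (l - M * n) + c" if "n > 0" for a b c l n :: real
        using that by (simp add: field_simps)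
      from this[OF N] show ?thesis .
    qed
    also have "\<dots> = ergodic_entropy \<Lambda> U N ((real N)\<^sup>2 * \<epsilon>) - (- real N * ln (real N) + real N * (M + 3/2 * ln (4/3 * pi) + 5/2))"
      unfolding e2 e3 l ergodic_entropy_formula[OF elim(2,1)] by (simp add: field_simps)
    finally show ?case using N by (simp add: field_simps)
  qed
  ultimately show "(\<lambda>N. (ergodic_entropy \<Lambda> U N ((real N)\<^sup>2 * \<epsilon>) - (- real N * ln (real N) + real N * (M + 3/2 * ln (4/3 * pi) + 5/2))) / real N) \<longlonglongrightarrow> 0"
    by (simp add: tendsto_cong)
qed

end

section \<open>The lower bound\<close>

text \<open>Under the product of the probability densities \<open>g\<close> the coordinates are
  independent, so two of them have the joint density \<open>g x * g y\<close>. Coordinate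
  \<open>i\<close> is integrated out separately; what remains is a plain product in which every
  factor other than the one for \<open>j\<close> is 1.\<close>

lemma nn_integral_PiM_two_coordinates:
  fixes h :: "'a \<Rightarrow> 'a \<Rightarrow> ennreal" and g :: "'a \<Rightarrow> ennreal"
  assumes M: "sigma_finite_measure M" and [measurable]: "g \<in> borel_measurable M"
    and h: "(\<lambda>x. h (fst x) (snd x)) \<in> borel_measurable (M \<Otimes>\<^sub>M M)"
    and g_one: "(\<integral>\<^sup>+x. g x \<partial>M) = 1"
    and I: "finite I" "i \<in> I" "j \<in> I" "i \<noteq> j"
  shows "(\<integral>\<^sup>+q. h (q i) (q j) * (\<Prod>k\<in>I. g (q k)) \<partial>Pi\<^sub>M I (\<lambda>_. M))
    = (\<integral>\<^sup>+y. \<integral>\<^sup>+x. h x y * g x * g y \<partial>M \<partial>M)"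
proof -
  interpret M: sigma_finite_measure M by fact
  interpret MM: pair_sigma_finite M M ..
  interpret PM: product_sigma_finite "\<lambda>_. M" ..
  define I' where "I' = I - {i}"
  have I': "finite I'" "i \<notin> I'" "j \<in> I'" "I = insert i I'"
    using I by (auto simp: I'_def)
  have comp: "(\<lambda>q. q k) \<in> Pi\<^sub>M I (\<lambda>_. M) \<rightarrow>\<^sub>M M" if "k \<in> I" for k
    by (rule measurable_component_singleton[OF that])
  have hij: "(\<lambda>q. h (q i) (q j)) \<in> borel_measurable (Pi\<^sub>M I (\<lambda>_. M))"
    using measurable_compose[OF measurable_Pair[OF comp[OF I(2)] comp[OF I(3)]] h] by simp
  have prod_meas: "(\<lambda>q. \<Prod>k\<in>I. g (q k)) \<in> borel_measurable (Pi\<^sub>M I (\<lambda>_. M))"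
    by (intro borel_measurable_prod_ennreal measurable_compose[OF comp assms(2)])
  define H where "H y = (\<integral>\<^sup>+x. h x y * g x \<partial>M)" for y
  have hx: "(\<lambda>x. h x y) \<in> borel_measurable M" if "y \<in> space M" for y
    using measurable_compose[OF measurable_Pair[OF measurable_ident measurable_const[OF that]] h] by simp
  have "(\<lambda>z. h (snd z) (fst z) * g (snd z)) \<in> borel_measurable (M \<Otimes>\<^sub>M M)"
    using measurable_compose[OF measurable_Pair[OF measurable_snd measurable_fst] h]
    by (intro borel_measurable_times_ennreal) auto
  then have H_meas [measurable]: "H \<in> borel_measurable M"
    unfolding H_def using M.borel_measurable_nn_integral_fst[of "\<lambda>z. h (snd z) (fst z) * g (snd z)" M] by simp
  have "(\<integral>\<^sup>+q. h (q i) (q j) * (\<Prod>k\<in>I. g (q k)) \<partial>Pi\<^sub>M I (\<lambda>_. M))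
    = (\<integral>\<^sup>+q. \<integral>\<^sup>+x. h ((q(i := x)) i) ((q(i := x)) j) * (\<Prod>k\<in>I. g ((q(i := x)) k)) \<partial>M \<partial>Pi\<^sub>M I' (\<lambda>_. M))"
    unfolding I'(4)
    by (rule PM.product_nn_integral_insert[OF I'(1,2)])
       (use borel_measurable_times_ennreal[OF hij prod_meas] in \<open>simp add: I'(4)\<close>)
  also have "\<dots> = (\<integral>\<^sup>+q. (\<Prod>k\<in>I'. (if k = j then H (q k) * g (q k) else g (q k))) \<partial>Pi\<^sub>M I' (\<lambda>_. M))"
  proof (intro nn_integral_cong)
    fix q assume q: "q \<in> space (Pi\<^sub>M I' (\<lambda>_. M))"
    then have qj: "q j \<in> space M" using I'(3) by (auto simp: space_PiM)
    have "(\<integral>\<^sup>+x. h ((q(i := x)) i) ((q(i := x)) j) * (\<Prod>k\<in>I. g ((q(i := x)) k)) \<partial>M)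
      = (\<integral>\<^sup>+x. (h x (q j) * g x) * (\<Prod>k\<in>I'. g (q k)) \<partial>M)"
    proof (intro nn_integral_cong)
      fix x
      have "(\<Prod>k\<in>I. g ((q(i := x)) k)) = g x * (\<Prod>k\<in>I'. g ((q(i := x)) k))"
        unfolding I'(4) using I'(1,2) by simp
      also have "(\<Prod>k\<in>I'. g ((q(i := x)) k)) = (\<Prod>k\<in>I'. g (q k))"
        using I'(2) by (intro prod.cong) auto
      finally show "h ((q(i := x)) i) ((q(i := x)) j) * (\<Prod>k\<in>I. g ((q(i := x)) k)) = (h x (q j) * g x) * (\<Prod>k\<in>I'. g (q k))"
        using I(4) by (simp add: mult.assoc)
    qed
    also have "\<dots> = H (q j) * (\<Prod>k\<in>I'. g (q k))"
      unfolding H_def using hx[OF qj] by (intro nn_integral_multc) auto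
    also have "\<dots> = (\<Prod>k\<in>I'. (if k = j then H (q k) * g (q k) else g (q k)))"
    proof -
      have "(\<Prod>k\<in>I' - {j}. (if k = j then H (q k) * g (q k) else g (q k))) = (\<Prod>k\<in>I' - {j}. g (q k))"
        by (intro prod.cong) auto
      then show ?thesis
        using I' by (simp add: prod.remove[OF I'(1,3)] mult.assoc)
    qed
    finally show "(\<integral>\<^sup>+x. h ((q(i := x)) i) ((q(i := x)) j) * (\<Prod>k\<in>I. g ((q(i := x)) k)) \<partial>M)
      = (\<Prod>k\<in>I'. (if k = j then H (q k) * g (q k) else g (q k)))" .
  qed
  also have "\<dots> = (\<Prod>k\<in>I'. \<integral>\<^sup>+y. (if k = j then H y * g y else g y) \<partial>M)"
    by (rule PM.product_nn_integral_prod[OF I'(1)]) auto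
  also have "\<dots> = (\<integral>\<^sup>+y. H y * g y \<partial>M)"
  proof -
    have "(\<Prod>k\<in>I' - {j}. \<integral>\<^sup>+y. (if k = j then H y * g y else g y) \<partial>M) = 1"
      by (intro prod.neutral) (auto simp: g_one)
    then show ?thesis using I' by (simp add: prod.remove[OF I'(1,3)])
  qed
  also have "\<dots> = (\<integral>\<^sup>+y. \<integral>\<^sup>+x. h x y * g x * g y \<partial>M \<partial>M)"
    unfolding H_def using hx by (intro nn_integral_cong nn_integral_multc[symmetric]) auto
  finally show ?thesis .
qed

context pair_potential
begin

text \<open>There are \<open>N * (N - 1) / 2\<close> pairs, and by independence each contributes
  \<open>2 * i\<close>.\<close>

lemma nn_integral_W:
  assumes [measurable]: "\<rho> \<in> borel_measurable L" and one: "(\<integral>\<^sup>+q. ennreal (\<rho> q) \<partial>L) = 1"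
    and I: "interaction_energy \<Lambda> U \<rho> = ennreal i" "0 \<le> i"
  shows "(\<integral>\<^sup>+q. W N q * (\<Prod>k<N. ennreal (\<rho> (q k))) \<partial>Q N) \<le> ennreal ((real N)\<^sup>2 * i)"
proof -
  let ?g = "\<lambda>q. \<Prod>k<N. ennreal (\<rho> (q k))"
  have comp: "(\<lambda>q. q k) \<in> Q N \<rightarrow>\<^sub>M L" if "k < N" for k
    by (rule measurable_component_singleton) (use that in auto)
  have g_meas: "?g \<in> borel_measurable (Q N)"
    by (intro borel_measurable_prod_ennreal measurable_compose[OF comp]) auto
  have U_meas: "(\<lambda>q. U (q a) (q b)) \<in> borel_measurable (Q N)" if "a < N" "b < N" for a b
    by (rule measurable_U[OF comp comp]) (fact that)+
  have pair: "(\<integral>\<^sup>+y. \<integral>\<^sup>+x. U x y * ennreal (\<rho> x) * ennreal (\<rho> y) \<partial>L \<partial>L) = ennreal (2 * i)"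
  proof -
    have "(\<integral>\<^sup>+y. \<integral>\<^sup>+x. U x y * ennreal (\<rho> x) * ennreal (\<rho> y) \<partial>L \<partial>L)
      = (\<integral>\<^sup>+y. mean_potential \<Lambda> U \<rho> y * ennreal (\<rho> y) \<partial>L)"
    proof (intro nn_integral_cong)
      fix y assume y: "y \<in> space L"
      have "(\<integral>\<^sup>+x. U x y * ennreal (\<rho> x) * ennreal (\<rho> y) \<partial>L) = (\<integral>\<^sup>+x. U y x * ennreal (\<rho> x) * ennreal (\<rho> y) \<partial>L)"
        by (intro nn_integral_cong) (simp only: U_sym)
      also have "\<dots> = mean_potential \<Lambda> U \<rho> y * ennreal (\<rho> y)"
        unfolding mean_potential_L using y
        by (intro nn_integral_multc borel_measurable_times_ennreal measurable_U_right) auto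
      finally show "(\<integral>\<^sup>+x. U x y * ennreal (\<rho> x) * ennreal (\<rho> y) \<partial>L) = mean_potential \<Lambda> U \<rho> y * ennreal (\<rho> y)" .
    qed
    moreover have "ennreal (1/2) * (\<integral>\<^sup>+y. mean_potential \<Lambda> U \<rho> y * ennreal (\<rho> y) \<partial>L) = ennreal i"
      using interaction_energy_mean_potential[OF assms(1)] I by simp
    then have "(\<integral>\<^sup>+y. mean_potential \<Lambda> U \<rho> y * ennreal (\<rho> y) \<partial>L) = ennreal (2 * i)"
      using I(2) by (rule ennreal_half_mult_eq)
    ultimately show ?thesis by simp
  qed
  have "(\<integral>\<^sup>+q. W N q * ?g q \<partial>Q N) = (\<integral>\<^sup>+q. (\<Sum>b<N. \<Sum>a<b. U (q a) (q b) * ?g q) \<partial>Q N)"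
    by (simp add: W_def sum_distrib_right)
  also have "\<dots> = (\<Sum>b<N. \<Sum>a<b. \<integral>\<^sup>+q. U (q a) (q b) * ?g q \<partial>Q N)"
  proof -
    have m: "(\<lambda>q. U (q a) (q b) * ?g q) \<in> borel_measurable (Q N)" if "b < N" "a < b" for a b
      using that by (intro borel_measurable_times_ennreal[OF U_meas g_meas]) auto
    have "(\<integral>\<^sup>+q. (\<Sum>b<N. \<Sum>a<b. U (q a) (q b) * ?g q) \<partial>Q N) = (\<Sum>b<N. \<integral>\<^sup>+q. (\<Sum>a<b. U (q a) (q b) * ?g q) \<partial>Q N)"
      by (intro nn_integral_sum borel_measurable_sum m) auto
    also have "\<dots> = (\<Sum>b<N. \<Sum>a<b. \<integral>\<^sup>+q. U (q a) (q b) * ?g q \<partial>Q N)"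
      by (intro sum.cong refl nn_integral_sum m) auto
    finally show ?thesis .
  qed
  also have "\<dots> = (\<Sum>b<N. \<Sum>a<b. ennreal (2 * i))"
  proof (intro sum.cong refl)
    fix a b assume "b \<in> {..<N}" "a \<in> {..<b}"
    then have "(\<integral>\<^sup>+q. U (q a) (q b) * ?g q \<partial>Q N) = (\<integral>\<^sup>+y. \<integral>\<^sup>+x. U x y * ennreal (\<rho> x) * ennreal (\<rho> y) \<partial>L \<partial>L)"
      by (intro nn_integral_PiM_two_coordinates[OF sigma_finite_measure_axioms _ measurable_U_pair one]) auto
    then show "(\<integral>\<^sup>+q. U (q a) (q b) * ?g q \<partial>Q N) = ennreal (2 * i)" by (simp only: pair)
  qed
  also have "\<dots> = ennreal (\<Sum>b<N. \<Sum>a<b. 2 * i)"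
    using I(2) by (simp add: sum_ennreal sum_nonneg del: sum_constant)
  also have "(\<Sum>b<N. \<Sum>a<b. 2 * i) = real N * (real N - 1) * i"
    by (induction N) (auto simp: algebra_simps)
  also have "ennreal (real N * (real N - 1) * i) \<le> ennreal ((real N)\<^sup>2 * i)"
    using I(2) by (intro ennreal_leI mult_right_mono) (auto simp: power2_eq_square intro!: mult_left_mono)
  finally show ?thesis .
qed

text \<open>At \<open>l = 0\<close> the moment is 1 and its derivative in \<open>l\<close> is
  \<open>ent \<rho>\<close>, so for small \<open>l\<close> it is below
  \<open>1 + l * (ent \<rho> + \<delta>)\<close>. This is the exponential moment of the Chernoff
  bound; boundedness of \<open>\<rho>\<close> provides the dominating function.\<close>

lemma small_exponent:
  assumes \<rho>: "entropic \<rho>" and bound: "\<And>q. q \<in> \<Lambda> \<Longrightarrow> \<rho> q \<le> B" and "\<delta> > 0"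
  obtains l where "0 < l" "integrable L (\<lambda>q. \<rho> q powr (1 + l))" "(\<integral>q. \<rho> q powr (1 + l) \<partial>L) < exp (l * (ent \<rho> + \<delta>))"
proof -
  have \<rho>_int: "integrable L \<rho>" and \<rho>_nonneg: "\<And>q. q \<in> \<Lambda> \<Longrightarrow> 0 \<le> \<rho> q" and \<rho>_one: "(\<integral>q. \<rho> q \<partial>L) = 1"
    and \<rho>_ln: "integrable L (\<lambda>q. \<rho> q * ln (\<rho> q))"
    using \<rho> by (auto simp: entropic_def)
  have [measurable]: "\<rho> \<in> borel_measurable L" using \<rho>_int by auto
  \<comment> \<open>At least 1, so that its powers with exponent up to 1 stay below it.\<close>
  define B' where "B' = max 1 B"
  have B': "1 \<le> B'" "\<And>q. q \<in> \<Lambda> \<Longrightarrow> \<rho> q \<le> B'" using bound by (auto simp: B'_def le_max_iff_disj)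
  define l where "l n = 1 / real (Suc n)" for n :: nat
  have l: "0 < l n" "l n \<le> 1" for n by (auto simp: l_def)
  have powr_int: "integrable L (\<lambda>q. \<rho> q powr (1 + l n))" for n
  proof (rule integrable_const_bound[where B = "B' powr (1 + l n)"])
    show "AE q in L. norm (\<rho> q powr (1 + l n)) \<le> B' powr (1 + l n)"
      using \<rho>_nonneg B' l[of n] by (intro AE_I2) (auto intro!: powr_mono2)
  qed measurable
  have "(\<lambda>n. \<integral>q. (\<rho> q powr (1 + l n) - \<rho> q) / l n \<partial>L) \<longlonglongrightarrow> (\<integral>q. \<rho> q * ln (\<rho> q) \<partial>L)"
  proof (rule integral_dominated_convergence[where w = "\<lambda>q. B' * \<bar>\<rho> q * ln (\<rho> q)\<bar>"])
    show "integrable L (\<lambda>q. B' * \<bar>\<rho> q * ln (\<rho> q)\<bar>)" using \<rho>_ln by auto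
    show "AE q in L. (\<lambda>n. (\<rho> q powr (1 + l n) - \<rho> q) / l n) \<longlonglongrightarrow> \<rho> q * ln (\<rho> q)"
    proof (rule AE_I2)
      fix q assume q: "q \<in> space L"
      show "(\<lambda>n. (\<rho> q powr (1 + l n) - \<rho> q) / l n) \<longlonglongrightarrow> \<rho> q * ln (\<rho> q)"
      proof (cases "\<rho> q = 0")
        case False
        then have x: "\<rho> q > 0" using \<rho>_nonneg[of q] q by simp
        have "((\<lambda>h. \<rho> q powr (1 + h)) has_real_derivative \<rho> q * ln (\<rho> q)) (at 0)"
          using x by (auto intro!: derivative_eq_intros)
        then have "((\<lambda>h. (\<rho> q powr (1 + h) - \<rho> q) / h) \<longlongrightarrow> \<rho> q * ln (\<rho> q)) (at 0)"
          using x by (simp add: DERIV_def)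
        moreover have "filterlim l (at 0) sequentially"
          unfolding l_def[abs_def] by (rule filterlim_atI[OF LIMSEQ_Suc[OF lim_inverse_n']]) simp
        ultimately show ?thesis by (rule filterlim_compose)
      qed simp
    qed
    show "AE q in L. norm ((\<rho> q powr (1 + l n) - \<rho> q) / l n) \<le> B' * \<bar>\<rho> q * ln (\<rho> q)\<bar>" for n
    proof (rule AE_I2)
      fix q assume q: "q \<in> space L"
      show "norm ((\<rho> q powr (1 + l n) - \<rho> q) / l n) \<le> B' * \<bar>\<rho> q * ln (\<rho> q)\<bar>"
      proof (cases "\<rho> q = 0")
        case False
        then have x: "\<rho> q > 0" using \<rho>_nonneg[of q] q by simp
        have xB: "\<rho> q \<le> B'" using B' q by simp
        define u where "u = l n * ln (\<rho> q)"
        have eu: "exp u = \<rho> q powr l n" using x by (simp add: u_def powr_def)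
        have "exp u \<le> B'"
        proof -
          have "\<rho> q powr l n \<le> B' powr l n" using x xB l[of n] by (intro powr_mono2) auto
          also have "\<dots> \<le> B' powr 1" using B' l[of n] by (intro powr_mono) auto
          finally show ?thesis using B' by (simp add: eu)
        qed
        \<comment> \<open>A Lipschitz bound for the exponential, uniform in \<open>n\<close> because
          \<open>exp u\<close> is a power of \<open>\<rho> q\<close> with exponent at most
          1.\<close>
        have "\<bar>exp u - 1\<bar> \<le> B' * \<bar>u\<bar>"
        proof (cases "u \<ge> 0")
          case True
          have "1 - exp (- u) \<le> u" using exp_ge_add_one_self[of "- u"] by simp
          then have "exp u * (1 - exp (- u)) \<le> B' * u"
            using True \<open>exp u \<le> B'\<close> B'(1) by (intro mult_mono) auto
          then show ?thesis using True by (simp add: exp_minus right_diff_distrib)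
        next
          case False
          then have "exp u \<le> 1" by simp
          then have "\<bar>exp u - 1\<bar> \<le> 1 * \<bar>u\<bar>" using exp_ge_add_one_self[of u] False by linarith
          also have "\<dots> \<le> B' * \<bar>u\<bar>" using B' by (intro mult_right_mono) auto
          finally show ?thesis .
        qed
        then have "\<rho> q * \<bar>exp u - 1\<bar> / l n \<le> \<rho> q * (B' * \<bar>u\<bar>) / l n"
          using x l[of n] by (intro divide_right_mono mult_left_mono) auto
        moreover have "norm ((\<rho> q powr (1 + l n) - \<rho> q) / l n) = \<rho> q * \<bar>exp u - 1\<bar> / l n"
        proof -
          have "\<rho> q powr (1 + l n) - \<rho> q = \<rho> q * (exp u - 1)"
            using x by (simp add: powr_add eu algebra_simps)
          then show ?thesis using x l[of n] by (simp add: abs_mult)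
        qed
        moreover have "\<rho> q * (B' * \<bar>u\<bar>) / l n = B' * \<bar>\<rho> q * ln (\<rho> q)\<bar>"
          using x l[of n] by (simp add: u_def abs_mult)
        ultimately show ?thesis by simp
      qed simp
    qed
  qed measurable
  then have "eventually (\<lambda>n. (\<integral>q. (\<rho> q powr (1 + l n) - \<rho> q) / l n \<partial>L) < ent \<rho> + \<delta>) sequentially"
    using \<open>\<delta> > 0\<close> by (intro order_tendstoD(2)) (auto simp: ent_def)
  then obtain n where "(\<integral>q. (\<rho> q powr (1 + l n) - \<rho> q) / l n \<partial>L) < ent \<rho> + \<delta>"
    by (auto simp: eventually_sequentially)
  then have "((\<integral>q. \<rho> q powr (1 + l n) \<partial>L) - 1) / l n < ent \<rho> + \<delta>"
    using powr_int[of n] \<rho>_int \<rho>_one by simp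
  then have "(\<integral>q. \<rho> q powr (1 + l n) \<partial>L) < 1 + l n * (ent \<rho> + \<delta>)"
    using l[of n] by (simp add: field_simps)
  also have "\<dots> \<le> exp (l n * (ent \<rho> + \<delta>))" by (rule exp_ge_add_one_self)
  finally show ?thesis using that[of "l n"] l powr_int by blast
qed


definition laplace_density :: "real \<Rightarrow> nat \<Rightarrow> (nat \<Rightarrow> real^3) \<Rightarrow> real" where
  "laplace_density \<epsilon> N q = (if W N q = \<infinity> then 0 else if 0 < \<epsilon> - enn2real (W N q) / (real N)\<^sup>2
      then (\<epsilon> - enn2real (W N q) / (real N)\<^sup>2) powr (3/2 * real N - 1) else 0)"

lemma laplace_integral_density: "laplace_integral \<epsilon> N = (\<integral>q. laplace_density \<epsilon> N q \<partial>Q N)"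
  unfolding laplace_integral_def laplace_density_def ..

lemma laplace_density_nonneg: "0 \<le> laplace_density \<epsilon> N q"
  by (simp add: laplace_density_def)

lemma measurable_laplace_density [measurable]: "laplace_density \<epsilon> N \<in> borel_measurable (Q N)"
  unfolding laplace_density_def by measurable

lemma integrable_laplace_density:
  assumes "N \<ge> 1"
  shows "integrable (Q N) (laplace_density \<epsilon> N)"
proof -
  let ?c = "((real N)\<^sup>2) powr (3/2 * real N - 1)"
  have eq: "laplace_density \<epsilon> N = (\<lambda>q. surplus_powr (3/2 * real N - 1) N ((real N)\<^sup>2 * \<epsilon>) q / ?c)"
    using assms by (intro ext) (simp add: surplus_powr_scale laplace_density_def)
  have "integrable (Q N) (surplus_powr (3/2 * real N - 1) N ((real N)\<^sup>2 * \<epsilon>))"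
    using assms by (intro integrable_surplus_powr) simp
  then show ?thesis unfolding eq by (rule integrable_divide)
qed

text \<open>Change of measure: where the product density is at most \<open>exp (N * m)\<close>,
  Lebesgue volume is at least \<open>exp (- N * m)\<close> times probability. Of the total
  probability 1, Markov's inequality removes at most \<open>i / (i + \<delta>)\<close> and the
  Chernoff bound \<open>r ^ N\<close>; half of the remaining
  \<open>\<delta> / (i + \<delta>)\<close> absorbs the latter for large \<open>N\<close>.\<close>

theorem laplace_lower_bound:
  assumes \<rho>: "entropic \<rho>" and bound: "\<And>q. q \<in> \<Lambda> \<Longrightarrow> \<rho> q \<le> B"
    and I: "interaction_energy \<Lambda> U \<rho> = ennreal i" "0 \<le> i" and \<delta>: "\<delta> > 0" "i + \<delta> < \<epsilon>"
  shows "eventually (\<lambda>N. \<delta> / (2 * (i + \<delta>)) * exp (- real N * (ent \<rho> + \<delta>)) * (\<epsilon> - i - \<delta>) powr (3/2 * real N - 1)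
     \<le> laplace_integral \<epsilon> N) sequentially"
proof -
  interpret conf: product_sigma_finite "\<lambda>_::nat. L" ..
  have \<rho>_int: "integrable L \<rho>" and \<rho>_nonneg: "\<And>q. q \<in> \<Lambda> \<Longrightarrow> 0 \<le> \<rho> q" and \<rho>_one: "(\<integral>q. \<rho> q \<partial>L) = 1"
    using \<rho> by (auto simp: entropic_def)
  have \<rho>_meas [measurable]: "\<rho> \<in> borel_measurable L" using \<rho>_int by auto
  have one: "(\<integral>\<^sup>+q. ennreal (\<rho> q) \<partial>L) = 1"
    using \<rho>_nonneg by (subst nn_integral_eq_integral[OF \<rho>_int]) (auto simp: \<rho>_one)
  obtain l where l: "0 < l" "integrable L (\<lambda>q. \<rho> q powr (1 + l))"
    "(\<integral>q. \<rho> q powr (1 + l) \<partial>L) < exp (l * (ent \<rho> + \<delta>))"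
    by (rule small_exponent[OF \<rho> bound \<delta>(1)])
  define m where "m = ent \<rho> + \<delta>"
  define r where "r = exp (- l * m) * (\<integral>q. \<rho> q powr (1 + l) \<partial>L)"
  have r: "0 \<le> r" "r < 1"
  proof -
    show "0 \<le> r" unfolding r_def by (intro mult_nonneg_nonneg integral_nonneg_AE AE_I2) auto
    have "r < exp (- l * m) * exp (l * m)"
      unfolding r_def using l(3) by (intro mult_strict_left_mono) (auto simp: m_def)
    also have "\<dots> = 1" by (simp flip: exp_add)
    finally show "r < 1" .
  qed
  define s where "s = \<epsilon> - i - \<delta>"
  have s: "s > 0" using \<delta> by (simp add: s_def)
  have i\<delta>: "i + \<delta> > 0" using \<delta> I(2) by simp
  have main: "(\<delta> / (i + \<delta>) - r ^ N) * exp (- real N * m) * s powr (3/2 * real N - 1) \<le> laplace_integral \<epsilon> N" if N: "N \<ge> 1" for N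
  proof -
    define p where "p q = (\<Prod>k<N. \<rho> (q k))" for q
    define \<pi> where "\<pi> q = (\<Prod>k<N. ennreal (\<rho> (q k)))" for q
    \<comment> \<open>The product density times its ratio to \<open>exp (N * m)\<close> raised to
      the power \<open>l\<close>; it dominates \<open>\<pi>\<close> wherever that ratio exceeds
      1.\<close>
    define \<tau> where "\<tau> q = (\<Prod>k<N. ennreal (exp (- l * m) * \<rho> (q k) powr (1 + l)))" for q
    define t where "t = ennreal ((real N)\<^sup>2 * (i + \<delta>))"
    have N2: "(real N)\<^sup>2 > 0" using N by simp
    have comp: "(\<lambda>q. q k) \<in> Q N \<rightarrow>\<^sub>M L" if "k \<in> {..<N}" for k
      by (rule measurable_component_singleton[OF that])
    have \<rho>k: "(\<lambda>q. \<rho> (q k)) \<in> borel_measurable (Q N)" if "k \<in> {..<N}" for k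
      by (rule measurable_compose[OF comp[OF that] \<rho>_meas])
    have p_meas [measurable]: "p \<in> borel_measurable (Q N)"
      unfolding p_def by (intro borel_measurable_prod \<rho>k)
    have \<pi>_meas [measurable]: "\<pi> \<in> borel_measurable (Q N)"
      unfolding \<pi>_def by (intro borel_measurable_prod_ennreal measurable_compose[OF \<rho>k measurable_ennreal])
    have \<tau>_factor: "(\<lambda>x. ennreal (exp (- l * m) * \<rho> x powr (1 + l))) \<in> borel_measurable L" by measurable
    have \<tau>_meas [measurable]: "\<tau> \<in> borel_measurable (Q N)"
      unfolding \<tau>_def by (intro borel_measurable_prod_ennreal measurable_compose[OF comp \<tau>_factor])
    have q_dom: "q k \<in> \<Lambda>" if "q \<in> space (Q N)" "k < N" for q k
      using that by (auto simp: space_PiM)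
    have p_nonneg: "0 \<le> p q" if "q \<in> space (Q N)" for q
      unfolding p_def using q_dom[OF that] \<rho>_nonneg by (intro prod_nonneg) auto
    have \<pi>_p: "\<pi> q = ennreal (p q)" if "q \<in> space (Q N)" for q
      unfolding p_def \<pi>_def using q_dom[OF that] \<rho>_nonneg by (intro prod_ennreal) auto
    have \<tau>_p: "\<tau> q = ennreal (exp (- l * m * real N) * p q powr (1 + l))" if "q \<in> space (Q N)" for q
    proof -
      have "\<tau> q = ennreal (\<Prod>k<N. exp (- l * m) * \<rho> (q k) powr (1 + l))"
        unfolding \<tau>_def by (intro prod_ennreal) auto
      also have "(\<Prod>k<N. exp (- l * m) * \<rho> (q k) powr (1 + l)) = exp (- l * m * real N) * p q powr (1 + l)"
      proof -
        have "exp (- l * m) ^ N = exp (- l * m * real N)"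
          by (simp add: mult.commute flip: exp_of_nat_mult)
        moreover have "p q powr (1 + l) = (\<Prod>k<N. \<rho> (q k) powr (1 + l))"
          unfolding p_def using q_dom[OF that] \<rho>_nonneg by (intro prod_powr_distrib)
        ultimately show ?thesis by (simp add: prod.distrib)
      qed
      finally show ?thesis .
    qed
    have \<pi>_one: "(\<integral>\<^sup>+q. \<pi> q \<partial>Q N) = 1"
      unfolding \<pi>_def by (subst conf.product_nn_integral_prod) (auto simp: one)
    have \<tau>_int: "(\<integral>\<^sup>+q. \<tau> q \<partial>Q N) = ennreal (r ^ N)"
    proof -
      have "(\<integral>\<^sup>+x. ennreal (exp (- l * m) * \<rho> x powr (1 + l)) \<partial>L) = ennreal r"
        unfolding r_def using l(2) by (subst nn_integral_eq_integral) auto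
      then show ?thesis
        unfolding \<tau>_def using r(1)
        by (subst conf.product_nn_integral_prod) (auto simp: ennreal_power)
    qed
    define G where "G = {q \<in> space (Q N). W N q < t \<and> p q \<le> exp (real N * m)}"
    have G_sets [measurable]: "G \<in> sets (Q N)" unfolding G_def by measurable
    define X where "X = (\<integral>\<^sup>+q. \<pi> q * indicator G q \<partial>Q N)"
    have W_int: "(\<integral>\<^sup>+q. ennreal (1 / ((real N)\<^sup>2 * (i + \<delta>))) * (W N q * \<pi> q) \<partial>Q N) \<le> ennreal (i / (i + \<delta>))"
    proof -
      have "(\<integral>\<^sup>+q. ennreal (1 / ((real N)\<^sup>2 * (i + \<delta>))) * (W N q * \<pi> q) \<partial>Q N)
        = ennreal (1 / ((real N)\<^sup>2 * (i + \<delta>))) * (\<integral>\<^sup>+q. W N q * \<pi> q \<partial>Q N)"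
        by (intro nn_integral_cmult borel_measurable_times_ennreal measurable_W \<pi>_meas)
      also have "\<dots> \<le> ennreal (1 / ((real N)\<^sup>2 * (i + \<delta>))) * ennreal ((real N)\<^sup>2 * i)"
        unfolding \<pi>_def by (intro mult_left_mono nn_integral_W \<rho>_meas one I) simp
      also have "\<dots> = ennreal (i / (i + \<delta>))"
        using N2 i\<delta> I(2) by (subst ennreal_mult[symmetric]) auto
      finally show ?thesis .
    qed
    \<comment> \<open>A pointwise union bound: a configuration is good, or has too much energy, or
      too large a density.\<close>
    have "\<pi> q \<le> \<pi> q * indicator G q + (ennreal (1 / ((real N)\<^sup>2 * (i + \<delta>))) * (W N q * \<pi> q) + \<tau> q)"
      if q: "q \<in> space (Q N)" for q
    proof -
      consider "q \<in> G" | "t \<le> W N q" | "exp (real N * m) < p q"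
        using q unfolding G_def mem_Collect_eq by (meson not_le)
      then show ?thesis
      proof cases
        case 1
        then show ?thesis by (simp add: add_increasing2)
      next
        case 2
        have "1 = ennreal (1 / ((real N)\<^sup>2 * (i + \<delta>))) * t"
          unfolding t_def using N2 i\<delta> by (subst ennreal_mult[symmetric]) auto
        also have "\<dots> \<le> ennreal (1 / ((real N)\<^sup>2 * (i + \<delta>))) * W N q"
          by (intro mult_left_mono 2) simp
        finally have "1 * \<pi> q \<le> ennreal (1 / ((real N)\<^sup>2 * (i + \<delta>))) * W N q * \<pi> q"
          by (intro mult_right_mono) auto
        then show ?thesis by (simp add: mult.assoc add_increasing add_increasing2)
      next
        case 3
        have pos: "0 < p q" using 3 by (rule less_trans[OF exp_gt_zero])
        have "real N * m \<le> ln (p q)" using 3 pos by (subst ln_ge_iff) auto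
        then have "l * (real N * m) \<le> l * ln (p q)" using l(1) by (intro mult_left_mono) auto
        then have "1 \<le> exp (- l * m * real N + l * ln (p q))" by (simp add: algebra_simps)
        then have "p q * 1 \<le> p q * exp (- l * m * real N + l * ln (p q))"
          using pos by (intro mult_left_mono) auto
        also have "\<dots> = exp (- l * m * real N) * p q powr (1 + l)"
          unfolding exp_add using pos by (simp add: powr_def distrib_right exp_add mult_ac)
        finally have "\<pi> q \<le> \<tau> q" unfolding \<pi>_p[OF q] \<tau>_p[OF q] by (intro ennreal_leI) simp
        then show ?thesis by (simp add: add_increasing)
      qed
    qed
    then have "(\<integral>\<^sup>+q. \<pi> q \<partial>Q N) \<le> (\<integral>\<^sup>+q. \<pi> q * indicator G q + (ennreal (1 / ((real N)\<^sup>2 * (i + \<delta>))) * (W N q * \<pi> q) + \<tau> q) \<partial>Q N)"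
      by (rule nn_integral_mono)
    also have "\<dots> = X + ((\<integral>\<^sup>+q. ennreal (1 / ((real N)\<^sup>2 * (i + \<delta>))) * (W N q * \<pi> q) \<partial>Q N) + ennreal (r ^ N))"
    proof -
      have a: "(\<lambda>q. ennreal (1 / ((real N)\<^sup>2 * (i + \<delta>))) * (W N q * \<pi> q)) \<in> borel_measurable (Q N)"
        by (intro borel_measurable_times_ennreal measurable_const measurable_W \<pi>_meas) simp
      have b: "(\<lambda>q. \<pi> q * indicator G q) \<in> borel_measurable (Q N)"
        by (intro borel_measurable_times_ennreal \<pi>_meas borel_measurable_indicator G_sets)
      show ?thesis
        unfolding X_def \<tau>_int[symmetric]
        using nn_integral_add[OF b borel_measurable_add[OF a \<tau>_meas]] nn_integral_add[OF a \<tau>_meas] by simp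
    qed
    also have "\<dots> \<le> X + (ennreal (i / (i + \<delta>)) + ennreal (r ^ N))"
      by (intro add_left_mono add_right_mono W_int)
    finally have X_ge: "1 \<le> X + (ennreal (i / (i + \<delta>)) + ennreal (r ^ N))" by (simp add: \<pi>_one)
    have "X \<le> (\<integral>\<^sup>+q. \<pi> q \<partial>Q N)"
      unfolding X_def by (intro nn_integral_mono) (auto simp: indicator_def)
    then have "X < \<infinity>" unfolding \<pi>_one by (rule le_less_trans) simp
    then obtain x where x: "X = ennreal x" "0 \<le> x" by (cases X) auto
    have "ennreal 1 \<le> ennreal (x + (i / (i + \<delta>) + r ^ N))"
      using X_ge x(2) i\<delta> I(2) r(1) by (simp add: x(1) ennreal_plus)
    then have "1 \<le> x + (i / (i + \<delta>) + r ^ N)"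
      using x(2) i\<delta> I(2) r(1) by (subst (asm) ennreal_le_iff) auto
    moreover have "1 - i / (i + \<delta>) = \<delta> / (i + \<delta>)" using i\<delta> by (simp add: field_simps)
    ultimately have x_ge: "\<delta> / (i + \<delta>) - r ^ N \<le> x" by linarith
    define K where "K = exp (- real N * m) * s powr (3/2 * real N - 1)"
    have K: "0 \<le> K" by (simp add: K_def)
    have "ennreal K * X = (\<integral>\<^sup>+q. ennreal K * (\<pi> q * indicator G q) \<partial>Q N)"
      unfolding X_def by (intro nn_integral_cmult[symmetric] borel_measurable_times_ennreal \<pi>_meas borel_measurable_indicator G_sets)
    also have "\<dots> \<le> (\<integral>\<^sup>+q. ennreal (laplace_density \<epsilon> N q) \<partial>Q N)"
    proof (intro nn_integral_mono)
      fix q assume q: "q \<in> space (Q N)"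
      show "ennreal K * (\<pi> q * indicator G q) \<le> ennreal (laplace_density \<epsilon> N q)"
      proof (cases "q \<in> G")
        case True
        then have W: "W N q < t" and p: "p q \<le> exp (real N * m)" by (auto simp: G_def)
        obtain w where w: "W N q = ennreal w" "0 \<le> w" using W by (cases "W N q") (auto simp: t_def)
        have "w < (real N)\<^sup>2 * (i + \<delta>)" using W w by (simp add: t_def ennreal_less_iff)
        then have "w / (real N)\<^sup>2 < i + \<delta>" using N2 by (simp add: divide_less_eq mult.commute)
        then have sw: "s \<le> \<epsilon> - w / (real N)\<^sup>2" by (simp add: s_def)
        then have "s powr (3/2 * real N - 1) \<le> laplace_density \<epsilon> N q"
          using s N w by (auto simp: laplace_density_def intro!: powr_mono2)
        moreover have "exp (- real N * m) * p q \<le> 1"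
        proof -
          have "exp (- real N * m) * p q \<le> exp (- real N * m) * exp (real N * m)"
            by (intro mult_left_mono p) simp
          then show ?thesis by (simp flip: exp_add)
        qed
        ultimately have "(exp (- real N * m) * p q) * s powr (3/2 * real N - 1) \<le> 1 * laplace_density \<epsilon> N q"
          using p_nonneg[OF q] by (intro mult_mono) auto
        then have "K * p q \<le> laplace_density \<epsilon> N q" by (simp add: K_def mult_ac)
        then have "ennreal (K * p q) \<le> ennreal (laplace_density \<epsilon> N q)" by (rule ennreal_leI)
        then show ?thesis
          using True K p_nonneg[OF q] by (simp add: \<pi>_p[OF q] ennreal_mult)
      qed simp
    qed
    also have "\<dots> = ennreal (laplace_integral \<epsilon> N)"
      unfolding laplace_integral_density
      by (intro nn_integral_eq_integral integrable_laplace_density N AE_I2 laplace_density_nonneg)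
    finally have "ennreal (K * x) \<le> ennreal (laplace_integral \<epsilon> N)"
      using K x by (simp add: ennreal_mult)
    moreover have "0 \<le> laplace_integral \<epsilon> N"
      unfolding laplace_integral_density by (intro integral_nonneg_AE AE_I2 laplace_density_nonneg)
    ultimately have "K * x \<le> laplace_integral \<epsilon> N" by (simp add: ennreal_le_iff)
    moreover have "K * (\<delta> / (i + \<delta>) - r ^ N) \<le> K * x" by (intro mult_left_mono x_ge K)
    ultimately have "K * (\<delta> / (i + \<delta>) - r ^ N) \<le> laplace_integral \<epsilon> N" by linarith
    then show ?thesis by (simp only: K_def mult_ac)
  qed
  have "(\<lambda>N. r ^ N) \<longlonglongrightarrow> 0" using r by (intro LIMSEQ_realpow_zero)
  then have "eventually (\<lambda>N. r ^ N < \<delta> / (2 * (i + \<delta>))) sequentially"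
    using \<delta>(1) i\<delta> by (intro order_tendstoD(2)) auto
  then show ?thesis
    using eventually_ge_at_top[of 1]
  proof eventually_elim
    case (elim N)
    have half: "\<delta> / (2 * (i + \<delta>)) = 1/2 * y" if "y = \<delta> / (i + \<delta>)" for y
      using that by simp
    have "\<delta> / (2 * (i + \<delta>)) \<le> y - r ^ N" if "y = \<delta> / (i + \<delta>)" for y
      using elim(1) unfolding half[OF that] by linarith
    then have "\<delta> / (2 * (i + \<delta>)) \<le> \<delta> / (i + \<delta>) - r ^ N" by blast
    then have "\<delta> / (2 * (i + \<delta>)) * exp (- real N * m) * s powr (3/2 * real N - 1)
      \<le> (\<delta> / (i + \<delta>) - r ^ N) * exp (- real N * m) * s powr (3/2 * real N - 1)"
      by (intro mult_right_mono) auto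
    also have "\<dots> \<le> laplace_integral \<epsilon> N" using main elim(2) by blast
    finally show ?case by (simp only: m_def s_def)
  qed
qed

end

section \<open>The upper bound\<close>

lemma sum_pairs_symmetric:
  fixes f :: "nat \<Rightarrow> nat \<Rightarrow> real"
  assumes "\<And>a b. f a b = f b a"
  shows "2 * (\<Sum>b<N. \<Sum>a<b. f a b) = (\<Sum>a<N. \<Sum>b<N. f a b) - (\<Sum>a<N. f a a)"
proof (induction N)
  case (Suc N)
  have "(\<Sum>a<Suc N. \<Sum>b<Suc N. f a b) = (\<Sum>a<N. \<Sum>b<N. f a b) + (\<Sum>a<N. f a N) + ((\<Sum>b<N. f N b) + f N N)"
    by (simp add: sum.distrib)
  moreover have "(\<Sum>b<N. f N b) = (\<Sum>a<N. f a N)" using assms by (intro sum.cong) auto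
  ultimately show ?case using Suc.IH by simp
qed simp

context pair_potential
begin

lemma cellU_sym: "cellU j a b = cellU j b a"
  unfolding cellU_def by (subst INF_commute) (simp only: U_sym)

lemma cell_energy_mono:
  assumes \<rho>: "entropic \<rho>" and "j \<le> i"
  shows "cell_energy j \<rho> \<le> cell_energy i \<rho>"
proof -
  have \<rho>': "integrable L \<rho>" "\<And>q. q \<in> \<Lambda> \<Longrightarrow> 0 \<le> \<rho> q" using \<rho> by (auto simp: entropic_def)
  have "(\<integral>\<^sup>+q. (\<integral>\<^sup>+q'. ennreal (1/2) * cellU j (cell j q) (cell j q') * ennreal (\<rho> q) * ennreal (\<rho> q') \<partial>L) \<partial>L)
    \<le> (\<integral>\<^sup>+q. (\<integral>\<^sup>+q'. ennreal (1/2) * cellU i (cell i q) (cell i q') * ennreal (\<rho> q) * ennreal (\<rho> q') \<partial>L) \<partial>L)"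
    by (intro nn_integral_mono mult_mono order_refl cellU_mono assms(2)) auto
  then have "ennreal (cell_energy j \<rho>) \<le> ennreal (cell_energy i \<rho>)"
    by (simp only: cell_energy_nn_integral[OF \<rho>'])
  then show ?thesis using cell_energy_nonneg[OF \<rho>] by (simp add: ennreal_le_iff)
qed

definition occupation :: "nat \<Rightarrow> nat \<Rightarrow> (nat \<Rightarrow> real^3) \<Rightarrow> int \<times> int \<times> int \<Rightarrow> real" where
  "occupation k N q a = (\<Sum>n<N. of_bool (cell k (q n) = a))"

lemma sum_occupation:
  fixes h :: "int \<times> int \<times> int \<Rightarrow> real"
  assumes "\<And>n. n < N \<Longrightarrow> q n \<in> \<Lambda>"
  shows "(\<Sum>n<N. h (cell k (q n))) = (\<Sum>a\<in>cell k ` \<Lambda>. occupation k N q a * h a)"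
proof -
  have "(\<Sum>a\<in>cell k ` \<Lambda>. occupation k N q a * h a) = (\<Sum>a\<in>cell k ` \<Lambda>. \<Sum>n<N. if cell k (q n) = a then h a else 0)"
    unfolding occupation_def sum_distrib_right by (intro sum.cong refl) auto
  also have "\<dots> = (\<Sum>n<N. \<Sum>a\<in>cell k ` \<Lambda>. if cell k (q n) = a then h a else 0)"
    by (rule sum.swap)
  also have "\<dots> = (\<Sum>n<N. h (cell k (q n)))"
    using finite_cells[OF bounded_dom] assms by (intro sum.cong refl) simp
  finally show ?thesis by simp
qed

text \<open>The sum over pairs is half of the full double sum minus the diagonal, and the full sum
  depends on the configuration only through the occupation numbers. The cap in \<open>cellU\<close>
  bounds each of the \<open>N\<close> diagonal terms by \<open>k\<close>.\<close>

lemma W_lower_bound: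
  assumes q: "\<And>n. n < N \<Longrightarrow> q n \<in> \<Lambda>" and W: "W N q = ennreal w" "0 \<le> w"
  shows "(\<Sum>a\<in>cell k ` \<Lambda>. (\<Sum>b\<in>cell k ` \<Lambda>. 1/2 * enn2real (cellU k a b) * occupation k N q b) * occupation k N q a)
    - real k * real N / 2 \<le> w"
proof -
  define u where "u a b = enn2real (cellU k (cell k (q a)) (cell k (q b)))" for a b
  have u_le: "u a b \<le> real k" for a b
    unfolding u_def using cellU_le_level[of k] by (intro enn2real_leI) (auto simp: ennreal_of_nat_eq_real_of_nat)
  have "ennreal (\<Sum>b<N. \<Sum>a<b. u a b) = (\<Sum>b<N. \<Sum>a<b. cellU k (cell k (q a)) (cell k (q b)))"
    by (simp add: sum_ennreal[symmetric] sum_nonneg u_def cellU_finite)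
  also have "\<dots> \<le> W N q"
    unfolding W_def using q by (intro sum_mono cellU_le) auto
  finally have "(\<Sum>b<N. \<Sum>a<b. u a b) \<le> w" using W by (simp add: ennreal_le_iff)
  moreover have "2 * (\<Sum>b<N. \<Sum>a<b. u a b) = (\<Sum>a<N. \<Sum>b<N. u a b) - (\<Sum>a<N. u a a)"
    by (rule sum_pairs_symmetric) (simp only: u_def cellU_sym)
  moreover have "(\<Sum>a<N. u a a) \<le> real N * real k"
    using sum_bounded_above[of "{..<N}" "\<lambda>a. u a a" "real k"] u_le by simp
  moreover have "(\<Sum>a<N. \<Sum>b<N. u a b) = 2 * (\<Sum>a\<in>cell k ` \<Lambda>. (\<Sum>b\<in>cell k ` \<Lambda>. 1/2 * enn2real (cellU k a b) * occupation k N q b) * occupation k N q a)"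
  proof -
    have "(\<Sum>a<N. \<Sum>b<N. u a b) = (\<Sum>a<N. (\<lambda>c. \<Sum>b\<in>cell k ` \<Lambda>. occupation k N q b * enn2real (cellU k c b)) (cell k (q a)))"
      unfolding u_def using sum_occupation[OF q, where k = k] by (intro sum.cong refl) simp
    also have "\<dots> = (\<Sum>a\<in>cell k ` \<Lambda>. occupation k N q a * (\<Sum>b\<in>cell k ` \<Lambda>. occupation k N q b * enn2real (cellU k a b)))"
      by (rule sum_occupation[OF q])
    also have "\<dots> = 2 * (\<Sum>a\<in>cell k ` \<Lambda>. (\<Sum>b\<in>cell k ` \<Lambda>. 1/2 * enn2real (cellU k a b) * occupation k N q b) * occupation k N q a)"
      unfolding sum_distrib_left sum_distrib_right by (intro sum.cong refl) (simp add: mult_ac)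
    finally show ?thesis .
  qed
  ultimately show ?thesis by (simp add: mult.commute)
qed

text \<open>The number of occupation vectors is at most a power of \<open>N + 1\<close>, hence
  subexponential, so the integral is governed by the best of them. Its frequencies define a step
  density \<open>\<rho>\<close>; the product of \<open>\<rho>\<close> over the particles is
  constant, equal to \<open>exp (N * ent \<rho>)\<close>, on the configurations of that type and has
  total mass 1, which bounds their volume.\<close>

theorem laplace_upper_bound:
  assumes N: "N \<ge> 1" and pos: "laplace_integral \<epsilon> N > 0"
  obtains \<rho> where "entropic \<rho>" "0 < \<epsilon> - cell_energy k \<rho> + real k / (2 * real N)"
    "ln (laplace_integral \<epsilon> N) \<le> real (card (cell k ` \<Lambda>)) * ln (real N + 1) - real N * ent \<rho>
      + (3/2 * real N - 1) * ln (\<epsilon> - cell_energy k \<rho> + real k / (2 * real N))"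
proof -
  interpret conf: product_sigma_finite "\<lambda>_::nat. L" ..
  interpret QN: finite_measure "Q N" by (rule finite_measure_Q)
  define A where "A = cell k ` \<Lambda>"
  have A: "finite A" unfolding A_def by (rule finite_cells[OF bounded_dom])
  define T where "T = Pi\<^sub>E A (\<lambda>_. real ` {..N})"
  have T: "finite T" "card T = (N + 1) ^ card A"
    unfolding T_def using A by (auto intro!: finite_PiE simp: card_PiE card_image)
  define S where "S \<nu> = {q \<in> space (Q N). \<forall>a\<in>A. occupation k N q a = \<nu> a}" for \<nu>
  have q_dom: "q n \<in> \<Lambda>" if "q \<in> space (Q N)" "n < N" for q n
    using that by (auto simp: space_PiM)
  have comp: "(\<lambda>q. q n) \<in> Q N \<rightarrow>\<^sub>M L" if "n \<in> {..<N}" for n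
    by (rule measurable_component_singleton[OF that])
  have of_bool_cell: "(\<lambda>x. of_bool (cell k x = a) :: real) \<in> borel_measurable L" for a
    by (rule measurable_step)
  have occ_meas: "(\<lambda>q. occupation k N q a) \<in> borel_measurable (Q N)" for a
    unfolding occupation_def by (intro borel_measurable_sum measurable_compose[OF comp of_bool_cell])
  have S_sets [measurable]: "S \<nu> \<in> sets (Q N)" for \<nu>
    unfolding S_def using A
    by (intro sets.sets_Collect_finite_All borel_measurable_eq[OF occ_meas]) auto
  have occ_range: "occupation k N q a \<in> real ` {..N}" for q a
  proof -
    have "occupation k N q a = real (card {n \<in> {..<N}. cell k (q n) = a})"
      unfolding occupation_def by (simp add: sum_of_bool_eq Int_def)
    moreover have "card {n \<in> {..<N}. cell k (q n) = a} \<le> N"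
      using card_mono[of "{..<N}" "{n \<in> {..<N}. cell k (q n) = a}"] by auto
    ultimately show ?thesis by auto
  qed
  have ld_int: "integrable (Q N) (laplace_density \<epsilon> N)" by (rule integrable_laplace_density[OF N])
  have ldS_int: "integrable (Q N) (\<lambda>q. laplace_density \<epsilon> N q * indicator (S \<nu>) q)" for \<nu>
    by (rule integrable_real_mult_indicator[OF S_sets ld_int])
  have decomp: "laplace_density \<epsilon> N q = (\<Sum>\<nu>\<in>T. laplace_density \<epsilon> N q * indicator (S \<nu>) q)" if q: "q \<in> space (Q N)" for q
  proof -
    let ?\<nu> = "\<lambda>a\<in>A. occupation k N q a"
    have \<nu>T: "?\<nu> \<in> T" using occ_range by (auto simp: T_def)
    have "indicator (S \<nu>) q = (if \<nu> = ?\<nu> then 1 else 0 :: real)" if "\<nu> \<in> T" for \<nu>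
    proof -
      have "q \<in> S \<nu> \<longleftrightarrow> \<nu> = ?\<nu>"
      proof
        assume "q \<in> S \<nu>"
        then show "\<nu> = ?\<nu>" using that by (intro ext) (auto simp: S_def T_def PiE_iff extensional_def)
      qed (use q in \<open>auto simp: S_def\<close>)
      then show ?thesis by (simp add: indicator_def)
    qed
    then have "(\<Sum>\<nu>\<in>T. laplace_density \<epsilon> N q * indicator (S \<nu>) q) = (\<Sum>\<nu>\<in>T. if \<nu> = ?\<nu> then laplace_density \<epsilon> N q else 0)"
      by (intro sum.cong refl) auto
    then show ?thesis using T(1) \<nu>T by simp
  qed
  define J where "J \<nu> = (\<integral>q. laplace_density \<epsilon> N q * indicator (S \<nu>) q \<partial>Q N)" for \<nu>
  have J_sum: "laplace_integral \<epsilon> N = (\<Sum>\<nu>\<in>T. J \<nu>)"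
    unfolding laplace_integral_density J_def
    by (subst Bochner_Integration.integral_cong[OF refl decomp], assumption)
       (simp add: Bochner_Integration.integral_sum ldS_int)
  \<comment> \<open>Some type contributes at least the average.\<close>
  have "\<exists>\<nu>\<in>T. laplace_integral \<epsilon> N \<le> real (card T) * J \<nu>"
  proof (rule ccontr)
    assume "\<not> ?thesis"
    then have less: "\<And>\<nu>. \<nu> \<in> T \<Longrightarrow> real (card T) * J \<nu> < laplace_integral \<epsilon> N" by auto
    have ne: "T \<noteq> {}" using T(2) by auto
    have "(\<Sum>\<nu>\<in>T. real (card T) * J \<nu>) < (\<Sum>\<nu>\<in>T. laplace_integral \<epsilon> N)"
      by (rule sum_strict_mono[OF T(1) ne less])
    then show False unfolding sum_distrib_left[symmetric] J_sum[symmetric] by simp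
  qed
  then obtain \<nu> where \<nu>: "\<nu> \<in> T" "laplace_integral \<epsilon> N \<le> real (card T) * J \<nu>" by blast
  have cardT: "real (card T) > 0" using T(2) by simp
  have J_pos: "J \<nu> > 0"
    using \<nu>(2) pos cardT by (metis less_le_trans zero_less_mult_pos)
  \<comment> \<open>A configuration of this type with finite energy and positive surplus; it shows
    below that \<open>t\<close> is positive, so that its logarithm makes sense.\<close>
  have "\<exists>q0\<in>S \<nu>. laplace_density \<epsilon> N q0 \<noteq> 0"
  proof (rule ccontr)
    assume "\<not> ?thesis"
    then have "J \<nu> = (\<integral>q. 0 \<partial>Q N)"
      unfolding J_def by (intro Bochner_Integration.integral_cong) (auto simp: indicator_def)
    then show False using J_pos by simp
  qed
  then obtain q0 where q0: "q0 \<in> S \<nu>" "laplace_density \<epsilon> N q0 \<noteq> 0" by blast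
  have q0_space: "q0 \<in> space (Q N)" and q0_\<nu>: "\<And>a. a \<in> A \<Longrightarrow> occupation k N q0 a = \<nu> a"
    using q0(1) by (auto simp: S_def)
  have \<nu>_nonneg: "0 \<le> \<nu> a" if "a \<in> A" for a
    unfolding q0_\<nu>[OF that, symmetric] occupation_def by (intro sum_nonneg) auto
  have \<nu>_sum: "(\<Sum>a\<in>A. \<nu> a) = real N"
    using sum_occupation[of N q0 "\<lambda>_. 1" k] q_dom[OF q0_space] q0_\<nu> by (simp add: A_def)
  \<comment> \<open>Particles almost surely avoid a cell of volume 0. Otherwise \<open>G\<close>,
    where division by 0 gives 0, would lose the mass of that cell.\<close>
  have \<nu>_zero: "\<nu> a = 0" if a: "a \<in> A" "vol k a = 0" for a
  proof (rule ccontr)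
    assume "\<nu> a \<noteq> 0"
    have "AE q in Q N. cell k (q n) \<noteq> a" if n: "n < N" for n
    proof -
      let ?g = "\<lambda>j x. if j = n then of_bool (cell k x = a) else 1 :: ennreal"
      have g_meas: "?g j \<in> borel_measurable L" for j
        by (cases "j = n") (auto intro!: measurable_compose[OF measurable_cell_L])
      have "(\<integral>\<^sup>+x. of_bool (cell k x = a) \<partial>L) = emeasure L {x \<in> space L. cell k x = a}"
        by (rule emeasure_eq_nn_integral_of_bool[OF measurable_cell, symmetric])
      also have "\<dots> = 0" using a(2) by (simp add: vol_def emeasure_eq_measure del: space_L)
      finally have zero: "integral\<^sup>N L (?g n) = 0" by simp
      have "(\<integral>\<^sup>+q. of_bool (cell k (q n) = a) \<partial>Q N) = (\<integral>\<^sup>+q. (\<Prod>j<N. ?g j (q j)) \<partial>Q N)"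
        using n by (intro nn_integral_cong) (simp add: prod.delta)
      also have "\<dots> = (\<Prod>j<N. integral\<^sup>N L (?g j))"
        by (intro conf.product_nn_integral_prod g_meas) auto
      also have "\<dots> = 0"
        using n by (intro prod_zero bexI[where x = n] zero) auto
      finally have "(\<integral>\<^sup>+q. of_bool (cell k (q n) = a) \<partial>Q N) = 0" .
      moreover have "(\<lambda>q. of_bool (cell k (q n) = a) :: ennreal) \<in> borel_measurable (Q N)"
        using n by (intro measurable_compose[OF comp] measurable_compose[OF measurable_cell_L]) auto
      ultimately have "AE q in Q N. (of_bool (cell k (q n) = a) :: ennreal) = 0"
        by (subst (asm) nn_integral_0_iff_AE) auto
      then show ?thesis by eventually_elim simp
    qed
    then have "AE q in Q N. \<forall>n\<in>{..<N}. cell k (q n) \<noteq> a"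
      by (intro AE_finite_allI) auto
    then have "AE q in Q N. laplace_density \<epsilon> N q * indicator (S \<nu>) q = 0"
    proof eventually_elim
      case (elim q)
      then have "occupation k N q a = 0" by (simp add: occupation_def)
      then show ?case using a(1) \<open>\<nu> a \<noteq> 0\<close> by (auto simp: S_def indicator_def)
    qed
    then have "J \<nu> = 0" unfolding J_def by (rule integral_eq_zero_AE)
    then show False using J_pos by simp
  qed
  have N0: "real N > 0" using N by simp
  define G where "G a = \<nu> a / (real N * vol k a)" for a
  have G_vol: "G a * vol k a = \<nu> a / real N" if "a \<in> A" for a
    using \<nu>_zero[OF that] N0 by (cases "vol k a = 0") (auto simp: G_def)
  have G_nonneg: "0 \<le> G a" if "a \<in> A" for a
    unfolding G_def using \<nu>_nonneg[OF that] vol_nonneg[of k a] by (intro divide_nonneg_nonneg) auto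
  define \<rho> where "\<rho> x = G (cell k x)" for x
  have cell_A: "cell k x \<in> A" if "x \<in> \<Lambda>" for x using that by (simp add: A_def)
  have \<rho>: "entropic \<rho>"
  proof (rule entropic_bounded)
    show "\<rho> \<in> borel_measurable L" unfolding \<rho>_def[abs_def] by (rule measurable_step)
    show "0 \<le> \<rho> q" if "q \<in> \<Lambda>" for q unfolding \<rho>_def by (rule G_nonneg[OF cell_A[OF that]])
    show "\<rho> q \<le> (\<Sum>a\<in>A. G a)" if "q \<in> \<Lambda>" for q
      unfolding \<rho>_def using G_nonneg by (intro member_le_sum cell_A that A) auto
    have "(\<integral>q. \<rho> q \<partial>L) = (\<Sum>a\<in>A. G a * vol k a)"
      unfolding \<rho>_def A_def using integral_step_vol[of G k] by simp
    also have "\<dots> = (\<Sum>a\<in>A. \<nu> a) / real N"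
      unfolding sum_divide_distrib by (intro sum.cong refl G_vol)
    finally show "(\<integral>q. \<rho> q \<partial>L) = 1" using \<nu>_sum N0 by simp
  qed
  have ent_\<rho>: "real N * ent \<rho> = (\<Sum>a\<in>A. \<nu> a * ln (G a))"
  proof -
    have "ent \<rho> = (\<Sum>a\<in>A. G a * ln (G a) * vol k a)"
      unfolding ent_def \<rho>_def A_def using integral_step_vol[of "\<lambda>a. G a * ln (G a)" k] by simp
    also have "\<dots> = (\<Sum>a\<in>A. \<nu> a / real N * ln (G a))"
      by (intro sum.cong refl) (simp add: G_vol[symmetric] mult_ac)
    finally show ?thesis using N0 by (simp add: sum_distrib_left)
  qed
  have mass_\<rho>: "mass \<rho> k a = \<nu> a / real N" if "a \<in> A" for a
  proof -
    have "mass \<rho> k a = (\<integral>x. (\<lambda>b. of_bool (b = a) * G b) (cell k x) \<partial>L)"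
      unfolding mass_def \<rho>_def by (intro Bochner_Integration.integral_cong) (auto simp: indicator_def)
    also have "\<dots> = (\<Sum>b\<in>A. of_bool (b = a) * G b * vol k b)"
      unfolding A_def using integral_step_vol[of "\<lambda>b. of_bool (b = a) * G b" k] by simp
    also have "\<dots> = (\<Sum>b\<in>A. if b = a then G b * vol k b else 0)" by (intro sum.cong) auto
    also have "\<dots> = G a * vol k a" using A that by simp
    finally show ?thesis using G_vol[OF that] by simp
  qed
  \<comment> \<open>The term \<open>k / (2 * N)\<close> is the diagonal correction
    \<open>k * N / 2\<close> divided by N^2.\<close>
  define t where "t = \<epsilon> - cell_energy k \<rho> + real k / (2 * real N)"
  have surplus: "\<epsilon> - enn2real (W N q) / (real N)\<^sup>2 \<le> t" if q: "q \<in> S \<nu>" "W N q \<noteq> \<infinity>" for q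
  proof -
    obtain w where w: "W N q = ennreal w" "0 \<le> w" using q(2) by (cases "W N q") auto
    have qs: "q \<in> space (Q N)" and occ: "\<And>a. a \<in> A \<Longrightarrow> occupation k N q a = \<nu> a" using q(1) by (auto simp: S_def)
    have "(\<Sum>a\<in>A. (\<Sum>b\<in>A. 1/2 * enn2real (cellU k a b) * occupation k N q b) * occupation k N q a)
        = (real N)\<^sup>2 * cell_energy k \<rho>"
      unfolding cell_energy_def A_def[symmetric] sum_distrib_left sum_distrib_right
      using N0 by (intro sum.cong refl) (simp add: occ mass_\<rho> power2_eq_square)
    then have "(real N)\<^sup>2 * cell_energy k \<rho> - real k * real N / 2 \<le> w"
      using W_lower_bound[OF q_dom[OF qs] w, of k] by (simp add: A_def)
    then have "((real N)\<^sup>2 * cell_energy k \<rho> - real k * real N / 2) / (real N)\<^sup>2 \<le> w / (real N)\<^sup>2"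
      by (intro divide_right_mono) auto
    moreover have "((real N)\<^sup>2 * cell_energy k \<rho> - real k * real N / 2) / (real N)\<^sup>2 = cell_energy k \<rho> - real k / (2 * real N)"
      using N0 by (simp add: diff_divide_distrib power2_eq_square)
    ultimately show ?thesis using w by (simp add: t_def)
  qed
  have "W N q0 \<noteq> \<infinity>" and "0 < \<epsilon> - enn2real (W N q0) / (real N)\<^sup>2"
    using q0(2) by (auto simp: laplace_density_def split: if_splits)
  then have t: "t > 0" using surplus[OF q0(1)] by linarith
  have ld_le: "laplace_density \<epsilon> N q \<le> t powr (3/2 * real N - 1)" if "q \<in> S \<nu>" for q
    using surplus[OF that] N by (auto simp: laplace_density_def intro!: powr_mono2)
  have vol_S: "measure (Q N) (S \<nu>) \<le> exp (- real N * ent \<rho>)"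
  proof -
    have "ennreal (exp (real N * ent \<rho>)) * emeasure (Q N) (S \<nu>) = (\<integral>\<^sup>+q. ennreal (exp (real N * ent \<rho>)) * indicator (S \<nu>) q \<partial>Q N)"
      by (rule nn_integral_cmult_indicator[symmetric]) (rule S_sets)
    also have "\<dots> \<le> (\<integral>\<^sup>+q. (\<Prod>n<N. ennreal (\<rho> (q n))) \<partial>Q N)"
    proof (intro nn_integral_mono)
      fix q assume qs: "q \<in> space (Q N)"
      show "ennreal (exp (real N * ent \<rho>)) * indicator (S \<nu>) q \<le> (\<Prod>n<N. ennreal (\<rho> (q n)))"
      proof (cases "q \<in> S \<nu>")
        case True
        then have occ: "\<And>a. a \<in> A \<Longrightarrow> occupation k N q a = \<nu> a" by (auto simp: S_def)
        have pos: "0 < \<rho> (q n)" if n: "n < N" for n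
        proof -
          let ?a = "cell k (q n)"
          have a: "?a \<in> A" by (rule cell_A[OF q_dom[OF qs n]])
          have "of_bool (cell k (q n) = ?a) \<le> occupation k N q ?a"
            unfolding occupation_def using n by (intro member_le_sum) auto
          then have "\<nu> ?a > 0" using occ[OF a] by simp
          moreover from this have "vol k ?a > 0" using \<nu>_zero[OF a] vol_nonneg[of k ?a] by (auto simp: less_le)
          ultimately show ?thesis using N0 by (simp add: \<rho>_def G_def)
        qed
        have "exp (real N * ent \<rho>) = exp (\<Sum>n<N. ln (G (cell k (q n))))"
          using sum_occupation[OF q_dom[OF qs], where h = "\<lambda>a. ln (G a)" and k = k] occ by (simp add: ent_\<rho> A_def)
        also have "\<dots> = (\<Prod>n<N. exp (ln (\<rho> (q n))))" by (simp add: exp_sum \<rho>_def)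
        also have "\<dots> = (\<Prod>n<N. \<rho> (q n))" by (intro prod.cong refl) (use pos in auto)
        finally have eq: "exp (real N * ent \<rho>) = (\<Prod>n<N. \<rho> (q n))" .
        have "ennreal (exp (real N * ent \<rho>)) = (\<Prod>n<N. ennreal (\<rho> (q n)))"
          unfolding eq using pos by (intro prod_ennreal[symmetric] less_imp_le) auto
        then show ?thesis by (simp add: indicator_def)
      qed simp
    qed
    also have "\<dots> = (\<Prod>n<N. \<integral>\<^sup>+x. ennreal (\<rho> x) \<partial>L)"
      using \<rho> by (intro conf.product_nn_integral_prod) (auto simp: entropic_def)
    also have "(\<integral>\<^sup>+x. ennreal (\<rho> x) \<partial>L) = 1"
      using \<rho> by (subst nn_integral_eq_integral) (auto simp: entropic_def)
    finally have "ennreal (exp (real N * ent \<rho>) * measure (Q N) (S \<nu>)) \<le> ennreal 1"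
      by (simp add: QN.emeasure_eq_measure ennreal_mult)
    then have "exp (real N * ent \<rho>) * measure (Q N) (S \<nu>) \<le> 1" by (simp add: ennreal_le_iff)
    then show ?thesis by (simp add: exp_minus field_simps)
  qed
  have "J \<nu> \<le> (\<integral>q. t powr (3/2 * real N - 1) * indicator (S \<nu>) q \<partial>Q N)"
    unfolding J_def
  proof (rule integral_mono[OF ldS_int])
    show "integrable (Q N) (\<lambda>q. t powr (3/2 * real N - 1) * indicator (S \<nu>) q)"
      by (intro integrable_mult_right integrable_real_indicator S_sets) (simp add: less_top[symmetric])
    show "laplace_density \<epsilon> N q * indicator (S \<nu>) q \<le> t powr (3/2 * real N - 1) * indicator (S \<nu>) q" for q
      using ld_le[of q] by (auto simp: indicator_def)
  qed
  also have "\<dots> = t powr (3/2 * real N - 1) * measure (Q N) (S \<nu>)"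
    using sets.sets_into_space[OF S_sets, of \<nu>] by (simp add: Int_absorb2)
  also have "\<dots> \<le> t powr (3/2 * real N - 1) * exp (- real N * ent \<rho>)"
    by (intro mult_left_mono vol_S) simp
  finally have "laplace_integral \<epsilon> N \<le> real (card T) * (t powr (3/2 * real N - 1) * exp (- real N * ent \<rho>))"
    using \<nu>(2) cardT by (meson mult_left_mono less_imp_le order_trans)
  then have "ln (laplace_integral \<epsilon> N) \<le> ln (real (card T) * (t powr (3/2 * real N - 1) * exp (- real N * ent \<rho>)))"
    using pos by (intro ln_mono) auto
  also have "\<dots> = ln (real (card T)) + (ln (t powr (3/2 * real N - 1)) + ln (exp (- real N * ent \<rho>)))"
    using cardT t by (subst ln_mult_pos, simp, simp, subst ln_mult_pos) auto
  also have "ln (real (card T)) = real (card A) * ln (real N + 1)"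
    unfolding T(2) using N0 by (simp add: ln_realpow add.commute)
  also have "ln (t powr (3/2 * real N - 1)) = (3/2 * real N - 1) * ln t" using t by (simp add: ln_powr)
  finally show ?thesis
    using that[OF \<rho>] t by (simp add: t_def A_def)
qed

end

section \<open>The microcanonical entropy\<close>

context pair_potential
begin

lemma interaction_energy_cong:
  assumes [measurable]: "\<rho> \<in> borel_measurable L" "\<sigma> \<in> borel_measurable L" and "AE q in L. \<rho> q = \<sigma> q"
  shows "interaction_energy \<Lambda> U \<rho> = interaction_energy \<Lambda> U \<sigma>"
  unfolding interaction_energy_mean_potential[OF assms(1)] interaction_energy_mean_potential[OF assms(2)]
    mean_potential_cong[OF assms(3)]
  by (intro arg_cong[where f = "\<lambda>x. ennreal (1/2) * x"] nn_integral_cong_AE, use assms(3) in eventually_elim) simp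

lemma boltzmann_factor_bounds:
  assumes "\<theta> > 0"
  shows "0 \<le> boltzmann_factor \<theta> u" "boltzmann_factor \<theta> u \<le> 1"
  using assms by (auto simp: boltzmann_factor_def)

text \<open>The fixed point equation holds almost everywhere, so its right side is taken as the
  representative of \<open>\<rho>\<close>. Potential, energy and temperature do not see the change
  on a null set, hence the equation then holds at every point; the new representative is also
  bounded by \<open>1 / Z\<close>, as the lower bound for the Laplace integral requires.\<close>

lemma minimizer_pointwise:
  assumes f: "H_minimizer \<Lambda> U \<epsilon> f" and \<epsilon>: "\<epsilon> > 0"
  obtains \<rho> B where "entropic \<rho>" "interaction_energy \<Lambda> U \<rho> < ennreal \<epsilon>" "boltzmann_H \<Lambda> f = reduced_H \<epsilon> \<rho>"
    "AE x in P. f x = maxwellian (vartheta \<Lambda> U \<epsilon> \<rho>) (fst x) * \<rho> (snd x)"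
    "\<And>\<sigma>. entropic \<sigma> \<Longrightarrow> interaction_energy \<Lambda> U \<sigma> < ennreal \<epsilon> \<Longrightarrow> reduced_H \<epsilon> \<rho> \<le> reduced_H \<epsilon> \<sigma>"
    "\<And>q. q \<in> \<Lambda> \<Longrightarrow> \<rho> q \<le> B"
    "\<And>q. \<rho> q = boltzmann_factor (vartheta \<Lambda> U \<epsilon> \<rho>) (mean_potential \<Lambda> U \<rho> q) /
                 (\<integral>r. boltzmann_factor (vartheta \<Lambda> U \<epsilon> \<rho>) (mean_potential \<Lambda> U \<rho> r) \<partial>L)"
proof -
  obtain \<rho>\<^sub>0 where \<rho>\<^sub>0: "entropic \<rho>\<^sub>0" "interaction_energy \<Lambda> U \<rho>\<^sub>0 < ennreal \<epsilon>" "boltzmann_H \<Lambda> f = reduced_H \<epsilon> \<rho>\<^sub>0"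
    "AE x in P. f x = maxwellian (vartheta \<Lambda> U \<epsilon> \<rho>\<^sub>0) (fst x) * \<rho>\<^sub>0 (snd x)"
    "\<And>\<sigma>. entropic \<sigma> \<Longrightarrow> interaction_energy \<Lambda> U \<sigma> < ennreal \<epsilon> \<Longrightarrow> reduced_H \<epsilon> \<rho>\<^sub>0 \<le> reduced_H \<epsilon> \<sigma>"
    using minimizer_reduction[OF f \<epsilon>] by blast
  define \<theta> where "\<theta> = vartheta \<Lambda> U \<epsilon> \<rho>\<^sub>0"
  have \<theta>: "\<theta> > 0" unfolding \<theta>_def by (rule vartheta_pos[OF \<rho>\<^sub>0(2)])
  define Z where "Z = (\<integral>r. boltzmann_factor \<theta> (mean_potential \<Lambda> U \<rho>\<^sub>0 r) \<partial>L)"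
  define \<rho> where "\<rho> q = boltzmann_factor \<theta> (mean_potential \<Lambda> U \<rho>\<^sub>0 q) / Z" for q
  have Z: "Z > 0" and eq: "AE q in L. \<rho>\<^sub>0 q = \<rho> q"
    using fixed_point_equation[OF \<rho>\<^sub>0(1,2,5)] by (simp_all add: Z_def \<rho>_def \<theta>_def)
  have meas0 [measurable]: "\<rho>\<^sub>0 \<in> borel_measurable L" using \<rho>\<^sub>0(1) by (auto simp: entropic_def)
  have [measurable]: "mean_potential \<Lambda> U \<rho>\<^sub>0 \<in> borel_measurable L"
    by (rule measurable_mean_potential[OF meas0])
  have meas [measurable]: "\<rho> \<in> borel_measurable L"
    unfolding \<rho>_def boltzmann_factor_def by measurable
  have bounds: "0 \<le> \<rho> q" "\<rho> q \<le> 1 / Z" for q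
    unfolding \<rho>_def using boltzmann_factor_bounds[OF \<theta>] Z by (auto intro: divide_right_mono)
  have "(\<integral>q. \<rho> q \<partial>L) = (\<integral>q. \<rho>\<^sub>0 q \<partial>L)"
    using eq by (intro integral_cong_AE) auto
  then have ent: "entropic \<rho>"
    using bounds \<rho>\<^sub>0(1) by (intro entropic_bounded[where B = "1 / Z"]) (auto simp: entropic_def)
  have I: "interaction_energy \<Lambda> U \<rho> = interaction_energy \<Lambda> U \<rho>\<^sub>0"
    by (rule interaction_energy_cong[OF meas0 meas eq, symmetric])
  have V: "mean_potential \<Lambda> U \<rho> q = mean_potential \<Lambda> U \<rho>\<^sub>0 q" for q
    by (rule mean_potential_cong[OF eq, symmetric])
  have \<theta>': "vartheta \<Lambda> U \<epsilon> \<rho> = \<theta>" by (simp add: vartheta_def I \<theta>_def)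
  have "ent \<rho> = ent \<rho>\<^sub>0"
    unfolding ent_def
  proof (rule integral_cong_AE)
    show "AE q in L. \<rho> q * ln (\<rho> q) = \<rho>\<^sub>0 q * ln (\<rho>\<^sub>0 q)"
      using eq by eventually_elim simp
  qed measurable
  then have H: "reduced_H \<epsilon> \<rho> = reduced_H \<epsilon> \<rho>\<^sub>0" by (simp add: reduced_H_def \<theta>' \<theta>_def)
  have "AE x in P. \<rho>\<^sub>0 (snd x) = \<rho> (snd x)"
  proof (rule PL.AE_pair_measure)
    show "{x \<in> space P. \<rho>\<^sub>0 (snd x) = \<rho> (snd x)} \<in> sets P" by measurable
  qed (use eq in auto)
  with \<rho>\<^sub>0(4) have "AE x in P. f x = maxwellian (vartheta \<Lambda> U \<epsilon> \<rho>) (fst x) * \<rho> (snd x)"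
    by eventually_elim (simp add: \<theta>' \<theta>_def)
  moreover have "\<rho> q = boltzmann_factor (vartheta \<Lambda> U \<epsilon> \<rho>) (mean_potential \<Lambda> U \<rho> q) /
                 (\<integral>r. boltzmann_factor (vartheta \<Lambda> U \<epsilon> \<rho>) (mean_potential \<Lambda> U \<rho> r) \<partial>L)" for q
    unfolding \<theta>' V by (simp add: \<rho>_def Z_def)
  ultimately show ?thesis
    using ent \<rho>\<^sub>0(2,3,5) bounds(2) by (intro that[of \<rho> "1 / Z"]) (simp_all add: I H)
qed

text \<open>The lower half lets \<open>\<delta>\<close> tend to 0. The upper half is by
  contradiction: if the rate were at least some \<open>a > M\<close> infinitely often, then for
  every level \<open>k\<close> some large \<open>N\<close> would yield a step density that almost
  achieves \<open>a\<close>, with its energy measured at level \<open>k\<close>. A limit of these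
  densities would beat the minimizer.\<close>

theorem laplace_limit:
  assumes \<rho>: "entropic \<rho>" and energy: "interaction_energy \<Lambda> U \<rho> < ennreal \<epsilon>" and \<epsilon>: "\<epsilon> > 0"
    and bound: "\<And>q. q \<in> \<Lambda> \<Longrightarrow> \<rho> q \<le> B"
    and min: "\<And>\<sigma>. entropic \<sigma> \<Longrightarrow> interaction_energy \<Lambda> U \<sigma> < ennreal \<epsilon> \<Longrightarrow> reduced_H \<epsilon> \<rho> \<le> reduced_H \<epsilon> \<sigma>"
  defines "M \<equiv> - ent \<rho> + 3/2 * ln (\<epsilon> - enn2real (interaction_energy \<Lambda> U \<rho>))"
  shows "eventually (\<lambda>N. laplace_integral \<epsilon> N > 0) sequentially"
    and "(\<lambda>N. ln (laplace_integral \<epsilon> N) / real N) \<longlonglongrightarrow> M"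
proof -
  define i where "i = enn2real (interaction_energy \<Lambda> U \<rho>)"
  have i: "interaction_energy \<Lambda> U \<rho> = ennreal i" "0 \<le> i"
    using ennreal_enn2real[OF less_trans[OF energy ennreal_less_top]] by (simp_all add: i_def)
  have i_less: "i < \<epsilon>" using energy i by (simp add: ennreal_less_iff)
  have lower: "\<exists>c>0. eventually (\<lambda>N. c * exp (- real N * (ent \<rho> + \<delta>)) * (\<epsilon> - i - \<delta>) powr (3/2 * real N - 1) \<le> laplace_integral \<epsilon> N) sequentially"
    if "0 < \<delta>" "i + \<delta> < \<epsilon>" for \<delta>
    using laplace_lower_bound[OF \<rho> bound i that] that i(2)
    by (intro exI[of _ "\<delta> / (2 * (i + \<delta>))"] conjI) auto
  show pos: "eventually (\<lambda>N. laplace_integral \<epsilon> N > 0) sequentially"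
  proof -
    \<comment> \<open>For positivity any value strictly between 0 and \<open>\<epsilon> - i\<close>
      will do.\<close>
    define \<delta> where "\<delta> = (\<epsilon> - i) / 2"
    have \<delta>: "0 < \<delta>" "i + \<delta> < \<epsilon>" using i_less by (auto simp: \<delta>_def field_simps)
    obtain c where c: "c > 0" "eventually (\<lambda>N. c * exp (- real N * (ent \<rho> + \<delta>)) * (\<epsilon> - i - \<delta>) powr (3/2 * real N - 1) \<le> laplace_integral \<epsilon> N) sequentially"
      using lower[OF \<delta>] by blast
    from c(2) show ?thesis
    proof eventually_elim
      case (elim N)
      have "0 < c * exp (- real N * (ent \<rho> + \<delta>)) * (\<epsilon> - i - \<delta>) powr (3/2 * real N - 1)"
        using c(1) \<delta> by (intro mult_pos_pos) auto
      then show ?case using elim by linarith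
    qed
  qed
  show "(\<lambda>N. ln (laplace_integral \<epsilon> N) / real N) \<longlonglongrightarrow> M"
  proof (rule order_tendstoI)
    fix a assume a: "a < M"
    have "((\<lambda>\<delta>. - (ent \<rho> + \<delta>) + 3/2 * ln (\<epsilon> - i - \<delta>)) \<longlongrightarrow> - (ent \<rho> + 0) + 3/2 * ln (\<epsilon> - i - 0)) (at_right 0)"
      using i_less by (intro tendsto_intros) auto
    then have "eventually (\<lambda>\<delta>. a < - (ent \<rho> + \<delta>) + 3/2 * ln (\<epsilon> - i - \<delta>)) (at_right 0)"
      using a by (intro order_tendstoD(1)) (auto simp: M_def i_def)
    moreover have "eventually (\<lambda>\<delta>. \<delta> \<in> {0<..<\<epsilon> - i}) (at_right 0)"
      using i_less by (intro eventually_at_right_real) auto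
    ultimately have "eventually (\<lambda>\<delta>. a < - (ent \<rho> + \<delta>) + 3/2 * ln (\<epsilon> - i - \<delta>) \<and> \<delta> \<in> {0<..<\<epsilon> - i}) (at_right 0)"
      by (rule eventually_conj)
    then have "\<exists>\<delta>. a < - (ent \<rho> + \<delta>) + 3/2 * ln (\<epsilon> - i - \<delta>) \<and> \<delta> \<in> {0<..<\<epsilon> - i}"
      by (rule eventually_happens'[OF trivial_limit_at_right_real])
    then obtain \<delta> where "a < - (ent \<rho> + \<delta>) + 3/2 * ln (\<epsilon> - i - \<delta>)" "\<delta> \<in> {0<..<\<epsilon> - i}" by blast
    then have \<delta>: "a < - (ent \<rho> + \<delta>) + 3/2 * ln (\<epsilon> - i - \<delta>)" "0 < \<delta>" "i + \<delta> < \<epsilon>" by auto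
    obtain c where c: "c > 0" "eventually (\<lambda>N. c * exp (- real N * (ent \<rho> + \<delta>)) * (\<epsilon> - i - \<delta>) powr (3/2 * real N - 1) \<le> laplace_integral \<epsilon> N) sequentially"
      using lower[OF \<delta>(2,3)] by blast
    define s where "s = \<epsilon> - i - \<delta>"
    have s: "s > 0" using \<delta> by (simp add: s_def)
    have "(\<lambda>N. ln c / real N - (ent \<rho> + \<delta>) + (3/2 - 1 / real N) * ln s) \<longlonglongrightarrow> 0 - (ent \<rho> + \<delta>) + (3/2 - 0) * ln s"
      by (intro tendsto_intros lim_const_over_n)
    then have "eventually (\<lambda>N. a < ln c / real N - (ent \<rho> + \<delta>) + (3/2 - 1 / real N) * ln s) sequentially"
      using \<delta>(1) by (intro order_tendstoD(1)) (auto simp: s_def)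
    then show "eventually (\<lambda>N. a < ln (laplace_integral \<epsilon> N) / real N) sequentially"
      using c(2) eventually_ge_at_top[of 1]
    proof eventually_elim
      case (elim N)
      have N: "real N > 0" using elim by simp
      have "ln c + (- real N * (ent \<rho> + \<delta>) + (3/2 * real N - 1) * ln s) = ln (c * exp (- real N * (ent \<rho> + \<delta>)) * s powr (3/2 * real N - 1))"
        using c(1) s by (simp add: ln_mult_pos ln_powr)
      also have "\<dots> \<le> ln (laplace_integral \<epsilon> N)"
        using elim(2) c(1) s by (intro ln_mono) (auto simp: s_def)
      finally have "(ln c + (- real N * (ent \<rho> + \<delta>) + (3/2 * real N - 1) * ln s)) / real N \<le> ln (laplace_integral \<epsilon> N) / real N"
        using N by (intro divide_right_mono) auto
      moreover have "(ln c + (- real N * (ent \<rho> + \<delta>) + (3/2 * real N - 1) * ln s)) / real N = ln c / real N - (ent \<rho> + \<delta>) + (3/2 - 1 / real N) * ln s"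
        using N by (simp add: field_simps)
      ultimately show ?case using elim(1) by linarith
    qed
  next
    fix a assume a: "M < a"
    show "eventually (\<lambda>N. ln (laplace_integral \<epsilon> N) / real N < a) sequentially"
    proof (rule ccontr)
      assume "\<not> ?thesis"
      then have freq: "frequently (\<lambda>N. a \<le> ln (laplace_integral \<epsilon> N) / real N) sequentially"
        by (simp add: not_eventually not_less)
      \<comment> \<open>\<open>N\<close> is taken so large for the given \<open>k\<close> that the
        contribution of the number of types and the diagonal correction are below
        \<open>1 / real (Suc k)\<close>; \<open>k + 2 \<le> N\<close> makes \<open>1 / N\<close> at
        most 1/2 and forces it to 0.\<close>
      have "\<exists>N \<rho>. k + 2 \<le> N \<and> real k / (2 * real N) \<le> 1 / real (Suc k) \<and> entropic \<rho> \<and>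
          0 < \<epsilon> - cell_energy k \<rho> + real k / (2 * real N) \<and>
          a - 1 / real (Suc k) \<le> - ent \<rho> + (3/2 - 1 / real N) * ln (\<epsilon> - cell_energy k \<rho> + real k / (2 * real N))" for k
      proof -
        define C where "C = real (card (cell k ` \<Lambda>))"
        have "(\<lambda>N. C * ln (real N + 1) / real N) \<longlonglongrightarrow> 0" "(\<lambda>N. real k / (2 * real N)) \<longlonglongrightarrow> 0"
          by real_asymp+
        then have "eventually (\<lambda>N. C * ln (real N + 1) / real N < 1 / real (Suc k)) sequentially"
          "eventually (\<lambda>N. real k / (2 * real N) < 1 / real (Suc k)) sequentially"
          by (auto intro!: order_tendstoD(2))
        then have "eventually (\<lambda>N. C * ln (real N + 1) / real N < 1 / real (Suc k) \<and> real k / (2 * real N) < 1 / real (Suc k)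
            \<and> k + 2 \<le> N \<and> laplace_integral \<epsilon> N > 0) sequentially"
          using eventually_ge_at_top[of "k + 2"] pos by eventually_elim auto
        from frequently_ex[OF frequently_eventually_frequently[OF freq this]]
        obtain N where N: "a \<le> ln (laplace_integral \<epsilon> N) / real N" "C * ln (real N + 1) / real N < 1 / real (Suc k)"
          "real k / (2 * real N) < 1 / real (Suc k)" "k + 2 \<le> N" "laplace_integral \<epsilon> N > 0" by blast
        have N1: "N \<ge> 1" "real N > 0" using N(4) by auto
        obtain \<rho>' where \<rho>': "entropic \<rho>'" "0 < \<epsilon> - cell_energy k \<rho>' + real k / (2 * real N)"
          "ln (laplace_integral \<epsilon> N) \<le> C * ln (real N + 1) - real N * ent \<rho>'
            + (3/2 * real N - 1) * ln (\<epsilon> - cell_energy k \<rho>' + real k / (2 * real N))"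
          unfolding C_def by (rule laplace_upper_bound[OF N1(1) N(5)])
        define t where "t = \<epsilon> - cell_energy k \<rho>' + real k / (2 * real N)"
        have "a \<le> (C * ln (real N + 1) - real N * ent \<rho>' + (3/2 * real N - 1) * ln t) / real N"
          using N(1) \<rho>'(3) N1(2) unfolding t_def[symmetric] by (meson divide_right_mono less_imp_le order_trans)
        also have "\<dots> = C * ln (real N + 1) / real N - ent \<rho>' + (3/2 - 1 / real N) * ln t"
          using N1(2) by (simp add: field_simps)
        finally have "a - 1 / real (Suc k) \<le> - ent \<rho>' + (3/2 - 1 / real N) * ln t"
          using N(2) by linarith
        then show ?thesis using N(3,4) \<rho>'(1,2) unfolding t_def by (intro exI[of _ N] exI[of _ \<rho>']) auto
      qed
      then obtain n \<sigma> where n: "\<And>k. k + 2 \<le> n k" "\<And>k. real k / (2 * real (n k)) \<le> 1 / real (Suc k)"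
        and \<sigma>: "\<And>k. entropic (\<sigma> k)" "\<And>k. 0 < \<epsilon> - cell_energy k (\<sigma> k) + real k / (2 * real (n k))"
          "\<And>k. a - 1 / real (Suc k) \<le> - ent (\<sigma> k) + (3/2 - 1 / real (n k)) * ln (\<epsilon> - cell_energy k (\<sigma> k) + real k / (2 * real (n k)))"
        by metis
      have inv: "(\<lambda>k. 1 / real (Suc k)) \<longlonglongrightarrow> 0" by (rule LIMSEQ_Suc[OF lim_inverse_n'])
      have n_inv: "(\<lambda>k. 1 / real (n k)) \<longlonglongrightarrow> 0"
      proof (rule Lim_null_comparison[OF _ inv], intro always_eventually allI)
        fix k
        have "real (Suc k) \<le> real (n k)" using n(1)[of k] by linarith
        then show "norm (1 / real (n k)) \<le> 1 / real (Suc k)" by (simp add: frac_le)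
      qed
      obtain \<tau> where \<tau>: "entropic \<tau>" "interaction_energy \<Lambda> U \<tau> < ennreal \<epsilon>"
        "a \<le> - ent \<tau> + 3/2 * ln (\<epsilon> - enn2real (interaction_energy \<Lambda> U \<tau>))"
      proof (rule maximizing_limit[where \<rho> = \<sigma> and \<epsilon> = \<epsilon> and T = "\<epsilon> + 1" and A' = a
            and t = "\<lambda>k. \<epsilon> - cell_energy k (\<sigma> k) + real k / (2 * real (n k))"
            and u = "\<lambda>k. real k / (2 * real (n k))" and \<kappa> = "\<lambda>k. 3/2 - 1 / real (n k)"
            and A = "\<lambda>k. a - 1 / real (Suc k)"])
        show "entropic (\<sigma> k)" "0 < \<epsilon> - cell_energy k (\<sigma> k) + real k / (2 * real (n k))"
          "a - 1 / real (Suc k) \<le> - ent (\<sigma> k) + (3/2 - 1 / real (n k)) * ln (\<epsilon> - cell_energy k (\<sigma> k) + real k / (2 * real (n k)))" for k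
          by (rule \<sigma>)+
        show "\<epsilon> - cell_energy k (\<sigma> k) + real k / (2 * real (n k)) \<le> \<epsilon> + 1" for k
        proof -
          have "1 / real (Suc k) \<le> 1" by simp
          then show ?thesis using n(2)[of k] cell_energy_nonneg[OF \<sigma>(1), of k k] by linarith
        qed
        \<comment> \<open>The levels increase with \<open>k\<close>, so the energy at any fixed
          level \<open>i\<close> is eventually at most the one at level \<open>k\<close>.\<close>
        show "eventually (\<lambda>k. cell_energy i (\<sigma> k) \<le> \<epsilon> - (\<epsilon> - cell_energy k (\<sigma> k) + real k / (2 * real (n k))) + real k / (2 * real (n k))) sequentially" for i
          using eventually_ge_at_top[of i] by eventually_elim (use cell_energy_mono[OF \<sigma>(1)] in simp)
        show "(\<lambda>k. real k / (2 * real (n k))) \<longlonglongrightarrow> 0"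
          by (rule Lim_null_comparison[OF _ inv], intro always_eventually allI) (use n(2) in simp)
        have n_half: "1 / real (n k) \<le> 1/2" for k
        proof -
          have "2 \<le> real (n k)" using n(1)[of k] by linarith
          then show ?thesis by (simp add: field_simps)
        qed
        then show "1 \<le> 3/2 - 1 / real (n k)" for k by (simp add: algebra_simps)
        show "3/2 - 1 / real (n k) \<le> 2" for k
        proof -
          have "0 \<le> 1 / real (n k)" by simp
          then show ?thesis by linarith
        qed
        show "(\<lambda>k. 3/2 - 1 / real (n k)) \<longlonglongrightarrow> 3/2"
          using tendsto_diff[OF tendsto_const[of "3/2"] n_inv] by simp
        show "(\<lambda>k. a - 1 / real (Suc k)) \<longlonglongrightarrow> a"
          using tendsto_diff[OF tendsto_const[of a] inv] by simp
        show "\<epsilon> > 0" by (rule \<epsilon>)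
      qed
      have "- ent \<tau> + 3/2 * ln (\<epsilon> - enn2real (interaction_energy \<Lambda> U \<tau>)) \<le> M"
        using min[OF \<tau>(1,2)] unfolding reduced_H_eq[OF energy] reduced_H_eq[OF \<tau>(2)] M_def by linarith
      then show False using \<tau>(3) a by linarith
    qed
  qed
qed

theorem entropy_limit:
  assumes f: "H_minimizer \<Lambda> U \<epsilon> f" and \<epsilon>: "\<epsilon> > 0"
  shows "(\<lambda>N. ergodic_entropy \<Lambda> U N ((real N)\<^sup>2 * \<epsilon>) -
    (- real N * ln (real N) + real N * (- boltzmann_H \<Lambda> f))) \<in> o(\<lambda>N. real N)"
proof -
  obtain \<rho> B where \<rho>: "entropic \<rho>" "interaction_energy \<Lambda> U \<rho> < ennreal \<epsilon>" "boltzmann_H \<Lambda> f = reduced_H \<epsilon> \<rho>"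
    "\<And>\<sigma>. entropic \<sigma> \<Longrightarrow> interaction_energy \<Lambda> U \<sigma> < ennreal \<epsilon> \<Longrightarrow> reduced_H \<epsilon> \<rho> \<le> reduced_H \<epsilon> \<sigma>"
    and B: "\<And>q. q \<in> \<Lambda> \<Longrightarrow> \<rho> q \<le> B"
    using minimizer_pointwise[OF f \<epsilon>] by metis
  have "- boltzmann_H \<Lambda> f = - ent \<rho> + 3/2 * ln (\<epsilon> - enn2real (interaction_energy \<Lambda> U \<rho>)) + 3/2 * ln (4/3 * pi) + 5/2"
    unfolding \<rho>(3) reduced_H_eq[OF \<rho>(2)] by simp
  then show ?thesis
    using ergodic_entropy_asymptotics[OF laplace_limit[OF \<rho>(1,2) \<epsilon> B \<rho>(4)]] by (simp only:)
qed

end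

theorem theorem2:
  fixes \<Lambda> :: "(real^3) set"
    and U :: "real^3 \<Rightarrow> real^3 \<Rightarrow> ennreal"
    and \<epsilon> :: real
  assumes "bounded \<Lambda>" and "connected \<Lambda>" and "open \<Lambda>"
    and "\<And>q q'. U q q' = U q' q"
    and "lower_semicontinuous_on (closure \<Lambda> \<times> closure \<Lambda>) (\<lambda>(q, q'). U q q')"
    and "\<And>\<eta>::real. \<eta> > 0 \<Longrightarrow>
           emeasure lborel {(q, q'). U q q' -
             (INF (r, r')\<in>closure \<Lambda> \<times> closure \<Lambda>. U r r') < ennreal \<eta>} > 0"
    and "\<And>q r. q \<in> \<Lambda> \<Longrightarrow> r > 0 \<Longrightarrow>
           (\<integral>\<^sup>+q'\<in>ball q r \<inter> \<Lambda>. (U q q')\<^sup>2 \<partial>lborel) < \<infinity>"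
    and "\<And>q q'. q \<notin> closure \<Lambda> \<or> q' \<notin> closure \<Lambda> \<Longrightarrow> U q q' = \<infinity>"
    and "ground_energy \<Lambda> U < ennreal \<epsilon>"
  shows "(density_ground_energy \<Lambda> U < ennreal \<epsilon> \<longrightarrow> (\<exists>f. H_minimizer \<Lambda> U \<epsilon> f)) \<and>
         (\<forall>f. H_minimizer \<Lambda> U \<epsilon> f \<longrightarrow>
           (\<lambda>N. ergodic_entropy \<Lambda> U N ((real N)\<^sup>2 * \<epsilon>) -
             (- real N * ln (real N) + real N * (- boltzmann_H \<Lambda> f))) \<in> o(\<lambda>N. real N)) \<and>
         (\<forall>f. H_minimizer \<Lambda> U \<epsilon> f \<longrightarrow>
           (\<exists>\<rho>\<in>prob_densities \<Lambda>.
              interaction_energy \<Lambda> U \<rho> < \<infinity> \<and>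
              0 < vartheta \<Lambda> U \<epsilon> \<rho> \<and>
              (AE x in lborel. x \<in> UNIV \<times> \<Lambda> \<longrightarrow>
                 f x = maxwellian (vartheta \<Lambda> U \<epsilon> \<rho>) (fst x) * \<rho> (snd x)) \<and>
              (\<forall>q\<in>\<Lambda>. \<rho> q =
                 boltzmann_factor (vartheta \<Lambda> U \<epsilon> \<rho>) (mean_potential \<Lambda> U \<rho> q) /
                 (LINT r:\<Lambda>|lborel.
                    boltzmann_factor (vartheta \<Lambda> U \<epsilon> \<rho>) (mean_potential \<Lambda> U \<rho> r)))))"
proof -
  \<comment> \<open>An energy in \<open>ennreal\<close> is at least 0, and \<open>ennreal\<close>
    sends negative reals to 0, so only a positive \<epsilon> can lie strictly above it.\<close>
  have \<epsilon>: "\<epsilon> > 0"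
    using assms(9) by (cases "\<epsilon> > 0") (simp_all add: ennreal_neg)
  interpret pair_potential \<Lambda> U
  proof
    show "bounded \<Lambda>" "open \<Lambda>" by (rule assms)+
    show "U q q' = U q' q" for q q' by (rule assms)
    show "lower_semicontinuous_on (\<Lambda> \<times> \<Lambda>) (\<lambda>(q, q'). U q q')"
      unfolding lower_semicontinuous_on_def
    proof (intro ballI allI impI)
      fix x a assume x: "x \<in> \<Lambda> \<times> \<Lambda>" and a: "a < (case x of (q, q') \<Rightarrow> U q q')"
      have sub: "\<Lambda> \<times> \<Lambda> \<subseteq> closure \<Lambda> \<times> closure \<Lambda>"
        by (intro Sigma_mono closure_subset)
      then have "eventually (\<lambda>y. a < (case y of (q, q') \<Rightarrow> U q q')) (at x within closure \<Lambda> \<times> closure \<Lambda>)"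
        using assms(5) x a unfolding lower_semicontinuous_on_def by blast
      then show "eventually (\<lambda>y. a < (case y of (q, q') \<Rightarrow> U q q')) (at x within \<Lambda> \<times> \<Lambda>)"
        by (rule filter_leD[OF at_le[OF sub]])
    qed
    show "(\<integral>\<^sup>+q'\<in>\<Lambda>. (U q q')\<^sup>2 \<partial>lborel) < \<infinity>" if q: "q \<in> \<Lambda>" for q
    proof -
      \<comment> \<open>A ball around \<open>q\<close> that contains the bounded set turns the local
        condition into the global one.\<close>
      obtain r where r: "r > 0" "\<Lambda> \<subseteq> ball q r" using bounded_subset_ballD[OF assms(1)] by blast
      show ?thesis using assms(7)[OF q r(1)] unfolding Int_absorb1[OF r(2)] .
    qed
  qed
  have fixed_point: "\<exists>\<rho>\<in>prob_densities \<Lambda>.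
      interaction_energy \<Lambda> U \<rho> < \<infinity> \<and> 0 < vartheta \<Lambda> U \<epsilon> \<rho> \<and>
      (AE x in lborel. x \<in> UNIV \<times> \<Lambda> \<longrightarrow> f x = maxwellian (vartheta \<Lambda> U \<epsilon> \<rho>) (fst x) * \<rho> (snd x)) \<and>
      (\<forall>q\<in>\<Lambda>. \<rho> q = boltzmann_factor (vartheta \<Lambda> U \<epsilon> \<rho>) (mean_potential \<Lambda> U \<rho> q) /
         (LINT r:\<Lambda>|lborel. boltzmann_factor (vartheta \<Lambda> U \<epsilon> \<rho>) (mean_potential \<Lambda> U \<rho> r)))"
    if f: "H_minimizer \<Lambda> U \<epsilon> f" for f
  proof (rule minimizer_pointwise[OF f \<epsilon>])
    fix \<rho>
    assume \<rho>: "entropic \<rho>" "interaction_energy \<Lambda> U \<rho> < ennreal \<epsilon>"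
      "AE x in P. f x = maxwellian (vartheta \<Lambda> U \<epsilon> \<rho>) (fst x) * \<rho> (snd x)"
      "\<And>q. \<rho> q = boltzmann_factor (vartheta \<Lambda> U \<epsilon> \<rho>) (mean_potential \<Lambda> U \<rho> q) /
                 (\<integral>r. boltzmann_factor (vartheta \<Lambda> U \<epsilon> \<rho>) (mean_potential \<Lambda> U \<rho> r) \<partial>L)"
    show ?thesis
    proof (intro bexI conjI ballI)
      show "\<rho> \<in> prob_densities \<Lambda>"
        using \<rho>(1) by (simp add: entropic_def prob_densities_def set_integrable_L set_integral_L)
      show "interaction_energy \<Lambda> U \<rho> < \<infinity>" using less_trans[OF \<rho>(2) ennreal_less_top] by simp
      show "0 < vartheta \<Lambda> U \<epsilon> \<rho>" by (rule vartheta_pos[OF \<rho>(2)])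
      show "AE x in lborel. x \<in> UNIV \<times> \<Lambda> \<longrightarrow> f x = maxwellian (vartheta \<Lambda> U \<epsilon> \<rho>) (fst x) * \<rho> (snd x)"
        unfolding AE_P by (rule \<rho>(3))
      show "\<rho> q = boltzmann_factor (vartheta \<Lambda> U \<epsilon> \<rho>) (mean_potential \<Lambda> U \<rho> q) /
         (LINT r:\<Lambda>|lborel. boltzmann_factor (vartheta \<Lambda> U \<epsilon> \<rho>) (mean_potential \<Lambda> U \<rho> r))" for q
        unfolding set_integral_L by (rule \<rho>(4))
    qed
  qed
  show ?thesis
    by (intro conjI allI impI) (rule minimizer_exists entropy_limit fixed_point, assumption | rule \<epsilon>)+
qed

end
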